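(* Let $\Omega$ be a nonempty open set in $\Omega_0=[-L/2,L/2]^2$. Let $\mathbf u$ be the solution to the periodic Navier-Stokes equations $$\frac{d}{dt}\mathbf u+\nu A\mathbf u+B(\mathbf u,\mathbf u)=\mathbf f,\qquad \nabla\cdot\mathbf u=0\quad\text{in }\Omega_0\times(0,\infty)$$ for some initial datum $\mathbf u_0\in V$ and forcing $\mathbf f\in L^\infty((0,\infty);H)$. Let $\sigma>0$ and assume additionally that $$M:=\limsup_{t\to\infty}\|A^{1/2}e^{\sigma A^{1/2}}\mathbf u(t)\|_{L^2(\Omega_0)}<\infty .$$ Let $\epsilon>0$ be given. There exists a spectral index $N_*=N_*(\Omega,G,\nu,\epsilon,M)\in\mathbb N$ so that, for any $N\ge N_*$, there exist a (large) value $\mu=\mu(\nu,\Omega,G,N)>0$, a (small) value $h_*=h_*(\nu,\Omega,G,N)>0$ and a (large) length scale $\sigma_*=\sigma_*(\Omega)$, depending only on $\Omega$, so that if $h\in(0,h_* )$ and $\sigma>\sigma_*$, then $$\|\mathbf u(t)-\mathbf v_N(t)\|_{L^2(\Omega_0)}<\epsilon\quad\text{for all sufficiently large } t,$$ where $\mathbf v_N$ is the global smooth solution, with values in $\operatorname{span}(\phi_1,\dots,\phi_N)$ and with zero initial data, to $$\frac{d}{dt}\mathbf v_N+\nu A\mathbf v_N+P_NB(\mathbf v_N,\mathbf v_N)=P_N\mathbf f-\mu\,(J_{h,N,\Omega}\mathbf v_N-J_{h,N,\Omega}\mathbf u),$$ taken with either $J_{h,N,\Omega}=I_{h,N,\Omega}$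 or $J_{h,N,\Omega}=\mathcal I_{h,N,\Omega}$.
   Context: Setting. $L>0$ and $\nu>0$ are fixed; $\Omega_0=[-L/2,L/2]^2$ with periodic boundary conditions. $H$ (resp. $V$) is the space of $L$-periodic, mean-zero, divergence-free vector fields in $L^2(\Omega_0)^2$ (resp. $H^1(\Omega_0)^2$). $\mathcal P_\sigma$ is the Leray projection, $A$ is the Stokes operator (here $A=-\Delta$ on mean-zero divergence-free periodic fields), and $B(\mathbf u,\mathbf v)=\mathcal P_\sigma(\mathbf u\cdot\nabla\mathbf v)$. For $\mathbf u_0\in V$ and $\mathbf f\in L^\infty((0,\infty);H)$ the Navier-Stokes equations have a unique global solution $\mathbf u\in C([0,T];V)\cap L^2((0,T);D(A))$, $\frac{d\mathbf u}{dt}\in L^2((0,T);H)$ for every $T>0$; this is the solution meant. $\phi_1,\phi_2,\dots$ are the orthonormal eigenvectors of $A$ with nondecreasing eigenvalues $\lambda_1\le\lambda_2\le\cdots$; $P_N$ is the projection from $L^2$ onto $\operatorname{span}(\phi_1,\dots,\phi_N)$. The operator $A^{1/2}e^{\sigma A^{1/2}}$ is defined by the spectral calculus of $A$ (multiplication of the coefficient along $\phi_j$ by $\lambda_j^{1/2}e^{\sigma\lambda_j^{1/2}}$), and its norm is $+\infty$ if $\mathbf u(t)$ is not in its domain. The Grashof number is $G=\frac{1}{\nu^2\lambda_1}\limsup_{t\to\infty}\|\mathbf f(t)\|_{L^2(\Omega_0)}$. Interpolants. For $h>0$, form a lattice of points in $\Omega$ so that the distance between neighboring points is $h$; this leads to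 a finite collection of closed squares $S_1,\dots,S_m$ of side length $h$ with $\Omega\subset\bigcup_{i=1}^m S_i$ and $S_i\cap\Omega\ne\emptyset$ for all $i$; $\mathbf x_i$ is the center of $S_i$. Let $\chi_E$ be the indicator function of a set $E$ and $(f)_{S_i}=\frac1{|S_i|}\int_{S_i}f$. Acting componentwise on vector fields, the volume-element operator is $$(I_{h,N,\Omega}f)(\mathbf x)=P_N\sum_{i=1}^m\chi_{S_i\cap\Omega}(\mathbf x)\,(f\chi_\Omega)_{S_i},$$ and the nodal-value operator is $$(\mathcal I_{h,N,\Omega}f)(\mathbf x)=P_N\sum_{i=1}^m\chi_{S_i\cap\Omega}(\mathbf x)\,(\chi_\Omega f)(\mathbf x_i).$$ Notation such as $N_*=N_*(\Omega,G,\nu,\epsilon,M)$ means that the quantity is determined only by the listed quantities ($L$ being fixed). *)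

theory Defs
  imports "HOL-Analysis.Analysis"
begin

(* Elements of L^2 and its subspaces are represented by functions on the plane that are
   L-periodic in both variables; equality in L^2 is equality almost everywhere. *)

type_synonym field = "real^2 \<Rightarrow> real^2"

definition square :: "real \<Rightarrow> (real^2) set" where
  "square L = cbox (\<chi> i. - L / 2) (\<chi> i. L / 2)"

definition periodic :: "real \<Rightarrow> (real^2 \<Rightarrow> 'b) \<Rightarrow> bool" where
  "periodic L f \<longleftrightarrow> (\<forall>x i. f (x + L *\<^sub>R axis i 1) = f x)"

definition partial :: "2 \<Rightarrow> (real^2 \<Rightarrow> 'b::real_normed_vector) \<Rightarrow> real^2 \<Rightarrow> 'b" where
  "partial i f x = frechet_derivative f (at x) (axis i 1)"

(* C^infinity on the plane: differentiable everywhere, with partial derivatives that are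
   again C^infinity (hence the coinductive reading). *)
coinductive smooth :: "(real^2 \<Rightarrow> 'b::real_normed_vector) \<Rightarrow> bool" where
  "(\<And>x. (f has_derivative (\<lambda>y. \<Sum>i\<in>UNIV. (y $ i) *\<^sub>R g i x)) (at x)) \<Longrightarrow>
   (\<And>i. smooth (g i)) \<Longrightarrow> smooth f"

definition l2_inner :: "real \<Rightarrow> field \<Rightarrow> field \<Rightarrow> real" where
  "l2_inner L f g = (LINT x|lebesgue_on (square L). f x \<bullet> g x)"

definition l2_norm :: "real \<Rightarrow> field \<Rightarrow> real" where
  "l2_norm L f = sqrt (l2_inner L f f)"

definition L2per :: "real \<Rightarrow> field set" where
  "L2per L = {f. periodic L f \<and> f \<in> borel_measurable lebesgue \<and>
     integrable (lebesgue_on (square L)) (\<lambda>x. (norm (f x))\<^sup>2)}"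

definition weak_partial :: "real \<Rightarrow> 2 \<Rightarrow> field \<Rightarrow> field \<Rightarrow> bool" where
  "weak_partial L i f g \<longleftrightarrow>
     (\<forall>\<psi> :: real^2 \<Rightarrow> real. smooth \<psi> \<and> periodic L \<psi> \<longrightarrow>
        (LINT x|lebesgue_on (square L). partial i \<psi> x *\<^sub>R f x)
          = - (LINT x|lebesgue_on (square L). \<psi> x *\<^sub>R g x))"

definition H1per :: "real \<Rightarrow> field set" where
  "H1per L = {f \<in> L2per L. \<forall>i. \<exists>g\<in>L2per L. weak_partial L i f g}"

definition wd :: "real \<Rightarrow> 2 \<Rightarrow> field \<Rightarrow> field" where
  "wd L i f = (SOME g. g \<in> L2per L \<and> weak_partial L i f g)"

definition H2per :: "real \<Rightarrow> field set" where
  "H2per L = {f \<in> H1per L. \<forall>i. wd L i f \<in> H1per L}"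

definition weakly_div_free :: "real \<Rightarrow> field \<Rightarrow> bool" where
  "weakly_div_free L u \<longleftrightarrow>
     (\<forall>\<psi> :: real^2 \<Rightarrow> real. smooth \<psi> \<and> periodic L \<psi> \<longrightarrow>
        (LINT x|lebesgue_on (square L). (\<Sum>i\<in>UNIV. u x $ i * partial i \<psi> x)) = 0)"

definition spaceH :: "real \<Rightarrow> field set" where
  "spaceH L = {u \<in> L2per L. (LINT x|lebesgue_on (square L). u x) = 0 \<and> weakly_div_free L u}"

definition spaceV :: "real \<Rightarrow> field set" where
  "spaceV L = spaceH L \<inter> H1per L"

definition v_norm :: "real \<Rightarrow> field \<Rightarrow> real" where
  "v_norm L u = sqrt ((l2_norm L u)\<^sup>2 + (\<Sum>i\<in>UNIV. (l2_norm L (wd L i u))\<^sup>2))"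

(* The Leray projection is the orthogonal projection of L^2 onto H. *)
definition leray :: "real \<Rightarrow> field \<Rightarrow> field" where
  "leray L g = (SOME w. w \<in> spaceH L \<and> (\<forall>z\<in>spaceH L. l2_inner L (\<lambda>x. g x - w x) z = 0))"

definition domA :: "real \<Rightarrow> field set" where
  "domA L = spaceV L \<inter> H2per L"

definition stokes :: "real \<Rightarrow> field \<Rightarrow> field" where
  "stokes L u = (\<lambda>x. - (\<Sum>i\<in>UNIV. wd L i (wd L i u) x))"

definition bilin :: "real \<Rightarrow> field \<Rightarrow> field \<Rightarrow> field" where
  "bilin L u v = leray L (\<lambda>x. \<Sum>i\<in>UNIV. (u x $ i) *\<^sub>R wd L i v x)"

(* Indices start at 1. The eigenvectors are taken as their smooth representatives, so that
   elements of their span have point values. Completeness is stated as totality in H. *)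
definition stokes_eigenbasis :: "real \<Rightarrow> (nat \<Rightarrow> field) \<Rightarrow> (nat \<Rightarrow> real) \<Rightarrow> bool" where
  "stokes_eigenbasis L \<phi> lam \<longleftrightarrow>
     (\<forall>j\<ge>1. smooth (\<phi> j) \<and> \<phi> j \<in> domA L \<and>
        (AE x in lebesgue_on (square L). stokes L (\<phi> j) x = lam j *\<^sub>R \<phi> j x)) \<and>
     (\<forall>i\<ge>1. \<forall>j\<ge>1. l2_inner L (\<phi> i) (\<phi> j) = (if i = j then 1 else 0)) \<and>
     (\<forall>i\<ge>1. \<forall>j\<ge>i. lam i \<le> lam j) \<and>
     (\<forall>w\<in>spaceH L. (\<forall>j\<ge>1. l2_inner L w (\<phi> j) = 0) \<longrightarrow> l2_norm L w = 0)"

definition galerkin_space :: "(nat \<Rightarrow> field) \<Rightarrow> nat \<Rightarrow> field set" where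
  "galerkin_space \<phi> N = range (\<lambda>(c :: nat \<Rightarrow> real) x. \<Sum>j=1..N. c j *\<^sub>R \<phi> j x)"

definition projN :: "real \<Rightarrow> (nat \<Rightarrow> field) \<Rightarrow> nat \<Rightarrow> field \<Rightarrow> field" where
  "projN L \<phi> N f = (\<lambda>x. \<Sum>j=1..N. l2_inner L f (\<phi> j) *\<^sub>R \<phi> j x)"

definition spectral_calculus ::
  "real \<Rightarrow> (nat \<Rightarrow> field) \<Rightarrow> (nat \<Rightarrow> real) \<Rightarrow> (real \<Rightarrow> real) \<Rightarrow> field \<Rightarrow> field \<Rightarrow> bool" where
  "spectral_calculus L \<phi> lam F u w \<longleftrightarrow>
     w \<in> spaceH L \<and> (\<forall>j\<ge>1. l2_inner L w (\<phi> j) = F (lam j) * l2_inner L u (\<phi> j))"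

definition gevrey_norm ::
  "real \<Rightarrow> (nat \<Rightarrow> field) \<Rightarrow> (nat \<Rightarrow> real) \<Rightarrow> real \<Rightarrow> field \<Rightarrow> ereal" where
  "gevrey_norm L \<phi> lam \<sigma> u =
     (let Op = spectral_calculus L \<phi> lam (\<lambda>l. sqrt l * exp (\<sigma> * sqrt l)) in
      if \<exists>w. Op u w then ereal (l2_norm L (SOME w. Op u w)) else \<infinity>)"

(* H is separable, so strong measurability of a function of time with values in H is
   weak measurability (Pettis). *)
definition time_measurable :: "real \<Rightarrow> real set \<Rightarrow> (real \<Rightarrow> field) \<Rightarrow> bool" where
  "time_measurable L I g \<longleftrightarrow>
     (AE t in lebesgue_on I. g t \<in> spaceH L) \<and>
     (\<forall>w\<in>spaceH L. (\<lambda>t. l2_inner L (g t) w) \<in> borel_measurable (lebesgue_on I))"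

definition L2_time :: "real \<Rightarrow> real \<Rightarrow> (real \<Rightarrow> field) \<Rightarrow> bool" where
  "L2_time L T g \<longleftrightarrow> time_measurable L {0<..<T} g \<and>
     integrable (lebesgue_on {0<..<T}) (\<lambda>t. (l2_norm L (g t))\<^sup>2)"

definition Linf_time :: "real \<Rightarrow> (real \<Rightarrow> field) \<Rightarrow> bool" where
  "Linf_time L g \<longleftrightarrow> time_measurable L {0<..} g \<and>
     (\<exists>C. AE t in lebesgue_on {0<..}. l2_norm L (g t) \<le> C)"

(* u(t) - u(s) is the H-valued integral of g over [s,t], which is identified by its inner
   products with the elements of H. *)
definition has_time_derivative :: "real \<Rightarrow> (real \<Rightarrow> field) \<Rightarrow> (real \<Rightarrow> field) \<Rightarrow> bool" where
  "has_time_derivative L u g \<longleftrightarrow>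
     (\<forall>w\<in>spaceH L. \<forall>s t. 0 \<le> s \<and> s \<le> t \<longrightarrow>
        l2_inner L (u t) w - l2_inner L (u s) w
          = (LINT r|lebesgue_on {s..t}. l2_inner L (g r) w))"

definition ns_solution ::
  "real \<Rightarrow> real \<Rightarrow> (real \<Rightarrow> field) \<Rightarrow> field \<Rightarrow> (real \<Rightarrow> field) \<Rightarrow> bool" where
  "ns_solution L \<nu> f u0 u \<longleftrightarrow>
     (\<forall>t\<ge>0. u t \<in> spaceV L \<and>
        ((\<lambda>s. v_norm L (\<lambda>x. u s x - u t x)) \<longlongrightarrow> 0) (at t within {0..})) \<and>
     (AE x in lebesgue_on (square L). u 0 x = u0 x) \<and>
     (AE t in lebesgue_on {0<..}. u t \<in> domA L) \<and>
     (\<forall>T>0. L2_time L T (\<lambda>t. stokes L (u t))) \<and>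
     (\<exists>du. (\<forall>T>0. L2_time L T du) \<and> has_time_derivative L u du \<and>
        (AE t in lebesgue_on {0<..}. AE x in lebesgue_on (square L).
           du t x + \<nu> *\<^sub>R stokes L (u t) x + bilin L (u t) (u t) x = f t x))"

(* The forcing is defined up to null sets of times, so the upper limit is the essential one:
   a property holds eventually along the filter used here iff it holds at almost every
   sufficiently large time. *)
definition grashof :: "real \<Rightarrow> real \<Rightarrow> (nat \<Rightarrow> real) \<Rightarrow> (real \<Rightarrow> field) \<Rightarrow> real" where
  "grashof L \<nu> lam f =
     1 / (\<nu>\<^sup>2 * lam 1) *
     real_of_ereal (Limsup (inf at_top (ae_filter lebesgue)) (\<lambda>t. ereal (l2_norm L (f t))))"

(* The closed square of side h with centre c. *)
definition cell :: "real \<Rightarrow> real^2 \<Rightarrow> (real^2) set" where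
  "cell h c = cbox (c - (\<chi> i. h / 2)) (c + (\<chi> i. h / 2))"

(* The centres of the squares that meet Omega, in the tiling of the plane by squares of side h
   one of which is centred at a. *)
definition centres :: "real \<Rightarrow> real^2 \<Rightarrow> (real^2) set \<Rightarrow> (real^2) set" where
  "centres h a \<Omega> =
     {c. (\<exists>k :: 2 \<Rightarrow> int. c = a + (\<chi> i. h * of_int (k i))) \<and> cell h c \<inter> \<Omega> \<noteq> {}}"

(* Point values of an L^2 function are those of its continuous representative, if any. *)
definition cont_rep :: "field \<Rightarrow> field" where
  "cont_rep f = (if \<exists>g. continuous_on UNIV g \<and> (AE x in lebesgue. g x = f x)
     then (THE g. continuous_on UNIV g \<and> (AE x in lebesgue. g x = f x)) else f)"

definition volume_interp ::
  "real \<Rightarrow> (nat \<Rightarrow> field) \<Rightarrow> real \<Rightarrow> real^2 \<Rightarrow> nat \<Rightarrow> (real^2) set \<Rightarrow> field \<Rightarrow> field" where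
  "volume_interp L \<phi> h a N \<Omega> f = projN L \<phi> N
     (\<lambda>x. \<Sum>c\<in>centres h a \<Omega>. indicat_real (cell h c \<inter> \<Omega>) x *\<^sub>R
        ((1 / measure lebesgue (cell h c)) *\<^sub>R
           (LINT y|lebesgue_on (cell h c). indicat_real \<Omega> y *\<^sub>R f y)))"

definition nodal_interp ::
  "real \<Rightarrow> (nat \<Rightarrow> field) \<Rightarrow> real \<Rightarrow> real^2 \<Rightarrow> nat \<Rightarrow> (real^2) set \<Rightarrow> field \<Rightarrow> field" where
  "nodal_interp L \<phi> h a N \<Omega> f = projN L \<phi> N
     (\<lambda>x. \<Sum>c\<in>centres h a \<Omega>. indicat_real (cell h c \<inter> \<Omega>) x *\<^sub>R
        (indicat_real \<Omega> c *\<^sub>R cont_rep f c))"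

(* Values in the span of the eigenvectors make the solution smooth in space; in time it is
   absolutely continuous, as the forcing is only bounded and measurable there. *)
definition nudged_solution ::
  "real \<Rightarrow> real \<Rightarrow> (nat \<Rightarrow> field) \<Rightarrow> nat \<Rightarrow> real \<Rightarrow> (field \<Rightarrow> field) \<Rightarrow>
   (real \<Rightarrow> field) \<Rightarrow> (real \<Rightarrow> field) \<Rightarrow> (real \<Rightarrow> field) \<Rightarrow> bool" where
  "nudged_solution L \<nu> \<phi> N \<mu> J f u v \<longleftrightarrow>
     (\<forall>t\<ge>0. v t \<in> galerkin_space \<phi> N) \<and>
     v 0 = (\<lambda>x. 0) \<and>
     (\<exists>dv. (\<forall>T>0. L2_time L T dv) \<and> has_time_derivative L v dv \<and>
        (AE t in lebesgue_on {0<..}. AE x in lebesgue_on (square L).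
           dv t x + \<nu> *\<^sub>R stokes L (v t) x + projN L \<phi> N (bilin L (v t) (v t)) x
             = projN L \<phi> N (f t) x - \<mu> *\<^sub>R (J (v t) x - J (u t) x)))"

end

theory Submission
  imports Defs
begin

text \<open>Everything is expressed through the coefficients of \<open>u\<close> and \<open>v\<close> in the eigenbasis. The eigenfunctions are
  trigonometric polynomials of frequency at most a multiple of \<open>sqrt (lam N)\<close>, so interpolation at equidistant nodes
  gives a spectral inequality: the squared sup norm of a field in the span of the first \<open>N\<close> of them is at most
  \<open>c\<^sub>1 exp (c\<^sub>2 sqrt (lam N))\<close> times its squared \<open>L\<^sup>2\<close> norm on a small square inside \<open>\<Omega>\<close>. For small \<open>h\<close> the observation
  of the low modes \<open>W\<close> of the error \<open>u - v\<close> is therefore coercive, with constant \<open>\<kappa>\<close> of order \<open>exp (- c\<^sub>2 sqrt (lam N))\<close>.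
  In the energy identity for \<open>W\<close> the nudging with \<open>\<mu>\<close> large against \<open>1 / \<kappa>\<close> dominates the trilinear terms, which by
  antisymmetry involve only \<open>u\<close> and \<open>W\<close>, and \<open>W\<close> decays to a size \<open>\<delta> / \<kappa>\<close> governed by the high modes of \<open>u\<close>.
  The Gevrey bound gives \<open>\<delta>\<close> of order \<open>exp (- (\<sigma> - 1) sqrt (lam N))\<close>, which for \<open>\<sigma> > c\<^sub>2 + 3\<close> beats \<open>1 / \<kappa>\<close> and
  the powers of \<open>lam N\<close>. Existence of \<open>v\<close> follows from Picard iteration, where the cancellation in the quadratic term
  prevents blow-up.\<close>

text \<open>Two constants grow with \<open>N\<close> in an untracked way: the gradients in the
  trilinear form and the Lipschitz constants of the eigenfunctions. The former enter only
  \<open>\<mu>\<close>, the latter only the smallness of \<open>h\<close>. Enlarging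
  \<open>\<mu>\<close> costs nothing, because the damping of the low modes and the observation error
  caused by the high modes are both proportional to it and only their ratio survives. Quantitative
  control is thus required for three quantities: the coercivity constant, the embedding of the
  domain of \<open>A\<close> into bounded fields (uniform in \<open>N\<close>), and the Gevrey tail.
  Weak derivatives, the Leray projection and the spectral calculus involve choice operators. They
  are identified only through moments against smooth periodic functions, which determine the
  coefficients in the eigenbasis. The eigenbasis itself is abstract: the Fourier support of its
  members and the growth of the eigenvalues are derived from its defining properties. The order of
  choice is delicate, since \<open>\<mu>\<close> and \<open>h\<close> must be fixed before the
  solution is known.\<close>

definition sqint :: "'a measure \<Rightarrow> ('a \<Rightarrow> 'b::euclidean_space) \<Rightarrow> bool" where
  "sqint M f \<longleftrightarrow> f \<in> borel_measurable M \<and> integrable M (\<lambda>x. (norm (f x))\<^sup>2)"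

definition norm2 :: "'a measure \<Rightarrow> ('a \<Rightarrow> 'b::euclidean_space) \<Rightarrow> real" where
  "norm2 M f = sqrt (LINT x|M. (norm (f x))\<^sup>2)"

lemma sqint_measurable [measurable_dest]: "sqint M f \<Longrightarrow> f \<in> borel_measurable M"
  by (simp add: sqint_def)

lemma sqint_inner:
  assumes "sqint M f" "sqint M g"
  shows "integrable M (\<lambda>x. f x \<bullet> g x)"
proof (rule Bochner_Integration.integrable_bound)
  show "integrable M (\<lambda>x. (norm (f x))\<^sup>2 + (norm (g x))\<^sup>2)"
    using assms by (auto simp: sqint_def)
  show "(\<lambda>x. f x \<bullet> g x) \<in> borel_measurable M"
    using assms by (auto simp: sqint_def)
  have "\<bar>a \<bullet> b\<bar> \<le> (norm a)\<^sup>2 + (norm b)\<^sup>2" for a b :: 'b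
  proof -
    have "\<bar>a \<bullet> b\<bar> \<le> norm a * norm b" by (rule Cauchy_Schwarz_ineq2)
    also have "\<dots> \<le> (norm a)\<^sup>2 + (norm b)\<^sup>2"
      using sum_squares_bound[of "norm a" "norm b"] mult_nonneg_nonneg[OF norm_ge_zero[of a] norm_ge_zero[of b]] by linarith
    finally show ?thesis .
  qed
  then show "AE x in M. norm (f x \<bullet> g x) \<le> norm ((norm (f x))\<^sup>2 + (norm (g x))\<^sup>2)"
    by (auto intro: order_trans[OF _ abs_ge_self])
qed

lemma sqint_add:
  assumes "sqint M f" "sqint M g"
  shows "sqint M (\<lambda>x. f x + g x)"
  unfolding sqint_def
proof
  show "(\<lambda>x. f x + g x) \<in> borel_measurable M" using assms by (auto simp: sqint_def)
  have "(\<lambda>x. (norm (f x + g x))\<^sup>2) = (\<lambda>x. (norm (f x))\<^sup>2 + 2 * (f x \<bullet> g x) + (norm (g x))\<^sup>2)"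
    by (simp add: power2_norm_eq_inner inner_add_left inner_add_right inner_commute fun_eq_iff)
  then show "integrable M (\<lambda>x. (norm (f x + g x))\<^sup>2)"
    using assms sqint_inner[OF assms] by (auto simp: sqint_def)
qed

lemma sqint_scaleR: "sqint M f \<Longrightarrow> sqint M (\<lambda>x. c *\<^sub>R f x)"
  by (auto simp: sqint_def power_mult_distrib)

lemma sqint_zero: "sqint M (\<lambda>x. 0)"
  by (auto simp: sqint_def)

lemma sqint_minus: "sqint M f \<Longrightarrow> sqint M (\<lambda>x. - f x)"
  by (auto simp: sqint_def)

lemma sqint_diff: "sqint M f \<Longrightarrow> sqint M g \<Longrightarrow> sqint M (\<lambda>x. f x - g x)"
  using sqint_add[OF _ sqint_minus[of M g], of f] by simp

lemma sqint_sum: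
  assumes "\<And>i. i \<in> I \<Longrightarrow> sqint M (f i)"
  shows "sqint M (\<lambda>x. \<Sum>i\<in>I. f i x)"
  using assms by (induction I rule: infinite_finite_induct) (auto intro: sqint_add sqint_zero)

lemma sqint_bounded_mult:
  assumes "sqint M f" "\<psi> \<in> borel_measurable M" "\<And>x. x \<in> space M \<Longrightarrow> \<bar>\<psi> x\<bar> \<le> C"
  shows "sqint M (\<lambda>x. \<psi> x *\<^sub>R f x)"
  unfolding sqint_def
proof
  show "(\<lambda>x. \<psi> x *\<^sub>R f x) \<in> borel_measurable M" using assms by (auto simp: sqint_def)
  show "integrable M (\<lambda>x. (norm (\<psi> x *\<^sub>R f x))\<^sup>2)"
  proof (rule Bochner_Integration.integrable_bound)
    show "integrable M (\<lambda>x. C\<^sup>2 * (norm (f x))\<^sup>2)" using assms by (auto simp: sqint_def)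
    show "(\<lambda>x. (norm (\<psi> x *\<^sub>R f x))\<^sup>2) \<in> borel_measurable M"
      using assms by (auto simp: sqint_def)
    show "AE x in M. norm ((norm (\<psi> x *\<^sub>R f x))\<^sup>2) \<le> norm (C\<^sup>2 * (norm (f x))\<^sup>2)"
    proof (rule AE_I2)
      fix x assume "x \<in> space M"
      then have "\<bar>\<psi> x\<bar>\<^sup>2 \<le> C\<^sup>2" using assms(3) by (intro power_mono) auto
      then show "norm ((norm (\<psi> x *\<^sub>R f x))\<^sup>2) \<le> norm (C\<^sup>2 * (norm (f x))\<^sup>2)"
        by (simp add: power_mult_distrib mult_right_mono)
    qed
  qed
qed

lemma (in finite_measure) sqint_bounded:
  assumes "f \<in> borel_measurable M" "AE x in M. norm (f x) \<le> C"
  shows "sqint M f"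
  unfolding sqint_def
proof
  show "integrable M (\<lambda>x. (norm (f x))\<^sup>2)"
  proof (rule integrable_const_bound[where B="C\<^sup>2"])
    show "AE x in M. norm ((norm (f x))\<^sup>2) \<le> C\<^sup>2"
      using assms(2) by eventually_elim (simp add: power_mono)
  qed (use assms in measurable)
qed fact

lemma (in finite_measure) sqint_integrable:
  assumes "sqint M f"
  shows "integrable M f"
proof (rule Bochner_Integration.integrable_bound)
  show "integrable M (\<lambda>x. 1 + (norm (f x))\<^sup>2)" using assms by (auto simp: sqint_def)
  have "a \<le> 1 + a\<^sup>2" if "a \<ge> 0" for a :: real
    using sum_squares_bound[of a 1] that by simp
  then show "AE x in M. norm (f x) \<le> norm (1 + (norm (f x))\<^sup>2)"
    by (auto intro!: AE_I2 order_trans[OF _ abs_ge_self])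
qed (use assms in \<open>auto simp: sqint_def\<close>)

lemma norm2_nonneg [simp]: "norm2 M f \<ge> 0"
  by (simp add: norm2_def)

lemma norm2_power2: "(norm2 M f)\<^sup>2 = (LINT x|M. (norm (f x))\<^sup>2)"
  by (simp add: norm2_def)

lemma sqint_expand:
  assumes "sqint M f" "sqint M g"
  shows "(norm2 M (\<lambda>x. f x + c *\<^sub>R g x))\<^sup>2 = (norm2 M f)\<^sup>2 + 2 * c * (LINT x|M. f x \<bullet> g x) + c\<^sup>2 * (norm2 M g)\<^sup>2"
proof -
  have "(\<lambda>x. (norm (f x + c *\<^sub>R g x))\<^sup>2) = (\<lambda>x. (norm (f x))\<^sup>2 + (2 * c) * (f x \<bullet> g x) + c\<^sup>2 * (norm (g x))\<^sup>2)"
    unfolding power2_norm_eq_inner inner_add_left inner_add_right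
    by (rule ext) (simp add: inner_commute power2_eq_square algebra_simps)
  then show ?thesis
    using assms sqint_inner[OF assms] by (simp add: norm2_power2 sqint_def)
qed

lemma sqint_Cauchy_Schwarz:
  assumes "sqint M f" "sqint M g"
  shows "\<bar>LINT x|M. f x \<bullet> g x\<bar> \<le> norm2 M f * norm2 M g"
proof -
  define a b c where "a = (norm2 M f)\<^sup>2" and "b = (LINT x|M. f x \<bullet> g x)" and "c = (norm2 M g)\<^sup>2"
  have *: "a + 2 * t * b + t\<^sup>2 * c \<ge> 0" for t
    using sqint_expand[OF assms, of t] by (simp add: a_def b_def c_def) (metis zero_le_power2)
  have "b\<^sup>2 \<le> a * c"
  proof (cases "c = 0")
    case True
    have "b = 0"
    proof (rule ccontr)
      assume "b \<noteq> 0"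
      \<comment> \<open>At this \<open>t\<close> the affine function \<open>a + 2 * t * b\<close>
        takes the value \<open>-1\<close>.\<close>
      then show False using *[of "- (a + 1) / (2 * b)"] True zero_le_power2[of "norm2 M f"]
        by (simp add: field_simps a_def)
    qed
    then show ?thesis using True by simp
  next
    case False
    then have c: "c > 0" by (simp add: c_def)
    have "0 \<le> (a + 2 * (- b / c) * b + (- b / c)\<^sup>2 * c) * c" using *[of "- b / c"] c by simp
    also have "\<dots> = a * c - b\<^sup>2" using c by (simp add: field_simps power2_eq_square)
    finally show ?thesis by simp
  qed
  then have "\<bar>b\<bar>\<^sup>2 \<le> (norm2 M f * norm2 M g)\<^sup>2" by (simp add: a_def c_def power_mult_distrib)
  then show ?thesis unfolding b_def by (rule power2_le_imp_le) simp
qed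

lemma norm2_triangle:
  assumes "sqint M f" "sqint M g"
  shows "norm2 M (\<lambda>x. f x + g x) \<le> norm2 M f + norm2 M g"
proof (rule power2_le_imp_le)
  have "(norm2 M (\<lambda>x. f x + g x))\<^sup>2 = (norm2 M f)\<^sup>2 + 2 * (LINT x|M. f x \<bullet> g x) + (norm2 M g)\<^sup>2"
    using sqint_expand[OF assms, of 1] by simp
  also have "\<dots> \<le> (norm2 M f + norm2 M g)\<^sup>2"
    using sqint_Cauchy_Schwarz[OF assms] by (simp add: power2_eq_square algebra_simps)
  finally show "(norm2 M (\<lambda>x. f x + g x))\<^sup>2 \<le> (norm2 M f + norm2 M g)\<^sup>2" .
qed simp

lemma norm2_minus: "norm2 M (\<lambda>x. f x - g x) = norm2 M (\<lambda>x. g x - f x)"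
  by (simp add: norm2_def norm_minus_commute)

lemma (in finite_measure) norm2_bounded:
  assumes "f \<in> borel_measurable M" "AE x in M. norm (f x) \<le> C" "C \<ge> 0"
  shows "norm2 M f \<le> sqrt (measure M (space M)) * C"
proof -
  have "(LINT x|M. (norm (f x))\<^sup>2) \<le> (LINT x|M. C\<^sup>2)"
  proof (rule integral_mono_AE)
    show "integrable M (\<lambda>x. (norm (f x))\<^sup>2)"
      using sqint_bounded[OF assms(1,2)] by (simp add: sqint_def)
    show "AE x in M. (norm (f x))\<^sup>2 \<le> C\<^sup>2"
      using assms(2) by eventually_elim (simp add: power_mono)
  qed simp
  then have "norm2 M f \<le> sqrt (measure M (space M) * C\<^sup>2)"
    unfolding norm2_def by (intro real_sqrt_le_mono) simp
  then show ?thesis using assms(3) by (simp add: real_sqrt_mult)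
qed

lemma norm2_0_iff_AE:
  assumes "sqint M f"
  shows "norm2 M f = 0 \<longleftrightarrow> (AE x in M. f x = 0)"
  using integral_nonneg_eq_0_iff_AE[of M "\<lambda>x. (norm (f x))\<^sup>2"] assms
  by (auto simp: norm2_def sqint_def)

lemma sqint_cong_AE:
  assumes "sqint M f" "g \<in> borel_measurable M" "AE x in M. f x = g x"
  shows "sqint M g"
  unfolding sqint_def
proof
  note [measurable] = assms(2) sqint_measurable[OF assms(1)]
  have "AE x in M. (norm (g x))\<^sup>2 = (norm (f x))\<^sup>2" using assms(3) by eventually_elim simp
  then show "integrable M (\<lambda>x. (norm (g x))\<^sup>2)"
    using assms(1) by (subst integrable_cong_AE) (auto simp: sqint_def)
qed (rule assms)

text \<open>Fatou's lemma for the squared norms. The bound is only required eventually, which suits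
  the differences of a Cauchy sequence.\<close>

lemma sqint_limit:
  assumes S: "\<And>n. sqint M (S n)" and f: "f \<in> borel_measurable M"
    and lim: "AE x in M. (\<lambda>n. S n x) \<longlonglongrightarrow> f x"
    and bd: "eventually (\<lambda>n. norm2 M (S n) \<le> C) sequentially" and C: "C \<ge> 0"
  shows "sqint M f \<and> norm2 M f \<le> C"
proof -
  note [measurable] = f S[THEN sqint_measurable]
  have "(\<integral>\<^sup>+x. ennreal ((norm (f x))\<^sup>2) \<partial>M) = (\<integral>\<^sup>+x. liminf (\<lambda>n. ennreal ((norm (S n x))\<^sup>2)) \<partial>M)"
  proof (rule nn_integral_cong_AE)
    show "AE x in M. ennreal ((norm (f x))\<^sup>2) = liminf (\<lambda>n. ennreal ((norm (S n x))\<^sup>2))"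
      using lim
    proof eventually_elim
      fix x assume "(\<lambda>n. S n x) \<longlonglongrightarrow> f x"
      then have "(\<lambda>n. ennreal ((norm (S n x))\<^sup>2)) \<longlonglongrightarrow> ennreal ((norm (f x))\<^sup>2)"
        by (intro tendsto_ennrealI tendsto_intros)
      then show "ennreal ((norm (f x))\<^sup>2) = liminf (\<lambda>n. ennreal ((norm (S n x))\<^sup>2))"
        by (metis lim_imp_Liminf sequentially_bot)
    qed
  qed
  also have "\<dots> \<le> liminf (\<lambda>n. \<integral>\<^sup>+x. ennreal ((norm (S n x))\<^sup>2) \<partial>M)"
    by (rule nn_integral_liminf) simp
  also have "\<dots> \<le> ennreal (C\<^sup>2)"
  proof (rule Liminf_le)
    show "eventually (\<lambda>n. (\<integral>\<^sup>+x. ennreal ((norm (S n x))\<^sup>2) \<partial>M) \<le> ennreal (C\<^sup>2)) sequentially"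
      using bd
    proof eventually_elim
      fix n assume "norm2 M (S n) \<le> C"
      then have "(norm2 M (S n))\<^sup>2 \<le> C\<^sup>2" by (rule power_mono) simp
      then show "(\<integral>\<^sup>+x. ennreal ((norm (S n x))\<^sup>2) \<partial>M) \<le> ennreal (C\<^sup>2)"
        using S[of n] by (subst nn_integral_eq_integral) (auto simp: sqint_def norm2_power2 intro: ennreal_leI)
    qed
  qed simp
  finally have *: "(\<integral>\<^sup>+x. ennreal ((norm (f x))\<^sup>2) \<partial>M) \<le> ennreal (C\<^sup>2)" .
  then have int: "integrable M (\<lambda>x. (norm (f x))\<^sup>2)"
    by (intro integrableI_bounded) (auto simp: less_top[symmetric] top_unique intro: le_less_trans)
  then have "ennreal (LINT x|M. (norm (f x))\<^sup>2) \<le> ennreal (C\<^sup>2)"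
    using * by (subst nn_integral_eq_integral[symmetric]) auto
  then have "(LINT x|M. (norm (f x))\<^sup>2) \<le> C\<^sup>2" by simp
  then have "norm2 M f \<le> C" unfolding norm2_def using C by (simp add: real_le_lsqrt)
  with int f show ?thesis by (simp add: sqint_def)
qed

text \<open>The limit is a pointwise limit of a subsequence, so that it inherits pointwise symmetries
  such as periodicity.\<close>

lemma (in finite_measure) Riesz_Fischer:
  fixes S :: "nat \<Rightarrow> 'a \<Rightarrow> 'b::euclidean_space"
  assumes S: "\<And>n. sqint M (S n)"
    and cauchy: "\<And>e. e > 0 \<Longrightarrow> \<exists>n0. \<forall>m\<ge>n0. \<forall>n\<ge>n0. norm2 M (\<lambda>x. S m x - S n x) \<le> e"
  obtains r :: "nat \<Rightarrow> nat" where "strict_mono r"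
    and "sqint M (\<lambda>x. lim (\<lambda>k. S (r k) x))"
    and "(\<lambda>n. norm2 M (\<lambda>x. S n x - lim (\<lambda>k. S (r k) x))) \<longlonglongrightarrow> 0"
proof -
  note [measurable] = S[THEN sqint_measurable]
  have "\<exists>n1>n0. \<forall>m\<ge>n1. \<forall>n\<ge>n1. norm2 M (\<lambda>x. S m x - S n x) \<le> (1/2)^k" for n0 k
  proof -
    obtain n1 where n1: "\<forall>m\<ge>n1. \<forall>n\<ge>n1. norm2 M (\<lambda>x. S m x - S n x) \<le> (1/2)^k"
      using cauchy[of "(1/2)^k"] by auto
    then show ?thesis by (intro exI[of _ "max n1 (Suc n0)"]) auto
  qed
  then have "\<exists>n1>n0. \<forall>m\<ge>n1. \<forall>n\<ge>n1. norm2 M (\<lambda>x. S m x - S n x) \<le> (1/2)^k" for n0 k by blast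
  then have "\<forall>k n0. \<exists>n1. n1 > n0 \<and> (\<forall>m\<ge>n1. \<forall>n\<ge>n1. norm2 M (\<lambda>x. S m x - S n x) \<le> (1/2)^k)" by blast
  then have "\<exists>nx. \<forall>k n0. nx k n0 > n0 \<and> (\<forall>m\<ge>nx k n0. \<forall>n\<ge>nx k n0. norm2 M (\<lambda>x. S m x - S n x) \<le> (1/2)^k)"
    by (simp only: choice_iff)
  then obtain nx where "\<forall>k n0. nx k n0 > n0 \<and> (\<forall>m\<ge>nx k n0. \<forall>n\<ge>nx k n0. norm2 M (\<lambda>x. S m x - S n x) \<le> (1/2)^k)"
    by (rule exE)
  then have nx: "nx k n0 > n0"
      "m \<ge> nx k n0 \<Longrightarrow> n \<ge> nx k n0 \<Longrightarrow> norm2 M (\<lambda>x. S m x - S n x) \<le> (1/2)^k" for k n0 m n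
    by blast+
  \<comment> \<open>Indices are chosen so far out that consecutive members of the subsequence differ
    by at most \<open>(1/2)^k\<close>.\<close>
  define r where "r = rec_nat (nx 0 0) (\<lambda>k n. nx (Suc k) n)"
  have r_Suc: "r (Suc k) = nx (Suc k) (r k)" for k by (simp add: r_def)
  have r_mono: "strict_mono r" by (rule strict_monoI_Suc) (simp add: r_Suc nx)
  have r_bd: "norm2 M (\<lambda>x. S m x - S n x) \<le> (1/2)^k" if "m \<ge> r k" "n \<ge> r k" for m n k
  proof -
    have "\<exists>n0. r k = nx k n0" by (cases k) (auto simp: r_def)
    then show ?thesis using that nx(2) by metis
  qed
  \<comment> \<open>On a finite measure space the mean-square bounds on the increments give summable
    \<open>L^1\<close> norms, by pairing with the constant 1; hence the telescoping series converges
    absolutely almost everywhere.\<close>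
  define d where "d k x = norm (S (r (Suc k)) x - S (r k) x)" for k x
  have [measurable]: "d k \<in> borel_measurable M" for k unfolding d_def by measurable
  have one: "sqint M (\<lambda>x. 1::real)" by (rule sqint_bounded[where C=1]) auto
  have d_sq: "sqint M (d k)" for k
    unfolding d_def using sqint_diff[OF S S] by (auto simp: sqint_def)
  have d_int: "integrable M (d k)" for k by (rule sqint_integrable[OF d_sq])
  have d_bd: "(LINT x|M. d k x) \<le> (1/2)^k * norm2 M (\<lambda>x. 1::real)" for k
  proof -
    have "(LINT x|M. d k x) \<le> norm2 M (d k) * norm2 M (\<lambda>x. 1::real)"
      using sqint_Cauchy_Schwarz[OF d_sq one, of k] by simp
    also have "\<dots> \<le> (1/2)^k * norm2 M (\<lambda>x. 1::real)"
    proof (rule mult_right_mono)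
      have "norm2 M (d k) = norm2 M (\<lambda>x. S (r (Suc k)) x - S (r k) x)"
        by (simp add: norm2_def d_def)
      also have "\<dots> \<le> (1/2)^k" using r_mono by (intro r_bd) (auto simp: strict_mono_less_eq)
      finally show "norm2 M (d k) \<le> (1/2)^k" .
    qed simp
    finally show ?thesis .
  qed
  have d_nonneg: "d k x \<ge> 0" for k x by (simp add: d_def)
  have "(\<integral>\<^sup>+x. (\<Sum>k. ennreal (d k x)) \<partial>M) = (\<Sum>k. \<integral>\<^sup>+x. ennreal (d k x) \<partial>M)"
    by (rule nn_integral_suminf) simp
  also have "\<dots> \<le> (\<Sum>k. ennreal ((1/2)^k * norm2 M (\<lambda>x. 1::real)))"
  proof (rule suminf_le)
    show "(\<integral>\<^sup>+x. ennreal (d k x) \<partial>M) \<le> ennreal ((1/2)^k * norm2 M (\<lambda>x. 1::real))" for k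
      using d_bd[of k] d_int[of k] by (subst nn_integral_eq_integral) (auto intro: ennreal_leI d_nonneg)
  qed auto
  also have "\<dots> < top"
  proof -
    have "summable (\<lambda>k. (1/2)^k * norm2 M (\<lambda>x. 1::real))"
      by (intro summable_mult2 summable_geometric) simp
    then show ?thesis by (subst suminf_ennreal2) auto
  qed
  finally have "(\<integral>\<^sup>+x. (\<Sum>k. ennreal (d k x)) \<partial>M) \<noteq> \<infinity>" by simp
  then have "AE x in M. (\<Sum>k. ennreal (d k x)) \<noteq> \<infinity>" by (intro nn_integral_PInf_AE) auto
  then have lim: "AE x in M. (\<lambda>k. S (r k) x) \<longlonglongrightarrow> lim (\<lambda>k. S (r k) x)"
  proof eventually_elim
    fix x assume "(\<Sum>k. ennreal (d k x)) \<noteq> \<infinity>"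
    then have "summable (\<lambda>k. d k x)" by (intro summable_suminf_not_top) (auto simp: d_def)
    then have "summable (\<lambda>k. S (r (Suc k)) x - S (r k) x)"
      unfolding d_def by (rule summable_norm_cancel)
    then have "convergent (\<lambda>n. \<Sum>k<n. S (r (Suc k)) x - S (r k) x)"
      by (simp add: summable_iff_convergent)
    then have "convergent (\<lambda>n. (S (r n) x - S (r 0) x) + S (r 0) x)"
      unfolding sum_lessThan_telescope[where f="\<lambda>k. S (r k) x"] by (rule convergent_add[OF _ convergent_const])
    then show "(\<lambda>k. S (r k) x) \<longlonglongrightarrow> lim (\<lambda>k. S (r k) x)" by (simp add: convergent_LIMSEQ_iff)
  qed
  define f where "f x = lim (\<lambda>k. S (r k) x)" for x
  have [measurable]: "f \<in> borel_measurable M" unfolding f_def by measurable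
  \<comment> \<open>\<open>n\<close> is fixed while the subsequence index runs, so Fatou bounds the
    distance from the limit for every late member of the sequence, not only for the
    subsequence.\<close>
  have diff: "sqint M (\<lambda>x. S n x - f x) \<and> norm2 M (\<lambda>x. S n x - f x) \<le> (1/2)^k" if "n \<ge> r k" for n k
  proof (rule sqint_limit[where S="\<lambda>i x. S n x - S (r i) x"])
    show "AE x in M. (\<lambda>i. S n x - S (r i) x) \<longlonglongrightarrow> S n x - f x"
      using lim by eventually_elim (auto simp: f_def intro: tendsto_intros)
    show "eventually (\<lambda>i. norm2 M (\<lambda>x. S n x - S (r i) x) \<le> (1/2)^k) sequentially"
      using eventually_ge_at_top[of k]
      by eventually_elim (use that r_mono in \<open>auto intro!: r_bd simp: strict_mono_less_eq\<close>)
  qed (auto intro: sqint_diff S)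
  have "sqint M (\<lambda>x. S (r 0) x - (S (r 0) x - f x))"
    by (rule sqint_diff[OF S conjunct1[OF diff[of 0 "r 0"]]]) simp
  then have f: "sqint M f" by simp
  have "(\<lambda>n. norm2 M (\<lambda>x. S n x - f x)) \<longlonglongrightarrow> 0"
  proof (rule LIMSEQ_I)
    fix e :: real assume "e > 0"
    then obtain k where k: "(1/2)^k < e" using real_arch_pow_inv[of e "1/2"] by auto
    have "norm (norm2 M (\<lambda>x. S n x - f x) - 0) < e" if "n \<ge> r k" for n
      using diff[OF that] k by simp
    then show "\<exists>no. \<forall>n\<ge>no. norm (norm2 M (\<lambda>x. S n x - f x) - 0) < e" by blast
  qed
  with that[OF r_mono] f show ?thesis by (simp add: f_def[abs_def])
qed

subsection \<open>Trigonometric polynomials\<close>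

definition freq :: "int \<times> int \<Rightarrow> 2 \<Rightarrow> real" where
  "freq k i = of_int (if i = 1 then fst k else snd k)"

definition phase :: "real \<Rightarrow> int \<times> int \<Rightarrow> real^2 \<Rightarrow> real" where
  "phase L k x = (2 * pi / L) * (\<Sum>i\<in>UNIV. freq k i * x $ i)"

lemma freq_add: "freq (k + l) i = freq k i + freq l i"
  by (simp add: freq_def)

lemma freq_diff: "freq (k - l) i = freq k i - freq l i"
  by (simp add: freq_def)

lemma freq_0 [simp]: "freq 0 i = 0"
  by (simp add: freq_def)

lemma phase_0 [simp]: "phase L 0 x = 0"
  by (simp add: phase_def)

lemma phase_add_left: "phase L (k + l) x = phase L k x + phase L l x"
  by (simp add: phase_def freq_add algebra_simps sum.distrib)

lemma phase_diff_left: "phase L (k - l) x = phase L k x - phase L l x"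
  by (simp add: phase_def freq_diff algebra_simps sum_subtractf)

lemma phase_add: "phase L k (x + y) = phase L k x + phase L k y"
  by (simp add: phase_def algebra_simps sum.distrib)

lemma phase_diff: "phase L k (x - y) = phase L k x - phase L k y"
  by (simp add: phase_def algebra_simps sum_subtractf)

lemma phase_eq: "phase L k x = (2 * pi / L * of_int (fst k)) * x $ 1 + (2 * pi / L * of_int (snd k)) * x $ 2"
  by (simp add: phase_def sum_2 freq_def algebra_simps)

text \<open>The set \<open>B\<close> of admissible frequencies is carried along because the
  Laplacian and the spectral inequality depend on it; the inductive form lets analytic properties be
  checked on single waves.\<close>

inductive trigpoly :: "real \<Rightarrow> (int \<times> int) set \<Rightarrow> (real^2 \<Rightarrow> real) \<Rightarrow> bool"
  for L :: real and B :: "(int \<times> int) set" where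
  trigpoly_cos: "k \<in> B \<Longrightarrow> trigpoly L B (\<lambda>x. cos (phase L k x))"
| trigpoly_sin: "k \<in> B \<Longrightarrow> trigpoly L B (\<lambda>x. sin (phase L k x))"
| trigpoly_zero: "trigpoly L B (\<lambda>x. 0)"
| trigpoly_scale: "trigpoly L B f \<Longrightarrow> trigpoly L B (\<lambda>x. c * f x)"
| trigpoly_add: "trigpoly L B f \<Longrightarrow> trigpoly L B g \<Longrightarrow> trigpoly L B (\<lambda>x. f x + g x)"

lemma trigpoly_mono:
  assumes "trigpoly L B f" "B \<subseteq> B'"
  shows "trigpoly L B' f"
  using assms by (induction) (auto intro: trigpoly.intros)

lemma trigpoly_sum:
  assumes "\<And>i. i \<in> I \<Longrightarrow> trigpoly L B (f i)"
  shows "trigpoly L B (\<lambda>x. \<Sum>i\<in>I. f i x)"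
  using assms by (induction I rule: infinite_finite_induct) (auto intro: trigpoly.intros)

lemma trigpoly_const: "0 \<in> B \<Longrightarrow> trigpoly L B (\<lambda>x. c)"
  using trigpoly_scale[OF trigpoly_cos[of 0 B L], of c] by simp

lemma trigpoly_minus: "trigpoly L B f \<Longrightarrow> trigpoly L B (\<lambda>x. - f x)"
  using trigpoly_scale[of L B f "-1"] by simp

lemma trigpoly_diff: "trigpoly L B f \<Longrightarrow> trigpoly L B g \<Longrightarrow> trigpoly L B (\<lambda>x. f x - g x)"
  using trigpoly_add[OF _ trigpoly_minus[of L B g], of f] by simp

text \<open>A free phase \<open>c\<close> lets one computation serve both cosine and sine, the sine
  being the shift by \<open>- (pi/2)\<close>.\<close>

lemma trigpoly_cos_shift: "k \<in> B \<Longrightarrow> trigpoly L B (\<lambda>x. cos (phase L k x + c))"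
  using trigpoly_diff[OF trigpoly_scale[OF trigpoly_cos, of k B L "cos c"] trigpoly_scale[OF trigpoly_sin, of k B L "sin c"]]
  by (simp add: cos_add mult.commute)

lemma trigpoly_cos_mult_cos:
  "trigpoly L UNIV (\<lambda>x. cos (phase L k x + c) * cos (phase L l x + d))"
proof -
  have "(\<lambda>x. cos (phase L k x + c) * cos (phase L l x + d)) =
    (\<lambda>x. 1/2 * cos (phase L (k - l) x + (c - d)) + 1/2 * cos (phase L (k + l) x + (c + d)))"
    by (rule ext) (simp add: cos_times_cos phase_add_left phase_diff_left algebra_simps add_divide_distrib)
  then show ?thesis by (simp only:) (intro trigpoly.intros trigpoly_cos_shift UNIV_I)
qed

lemma trigpoly_mult_cos:
  assumes "trigpoly L UNIV f"
  shows "trigpoly L UNIV (\<lambda>x. f x * cos (phase L l x + d))"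
  using assms
proof induction
  case (trigpoly_cos k)
  then show ?case using trigpoly_cos_mult_cos[of L k 0 l d] by simp
next
  case (trigpoly_sin k)
  have "sin y = cos (y + - (pi/2))" for y :: real by (simp add: cos_diff)
  then show ?case using trigpoly_cos_mult_cos[of L k "-(pi/2)" l d] by simp
qed (auto simp: algebra_simps intro: trigpoly.intros)

lemma trigpoly_mult:
  assumes "trigpoly L UNIV g" "trigpoly L UNIV f"
  shows "trigpoly L UNIV (\<lambda>x. f x * g x)"
  using assms(1)
proof induction
  case (trigpoly_cos k)
  then show ?case using trigpoly_mult_cos[OF assms(2), of k 0] by simp
next
  case (trigpoly_sin k)
  have "sin y = cos (y + - (pi/2))" for y :: real by (simp add: cos_diff)
  then show ?case using trigpoly_mult_cos[OF assms(2), of k "-(pi/2)"] by simp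
qed (auto simp: algebra_simps intro: trigpoly.intros)

lemma trigpoly_power:
  assumes "trigpoly L UNIV f"
  shows "trigpoly L UNIV (\<lambda>x. f x ^ n)"
  by (induction n) (auto intro: trigpoly_const trigpoly_mult assms)

lemma phase_has_derivative:
  "(phase L k has_derivative (\<lambda>y. \<Sum>i\<in>UNIV. (y $ i) * (2 * pi / L * freq k i))) (at x)"
proof -
  have 1: "phase L k = (\<lambda>x. (2 * pi / L) * (\<Sum>i\<in>UNIV. freq k i * x $ i))"
    by (simp add: phase_def fun_eq_iff)
  have 2: "((\<lambda>x. w * (\<Sum>i\<in>UNIV. freq k i * x $ i)) has_derivative
     (\<lambda>y. w * (\<Sum>i\<in>UNIV. freq k i * y $ i))) (at x)" for w
    by (auto intro!: derivative_eq_intros bounded_linear.has_derivative[OF bounded_linear_vec_nth])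
  show ?thesis unfolding 1
    by (rule has_derivative_eq_rhs[OF 2]) (simp add: sum_distrib_left mult_ac fun_eq_iff)
qed

lemma trigpoly_has_derivative_ex:
  assumes "trigpoly L B f"
  shows "\<exists>g. (\<forall>x. (f has_derivative (\<lambda>y. \<Sum>i\<in>UNIV. (y $ i) *\<^sub>R g i x)) (at x)) \<and> (\<forall>i. trigpoly L B (g i))"
  using assms
proof induction
  case (trigpoly_cos k)
  show ?case
  proof (intro exI[of _ "\<lambda>i x. - (2 * pi / L * freq k i) * sin (phase L k x)"] conjI allI)
    show "((\<lambda>x. cos (phase L k x)) has_derivative
        (\<lambda>y. \<Sum>i\<in>UNIV. y $ i *\<^sub>R (- (2 * pi / L * freq k i) * sin (phase L k x)))) (at x)" for x
      by (rule has_derivative_eq_rhs, rule has_derivative_cos, rule phase_has_derivative)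
         (simp add: sum_distrib_left sum_2 algebra_simps fun_eq_iff)
    show "trigpoly L B (\<lambda>x. - (2 * pi / L * freq k i) * sin (phase L k x))" for i
      by (rule trigpoly.trigpoly_scale, rule trigpoly.trigpoly_sin[OF trigpoly_cos])
  qed
next
  case (trigpoly_sin k)
  show ?case
  proof (intro exI[of _ "\<lambda>i x. (2 * pi / L * freq k i) * cos (phase L k x)"] conjI allI)
    show "((\<lambda>x. sin (phase L k x)) has_derivative
        (\<lambda>y. \<Sum>i\<in>UNIV. y $ i *\<^sub>R ((2 * pi / L * freq k i) * cos (phase L k x)))) (at x)" for x
      by (rule has_derivative_eq_rhs, rule has_derivative_sin, rule phase_has_derivative)
         (simp add: sum_distrib_left sum_2 algebra_simps fun_eq_iff)
    show "trigpoly L B (\<lambda>x. (2 * pi / L * freq k i) * cos (phase L k x))" for i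
      by (rule trigpoly.trigpoly_scale, rule trigpoly.trigpoly_cos[OF trigpoly_sin])
  qed
next
  case trigpoly_zero
  show ?case by (rule exI[of _ "\<lambda>i x. 0"]) (auto intro: trigpoly.trigpoly_zero)
next
  case (trigpoly_scale f c)
  then obtain g where g: "\<And>x. (f has_derivative (\<lambda>y. \<Sum>i\<in>UNIV. (y $ i) *\<^sub>R g i x)) (at x)"
    "\<And>i. trigpoly L B (g i)" by blast
  show ?case
  proof (intro exI[of _ "\<lambda>i x. c * g i x"] conjI allI)
    show "((\<lambda>x. c * f x) has_derivative (\<lambda>y. \<Sum>i\<in>UNIV. y $ i *\<^sub>R (c * g i x))) (at x)" for x
      by (rule has_derivative_eq_rhs, rule has_derivative_mult_right, rule g)
        (simp add: sum_2 algebra_simps)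
  qed (auto intro: g trigpoly.intros)
next
  case (trigpoly_add f f')
  then obtain g g' where g: "\<And>x. (f has_derivative (\<lambda>y. \<Sum>i\<in>UNIV. (y $ i) *\<^sub>R g i x)) (at x)"
    "\<And>i. trigpoly L B (g i)" and g': "\<And>x. (f' has_derivative (\<lambda>y. \<Sum>i\<in>UNIV. (y $ i) *\<^sub>R g' i x)) (at x)"
    "\<And>i. trigpoly L B (g' i)" by blast
  show ?case
  proof (intro exI[of _ "\<lambda>i x. g i x + g' i x"] conjI allI)
    show "((\<lambda>x. f x + f' x) has_derivative (\<lambda>y. \<Sum>i\<in>UNIV. y $ i *\<^sub>R (g i x + g' i x))) (at x)" for x
      by (rule has_derivative_eq_rhs, rule has_derivative_add, rule g, rule g')
        (simp add: sum_2 algebra_simps)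
  qed (auto intro: g g' trigpoly.intros)
qed

lemma partialI:
  assumes "(f has_derivative (\<lambda>y. \<Sum>i\<in>UNIV. (y $ i) *\<^sub>R g i)) (at x)"
  shows "partial i f x = g i"
proof -
  have "partial i f x = (\<Sum>j\<in>UNIV. (axis i 1 $ j :: real) *\<^sub>R g j)"
    by (simp add: partial_def frechet_derivative_at[OF assms, symmetric])
  also have "\<dots> = (\<Sum>j\<in>UNIV. if j = i then g j else 0)"
    by (rule sum.cong) (auto simp: axis_def)
  finally show ?thesis by simp
qed

lemma trigpoly_has_derivative:
  assumes "trigpoly L B f"
  shows "(f has_derivative (\<lambda>y. \<Sum>i\<in>UNIV. (y $ i) *\<^sub>R partial i f x)) (at x)"
proof -
  obtain g where g: "\<And>x. (f has_derivative (\<lambda>y. \<Sum>i\<in>UNIV. (y $ i) *\<^sub>R g i x)) (at x)"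
    using trigpoly_has_derivative_ex[OF assms] by blast
  show ?thesis using g[of x] unfolding partialI[OF g] .
qed

lemma trigpoly_partial:
  assumes "trigpoly L B f"
  shows "trigpoly L B (partial i f)"
proof -
  obtain g where g: "\<And>x. (f has_derivative (\<lambda>y. \<Sum>i\<in>UNIV. (y $ i) *\<^sub>R g i x)) (at x)"
    "trigpoly L B (g i)"
    using trigpoly_has_derivative_ex[OF assms] by blast
  have "partial i f = g i" by (rule ext) (rule partialI[OF g(1)])
  then show ?thesis using g(2) by simp
qed

text \<open>Trigonometric polynomials are closed under partial derivatives, so they form a set to
  which the coinduction principle of \<open>smooth\<close> applies.\<close>

lemma trigpoly_smooth: "trigpoly L B f \<Longrightarrow> smooth f"
proof (coinduction arbitrary: f rule: smooth.coinduct)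
  case smooth
  then show ?case using trigpoly_has_derivative trigpoly_partial
    by (intro exI[of _ f] exI[of _ "\<lambda>i. partial i f"]) auto
qed

lemma trigpoly_continuous: "trigpoly L B f \<Longrightarrow> continuous_on S f"
  by (meson continuous_at_imp_continuous_on has_derivative_continuous trigpoly_has_derivative)

lemma trigpoly_bounded: "trigpoly L B f \<Longrightarrow> \<exists>C. \<forall>x. \<bar>f x\<bar> \<le> C"
proof (induction rule: trigpoly.induct)
  case (trigpoly_scale f c)
  then obtain C where "\<forall>x. \<bar>f x\<bar> \<le> C" by blast
  then have "\<forall>x. \<bar>c * f x\<bar> \<le> \<bar>c\<bar> * C" by (auto simp: abs_mult intro: mult_left_mono)
  then show ?case by blast
next
  case (trigpoly_add f g)
  then obtain C D where "\<forall>x. \<bar>f x\<bar> \<le> C" "\<forall>x. \<bar>g x\<bar> \<le> D" by blast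
  then have "\<forall>x. \<bar>f x + g x\<bar> \<le> C + D" by (meson abs_triangle_ineq add_mono order_trans)
  then show ?case by blast
qed (auto intro: exI[of _ 1])

lemma phase_shift: "L \<noteq> 0 \<Longrightarrow> phase L k (x + L *\<^sub>R axis i 1) = phase L k x + 2 * pi * freq k i"
proof -
  assume "L \<noteq> 0"
  have "(\<Sum>j\<in>UNIV. freq k j * (L *\<^sub>R axis i 1) $ j) = (\<Sum>j\<in>UNIV. if j = i then freq k j * L else 0)"
    by (rule sum.cong) (auto simp: axis_def)
  then show ?thesis using \<open>L \<noteq> 0\<close> by (simp add: phase_add) (simp add: phase_def)
qed

lemma trigpoly_periodic: "trigpoly L B f \<Longrightarrow> L \<noteq> 0 \<Longrightarrow> periodic L f"
  unfolding periodic_def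
proof (induction rule: trigpoly.induct)
  case (trigpoly_cos k)
  then show ?case by (auto simp: phase_shift cos_add freq_def)
next
  case (trigpoly_sin k)
  then show ?case by (auto simp: phase_shift sin_add freq_def)
qed auto

lemma partial_add:
  assumes "trigpoly L B f" "trigpoly L B' g"
  shows "partial i (\<lambda>x. f x + g x) x = partial i f x + partial i g x"
  by (rule partialI[where g="\<lambda>i. partial i f x + partial i g x"], rule has_derivative_eq_rhs,
      rule has_derivative_add[OF trigpoly_has_derivative[OF assms(1)] trigpoly_has_derivative[OF assms(2)]])
     (simp add: sum_2 algebra_simps)

lemma partial_scale:
  assumes "trigpoly L B f"
  shows "partial i (\<lambda>x. c * f x) x = c * partial i f x"
  by (rule partialI[where g="\<lambda>i. c * partial i f x"], rule has_derivative_eq_rhs,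
      rule has_derivative_mult_right[OF trigpoly_has_derivative[OF assms(1)]])
     (simp add: sum_2 algebra_simps)

lemma partial_sum:
  assumes "\<And>j. j \<in> I \<Longrightarrow> trigpoly L B (f j)"
  shows "partial i (\<lambda>x. \<Sum>j\<in>I. f j x) x = (\<Sum>j\<in>I. partial i (f j) x)"
  by (rule partialI[where g="\<lambda>i. \<Sum>j\<in>I. partial i (f j) x"], rule has_derivative_eq_rhs,
      rule has_derivative_sum[OF trigpoly_has_derivative[OF assms]], assumption)
     (simp add: sum_2 sum.distrib sum_distrib_left)

lemma partial_mult:
  assumes "trigpoly L B f" "trigpoly L B' g"
  shows "partial i (\<lambda>x. f x * g x) x = partial i f x * g x + f x * partial i g x"
  by (rule partialI[where g="\<lambda>i. partial i f x * g x + f x * partial i g x"], rule has_derivative_eq_rhs,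
      rule has_derivative_mult[OF trigpoly_has_derivative[OF assms(1)] trigpoly_has_derivative[OF assms(2)]])
     (simp add: sum_2 algebra_simps)

lemma partial_cos_phase:
  "partial i (\<lambda>x. cos (phase L k x + c)) x = - (2 * pi / L * freq k i) * sin (phase L k x + c)"
  by (rule partialI[where g="\<lambda>i. - (2 * pi / L * freq k i) * sin (phase L k x + c)"], rule has_derivative_eq_rhs,
      rule has_derivative_cos[OF has_derivative_add[OF phase_has_derivative has_derivative_const]])
     (simp add: sum_distrib_left sum_2 algebra_simps fun_eq_iff)

lemma partial_sin_phase:
  "partial i (\<lambda>x. sin (phase L k x + c)) x = (2 * pi / L * freq k i) * cos (phase L k x + c)"
  by (rule partialI[where g="\<lambda>i. (2 * pi / L * freq k i) * cos (phase L k x + c)"], rule has_derivative_eq_rhs,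
      rule has_derivative_sin[OF has_derivative_add[OF phase_has_derivative has_derivative_const]])
     (simp add: sum_distrib_left sum_2 algebra_simps fun_eq_iff)

section \<open>Derivatives of smooth periodic functions\<close>

lemma smooth_has_derivative:
  assumes "smooth f"
  shows "(f has_derivative (\<lambda>y. \<Sum>i\<in>UNIV. (y $ i) *\<^sub>R partial i f x)) (at x)" "smooth (partial i f)"
proof -
  obtain g where g: "\<And>x. (f has_derivative (\<lambda>y. \<Sum>i\<in>UNIV. (y $ i) *\<^sub>R g i x)) (at x)" "\<And>i. smooth (g i)"
    using assms by (cases rule: smooth.cases) blast
  have p: "partial i f = g i" for i by (rule ext) (rule partialI[OF g(1)])
  show "(f has_derivative (\<lambda>y. \<Sum>i\<in>UNIV. (y $ i) *\<^sub>R partial i f x)) (at x)" "smooth (partial i f)"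
    using g by (simp_all add: p)
qed

lemma smooth_continuous: "smooth f \<Longrightarrow> continuous_on S f"
  by (meson continuous_at_imp_continuous_on has_derivative_continuous smooth_has_derivative(1))

text \<open>The translate of \<open>f\<close> by a period is \<open>f\<close> itself, and
  derivatives are unique.\<close>

lemma periodic_partial:
  assumes "smooth f" "periodic L f"
  shows "periodic L (partial i f)"
  unfolding periodic_def
proof (intro allI)
  fix x j
  let ?s = "L *\<^sub>R axis j 1 :: real^2"
  have "((\<lambda>x. f (x + ?s)) has_derivative (\<lambda>y. \<Sum>i\<in>UNIV. (y $ i) *\<^sub>R partial i f (x + ?s))) (at x)"
    by (rule has_derivative_compose[where f="\<lambda>x. x + ?s" and g=f and f'="\<lambda>y. y", OF _ smooth_has_derivative(1)[OF assms(1)]])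
      (auto intro!: derivative_eq_intros)
  moreover have "(\<lambda>x. f (x + ?s)) = f" using assms(2) by (auto simp: periodic_def)
  ultimately have "(f has_derivative (\<lambda>y. \<Sum>i\<in>UNIV. (y $ i) *\<^sub>R partial i f (x + ?s))) (at x)" by simp
  from partialI[OF this] show "partial i f (x + ?s) = partial i f x" by simp
qed

subsection \<open>Integration over the period square\<close>

lemma square_measurable [measurable]: "square L \<in> sets lebesgue" "square L \<in> sets borel"
  by (auto simp: square_def)

lemma mem_square: "x \<in> square L \<longleftrightarrow> (\<forall>i. - L / 2 \<le> x $ i \<and> x $ i \<le> L / 2)"
  by (simp add: square_def mem_box_cart)

lemma measure_square: "L > 0 \<Longrightarrow> measure lebesgue (square L) = L\<^sup>2"
proof -
  assume "L > 0"
  have "measure lebesgue (square L) = measure lborel (square L)" by (simp add: square_def)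
  also have "\<dots> = L\<^sup>2" using \<open>L > 0\<close> unfolding square_def
    by (subst content_cbox_cart) (auto simp: power2_eq_square interval_ne_empty_cart)
  finally show ?thesis .
qed

lemma finite_measure_square: "finite_measure (lebesgue_on (square L))"
  by (rule finite_measure_lebesgue_on) (simp add: square_def)

lemma continuous_imp_integrable_square:
  fixes f :: "real^2 \<Rightarrow> 'b::euclidean_space"
  shows "continuous_on UNIV f \<Longrightarrow> integrable (lebesgue_on (square L)) f"
  unfolding square_def by (rule continuous_imp_integrable) (rule continuous_on_subset[OF _ subset_UNIV])

lemma continuous_imp_sqint_square:
  fixes f :: "real^2 \<Rightarrow> 'b::euclidean_space"
  assumes "continuous_on UNIV f" shows "sqint (lebesgue_on (square L)) f"
  unfolding sqint_def
proof
  show "f \<in> borel_measurable (lebesgue_on (square L))"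
    by (rule borel_measurable_integrable[OF continuous_imp_integrable_square[OF assms]])
  have "continuous_on UNIV (\<lambda>x. (norm (f x))\<^sup>2)" using assms by (intro continuous_intros)
  then show "integrable (lebesgue_on (square L)) (\<lambda>x. (norm (f x))\<^sup>2)"
    by (rule continuous_imp_integrable_square)
qed

text \<open>Lebesgue measure on the plane is the image of a product measure indexed by
  \<open>Basis\<close>, where integrals of products factor. The factors \<open>h b\<close> include
  the indicator of the interval, so that their product carries the indicator of the square.\<close>

lemma LINT_square_prod:
  fixes f g :: "real \<Rightarrow> real"
  assumes "continuous_on UNIV f" "continuous_on UNIV g"
  shows "(LINT x|lebesgue_on (square L). f (x $ 1) * g (x $ 2)) =
    (LINT t|lborel. indicator {- L / 2..L / 2} t * f t) * (LINT t|lborel. indicator {- L / 2..L / 2} t * g t)"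
proof -
  define h where "h b t = (indicator {- L / 2..L / 2} t :: real) * (if b = axis 1 1 then f t else g t)" for b :: "real^2" and t
  have [measurable]: "f \<in> borel_measurable borel" "g \<in> borel_measurable borel"
    using assms by (auto intro: borel_measurable_continuous_onI)
  have hm[measurable]: "h b \<in> borel_measurable borel" for b unfolding h_def by measurable
  have B: "(Basis :: (real^2) set) = {axis 1 1, axis 2 1}"
    by (auto simp: Basis_vec_def UNIV_2)
  have ne: "(axis 1 1 :: real^2) \<noteq> axis 2 1" by (simp add: axis_eq_axis)
  have hint: "integrable lborel (h b)" for b
  proof -
    have "continuous_on {- L / 2..L / 2} (if b = axis 1 1 then f else g)"
      using assms by (auto intro: continuous_on_subset)
    then have "integrable lborel (\<lambda>t. indicator {- L / 2..L / 2} t *\<^sub>R (if b = axis 1 1 then f else g) t)"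
      by (intro borel_integrable_compact) auto
    moreover have "h b = (\<lambda>t. indicator {- L / 2..L / 2} t *\<^sub>R (if b = axis 1 1 then f else g) t)"
      by (auto simp: h_def fun_eq_iff)
    ultimately show ?thesis by simp
  qed
  have prodeq: "indicator (square L) x *\<^sub>R (f (x $ 1) * g (x $ 2)) = (\<Prod>b\<in>Basis. h b (x \<bullet> b))" for x
    unfolding B using ne by (auto simp: h_def inner_axis mem_square forall_2 indicator_def)
  have "(LINT x|lebesgue_on (square L). f (x $ 1) * g (x $ 2)) =
      (LINT x|lebesgue. indicator (square L) x *\<^sub>R (f (x $ 1) * g (x $ 2)))"
    by (subst integral_restrict_space) auto
  also have "\<dots> = (LINT x|lborel. indicator (square L) x *\<^sub>R (f (x $ 1) * g (x $ 2)))"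
    by (rule integral_completion) measurable
  also have "\<dots> = (LINT x|lborel. (\<Prod>b\<in>Basis. h b (x \<bullet> b)))"
    by (simp only: prodeq)
  also have "\<dots> = (LINT y|(\<Pi>\<^sub>M b\<in>Basis. lborel). (\<Prod>b\<in>Basis. h b ((\<Sum>b\<in>Basis. y b *\<^sub>R b) \<bullet> (b :: real^2))))"
    by (subst lborel_eq, rule integral_distr) measurable
  also have "\<dots> = (LINT y|(\<Pi>\<^sub>M b\<in>(Basis :: (real^2) set). lborel). (\<Prod>b\<in>Basis. h b (y b)))"
    by (intro Bochner_Integration.integral_cong prod.cong refl) (simp add: inner_sum_left_Basis)
  also have "\<dots> = (\<Prod>b\<in>Basis. (LINT t|lborel. h b t))"
  proof -
    interpret product_sigma_finite "\<lambda>_ :: real^2. lborel :: real measure" by standard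
    show ?thesis by (rule product_integral_prod) (auto intro: hint)
  qed
  also have "\<dots> = (LINT t|lborel. indicator {- L / 2..L / 2} t * f t) * (LINT t|lborel. indicator {- L / 2..L / 2} t * g t)"
    unfolding B using ne by (simp add: h_def)
  finally show ?thesis .
qed

lemma LINT_cos_interval:
  fixes n :: int
  assumes "L > 0" "n \<noteq> 0"
  shows "(LINT t|lborel. indicator {- L / 2..L / 2} t * cos (2 * pi / L * of_int n * t + c)) = 0"
proof -
  let ?w = "2 * pi / L * of_int n"
  have w: "?w \<noteq> 0" using assms by simp
  have "(LINT t|lborel. cos (?w * t + c) * indicator {- L / 2..L / 2} t) =
      sin (?w * (L / 2) + c) / ?w - sin (?w * (- L / 2) + c) / ?w"
  proof (rule integral_FTC_Icc_real)
    show "((\<lambda>t. sin (?w * t + c) / ?w) has_real_derivative cos (?w * t + c)) (at t)" for t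
      using w by (auto intro!: derivative_eq_intros)
  qed (use assms in \<open>auto intro!: continuous_intros\<close>)
  also have "sin (?w * (L / 2) + c) = sin (?w * (- L / 2) + c)"
  proof -
    have "?w * (L / 2) + c = (?w * (- L / 2) + c) + 2 * pi * of_int n" using assms by (simp add: field_simps)
    then show ?thesis by (simp only: sin_add) simp
  qed
  finally show ?thesis by (simp add: mult.commute)
qed

text \<open>The addition formula separates the variables; a nonzero frequency has a nonzero
  component, and the integral over the corresponding variable runs over full periods.\<close>

lemma LINT_cos_phase:
  assumes "L > 0" "k \<noteq> 0"
  shows "(LINT x|lebesgue_on (square L). cos (phase L k x + c)) = 0"
proof -
  define a b where "a = 2 * pi / L * of_int (fst k)" and "b = 2 * pi / L * of_int (snd k)"
  have s: "sin y = cos (y + - (pi/2))" for y :: real by (simp add: cos_diff)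
  have "(LINT x|lebesgue_on (square L). cos (phase L k x + c)) =
    (LINT x|lebesgue_on (square L). cos (a * x $ 1 + c) * cos (b * x $ 2 + 0)
       - cos (a * x $ 1 + (c + - (pi/2))) * cos (b * x $ 2 + - (pi/2)))"
    unfolding add.assoc[symmetric] s[symmetric] phase_eq a_def[symmetric] b_def[symmetric]
    by (rule Bochner_Integration.integral_cong) (simp_all add: cos_add sin_add algebra_simps)
  also have "\<dots> = (LINT x|lebesgue_on (square L). cos (a * x $ 1 + c) * cos (b * x $ 2 + 0))
     - (LINT x|lebesgue_on (square L). cos (a * x $ 1 + (c + - (pi/2))) * cos (b * x $ 2 + - (pi/2)))"
    by (rule Bochner_Integration.integral_diff) (auto intro!: continuous_imp_integrable_square continuous_intros)
  also have "\<dots> = 0"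
  proof -
    have "fst k \<noteq> 0 \<or> snd k \<noteq> 0" using assms by (metis prod.collapse zero_prod_def)
    then have zero: "(LINT t|lborel. indicator {- L / 2..L / 2} t * cos (a * t + d)) *
         (LINT t|lborel. indicator {- L / 2..L / 2} t * cos (b * t + e)) = 0" for d e
      unfolding a_def b_def
      using LINT_cos_interval[OF assms(1), of "fst k" d] LINT_cos_interval[OF assms(1), of "snd k" e]
      by (elim disjE) simp_all
    have "(LINT x|lebesgue_on (square L). cos (a * x $ 1 + d) * cos (b * x $ 2 + e)) =
      (LINT t|lborel. indicator {- L / 2..L / 2} t * cos (a * t + d)) *
         (LINT t|lborel. indicator {- L / 2..L / 2} t * cos (b * t + e))" for d e
      by (rule LINT_square_prod) (auto intro!: continuous_intros)
    then show ?thesis by (simp only: zero diff_self)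
  qed
  finally show ?thesis .
qed

text \<open>Of the product-to-sum formula only the resonances \<open>k = l\<close> and
  \<open>k = - l\<close> survive. Both occur at \<open>k = l = 0\<close>, where together they give
  the full area.\<close>

lemma LINT_cos_phase_cos_phase:
  assumes "L > 0"
  shows "(LINT x|lebesgue_on (square L). cos (phase L k x + c) * cos (phase L l x + d)) =
    L\<^sup>2 / 2 * ((if k = l then cos (c - d) else 0) + (if k = - l then cos (c + d) else 0))"
proof -
  have *: "(LINT x|lebesgue_on (square L). cos (phase L m x + e)) = (if m = 0 then L\<^sup>2 * cos e else 0)" for m e
    using LINT_cos_phase[OF assms] measure_square[OF assms]
    by (auto simp: measure_restrict_space)
  have int: "integrable (lebesgue_on (square L)) (\<lambda>x. cos (phase L m x + e))" for m e
    by (rule continuous_imp_integrable_square[OF trigpoly_continuous[OF trigpoly_cos_shift[OF UNIV_I]]])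
  have "(LINT x|lebesgue_on (square L). cos (phase L k x + c) * cos (phase L l x + d)) =
    (LINT x|lebesgue_on (square L). 1/2 * cos (phase L (k - l) x + (c - d)) + 1/2 * cos (phase L (k + l) x + (c + d)))"
    by (rule Bochner_Integration.integral_cong)
       (auto simp: cos_times_cos phase_add_left phase_diff_left algebra_simps add_divide_distrib)
  also have "\<dots> = 1/2 * (LINT x|lebesgue_on (square L). cos (phase L (k - l) x + (c - d)))
     + 1/2 * (LINT x|lebesgue_on (square L). cos (phase L (k + l) x + (c + d)))"
    by (simp only: Bochner_Integration.integral_add integrable_mult_right int integral_mult_right_zero)
  also have "\<dots> = L\<^sup>2 / 2 * ((if k = l then cos (c - d) else 0) + (if k = - l then cos (c + d) else 0))"
    unfolding * by (auto simp: algebra_simps eq_neg_iff_add_eq_0)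
  finally show ?thesis .
qed

lemma periodic_int_shift:
  assumes "periodic L f"
  shows "f (x + (\<chi> i. L * of_int (m i))) = f x"
proof -
  have n: "f (x + (real n * L) *\<^sub>R axis i 1) = f x" for n i x
  proof (induction n)
    case (Suc n)
    have "x + (real (Suc n) * L) *\<^sub>R axis i 1 = (x + (real n * L) *\<^sub>R axis i 1) + L *\<^sub>R axis i 1"
      by (simp add: algebra_simps)
    then show ?case using Suc assms by (metis periodic_def)
  qed simp
  have i: "f (x + (of_int k * L) *\<^sub>R axis i 1) = f x" for k :: int and i x
  proof (cases "k \<ge> 0")
    case True
    then show ?thesis using n[of x "nat k" i] by simp
  next
    case False
    then show ?thesis using n[of "x + (of_int k * L) *\<^sub>R axis i 1" "nat (- k)" i] by simp
  qed
  have "x + (\<chi> i. L * of_int (m i)) = (x + (of_int (m 1) * L) *\<^sub>R axis 1 1) + (of_int (m 2) * L) *\<^sub>R axis 2 1"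
    by (simp add: vec_eq_iff forall_2 axis_def)
  then show ?thesis by (simp only: i)
qed

lemma square_shift_ex:
  assumes "L > 0"
  obtains m where "x + (\<chi> i. L * of_int (m i)) \<in> square L"
proof
  show "x + (\<chi> i. L * of_int (- round (x $ i / L))) \<in> square L"
    unfolding mem_square
  proof
    fix i
    have "\<bar>of_int (round (x $ i / L)) - x $ i / L\<bar> \<le> 1 / 2" by (rule of_int_round_abs_le)
    then have "x $ i / L - of_int (round (x $ i / L)) \<le> 1 / 2" "- (1 / 2) \<le> x $ i / L - of_int (round (x $ i / L))"
      by linarith+
    then have "(x $ i / L - of_int (round (x $ i / L))) * L \<le> 1 / 2 * L"
      "- (1 / 2) * L \<le> (x $ i / L - of_int (round (x $ i / L))) * L"
      using assms by (intro mult_right_mono; simp)+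
    moreover have "(x $ i / L - of_int (round (x $ i / L))) * L = x $ i - L * of_int (round (x $ i / L))"
      using assms by (simp add: algebra_simps)
    ultimately show "- L / 2 \<le> (x + (\<chi> i. L * of_int (- round (x $ i / L)))) $ i \<and>
      (x + (\<chi> i. L * of_int (- round (x $ i / L)))) $ i \<le> L / 2"
      by auto
  qed
qed

text \<open>The reflection of \<open>t\<close> about \<open>L / 2\<close> leaves the cosine
  unchanged and reduces the claim to the half period on which the cosine decreases.\<close>

lemma cos_period_le:
  assumes "0 < d" "d \<le> t" "t \<le> L - d" "L > 0"
  shows "cos (2 * pi / L * t) \<le> cos (2 * pi / L * d)"
proof (cases "t \<le> L / 2")
  case True
  then show ?thesis using assms by (intro cos_monotone_0_pi_le) (auto simp: field_simps)
next
  case False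
  have "cos (2 * pi / L * t) = cos (2 * pi / L * (L - t))"
    using assms by (simp add: right_diff_distrib cos_diff)
  also have "\<dots> \<le> cos (2 * pi / L * d)"
  proof (rule cos_monotone_0_pi_le)
    show "0 \<le> 2 * pi / L * d" using assms by simp
    show "2 * pi / L * d \<le> 2 * pi / L * (L - t)" using assms by (intro mult_left_mono) auto
    have "2 * pi / L * (L - t) \<le> 2 * pi / L * (L / 2)" using assms False by (intro mult_left_mono) auto
    then show "2 * pi / L * (L - t) \<le> pi" using assms by simp
  qed
  finally show ?thesis .
qed

text \<open>The powers of the kernel \<open>T\<close> concentrate at the point \<open>x0\<close>.\<close>

lemma trigpoly_orthogonal_nonpos:
  assumes L: "L > 0" and f: "continuous_on UNIV f"
    and orth: "\<And>\<psi>. trigpoly L UNIV \<psi> \<Longrightarrow> (LINT x|lebesgue_on (square L). f x * \<psi> x) = 0"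
    and x0: "\<And>i. - L / 2 < x0 $ i" "\<And>i. x0 $ i < L / 2"
  shows "f x0 \<le> 0"
proof (rule ccontr)
  assume "\<not> f x0 \<le> 0"
  define c where "c = f x0 / 2"
  have c: "c > 0" using \<open>\<not> f x0 \<le> 0\<close> by (simp add: c_def)
  have "isCont f x0" using f by (simp add: continuous_on_eq_continuous_at)
  then have "\<exists>d>0. \<forall>y. dist y x0 < d \<longrightarrow> dist (f y) (f x0) < c"
    using c by (auto simp: continuous_at_eps_delta)
  then obtain d0 where d0: "d0 > 0" "\<And>y. dist y x0 < d0 \<Longrightarrow> \<bar>f y - f x0\<bar> < c"
    by (auto simp: dist_real_def)
  \<comment> \<open>The terms with \<open>x0\<close> ensure that a coordinate of a point of the
    square which is \<open>d\<close> away from \<open>x0\<close> is also \<open>d\<close> away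
    modulo the period; \<open>L/4\<close> keeps \<open>d\<close> below half a period, so that
    \<open>r2\<close> is positive.\<close>
  define d where "d = Min {d0 / 2, L/2 + x0 $ 1, L/2 - x0 $ 1, L/2 + x0 $ 2, L/2 - x0 $ 2, L/4}"
  have d: "d > 0" "d \<le> d0 / 2" "d \<le> L/2 + x0 $ i" "d \<le> L/2 - x0 $ i" "d < L / 2" for i
    using d0 x0[of 1] x0[of 2] L exhaust_2[of i] by (auto simp: d_def min_def)
  have near: "f y > c" if "\<And>i. \<bar>y $ i - x0 $ i\<bar> < d" for y
  proof -
    have "dist y x0 \<le> (\<Sum>i\<in>UNIV. \<bar>(y - x0) $ i\<bar>)" unfolding dist_norm by (rule norm_le_l1_cart)
    also have "\<dots> < d0" using that[of 1] that[of 2] d(2) by (simp add: sum_2)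
    finally show ?thesis using d0(2)[of y] by (auto simp: c_def abs_if field_simps split: if_splits)
  qed
  define T1 where "T1 i y = (1 + cos (2 * pi / L * (y $ i - x0 $ i))) / 2" for i :: 2 and y :: "real^2"
  define T where "T y = T1 1 y * T1 2 y" for y
  have T1: "0 \<le> T1 i y" "T1 i y \<le> 1" for i y
  proof -
    have "0 \<le> (1 + c) / 2 \<and> (1 + c) / 2 \<le> 1" if "-1 \<le> c" "c \<le> 1" for c :: real using that by simp
    then show "0 \<le> T1 i y" "T1 i y \<le> 1"
      unfolding T1_def using cos_ge_minus_one cos_le_one by blast+
  qed
  define r2 where "r2 = (1 + cos (2 * pi / L * d)) / 2"
  have "cos pi < cos (2 * pi / L * d)" using d L by (intro cos_monotone_0_pi) (auto simp: field_simps)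
  then have r2: "r2 > 0" by (simp add: r2_def)
  have "cos (2 * pi / L * d) < cos 0" using d L by (intro cos_monotone_0_pi) (auto simp: field_simps)
  then have r2': "r2 < 1" by (simp add: r2_def)
  have far: "T y \<le> r2" if "y \<in> square L" "\<bar>y $ i - x0 $ i\<bar> \<ge> d" for y i
  proof -
    have "cos (2 * pi / L * (y $ i - x0 $ i)) = cos (2 * pi / L * \<bar>y $ i - x0 $ i\<bar>)"
    proof (cases "y $ i - x0 $ i \<ge> 0")
      case False
      then have "2 * pi / L * \<bar>y $ i - x0 $ i\<bar> = - (2 * pi / L * (y $ i - x0 $ i))"
        by (metis abs_of_neg linorder_not_le mult_minus_right)
      then show ?thesis by (simp only: cos_minus)
    qed simp
    also have "\<dots> \<le> cos (2 * pi / L * d)"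
    proof (rule cos_period_le)
      have "- L / 2 \<le> y $ i" "y $ i \<le> L / 2" using that by (auto simp: mem_square)
      then show "\<bar>y $ i - x0 $ i\<bar> \<le> L - d" using d(3)[of i] d(4)[of i] by linarith
    qed (use that d L in auto)
    finally have "T1 i y \<le> r2" by (simp add: T1_def r2_def)
    moreover have "T y \<le> T1 i y"
      using T1[of 1 y] T1[of 2 y] exhaust_2[of i] by (auto simp: T_def mult_left_le mult_left_le_one_le)
    ultimately show ?thesis by simp
  qed
  have T: "0 \<le> T y" for y using T1 by (simp add: T_def)
  \<comment> \<open>Any value strictly between \<open>r2\<close> and 1 serves: \<open>T\<close>
    exceeds it near \<open>x0\<close> and stays below \<open>r2\<close> far away, so the far
    contribution to the powers becomes negligible.\<close>
  define r1 where "r1 = (1 + r2) / 2"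
  have r1: "r1 > r2" "r1 < 1" "r1 > 0" using r2 r2' by (auto simp: r1_def)
  have "continuous_on UNIV T" unfolding T_def T1_def by (intro continuous_intros) (use L in auto)
  then have "isCont T x0" by (simp add: continuous_on_eq_continuous_at)
  moreover have "T x0 = 1" by (simp add: T_def T1_def)
  ultimately have "\<exists>d>0. \<forall>y. dist y x0 < d \<longrightarrow> dist (T y) 1 < 1 - r1"
    using r1 by (auto simp: continuous_at_eps_delta)
  then obtain d1 where d1: "d1 > 0" "\<And>y. dist y x0 < d1 \<Longrightarrow> \<bar>T y - 1\<bar> < 1 - r1"
    by (auto simp: dist_real_def)
  define d2 where "d2 = min d (d1/2) / 2"
  have d2: "d2 > 0" "d2 < d" "d2 < d1 / 2" using d(1) d1(1) by (auto simp: d2_def min_def)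
  define I where "I = cbox (x0 - (\<chi> i. d2)) (x0 + (\<chi> i. d2))"
  have I: "y \<in> I \<longleftrightarrow> (\<forall>i. \<bar>y $ i - x0 $ i\<bar> \<le> d2)" for y
    by (auto simp: I_def mem_box_cart abs_le_iff algebra_simps)
  have I_sub: "I \<subseteq> square L"
  proof
    fix y assume y: "y \<in> I"
    have "- L / 2 \<le> y $ i \<and> y $ i \<le> L / 2" for i
    proof -
      have "\<bar>y $ i - x0 $ i\<bar> \<le> d2" using y by (simp add: I)
      then show ?thesis using d(3)[of i] d(4)[of i] d2(2) by (auto simp: abs_le_iff)
    qed
    then show "y \<in> square L" by (simp add: mem_square)
  qed
  have inner: "r1 \<le> T y" if "y \<in> I" for y
  proof -
    have "dist y x0 \<le> (\<Sum>i\<in>UNIV. \<bar>(y - x0) $ i\<bar>)" unfolding dist_norm by (rule norm_le_l1_cart)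
    also have "\<dots> < d1" using that d2(3) by (auto simp: sum_2 I forall_2)
    finally show ?thesis using d1(2)[of y] by (auto simp: abs_if split: if_splits)
  qed
  have "compact (f ` square L)" unfolding square_def
    by (intro compact_continuous_image continuous_on_subset[OF f]) auto
  then have "bounded (f ` square L)" by (rule compact_imp_bounded)
  then obtain B where B: "\<And>y. y \<in> square L \<Longrightarrow> \<bar>f y\<bar> \<le> B" "B > 0"
    by (force simp: bounded_pos)
  have Im: "I \<in> sets lebesgue" by (simp add: I_def)
  have mI: "measure lebesgue I > 0"
  proof -
    have "measure lebesgue I = measure lborel I" by (simp add: I_def)
    also have "\<dots> = (2 * d2)^2" unfolding I_def using d2
      by (subst content_cbox_cart) (auto simp: interval_ne_empty_cart power2_eq_square)
    finally show ?thesis using d2 by simp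
  qed
  have T_tp: "trigpoly L UNIV T"
  proof -
    have "T = (\<lambda>y. (1/2 + 1/2 * cos (phase L (1,0) y + (- phase L (1,0) x0))) * (1/2 + 1/2 * cos (phase L (0,1) y + (- phase L (0,1) x0))))"
      by (auto simp: fun_eq_iff T_def T1_def phase_eq diff_divide_distrib add_divide_distrib right_diff_distrib)
    then show ?thesis by (simp only:) (intro trigpoly_mult trigpoly_add trigpoly_scale trigpoly_const trigpoly_cos_shift UNIV_I)
  qed
  \<comment> \<open>Orthogonality makes the integral of \<open>f * T ^ n\<close> vanish. It is
    bounded below by the contribution of \<open>I\<close>, of order \<open>r1 ^ n\<close>, minus
    that of the far region, of order \<open>r2 ^ n\<close>; in between the integrand is
    nonnegative.\<close>
  have key: "c * measure lebesgue I * r1 ^ n \<le> B * L\<^sup>2 * r2 ^ n" for n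
  proof -
    let ?M = "lebesgue_on (square L)"
    interpret finite_measure ?M by (rule finite_measure_square)
    have "(LINT y|?M. (c * r1 ^ n) * indicator I y - B * r2 ^ n) \<le> (LINT y|?M. f y * T y ^ n)"
    proof (rule integral_mono)
      show "integrable ?M (\<lambda>y. (c * r1 ^ n) * indicator I y - B * r2 ^ n)"
        using I_sub Im by (intro Bochner_Integration.integrable_diff integrable_mult_right integrable_real_indicator)
          (auto simp: sets_restrict_space_iff less_top[symmetric])
      show "integrable ?M (\<lambda>y. f y * T y ^ n)"
        by (intro continuous_imp_integrable_square continuous_intros f trigpoly_continuous[OF T_tp])
      fix y assume "y \<in> space ?M"
      then have y: "y \<in> square L" by simp
      have B2: "B * r2 ^ n \<ge> 0" using B r2 by simp
      show "(c * r1 ^ n) * indicator I y - B * r2 ^ n \<le> f y * T y ^ n"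
      proof (cases "\<forall>i. \<bar>y $ i - x0 $ i\<bar> < d")
        case True
        then have fy: "f y > c" using near by blast
        show ?thesis
        proof (cases "y \<in> I")
          case True
          have "c * r1 ^ n \<le> f y * T y ^ n"
            using fy c r1 inner[OF True] by (intro mult_mono power_mono) auto
          then show ?thesis using True B2 by simp
        next
          case False
          have "f y * T y ^ n \<ge> 0" using fy c T by simp
          then show ?thesis using False B2 by simp
        qed
      next
        case False
        then obtain i where i: "\<bar>y $ i - x0 $ i\<bar> \<ge> d" by (auto simp: not_less)
        then have "\<not> \<bar>y $ i - x0 $ i\<bar> \<le> d2" using d2(2) by linarith
        then have "y \<notin> I" unfolding I by blast
        have "\<bar>f y * T y ^ n\<bar> \<le> B * r2 ^ n"
          unfolding abs_mult using B(1)[OF y] far[OF y i] T[of y] B(2) by (intro mult_mono) (auto simp: power_abs intro: power_mono)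
        then show ?thesis using \<open>y \<notin> I\<close> by (auto simp: abs_le_iff)
      qed
    qed
    also have "\<dots> = 0" by (rule orth[OF trigpoly_power[OF T_tp]])
    also have "(LINT y|?M. (c * r1 ^ n) * indicator I y - B * r2 ^ n) = c * r1 ^ n * measure lebesgue I - L\<^sup>2 * (B * r2 ^ n)"
    proof (subst Bochner_Integration.integral_diff)
      show "integrable ?M (\<lambda>y. (c * r1 ^ n) * indicator I y)"
        using I_sub Im by (intro integrable_mult_right integrable_real_indicator)
          (auto simp: sets_restrict_space_iff less_top[symmetric])
      have "(LINT y|?M. indicator I y :: real) = measure lebesgue I"
        using I_sub Im by (simp add: measure_restrict_space Int_absorb2)
      then show "(LINT y|?M. c * r1 ^ n * indicat_real I y) - (LINT y|?M. B * r2 ^ n) =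
          c * r1 ^ n * measure lebesgue I - L\<^sup>2 * (B * r2 ^ n)"
        using measure_square[OF L] by (simp add: measure_restrict_space)
    qed simp
    finally show ?thesis by (simp add: mult_ac)
  qed
  have "(\<lambda>n. B * L\<^sup>2 * (r2 / r1) ^ n) \<longlonglongrightarrow> B * L\<^sup>2 * 0"
    using r1 r2 by (intro tendsto_intros LIMSEQ_realpow_zero) auto
  moreover have "c * measure lebesgue I \<le> B * L\<^sup>2 * (r2 / r1) ^ n" for n
    using key[of n] r1(3) by (simp add: power_divide field_simps)
  ultimately have "c * measure lebesgue I \<le> 0"
    by (intro LIMSEQ_le_const[of "\<lambda>n. B * L\<^sup>2 * (r2 / r1) ^ n"]) auto
  then show False using c mI by (simp add: mult_le_0_iff)
qed

text \<open>The one-sided statement for \<open>f\<close> and for \<open>- f\<close> gives zero in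
  the open square; continuity and periodicity extend this to the plane.\<close>

lemma trigpoly_orthogonal_imp_zero:
  assumes L: "L > 0" and f: "continuous_on UNIV f" "periodic L f"
    and orth: "\<And>\<psi>. trigpoly L UNIV \<psi> \<Longrightarrow> (LINT x|lebesgue_on (square L). f x * \<psi> x) = 0"
  shows "f x = 0"
proof -
  let ?B = "box (\<chi> i. - L / 2) (\<chi> i. L / 2) :: (real^2) set"
  have zero: "f y = 0" if "y \<in> ?B" for y
  proof -
    have y: "- L / 2 < y $ i" "y $ i < L / 2" for i using that by (auto simp: mem_box_cart)
    have "f y \<le> 0" by (rule trigpoly_orthogonal_nonpos[OF L f(1) orth y])
    moreover have "- f y \<le> 0"
      by (rule trigpoly_orthogonal_nonpos[where f="\<lambda>x. - f x", OF L _ _ y]) (auto intro!: continuous_intros f orth)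
    ultimately show ?thesis by simp
  qed
  obtain m where m: "x + (\<chi> i. L * of_int (m i)) \<in> square L" using square_shift_ex[OF L] .
  have "?B \<noteq> {}" using L by (simp add: interval_ne_empty_cart)
  then have cl: "closure ?B = square L" unfolding square_def by (rule closure_box)
  have "f (x + (\<chi> i. L * of_int (m i))) = 0"
    by (rule continuous_constant_on_closure[of ?B f 0]) (use cl m f zero in \<open>auto intro: continuous_on_subset\<close>)
  then show ?thesis using periodic_int_shift[OF f(2)] by simp
qed

subsection \<open>The spaces of the problem\<close>

lemma l2_norm_eq: "l2_norm L f = norm2 (lebesgue_on (square L)) f"
  by (simp add: l2_norm_def l2_inner_def norm2_def power2_norm_eq_inner)

lemma l2_inner_commute: "l2_inner L f g = l2_inner L g f"
  by (simp add: l2_inner_def inner_commute)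

lemma L2per_sqint: "f \<in> L2per L \<Longrightarrow> sqint (lebesgue_on (square L)) f"
  by (auto simp: L2per_def sqint_def intro: measurable_restrict_space1)

lemma L2per_I:
  assumes "periodic L f" "f \<in> borel_measurable lebesgue" "sqint (lebesgue_on (square L)) f"
  shows "f \<in> L2per L"
  using assms by (auto simp: L2per_def sqint_def)

lemma L2per_measurable: "f \<in> L2per L \<Longrightarrow> f \<in> borel_measurable lebesgue"
  by (simp add: L2per_def)

lemma L2per_periodic: "f \<in> L2per L \<Longrightarrow> periodic L f"
  by (simp add: L2per_def)

lemma L2per_add: "f \<in> L2per L \<Longrightarrow> g \<in> L2per L \<Longrightarrow> (\<lambda>x. f x + g x) \<in> L2per L"
  by (rule L2per_I) (auto simp: periodic_def L2per_periodic[unfolded periodic_def] intro: sqint_add L2per_sqint L2per_measurable borel_measurable_add)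

lemma L2per_scaleR: "f \<in> L2per L \<Longrightarrow> (\<lambda>x. c *\<^sub>R f x) \<in> L2per L"
  by (rule L2per_I) (auto simp: periodic_def L2per_periodic[unfolded periodic_def] intro: sqint_scaleR L2per_sqint L2per_measurable borel_measurable_scaleR)

lemma L2per_zero: "(\<lambda>x. 0) \<in> L2per L"
  by (rule L2per_I) (auto simp: periodic_def intro: sqint_zero)

lemma L2per_minus: "f \<in> L2per L \<Longrightarrow> (\<lambda>x. - f x) \<in> L2per L"
  using L2per_scaleR[of f L "-1"] by simp

lemma L2per_diff: "f \<in> L2per L \<Longrightarrow> g \<in> L2per L \<Longrightarrow> (\<lambda>x. f x - g x) \<in> L2per L"
  using L2per_add[OF _ L2per_minus[of g L], of f] by simp

lemma L2per_sum: "(\<And>i. i \<in> I \<Longrightarrow> f i \<in> L2per L) \<Longrightarrow> (\<lambda>x. \<Sum>i\<in>I. f i x) \<in> L2per L"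
  by (induction I rule: infinite_finite_induct) (auto intro: L2per_add L2per_zero)

lemma continuous_L2per:
  assumes "continuous_on UNIV f" "periodic L f"
  shows "f \<in> L2per L"
  using assms continuous_imp_measurable_on_sets_lebesgue[OF assms(1)]
  by (intro L2per_I continuous_imp_sqint_square) (auto simp: lebesgue_on_UNIV_eq)

lemma l2_inner_add_left:
  assumes "sqint (lebesgue_on (square L)) f" "sqint (lebesgue_on (square L)) g" "sqint (lebesgue_on (square L)) h"
  shows "l2_inner L (\<lambda>x. f x + g x) h = l2_inner L f h + l2_inner L g h"
  unfolding l2_inner_def inner_add_left by (intro Bochner_Integration.integral_add sqint_inner assms)

lemma l2_inner_diff_left:
  assumes "sqint (lebesgue_on (square L)) f" "sqint (lebesgue_on (square L)) g" "sqint (lebesgue_on (square L)) h"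
  shows "l2_inner L (\<lambda>x. f x - g x) h = l2_inner L f h - l2_inner L g h"
  unfolding l2_inner_def inner_diff_left by (intro Bochner_Integration.integral_diff sqint_inner assms)

lemma l2_inner_scaleR_left: "l2_inner L (\<lambda>x. c *\<^sub>R f x) h = c * l2_inner L f h"
  unfolding l2_inner_def by simp

lemma l2_inner_sum_left:
  assumes "\<And>i. i \<in> I \<Longrightarrow> sqint (lebesgue_on (square L)) (f i)" "sqint (lebesgue_on (square L)) h"
  shows "l2_inner L (\<lambda>x. \<Sum>i\<in>I. f i x) h = (\<Sum>i\<in>I. l2_inner L (f i) h)"
  unfolding l2_inner_def inner_sum_left by (intro Bochner_Integration.integral_sum sqint_inner assms) simp

lemma l2_inner_bound:
  assumes "sqint (lebesgue_on (square L)) f" "sqint (lebesgue_on (square L)) g"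
  shows "\<bar>l2_inner L f g\<bar> \<le> l2_norm L f * l2_norm L g"
  unfolding l2_inner_def l2_norm_eq by (rule sqint_Cauchy_Schwarz[OF assms])

lemma smooth_test_mult:
  assumes "smooth \<psi>" "sqint (lebesgue_on (square L)) f"
  shows "sqint (lebesgue_on (square L)) (\<lambda>x. \<psi> x *\<^sub>R f x)"
    and "integrable (lebesgue_on (square L)) (\<lambda>x. \<psi> x *\<^sub>R f x)"
proof -
  have c: "continuous_on (square L) \<psi>" by (rule smooth_continuous[OF assms(1)])
  have "compact (\<psi> ` square L)" using c unfolding square_def
    by (intro compact_continuous_image) auto
  then have "bounded (\<psi> ` square L)" by (rule compact_imp_bounded)
  then obtain B where B: "\<And>y. y \<in> square L \<Longrightarrow> \<bar>\<psi> y\<bar> \<le> B" by (force simp: bounded_iff)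
  have "\<psi> \<in> borel_measurable (lebesgue_on (square L))"
    by (rule continuous_imp_measurable_on_sets_lebesgue[OF c]) simp
  then show 1: "sqint (lebesgue_on (square L)) (\<lambda>x. \<psi> x *\<^sub>R f x)"
    using assms B by (intro sqint_bounded_mult) auto
  interpret finite_measure "lebesgue_on (square L)" by (rule finite_measure_square)
  show "integrable (lebesgue_on (square L)) (\<lambda>x. \<psi> x *\<^sub>R f x)" by (rule sqint_integrable[OF 1])
qed

lemma smooth_test_mult_component:
  assumes "smooth \<psi>" "sqint (lebesgue_on (square L)) (f :: field)"
  shows "integrable (lebesgue_on (square L)) (\<lambda>x. \<psi> x * f x $ m)"
    and "(LINT x|lebesgue_on (square L). \<psi> x *\<^sub>R f x) $ m = (LINT x|lebesgue_on (square L). \<psi> x * f x $ m)"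
  using integral_bounded_linear[OF bounded_linear_vec_nth smooth_test_mult(2)[OF assms], of m]
    integrable_bounded_linear[OF bounded_linear_vec_nth smooth_test_mult(2)[OF assms], of m]
  by simp_all

lemma weak_partial_component:
  assumes "weak_partial L i f g" "f \<in> L2per L" "g \<in> L2per L" "smooth \<psi>" "periodic L \<psi>"
  shows "(LINT x|lebesgue_on (square L). partial i \<psi> x * f x $ m) = - (LINT x|lebesgue_on (square L). \<psi> x * g x $ m)"
proof -
  have "(LINT x|lebesgue_on (square L). partial i \<psi> x *\<^sub>R f x) = - (LINT x|lebesgue_on (square L). \<psi> x *\<^sub>R g x)"
    using assms unfolding weak_partial_def by blast
  then have "(LINT x|lebesgue_on (square L). partial i \<psi> x *\<^sub>R f x) $ m = - ((LINT x|lebesgue_on (square L). \<psi> x *\<^sub>R g x) $ m)"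
    by simp
  then show ?thesis
    by (simp only: smooth_test_mult_component(2)[OF smooth_has_derivative(2)[OF assms(4)] L2per_sqint[OF assms(2)]]
        smooth_test_mult_component(2)[OF assms(4) L2per_sqint[OF assms(3)]])
qed

lemma wd_props:
  assumes "f \<in> H1per L"
  shows "wd L i f \<in> L2per L" "weak_partial L i f (wd L i f)"
proof -
  have "\<exists>g. g \<in> L2per L \<and> weak_partial L i f g" using assms by (auto simp: H1per_def)
  from someI_ex[OF this] show "wd L i f \<in> L2per L" "weak_partial L i f (wd L i f)"
    by (auto simp: wd_def)
qed

lemma H1per_L2per: "f \<in> H1per L \<Longrightarrow> f \<in> L2per L"
  by (simp add: H1per_def)

lemma domA_H1per:
  assumes "u \<in> domA L"
  shows "u \<in> H1per L" "wd L i u \<in> H1per L" "u \<in> spaceH L"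
  using assms by (auto simp: domA_def spaceV_def H2per_def)

lemma stokes_L2per: "u \<in> domA L \<Longrightarrow> stokes L u \<in> L2per L"
  unfolding stokes_def by (rule L2per_minus, rule L2per_sum, rule wd_props(1), rule domA_H1per(2))

text \<open>With both derivatives on the test function the choices made in \<open>wd\<close>
  disappear, and the moments of \<open>stokes L u\<close> are determined by
  \<open>u\<close>.\<close>

lemma stokes_moment:
  assumes u: "u \<in> domA L" and \<psi>: "smooth \<psi>" "periodic L \<psi>"
  shows "(LINT x|lebesgue_on (square L). \<psi> x * stokes L u x $ m) =
    - (\<Sum>i\<in>UNIV. LINT x|lebesgue_on (square L). partial i (partial i \<psi>) x * u x $ m)"
proof -
  have *: "(LINT x|lebesgue_on (square L). \<psi> x * wd L i (wd L i u) x $ m) =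
    (LINT x|lebesgue_on (square L). partial i (partial i \<psi>) x * u x $ m)" for i
  proof -
    have "(LINT x|lebesgue_on (square L). partial i (partial i \<psi>) x * u x $ m) =
       - (LINT x|lebesgue_on (square L). partial i \<psi> x * wd L i u x $ m)"
      by (intro weak_partial_component wd_props domA_H1per[OF u] H1per_L2per periodic_partial smooth_has_derivative(2) \<psi>)
    also have "\<dots> = (LINT x|lebesgue_on (square L). \<psi> x * wd L i (wd L i u) x $ m)"
      by (subst weak_partial_component[of _ _ _ "wd L i (wd L i u)"])
        (auto intro: wd_props domA_H1per[OF u] H1per_L2per \<psi>)
    finally show ?thesis by simp
  qed
  have "(LINT x|lebesgue_on (square L). \<psi> x * stokes L u x $ m) =
      (LINT x|lebesgue_on (square L). - (\<Sum>i\<in>UNIV. \<psi> x * wd L i (wd L i u) x $ m))"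
    by (simp add: stokes_def sum_distrib_left)
  also have "\<dots> = - (\<Sum>i\<in>UNIV. LINT x|lebesgue_on (square L). \<psi> x * wd L i (wd L i u) x $ m)"
    by (subst integral_minus, subst Bochner_Integration.integral_sum)
      (auto intro!: smooth_test_mult_component \<psi> L2per_sqint wd_props domA_H1per[OF u])
  finally show ?thesis by (simp only: *)
qed

subsection \<open>Fourier support of the eigenfunctions\<close>

text \<open>The eigenvalue of minus the Laplacian on the waves of frequency
  \<open>k\<close>.\<close>

definition ksq :: "real \<Rightarrow> int \<times> int \<Rightarrow> real" where
  "ksq L k = (2 * pi / L)\<^sup>2 * (\<Sum>i\<in>UNIV. (freq k i)\<^sup>2)"

lemma ksq_uminus [simp]: "ksq L (- k) = ksq L k"
  by (simp add: ksq_def freq_def sum_2)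

lemma phase_uminus: "phase L (- k) x = - phase L k x"
  using phase_diff_left[of L 0 k x] by simp

lemma ksq_ge:
  assumes "L > 0"
  shows "of_int (fst k) ^ 2 \<le> ksq L k * (L / (2 * pi))\<^sup>2" "of_int (snd k) ^ 2 \<le> ksq L k * (L / (2 * pi))\<^sup>2"
  using assms by (auto simp: ksq_def sum_2 freq_def power_divide field_simps)

lemma finite_ksq:
  assumes "L > 0"
  shows "finite {k. ksq L k \<le> l}"
proof (rule finite_subset)
  define K where "K = \<lceil>\<bar>l\<bar> * (L / (2 * pi))\<^sup>2\<rceil>"
  have *: "\<bar>n\<bar> \<le> K" if "of_int n ^ 2 \<le> ksq L k * (L / (2 * pi))\<^sup>2" "ksq L k \<le> l" for n :: int and k
  proof -
    have "\<bar>n\<bar> \<le> n\<^sup>2"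
    proof (cases "n = 0")
      case False
      then have "\<bar>n\<bar> * 1 \<le> \<bar>n\<bar> * \<bar>n\<bar>" by (intro mult_left_mono) auto
      then show ?thesis by (simp add: power2_eq_square)
    qed simp
    then have "of_int \<bar>n\<bar> \<le> (of_int n :: real)\<^sup>2" by (metis of_int_le_iff of_int_power)
    also have "\<dots> \<le> ksq L k * (L / (2 * pi))\<^sup>2" by (rule that)
    also have "\<dots> \<le> \<bar>l\<bar> * (L / (2 * pi))\<^sup>2" using that by (intro mult_right_mono) auto
    finally have "of_int \<bar>n\<bar> \<le> \<bar>l\<bar> * (L / (2 * pi))\<^sup>2" .
    then show ?thesis unfolding K_def by linarith
  qed
  show "{k. ksq L k \<le> l} \<subseteq> {-K..K} \<times> {-K..K}"
    using *[OF ksq_ge(1)[OF assms]] *[OF ksq_ge(2)[OF assms]] by (auto simp: abs_le_iff) (metis fst_conv snd_conv minus_le_iff)+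
qed simp

lemma trigpoly_laplace:
  assumes "trigpoly L {k. ksq L k = l} \<psi>"
  shows "(\<Sum>i\<in>UNIV. partial i (partial i \<psi>) x) = - l * \<psi> x"
  using assms
proof induction
  case (trigpoly_cos k)
  have p: "partial i (\<lambda>x. cos (phase L k x)) = (\<lambda>x. - (2 * pi / L * freq k i) * sin (phase L k x))" for i
    using partial_cos_phase[of i L k 0] by auto
  have "partial i (partial i (\<lambda>x. cos (phase L k x))) x = - (2 * pi / L * freq k i)\<^sup>2 * cos (phase L k x)" for i
    unfolding p using partial_scale[OF trigpoly.trigpoly_sin[of k UNIV L], of i "- (2 * pi / L * freq k i)" x] partial_sin_phase[of i L k 0 x]
    by (simp add: power2_eq_square)
  then show ?case using trigpoly_cos by (auto simp: ksq_def sum_2 power_mult_distrib power_divide algebra_simps add_divide_distrib)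
next
  case (trigpoly_sin k)
  have p: "partial i (\<lambda>x. sin (phase L k x)) = (\<lambda>x. (2 * pi / L * freq k i) * cos (phase L k x))" for i
    using partial_sin_phase[of i L k 0] by auto
  have "partial i (partial i (\<lambda>x. sin (phase L k x))) x = - (2 * pi / L * freq k i)\<^sup>2 * sin (phase L k x)" for i
    unfolding p using partial_scale[OF trigpoly.trigpoly_cos[of k UNIV L], of i "(2 * pi / L * freq k i)" x] partial_cos_phase[of i L k 0 x]
    by (simp add: power2_eq_square)
  then show ?case using trigpoly_sin by (auto simp: ksq_def sum_2 power_mult_distrib power_divide algebra_simps add_divide_distrib)
next
  case trigpoly_zero
  have "partial i (\<lambda>x. 0 :: real) = (\<lambda>x. 0)" for i by (auto simp: partial_def)
  then show ?case by simp
next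
  case (trigpoly_scale f c)
  have "partial i (\<lambda>x. c * f x) = (\<lambda>x. c * partial i f x)" for i
    using partial_scale[OF trigpoly_scale(1)] by auto
  then show ?case using trigpoly_scale partial_scale[OF trigpoly_partial[OF trigpoly_scale(1)]]
    by (simp add: sum_distrib_left[symmetric])
next
  case (trigpoly_add f g)
  have "partial i (\<lambda>x. f x + g x) = (\<lambda>x. partial i f x + partial i g x)" for i
    using partial_add[OF trigpoly_add(1,2)] by auto
  then show ?case using trigpoly_add partial_add[OF trigpoly_partial[OF trigpoly_add(1)] trigpoly_partial[OF trigpoly_add(2)]]
    by (simp add: sum.distrib algebra_simps)
qed

lemma trigpoly_orthogonalI:
  assumes "sqint (lebesgue_on (square L)) (T :: real^2 \<Rightarrow> real)"
    and "\<And>k c. (LINT x|lebesgue_on (square L). T x * cos (phase L k x + c)) = 0" "trigpoly L UNIV \<psi>"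
  shows "(LINT x|lebesgue_on (square L). T x * \<psi> x) = 0"
  using assms(3)
proof induction
  have int: "integrable (lebesgue_on (square L)) (\<lambda>x. T x * f x)" if "trigpoly L UNIV f" for f
    using smooth_test_mult(2)[OF trigpoly_smooth[OF that] assms(1)] by (simp add: mult.commute)
  {
    case (trigpoly_cos k)
    then show ?case using assms(2)[of k 0] by simp
  next
    case (trigpoly_sin k)
    then show ?case using assms(2)[of k "-(pi/2)"] by (simp add: cos_diff)
  next
    case (trigpoly_scale f c)
    have "(\<lambda>x. T x * (c * f x)) = (\<lambda>x. c * (T x * f x))" by (simp add: mult_ac fun_eq_iff)
    then show ?case using trigpoly_scale by simp
  next
    case (trigpoly_add f g)
    then show ?case using int[of f] int[of g] by (simp add: distrib_left)
  }
qed simp_all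

section \<open>Eigenfunctions as divergence-free trigonometric polynomials\<close>

locale stokes_basis =
  fixes L :: real and \<phi> :: "nat \<Rightarrow> field" and lam :: "nat \<Rightarrow> real"
  assumes L_pos: "L > 0" and basis: "stokes_eigenbasis L \<phi> lam"
begin

abbreviation Q :: "(real^2) measure" where "Q \<equiv> lebesgue_on (square L)"

lemma phi_domA: "j \<ge> 1 \<Longrightarrow> \<phi> j \<in> domA L"
  and phi_smooth: "j \<ge> 1 \<Longrightarrow> smooth (\<phi> j)"
  and phi_eigen: "j \<ge> 1 \<Longrightarrow> AE x in Q. stokes L (\<phi> j) x = lam j *\<^sub>R \<phi> j x"
  and phi_orthonormal: "i \<ge> 1 \<Longrightarrow> j \<ge> 1 \<Longrightarrow> l2_inner L (\<phi> i) (\<phi> j) = (if i = j then 1 else 0)"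
  and lam_mono: "i \<ge> 1 \<Longrightarrow> i \<le> j \<Longrightarrow> lam i \<le> lam j"
  and phi_total: "w \<in> spaceH L \<Longrightarrow> (\<And>j. j \<ge> 1 \<Longrightarrow> l2_inner L w (\<phi> j) = 0) \<Longrightarrow> l2_norm L w = 0"
  using basis unfolding stokes_eigenbasis_def by auto

lemma phi_H: "j \<ge> 1 \<Longrightarrow> \<phi> j \<in> spaceH L"
  using domA_H1per(3)[OF phi_domA] .

lemma phi_L2per: "j \<ge> 1 \<Longrightarrow> \<phi> j \<in> L2per L"
  using phi_H by (simp add: spaceH_def)

lemma phi_sqint: "j \<ge> 1 \<Longrightarrow> sqint Q (\<phi> j)"
  using L2per_sqint[OF phi_L2per] .

lemma phi_continuous: "j \<ge> 1 \<Longrightarrow> continuous_on S (\<phi> j)"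
  by (rule smooth_continuous[OF phi_smooth])

text \<open>The moment of \<open>stokes L (\<phi> j)\<close> equals \<open>lam j\<close> times the
  moment of \<open>\<phi> j\<close> by the eigenvalue equation and \<open>ksq L k\<close> times it
  by two integrations by parts.\<close>

lemma phi_moment_zero:
  assumes j: "j \<ge> 1" and k: "ksq L k \<noteq> lam j"
  shows "(LINT x|Q. \<phi> j x $ m * cos (phase L k x + c)) = 0"
proof -
  let ?\<psi> = "\<lambda>x. cos (phase L k x + c)"
  have tp: "trigpoly L {l. ksq L l = ksq L k} ?\<psi>" by (rule trigpoly_cos_shift) simp
  have sm: "smooth ?\<psi>" by (rule trigpoly_smooth[OF tp])
  have p: "periodic L ?\<psi>" using trigpoly_periodic[OF tp] L_pos by simp
  define I where "I = (LINT x|Q. ?\<psi> x * \<phi> j x $ m)"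
  have "(LINT x|Q. ?\<psi> x * stokes L (\<phi> j) x $ m) = - (\<Sum>i\<in>UNIV. LINT x|Q. partial i (partial i ?\<psi>) x * \<phi> j x $ m)"
    by (rule stokes_moment[OF phi_domA[OF j] sm p])
  also have "\<dots> = - (LINT x|Q. (\<Sum>i\<in>UNIV. partial i (partial i ?\<psi>) x) * \<phi> j x $ m)"
    unfolding sum_distrib_right
    by (subst Bochner_Integration.integral_sum)
      (auto intro!: smooth_test_mult_component phi_sqint j smooth_has_derivative sm)
  also have "\<dots> = ksq L k * I"
    unfolding trigpoly_laplace[OF tp] I_def by (simp add: mult.assoc)
  finally have 1: "(LINT x|Q. ?\<psi> x * stokes L (\<phi> j) x $ m) = ksq L k * I" .
  have "(LINT x|Q. ?\<psi> x * stokes L (\<phi> j) x $ m) = (LINT x|Q. lam j * (?\<psi> x * \<phi> j x $ m))"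
  proof (rule integral_cong_AE)
    show "AE x in Q. ?\<psi> x * stokes L (\<phi> j) x $ m = lam j * (?\<psi> x * \<phi> j x $ m)"
      using phi_eigen[OF j] by eventually_elim simp
    show "(\<lambda>x. ?\<psi> x * stokes L (\<phi> j) x $ m) \<in> borel_measurable Q"
      by (rule borel_measurable_integrable[OF smooth_test_mult_component(1)[OF sm L2per_sqint[OF stokes_L2per[OF phi_domA[OF j]]]]])
    show "(\<lambda>x. lam j * (?\<psi> x * \<phi> j x $ m)) \<in> borel_measurable Q"
      using borel_measurable_integrable[OF smooth_test_mult_component(1)[OF sm phi_sqint[OF j], of m]] by simp
  qed
  then have "ksq L k * I = lam j * I" using 1 by (simp add: I_def)
  then have "I = 0" using k by simp
  then show ?thesis by (simp add: I_def mult.commute)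
qed

text \<open>Real Fourier coefficients without normalisation. The frequencies \<open>k\<close> and
  \<open>- k\<close> are both kept, so each wave is counted twice in \<open>phi_rep\<close>.\<close>

definition acoef :: "nat \<Rightarrow> 2 \<Rightarrow> int \<times> int \<Rightarrow> real" where
  "acoef j m k = (LINT x|Q. \<phi> j x $ m * cos (phase L k x))"

definition bcoef :: "nat \<Rightarrow> 2 \<Rightarrow> int \<times> int \<Rightarrow> real" where
  "bcoef j m k = (LINT x|Q. \<phi> j x $ m * sin (phase L k x))"

lemma phi_component_int:
  assumes "j \<ge> 1" "smooth \<psi>"
  shows "integrable Q (\<lambda>x. \<phi> j x $ m * \<psi> x)"
  using smooth_test_mult_component(1)[OF assms(2) phi_sqint[OF assms(1)]] by (simp add: mult.commute)

lemma phi_moment: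
  assumes j: "j \<ge> 1"
  shows "(LINT x|Q. \<phi> j x $ m * cos (phase L k x + c)) = acoef j m k * cos c - bcoef j m k * sin c"
proof -
  have [simp]: "integrable Q (\<lambda>x. \<phi> j x $ m * cos (phase L k x))" "integrable Q (\<lambda>x. \<phi> j x $ m * sin (phase L k x))"
    by (intro phi_component_int j trigpoly_smooth[of L UNIV] trigpoly_cos trigpoly_sin UNIV_I)+
  have "(LINT x|Q. \<phi> j x $ m * cos (phase L k x + c)) =
    (LINT x|Q. (\<phi> j x $ m * cos (phase L k x)) * cos c - (\<phi> j x $ m * sin (phase L k x)) * sin c)"
    by (rule Bochner_Integration.integral_cong) (auto simp: cos_add algebra_simps)
  also have "\<dots> = acoef j m k * cos c - bcoef j m k * sin c"
    by (simp add: acoef_def bcoef_def)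
  finally show ?thesis .
qed

lemma coef_uminus: "acoef j m (- k) = acoef j m k" "bcoef j m (- k) = - bcoef j m k"
  by (simp_all add: acoef_def bcoef_def phase_uminus)

lemma coef_zero:
  assumes "j \<ge> 1" "ksq L k \<noteq> lam j"
  shows "acoef j m k = 0" "bcoef j m k = 0"
  using phi_moment_zero[OF assms, of m 0] phi_moment_zero[OF assms, of m "pi/2"] phi_moment[OF assms(1), of m k 0]
    phi_moment[OF assms(1), of m k "pi/2"] by auto

text \<open>Sine and cosine waves are used as test functions in the weak divergence constraint;
  differentiating the sine yields the cosine coefficients, and conversely.\<close>

lemma coef_div_free:
  assumes j: "j \<ge> 1"
  shows "(\<Sum>m\<in>UNIV. freq k m * acoef j m k) = 0" "(\<Sum>m\<in>UNIV. freq k m * bcoef j m k) = 0"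
proof -
  have wdf: "(LINT x|Q. (\<Sum>i\<in>UNIV. \<phi> j x $ i * partial i \<psi> x)) = 0" if "trigpoly L UNIV \<psi>" for \<psi>
    using phi_H[OF j] trigpoly_smooth[OF that] trigpoly_periodic[OF that] L_pos
    by (auto simp: spaceH_def weakly_div_free_def)
  have w: "2 * pi / L \<noteq> 0" using L_pos by simp
  have int: "integrable Q (\<lambda>x. \<phi> j x $ i * partial i \<psi> x)" if "trigpoly L UNIV \<psi>" for \<psi> i
    by (intro phi_component_int j trigpoly_smooth[of L UNIV] trigpoly_partial that)
  have *: "(\<Sum>i\<in>UNIV. LINT x|Q. \<phi> j x $ i * partial i \<psi> x) = 0" if "trigpoly L UNIV \<psi>" for \<psi>
    using wdf[OF that] int[OF that] by (simp add: Bochner_Integration.integral_sum)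
  have "(\<Sum>i\<in>UNIV. LINT x|Q. \<phi> j x $ i * partial i (\<lambda>x. sin (phase L k x + 0)) x) =
      2 * pi / L * (\<Sum>m\<in>UNIV. freq k m * acoef j m k)"
    unfolding partial_sin_phase by (simp add: acoef_def sum_2 algebra_simps integral_mult_right_zero[symmetric] del: integral_mult_right_zero)
  then show "(\<Sum>m\<in>UNIV. freq k m * acoef j m k) = 0"
    using *[OF trigpoly_sin[of k UNIV L]] w by simp
  have "(\<Sum>i\<in>UNIV. LINT x|Q. \<phi> j x $ i * partial i (\<lambda>x. cos (phase L k x + 0)) x) =
      - (2 * pi / L) * (\<Sum>m\<in>UNIV. freq k m * bcoef j m k)"
    unfolding partial_cos_phase by (simp add: bcoef_def sum_2 algebra_simps integral_mult_right_zero[symmetric] del: integral_mult_right_zero)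
  then show "(\<Sum>m\<in>UNIV. freq k m * bcoef j m k) = 0"
    using *[OF trigpoly_cos[of k UNIV L]] w by simp
qed

text \<open>The difference of the two sides is continuous, periodic and has vanishing moments
  against all waves, so it is zero at every point. The sum is finite since only frequencies on one
  circle carry coefficients.\<close>

lemma phi_rep:
  assumes j: "j \<ge> 1"
  shows "\<phi> j x $ m = 1 / L\<^sup>2 * (\<Sum>k | ksq L k = lam j. acoef j m k * cos (phase L k x) + bcoef j m k * sin (phase L k x))"
proof -
  define B where "B = {k. ksq L k = lam j}"
  have fB: "finite B" unfolding B_def by (rule finite_subset[OF _ finite_ksq[OF L_pos, of "lam j"]]) auto
  define S where "S x = (\<Sum>k\<in>B. acoef j m k * cos (phase L k x) + bcoef j m k * sin (phase L k x))" for x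
  have S_tp: "trigpoly L B S" unfolding S_def
    by (intro trigpoly_sum trigpoly_add trigpoly_scale trigpoly_cos trigpoly_sin)
  have S_mom: "(LINT x|Q. S x * cos (phase L l x + c)) = L\<^sup>2 * (acoef j m l * cos c - bcoef j m l * sin c)" for l c
  proof -
    have cc: "integrable Q (\<lambda>x. cos (phase L k x + d) * cos (phase L l x + c))" for k d
      by (rule continuous_imp_integrable_square[OF trigpoly_continuous[OF trigpoly_cos_mult_cos]])
    \<comment> \<open>At frequency zero the cases \<open>k = l\<close> and \<open>k = - l\<close>
      coincide and the sine contributions cancel, which agrees with the formula only if this
      coefficient is zero.\<close>
    have b0: "bcoef j m (0, 0) = 0"
      using coef_uminus(2)[of j m 0] by (simp add: zero_prod_def)
    have "(LINT x|Q. S x * cos (phase L l x + c)) =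
      (LINT x|Q. (\<Sum>k\<in>B. acoef j m k * (cos (phase L k x + 0) * cos (phase L l x + c)) + bcoef j m k * (cos (phase L k x + - (pi/2)) * cos (phase L l x + c))))"
      by (rule Bochner_Integration.integral_cong) (simp_all add: S_def sum_distrib_right sum_distrib_left cos_diff algebra_simps)
    also have "\<dots> = (\<Sum>k\<in>B. acoef j m k * (LINT x|Q. cos (phase L k x + 0) * cos (phase L l x + c)) + bcoef j m k * (LINT x|Q. cos (phase L k x + - (pi/2)) * cos (phase L l x + c)))"
      by (simp only: Bochner_Integration.integral_sum Bochner_Integration.integral_add Bochner_Integration.integrable_add integrable_mult_right integral_mult_right_zero cc)
    also have "\<dots> = (\<Sum>k\<in>B. (if k = l then L\<^sup>2 / 2 * (acoef j m l * cos c - bcoef j m l * sin c) else 0) +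
        (if k = - l then L\<^sup>2 / 2 * (acoef j m l * cos c - bcoef j m l * sin c) else 0))"
      unfolding LINT_cos_phase_cos_phase[OF L_pos]
      by (rule sum.cong) (auto simp: coef_uminus cos_add cos_diff algebra_simps b0)
    also have "\<dots> = (if l \<in> B then L\<^sup>2 * (acoef j m l * cos c - bcoef j m l * sin c) else 0)"
      using fB by (simp add: sum.distrib B_def)
    also have "\<dots> = L\<^sup>2 * (acoef j m l * cos c - bcoef j m l * sin c)"
      using coef_zero[OF j] by (auto simp: B_def)
    finally show ?thesis .
  qed
  have T0: "\<phi> j x $ m - 1 / L\<^sup>2 * S x = 0" for x
  proof (rule trigpoly_orthogonal_imp_zero[OF L_pos])
    show cT: "continuous_on UNIV (\<lambda>x. \<phi> j x $ m - 1 / L\<^sup>2 * S x)"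
      by (intro continuous_intros phi_continuous j trigpoly_continuous[OF S_tp])
    show "periodic L (\<lambda>x. \<phi> j x $ m - 1 / L\<^sup>2 * S x)"
      using trigpoly_periodic[OF S_tp] L_pos L2per_periodic[OF phi_L2per[OF j]] by (auto simp: periodic_def)
    fix \<psi> assume \<psi>: "trigpoly L UNIV \<psi>"
    show "(LINT x|Q. (\<phi> j x $ m - 1 / L\<^sup>2 * S x) * \<psi> x) = 0"
    proof (rule trigpoly_orthogonalI[OF continuous_imp_sqint_square[OF cT] _ \<psi>])
      fix k c
      have i1: "integrable Q (\<lambda>x. \<phi> j x $ m * cos (phase L k x + c))"
        by (intro phi_component_int j trigpoly_smooth[of L UNIV] trigpoly_cos_shift UNIV_I)
      have i2: "integrable Q (\<lambda>x. S x * cos (phase L k x + c))"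
        by (intro continuous_imp_integrable_square continuous_intros trigpoly_continuous[OF S_tp] trigpoly_continuous[OF trigpoly_cos_shift[OF UNIV_I]])
      have "(LINT x|Q. (\<phi> j x $ m - 1 / L\<^sup>2 * S x) * cos (phase L k x + c)) =
        (LINT x|Q. \<phi> j x $ m * cos (phase L k x + c) - 1 / L\<^sup>2 * (S x * cos (phase L k x + c)))"
        by (rule Bochner_Integration.integral_cong) (auto simp: algebra_simps)
      also have "\<dots> = 0"
        by (subst Bochner_Integration.integral_diff[OF i1 integrable_mult_right[OF i2]])
          (use L_pos in \<open>simp only: integral_mult_right_zero S_mom phi_moment[OF j]; simp\<close>)
      finally show "(LINT x|Q. (\<phi> j x $ m - 1 / L\<^sup>2 * S x) * cos (phase L k x + c)) = 0" .
    qed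
  qed
  show ?thesis using T0[of x] by (simp add: S_def B_def)
qed

lemma phi_trigpoly: "j \<ge> 1 \<Longrightarrow> trigpoly L {k. ksq L k = lam j} (\<lambda>x. \<phi> j x $ m)"
  unfolding phi_rep by (intro trigpoly_scale trigpoly_sum trigpoly_add trigpoly_cos trigpoly_sin) auto

text \<open>The weak constraint becomes a pointwise identity: after termwise differentiation the
  divergence is a sum of waves whose coefficients are the sums in
  \<open>coef_div_free\<close>.\<close>

lemma phi_div_free:
  assumes j: "j \<ge> 1"
  shows "(\<Sum>m\<in>UNIV. partial m (\<lambda>x. \<phi> j x $ m) x) = 0"
proof -
  define B where "B = {k. ksq L k = lam j}"
  define c where "c k = (\<lambda>x::real^2. cos (phase L k x))" for k
  define s where "s k = (\<lambda>x::real^2. sin (phase L k x))" for k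
  have tp: "trigpoly L UNIV (c k)" "trigpoly L UNIV (s k)" for k
    by (auto simp: c_def s_def intro: trigpoly.intros)
  have eq: "(\<lambda>x. \<phi> j x $ m) = (\<lambda>x. 1 / L\<^sup>2 * (\<Sum>k\<in>B. acoef j m k * c k x + bcoef j m k * s k x))" for m
    using phi_rep[OF j] by (simp add: fun_eq_iff B_def c_def s_def)
  have tp2: "trigpoly L UNIV (\<lambda>x. acoef j m k * c k x + bcoef j m k * s k x)" for m k
    by (intro trigpoly_add trigpoly_scale tp)
  have "partial m (\<lambda>x. \<phi> j x $ m) x = 1 / L\<^sup>2 * (\<Sum>k\<in>B. acoef j m k * partial m (c k) x + bcoef j m k * partial m (s k) x)" for m
    unfolding eq
    by (subst partial_scale[OF trigpoly_sum[OF tp2]], subst partial_sum[OF tp2])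
      (simp add: partial_add[OF trigpoly_scale[OF tp(1)] trigpoly_scale[OF tp(2)]] partial_scale[OF tp(1)] partial_scale[OF tp(2)])
  moreover have "partial m (c k) x = - (2 * pi / L * freq k m) * s k x" "partial m (s k) x = 2 * pi / L * freq k m * c k x" for k m
    using partial_cos_phase[of m L k 0 x] partial_sin_phase[of m L k 0 x] by (simp_all add: c_def s_def)
  ultimately have p: "partial m (\<lambda>x. \<phi> j x $ m) x = 1 / L\<^sup>2 * (\<Sum>k\<in>B. 2 * pi / L * (c k x * (freq k m * bcoef j m k) - s k x * (freq k m * acoef j m k)))" for m
    by (simp add: algebra_simps)
  have "(\<Sum>m\<in>UNIV. partial m (\<lambda>x. \<phi> j x $ m) x) =
     1 / L\<^sup>2 * (\<Sum>k\<in>B. 2 * pi / L * (c k x * (\<Sum>m\<in>UNIV. freq k m * bcoef j m k) - s k x * (\<Sum>m\<in>UNIV. freq k m * acoef j m k)))"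
    unfolding p
  proof (subst sum_distrib_left[symmetric], rule arg_cong[where f="\<lambda>y. 1 / L\<^sup>2 * y"], subst sum.swap, rule sum.cong)
    fix k
    show "(\<Sum>m\<in>UNIV. 2 * pi / L * (c k x * (freq k m * bcoef j m k) - s k x * (freq k m * acoef j m k))) =
      2 * pi / L * (c k x * (\<Sum>m\<in>UNIV. freq k m * bcoef j m k) - s k x * (\<Sum>m\<in>UNIV. freq k m * acoef j m k))"
      by (simp only: sum_distrib_left sum_subtractf right_diff_distrib)
  qed simp
  also have "\<dots> = 0" by (simp only: coef_div_free[OF j]) simp
  finally show ?thesis .
qed

text \<open>A nonpositive eigenvalue would leave only frequency zero, which the vanishing mean
  excludes; then \<open>\<phi> j\<close> would be zero, against its normalisation.\<close>

lemma lam_pos: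
  assumes j: "j \<ge> 1"
  shows "lam j > 0"
proof (rule ccontr)
  assume "\<not> lam j > 0"
  have z: "acoef j m k = 0 \<and> bcoef j m k = 0" for m k
  proof (cases "k = 0")
    case True
    have "(LINT x|Q. \<phi> j x) = 0" using phi_H[OF j] by (simp add: spaceH_def)
    then have "(LINT x|Q. \<phi> j x $ m) = 0"
      using smooth_test_mult_component(2)[OF trigpoly_smooth[OF trigpoly_const[of UNIV L 1, OF UNIV_I]] phi_sqint[OF j], of m] by simp
    then show ?thesis using True by (simp add: acoef_def bcoef_def)
  next
    case False
    then have "fst k \<noteq> 0 \<or> snd k \<noteq> 0" by (metis prod.collapse zero_prod_def)
    then have "ksq L k > 0" using L_pos unfolding ksq_def sum_2 freq_def
      by (intro mult_pos_pos) (auto simp: sum_power2_gt_zero_iff)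
    then show ?thesis using coef_zero[OF j] \<open>\<not> lam j > 0\<close> by auto
  qed
  then have "\<phi> j x = 0" for x using phi_rep[OF j, of x] by (simp add: vec_eq_iff)
  then have "l2_inner L (\<phi> j) (\<phi> j) = 0" by (simp add: l2_inner_def)
  then show False using phi_orthonormal[OF j j] by simp
qed

end

subsection \<open>Pointwise bounds for the eigenfunctions\<close>

lemma int_inverse_square_sum_bounded: "\<exists>S>0. \<forall>A :: int set. finite A \<longrightarrow> (\<Sum>n\<in>A. 1 / (1 + (of_int n)\<^sup>2)) \<le> (S :: real)"
proof -
  define g where "g n = 1 / (1 + (real n)\<^sup>2)" for n :: nat
  have "summable (\<lambda>n. 1 / (real (Suc n))\<^sup>2)"
    using inverse_power_summable[of 2, where 'a=real] summable_Suc_iff[of "\<lambda>n. inverse ((of_nat n :: real)\<^sup>2)"]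
    by (simp add: divide_inverse del: of_nat_Suc)
  then have "summable (\<lambda>n. g (Suc n))"
  proof (rule summable_comparison_test'[where N=0])
    fix n :: nat
    show "norm (g (Suc n)) \<le> 1 / (real (Suc n))\<^sup>2"
      by (auto simp: g_def intro!: divide_left_mono mult_pos_pos add_pos_nonneg)
  qed
  then have sg: "summable g" by (simp add: summable_Suc_iff)
  have gn: "g n \<ge> 0" for n by (simp add: g_def)
  show ?thesis
  \<comment> \<open>Nonnegative and negative integers are each bounded by one series over the
    naturals; the 1 makes the bound positive.\<close>
  proof (intro exI[of _ "1 + suminf g + suminf g"] conjI allI impI)
    show "1 + suminf g + suminf g > 0" using suminf_nonneg[OF sg gn] by simp
    fix A :: "int set" assume A: "finite A"
    have "(\<Sum>n\<in>A. 1 / (1 + (of_int n)\<^sup>2)) = (\<Sum>n\<in>A. g (nat \<bar>n\<bar>))"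
      by (rule sum.cong) (auto simp: g_def)
    also have "\<dots> = (\<Sum>n\<in>A \<inter> {0..}. g (nat \<bar>n\<bar>)) + (\<Sum>n\<in>A \<inter> {..<0}. g (nat \<bar>n\<bar>))"
      by (subst sum.union_disjoint[symmetric]) (use A in \<open>auto intro!: sum.cong\<close>)
    also have "(\<Sum>n\<in>A \<inter> {0..}. g (nat \<bar>n\<bar>)) = sum g ((\<lambda>n. nat \<bar>n\<bar>) ` (A \<inter> {0..}))"
      by (subst sum.reindex) (auto simp: inj_on_def)
    also have "(\<Sum>n\<in>A \<inter> {..<0}. g (nat \<bar>n\<bar>)) = sum g ((\<lambda>n. nat \<bar>n\<bar>) ` (A \<inter> {..<0}))"
      by (subst sum.reindex) (auto simp: inj_on_def)
    also have "sum g ((\<lambda>n. nat \<bar>n\<bar>) ` (A \<inter> {0..})) \<le> suminf g"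
      using A by (intro sum_le_suminf sg) (auto simp: gn)
    also have "sum g ((\<lambda>n. nat \<bar>n\<bar>) ` (A \<inter> {..<0})) \<le> suminf g"
      using A by (intro sum_le_suminf sg) (auto simp: gn)
    finally show "(\<Sum>n\<in>A. 1 / (1 + (of_int n)\<^sup>2)) \<le> 1 + suminf g + suminf g" by simp
  qed
qed

text \<open>The sum of \<open>|k|^(-4)\<close> over the plane lattice is dominated by a product of
  two sums over the integers, because \<open>(1 + a) * (1 + b) \<le> 4 * (a + b)\<^sup>2\<close>
  once \<open>a + b \<ge> 1\<close>, which holds for nonzero integer vectors.\<close>

lemma lattice_sum_bounded:
  assumes L: "L > 0"
  shows "\<exists>Z>0. \<forall>B. finite B \<and> 0 \<notin> B \<longrightarrow> (\<Sum>k\<in>B. (1 / ksq L k)\<^sup>2) \<le> Z"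
proof -
  obtain S :: real where S: "S > 0" "\<And>A :: int set. finite A \<Longrightarrow> (\<Sum>n\<in>A. 1 / (1 + (of_int n)\<^sup>2)) \<le> S"
    using int_inverse_square_sum_bounded by blast
  define h where "h n = 1 / (1 + (of_int n :: real)\<^sup>2)" for n :: int
  have h: "h n \<ge> 0" for n by (simp add: h_def)
  define c where "c = ((L / (2 * pi))\<^sup>2)\<^sup>2 * 4"
  have c: "c > 0" using L by (simp add: c_def)
  have termb: "(1 / ksq L k)\<^sup>2 \<le> c * (h (fst k) * h (snd k))" if "k \<noteq> 0" for k
  proof -
    define a b where "a = (of_int (fst k) :: real)\<^sup>2" and "b = (of_int (snd k) :: real)\<^sup>2"
    have ab: "a \<ge> 0" "b \<ge> 0" by (auto simp: a_def b_def)
    have "fst k \<noteq> 0 \<or> snd k \<noteq> 0" using that by (auto simp: prod_eq_iff)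
    then have "1 \<le> (fst k)\<^sup>2 + (snd k)\<^sup>2"
      by (metis int_one_le_iff_zero_less sum_power2_gt_zero_iff)
    then have "(of_int 1 :: real) \<le> of_int ((fst k)\<^sup>2 + (snd k)\<^sup>2)" by (simp only: of_int_le_iff)
    then have 1: "1 \<le> a + b" by (simp add: a_def b_def)
    have "(1 + a) * (1 + b) \<le> (1 + (a + b)) * (1 + (a + b))" using ab by (intro mult_mono) auto
    also have "\<dots> \<le> (2 * (a + b)) * (2 * (a + b))" using 1 ab by (intro mult_mono) auto
    finally have 2: "(1 + a) * (1 + b) \<le> 4 * (a + b)\<^sup>2" by (simp add: power2_eq_square algebra_simps)
    have k: "ksq L k = (2 * pi / L)\<^sup>2 * (a + b)" by (simp add: ksq_def sum_2 freq_def a_def b_def)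
    have "(1 / ksq L k)\<^sup>2 = ((L / (2 * pi))\<^sup>2)\<^sup>2 / (a + b)\<^sup>2"
      unfolding k by (simp add: power_mult_distrib power_divide)
    also have "\<dots> \<le> ((L / (2 * pi))\<^sup>2)\<^sup>2 * (4 / ((1 + a) * (1 + b)))"
    proof -
      have "1 / (a + b)\<^sup>2 \<le> 4 / ((1 + a) * (1 + b))"
        using 1 2 ab by (simp add: divide_simps)
      then show ?thesis using mult_left_mono[of _ _ "((L / (2 * pi))\<^sup>2)\<^sup>2"] by fastforce
    qed
    also have "\<dots> = c * (h (fst k) * h (snd k))" by (simp add: c_def h_def a_def b_def)
    finally show ?thesis .
  qed
  show ?thesis
  proof (intro exI[of _ "c * (S * S)"] conjI allI impI)
    show "c * (S * S) > 0" using c S by simp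
    fix B :: "(int \<times> int) set" assume B: "finite B \<and> 0 \<notin> B"
    have "(\<Sum>k\<in>B. (1 / ksq L k)\<^sup>2) \<le> (\<Sum>k\<in>B. c * (h (fst k) * h (snd k)))"
      using B by (intro sum_mono termb) auto
    also have "\<dots> \<le> (\<Sum>k\<in>fst ` B \<times> snd ` B. c * (h (fst k) * h (snd k)))"
    proof (rule sum_mono2)
      show "B \<subseteq> fst ` B \<times> snd ` B" by (metis mem_Times_iff imageI subsetI)
    qed (use B c h in \<open>auto intro!: mult_nonneg_nonneg\<close>)
    also have "\<dots> = c * ((\<Sum>n\<in>fst ` B. h n) * (\<Sum>n\<in>snd ` B. h n))"
      unfolding sum_product sum.cartesian_product by (simp add: sum_distrib_left split_def)
    also have "\<dots> \<le> c * (S * S)"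
      using S(2)[of "fst ` B"] S(2)[of "snd ` B"] B c h S(1)
      by (intro mult_left_mono mult_mono sum_nonneg) (auto simp: h_def)
    finally show "(\<Sum>k\<in>B. (1 / ksq L k)\<^sup>2) \<le> c * (S * S)" .
  qed
qed

section \<open>Finite combinations of eigenfunctions and a supremum bound\<close>

context stokes_basis
begin

abbreviation cf :: "field \<Rightarrow> nat \<Rightarrow> real" where "cf u j \<equiv> l2_inner L u (\<phi> j)"

definition comb :: "nat set \<Rightarrow> (nat \<Rightarrow> real) \<Rightarrow> field" where
  "comb F c x = (\<Sum>j\<in>F. c j *\<^sub>R \<phi> j x)"

lemma comb_continuous: "F \<subseteq> {1..} \<Longrightarrow> continuous_on S (comb F c)"
  unfolding comb_def by (intro continuous_intros phi_continuous) auto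

lemma comb_sqint: "F \<subseteq> {1..} \<Longrightarrow> sqint Q (comb F c)"
  by (intro continuous_imp_sqint_square comb_continuous)

lemma cf_comb:
  assumes "finite F" "F \<subseteq> {1..}" "i \<ge> 1"
  shows "cf (comb F c) i = (if i \<in> F then c i else 0)"
proof -
  have "cf (comb F c) i = (\<Sum>j\<in>F. l2_inner L (\<lambda>x. c j *\<^sub>R \<phi> j x) (\<phi> i))"
    unfolding comb_def using assms by (intro l2_inner_sum_left sqint_scaleR phi_sqint) auto
  also have "\<dots> = (\<Sum>j\<in>F. if j = i then c j else 0)"
    using assms by (intro sum.cong) (auto simp: l2_inner_scaleR_left phi_orthonormal)
  finally show ?thesis using assms by simp
qed

lemma inner_comb:
  assumes "finite F" "F \<subseteq> {1..}" "sqint Q h"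
  shows "l2_inner L h (comb F c) = (\<Sum>j\<in>F. c j * cf h j)"
proof -
  have "l2_inner L (comb F c) h = (\<Sum>j\<in>F. l2_inner L (\<lambda>x. c j *\<^sub>R \<phi> j x) h)"
    unfolding comb_def using assms by (intro l2_inner_sum_left sqint_scaleR phi_sqint) auto
  then show ?thesis by (simp add: l2_inner_scaleR_left l2_inner_commute[of _ h])
qed

lemma norm_comb:
  assumes "finite F" "F \<subseteq> {1..}"
  shows "(norm2 Q (comb F c))\<^sup>2 = (\<Sum>j\<in>F. (c j)\<^sup>2)"
proof -
  have "(norm2 Q (comb F c))\<^sup>2 = l2_inner L (comb F c) (comb F c)"
    by (simp add: norm2_power2 l2_inner_def power2_norm_eq_inner)
  also have "\<dots> = (\<Sum>j\<in>F. c j * cf (comb F c) j)" by (rule inner_comb[OF assms comb_sqint[OF assms(2)]])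
  also have "\<dots> = (\<Sum>j\<in>F. (c j)\<^sup>2)"
    using assms by (intro sum.cong) (auto simp: cf_comb power2_eq_square subset_iff)
  finally show ?thesis .
qed

lemma Bessel:
  assumes F: "finite F" "F \<subseteq> {1..}" and h: "sqint Q h"
  shows "(\<Sum>j\<in>F. (cf h j)\<^sup>2) \<le> (norm2 Q h)\<^sup>2"
proof -
  have "0 \<le> (norm2 Q (\<lambda>x. h x + (-1) *\<^sub>R comb F (cf h) x))\<^sup>2" by simp
  also have "\<dots> = (norm2 Q h)\<^sup>2 + 2 * (-1) * l2_inner L h (comb F (cf h)) + (-1)\<^sup>2 * (norm2 Q (comb F (cf h)))\<^sup>2"
    unfolding sqint_expand[OF h comb_sqint[OF F(2)]] l2_inner_def ..
  also have "\<dots> = (norm2 Q h)\<^sup>2 - (\<Sum>j\<in>F. (cf h j)\<^sup>2)"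
    unfolding inner_comb[OF F h] norm_comb[OF F] by (simp add: power2_eq_square)
  finally show ?thesis by simp
qed

text \<open>Bessel's inequality for \<open>G\<close>, a truncation of the Green function of minus
  the Laplacian with pole at \<open>x\<close> in direction \<open>m\<close>: its coefficient along
  \<open>\<phi> j\<close> is \<open>\<phi> j x $ m / lam j\<close>, and its squared norm is the
  right-hand side.\<close>

lemma weyl_component:
  assumes F: "finite F" "F \<subseteq> {1..}"
  defines "B \<equiv> \<Union>j\<in>F. {k. ksq L k = lam j}"
  shows "(\<Sum>j\<in>F. (\<phi> j x $ m / lam j)\<^sup>2) \<le> 1 / L\<^sup>2 * (\<Sum>k\<in>B. (1 / ksq L k)\<^sup>2)"
proof -
  have fin: "finite {k. ksq L k = l}" for l
    by (rule finite_subset[OF _ finite_ksq[OF L_pos, of l]]) auto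
  have fB: "finite B" unfolding B_def using F fin by auto
  have Bm: "- k \<in> B \<longleftrightarrow> k \<in> B" for k by (simp add: B_def)
  define w where "w k = 1 / L\<^sup>2 * (1 / ksq L k)" for k
  have wm: "w (- k) = w k" for k by (simp add: w_def)
  define e where "e k = (\<lambda>y::real^2. cos (phase L k y + (- phase L k x)))" for k
  have e_tp: "trigpoly L UNIV (e k)" for k unfolding e_def by (intro trigpoly_cos_shift UNIV_I)
  define g where "g y = (\<Sum>k\<in>B. w k * e k y)" for y
  have g_tp: "trigpoly L UNIV g" unfolding g_def by (intro trigpoly_sum trigpoly_scale e_tp)
  define G where "G y = g y *\<^sub>R (axis m 1 :: real^2)" for y
  have G: "sqint Q G" unfolding G_def
    by (intro continuous_imp_sqint_square continuous_intros trigpoly_continuous[OF g_tp])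
  have "cf G j = \<phi> j x $ m / lam j" if j: "j \<in> F" for j
  proof -
    have j1: "j \<ge> 1" using j F by auto
    have i: "integrable Q (\<lambda>y. \<phi> j y $ m * e k y)" for k
      by (rule phi_component_int[OF j1 trigpoly_smooth[OF e_tp]])
    have "cf G j = (LINT y|Q. (\<Sum>k\<in>B. w k * (\<phi> j y $ m * e k y)))"
      unfolding l2_inner_def
      by (rule Bochner_Integration.integral_cong) (auto simp: G_def g_def inner_commute[of "axis m 1"] inner_axis sum_distrib_right sum_distrib_left mult_ac)
    also have "\<dots> = (\<Sum>k\<in>B. w k * (LINT y|Q. \<phi> j y $ m * e k y))"
      by (simp add: Bochner_Integration.integral_sum i)
    also have "\<dots> = (\<Sum>k\<in>B. w k * (acoef j m k * cos (phase L k x) + bcoef j m k * sin (phase L k x)))"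
      unfolding e_def phi_moment[OF j1] by simp
    also have "\<dots> = (\<Sum>k | ksq L k = lam j. w k * (acoef j m k * cos (phase L k x) + bcoef j m k * sin (phase L k x)))"
      using j coef_zero[OF j1] by (intro sum.mono_neutral_right fB) (auto simp: B_def)
    also have "\<dots> = 1 / lam j * (1 / L\<^sup>2 * (\<Sum>k | ksq L k = lam j. acoef j m k * cos (phase L k x) + bcoef j m k * sin (phase L k x)))"
      unfolding sum_distrib_left by (rule sum.cong) (auto simp: w_def)
    also have "\<dots> = \<phi> j x $ m / lam j" by (subst phi_rep[OF j1, of x m]) simp
    finally show ?thesis .
  qed
  then have "(\<Sum>j\<in>F. (\<phi> j x $ m / lam j)\<^sup>2) = (\<Sum>j\<in>F. (cf G j)\<^sup>2)" by simp
  also have "\<dots> \<le> (norm2 Q G)\<^sup>2" by (rule Bessel[OF F G])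
  also have "(norm2 Q G)\<^sup>2 = (LINT y|Q. (\<Sum>k\<in>B. \<Sum>l\<in>B. (w k * w l) * (e k y * e l y)))"
    unfolding norm2_power2
    by (rule Bochner_Integration.integral_cong) (auto simp: G_def g_def power2_eq_square norm_axis_1 sum_product mult_ac)
  also have "\<dots> = (\<Sum>k\<in>B. \<Sum>l\<in>B. (w k * w l) * (LINT y|Q. e k y * e l y))"
    by (simp add: Bochner_Integration.integral_sum continuous_imp_integrable_square[OF trigpoly_continuous[OF trigpoly_mult[OF e_tp e_tp]]])
  also have "\<dots> = (\<Sum>k\<in>B. \<Sum>l\<in>B. (if l = k then L\<^sup>2 / 2 * (w k)\<^sup>2 else 0) + (if l = - k then L\<^sup>2 / 2 * (w k)\<^sup>2 else 0))"
    unfolding e_def LINT_cos_phase_cos_phase[OF L_pos]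
    by (intro sum.cong refl) (auto simp: wm phase_uminus power2_eq_square algebra_simps)
  also have "\<dots> = (\<Sum>k\<in>B. L\<^sup>2 * (w k)\<^sup>2)"
    using fB Bm by (intro sum.cong refl) (simp add: sum.distrib)
  also have "\<dots> = 1 / L\<^sup>2 * (\<Sum>k\<in>B. (1 / ksq L k)\<^sup>2)"
    unfolding sum_distrib_left
    by (rule sum.cong) (use L_pos in \<open>auto simp: w_def power2_eq_square field_simps\<close>)
  finally show ?thesis .
qed

text \<open>Uniformity in \<open>x\<close> and in the finite set \<open>F\<close> makes this the
  embedding of the domain of \<open>A\<close> into bounded fields, in coefficient form.\<close>

lemma weyl_ex: "\<exists>C>0. \<forall>x F. finite F \<and> F \<subseteq> {1..} \<longrightarrow> (\<Sum>j\<in>F. (norm (\<phi> j x) / lam j)\<^sup>2) \<le> C\<^sup>2"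
proof -
  obtain Z where Z: "Z > 0" "\<And>B. finite B \<Longrightarrow> 0 \<notin> B \<Longrightarrow> (\<Sum>k\<in>B. (1 / ksq L k)\<^sup>2) \<le> Z"
    using lattice_sum_bounded[OF L_pos] by blast
  show ?thesis
  proof (intro exI[of _ "sqrt (2 * Z / L\<^sup>2)"] conjI allI impI)
    show "sqrt (2 * Z / L\<^sup>2) > 0" using Z L_pos by simp
    fix x F assume F: "finite F \<and> F \<subseteq> {1::nat..}"
    let ?B = "\<Union>j\<in>F. {k. ksq L k = lam j}"
    have fin: "finite {k. ksq L k = l}" for l
      by (rule finite_subset[OF _ finite_ksq[OF L_pos, of l]]) auto
    have "0 \<notin> ?B"
    proof
      assume "0 \<in> ?B"
      then obtain j where "j \<in> F" "ksq L 0 = lam j" by auto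
      then show False using lam_pos[of j] F by (auto simp: ksq_def)
    qed
    then have "(\<Sum>k\<in>?B. (1 / ksq L k)\<^sup>2) \<le> Z" using F fin by (intro Z) auto
    then have 1: "(\<Sum>j\<in>F. (\<phi> j x $ m / lam j)\<^sup>2) \<le> Z / L\<^sup>2" for m
    proof -
      have "(\<Sum>j\<in>F. (\<phi> j x $ m / lam j)\<^sup>2) \<le> 1 / L\<^sup>2 * (\<Sum>k\<in>?B. (1 / ksq L k)\<^sup>2)"
        using F by (intro weyl_component) auto
      also have "\<dots> \<le> 1 / L\<^sup>2 * Z"
        by (rule mult_left_mono[OF \<open>(\<Sum>k\<in>?B. (1 / ksq L k)\<^sup>2) \<le> Z\<close>]) simp
      finally show ?thesis by simp
    qed
    have n2: "(norm v)\<^sup>2 = (v $ 1)\<^sup>2 + (v $ 2)\<^sup>2" for v :: "real^2"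
      by (simp add: power2_norm_eq_inner inner_vec_def sum_2) (simp add: power2_eq_square)
    have "(norm (\<phi> j x) / lam j)\<^sup>2 = (\<phi> j x $ 1 / lam j)\<^sup>2 + (\<phi> j x $ 2 / lam j)\<^sup>2" for j
      by (simp only: power_divide n2 add_divide_distrib)
    then have "(\<Sum>j\<in>F. (norm (\<phi> j x) / lam j)\<^sup>2) \<le> 2 * Z / L\<^sup>2"
      using 1[of 1] 1[of 2] by (simp add: sum.distrib)
    also have "\<dots> = (sqrt (2 * Z / L\<^sup>2))\<^sup>2" using Z L_pos by simp
    finally show "(\<Sum>j\<in>F. (norm (\<phi> j x) / lam j)\<^sup>2) \<le> (sqrt (2 * Z / L\<^sup>2))\<^sup>2" .
  qed
qed

definition weylC :: real where
  "weylC = (SOME C. C > 0 \<and> (\<forall>x F. finite F \<and> F \<subseteq> {1..} \<longrightarrow> (\<Sum>j\<in>F. (norm (\<phi> j x) / lam j)\<^sup>2) \<le> C\<^sup>2))"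

lemma weylC: "weylC > 0"
  "finite F \<Longrightarrow> F \<subseteq> {1..} \<Longrightarrow> (\<Sum>j\<in>F. (norm (\<phi> j x) / lam j)\<^sup>2) \<le> weylC\<^sup>2"
  using someI_ex[OF weyl_ex] unfolding weylC_def by blast+

text \<open>Cauchy-Schwarz after splitting each term into \<open>norm (\<phi> j x) / lam j\<close>
  and \<open>lam j * \<bar>c j\<bar>\<close>.\<close>

lemma sum_sup_bound:
  assumes F: "finite F" "F \<subseteq> {1..}" and K: "(\<Sum>j\<in>F. (lam j * c j)\<^sup>2) \<le> K\<^sup>2" "K \<ge> 0"
  shows "(\<Sum>j\<in>F. norm (c j *\<^sub>R \<phi> j x)) \<le> weylC * K"
proof (rule power2_le_imp_le)
  have "(\<Sum>j\<in>F. norm (c j *\<^sub>R \<phi> j x)) = (\<Sum>j\<in>F. (norm (\<phi> j x) / lam j) * (lam j * \<bar>c j\<bar>))"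
  proof (rule sum.cong)
    fix j assume "j \<in> F"
    then have "lam j > 0" using F lam_pos by auto
    then show "norm (c j *\<^sub>R \<phi> j x) = (norm (\<phi> j x) / lam j) * (lam j * \<bar>c j\<bar>)" by simp
  qed simp
  then have "(\<Sum>j\<in>F. norm (c j *\<^sub>R \<phi> j x))\<^sup>2 \<le> (\<Sum>j\<in>F. (norm (\<phi> j x) / lam j)\<^sup>2) * (\<Sum>j\<in>F. (lam j * \<bar>c j\<bar>)\<^sup>2)"
    using Cauchy_Schwarz_ineq_sum[of "\<lambda>j. norm (\<phi> j x) / lam j" "\<lambda>j. lam j * \<bar>c j\<bar>" F] by simp
  also have "\<dots> \<le> weylC\<^sup>2 * K\<^sup>2"
    using weylC(2)[OF F] K by (intro mult_mono sum_nonneg) (auto simp: power_mult_distrib)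
  finally show "(\<Sum>j\<in>F. norm (c j *\<^sub>R \<phi> j x))\<^sup>2 \<le> (weylC * K)\<^sup>2" by (simp add: power_mult_distrib)
  show "0 \<le> weylC * K" using weylC(1) K by simp
qed

text \<open>Integrating the pointwise bound over the square bounds the sum of
  \<open>1 / (lam j)\<^sup>2\<close>, since the eigenfunctions are normalised; bounded eigenvalues
  would make it diverge.\<close>

lemma lam_at_top: "\<exists>n\<ge>1. \<forall>j\<ge>n. lam j > \<Lambda>"
proof (rule ccontr)
  assume "\<not> ?thesis"
  then have "\<forall>n\<ge>1. \<exists>j\<ge>n. lam j \<le> \<Lambda>" by (auto simp: not_less)
  then have le: "lam n \<le> \<Lambda>" if "n \<ge> 1" for n using lam_mono that by (meson order_trans)
  have \<Lambda>: "\<Lambda> > 0" using le[of 1] lam_pos[of 1] by simp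
  have "real n * (1 / \<Lambda>\<^sup>2) \<le> L\<^sup>2 * weylC\<^sup>2" for n
  proof -
    have i: "integrable Q (\<lambda>x. (norm (\<phi> j x) / lam j)\<^sup>2)" if "j \<ge> 1" for j
      using phi_sqint[OF that] by (simp add: sqint_def power_divide)
    have i': "(LINT x|Q. (norm (\<phi> j x) / lam j)\<^sup>2) = 1 / (lam j)\<^sup>2" if "j \<ge> 1" for j
      using phi_orthonormal[OF that that] by (simp add: power_divide l2_inner_def power2_norm_eq_inner)
    have "real n * (1 / \<Lambda>\<^sup>2) = (\<Sum>j\<in>{1..n}. 1 / \<Lambda>\<^sup>2)" by simp
    also have "\<dots> \<le> (\<Sum>j\<in>{1..n}. 1 / (lam j)\<^sup>2)"
    proof (rule sum_mono)
      fix j assume "j \<in> {1..n}"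
      then have j: "0 < lam j" "lam j \<le> \<Lambda>" using lam_pos le by auto
      then have "(lam j)\<^sup>2 \<le> \<Lambda>\<^sup>2" by (intro power_mono) auto
      then show "1 / \<Lambda>\<^sup>2 \<le> 1 / (lam j)\<^sup>2" using j by (intro divide_left_mono) auto
    qed
    also have "\<dots> = (LINT x|Q. (\<Sum>j\<in>{1..n}. (norm (\<phi> j x) / lam j)\<^sup>2))"
      by (subst Bochner_Integration.integral_sum) (auto simp: i i')
    also have "\<dots> \<le> (LINT x|Q. weylC\<^sup>2)"
    proof (rule integral_mono)
      show "integrable Q (\<lambda>x. \<Sum>j = 1..n. (norm (\<phi> j x) / lam j)\<^sup>2)"
        by (intro Bochner_Integration.integrable_sum i) auto
      show "integrable Q (\<lambda>x. weylC\<^sup>2)" by (intro continuous_imp_integrable_square continuous_intros)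
    qed (rule weylC(2); auto)
    also have "\<dots> = L\<^sup>2 * weylC\<^sup>2" using measure_square[OF L_pos] by (simp add: measure_restrict_space)
    finally show ?thesis .
  qed
  moreover obtain n :: nat where "real n > L\<^sup>2 * weylC\<^sup>2 * \<Lambda>\<^sup>2" using reals_Archimedean2 by blast
  ultimately show False using \<Lambda> by (auto simp: field_simps not_le[symmetric])
qed

end

subsection \<open>Expansions in the eigenbasis\<close>

lemma abs_le_tendsto_zero:
  fixes f g :: "nat \<Rightarrow> real"
  assumes "\<And>n. \<bar>f n\<bar> \<le> g n" "g \<longlonglongrightarrow> 0"
  shows "f \<longlonglongrightarrow> 0"
  by (rule Lim_null_comparison[OF _ assms(2)]) (simp add: assms(1))

lemma spaceH_L2per: "u \<in> spaceH L \<Longrightarrow> u \<in> L2per L"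
  by (simp add: spaceH_def)

lemma spaceH_sqint: "u \<in> spaceH L \<Longrightarrow> sqint (lebesgue_on (square L)) u"
  by (rule L2per_sqint[OF spaceH_L2per])

lemma sqint_component: "sqint M (f :: 'a \<Rightarrow> real^2) \<Longrightarrow> sqint M (\<lambda>x. f x $ i)"
  unfolding sqint_def
proof (elim conjE, intro conjI)
  assume f: "f \<in> borel_measurable M" "integrable M (\<lambda>x. (norm (f x))\<^sup>2)"
  show m: "(\<lambda>x. f x $ i) \<in> borel_measurable M" unfolding cart_eq_inner_axis using f(1) by measurable
  show "integrable M (\<lambda>x. (norm (f x $ i))\<^sup>2)"
  proof (rule Bochner_Integration.integrable_bound[OF f(2)])
    show "AE x in M. norm ((norm (f x $ i))\<^sup>2) \<le> norm ((norm (f x))\<^sup>2)"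
      by (intro AE_I2) (simp add: abs_le_square_iff[symmetric] component_le_norm_cart)
  qed (use m in simp)
qed

lemma weakly_div_free_iff_components:
  fixes u :: field and f :: "2 \<Rightarrow> real^2 \<Rightarrow> real"
  assumes "sqint (lebesgue_on (square L)) u" "\<And>i. smooth (f i)"
  shows "(LINT x|lebesgue_on (square L). (\<Sum>i\<in>UNIV. u x $ i * f i x)) =
     (\<Sum>i\<in>UNIV. LINT x|lebesgue_on (square L). f i x * u x $ i)"
  by (subst Bochner_Integration.integral_sum[symmetric])
    (auto intro!: smooth_test_mult_component(1)[OF assms(2,1)] simp: mult.commute)

text \<open>Both constraints defining \<open>spaceH\<close> are integrals against smooth functions.\<close>

lemma spaceH_I:
  assumes u: "u \<in> L2per L" and L: "L > 0"
    and mean: "\<And>m. (LINT x|lebesgue_on (square L). u x $ m) = 0"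
    and div: "\<And>\<psi>. smooth \<psi> \<Longrightarrow> periodic L \<psi> \<Longrightarrow>
      (\<Sum>i\<in>UNIV. LINT x|lebesgue_on (square L). partial i \<psi> x * u x $ i) = 0"
  shows "u \<in> spaceH L"
proof -
  have one: "smooth (\<lambda>x :: real^2. 1 :: real)"
    by (rule trigpoly_smooth[OF trigpoly_const[of UNIV L 1, OF UNIV_I]])
  have "(LINT x|lebesgue_on (square L). u x) $ m = 0" for m
    using smooth_test_mult_component(2)[OF one L2per_sqint[OF u], of m] mean[of m] by simp
  then have "(LINT x|lebesgue_on (square L). u x) = 0" by (simp add: vec_eq_iff)
  moreover have "weakly_div_free L u"
    unfolding weakly_div_free_def
  proof (intro allI impI)
    fix \<psi> :: "real^2 \<Rightarrow> real" assume \<psi>: "smooth \<psi> \<and> periodic L \<psi>"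
    show "(LINT x|lebesgue_on (square L). (\<Sum>i\<in>UNIV. u x $ i * partial i \<psi> x)) = 0"
      by (subst weakly_div_free_iff_components[OF L2per_sqint[OF u]])
        (use \<psi> div smooth_has_derivative(2) in auto)
  qed
  ultimately show ?thesis using u by (simp add: spaceH_def)
qed

lemma spaceH_mean: "u \<in> spaceH L \<Longrightarrow> (LINT x|lebesgue_on (square L). u x $ m) = 0"
  using smooth_test_mult_component(2)[OF trigpoly_smooth[OF trigpoly_const[of UNIV L 1, OF UNIV_I]] spaceH_sqint, of u L m]
  by (simp add: spaceH_def)

lemma spaceH_div:
  "u \<in> spaceH L \<Longrightarrow> smooth \<psi> \<Longrightarrow> periodic L \<psi> \<Longrightarrow>
    (\<Sum>i\<in>UNIV. LINT x|lebesgue_on (square L). partial i \<psi> x * u x $ i) = 0"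
  using weakly_div_free_iff_components[OF spaceH_sqint, of u L "\<lambda>i. partial i \<psi>"] smooth_has_derivative(2)
  by (auto simp: spaceH_def weakly_div_free_def)

lemma smooth_bounded_square:
  assumes "smooth \<psi>"
  shows "sqint (lebesgue_on (square L)) (\<psi> :: real^2 \<Rightarrow> real)"
  by (rule continuous_imp_sqint_square[OF smooth_continuous[OF assms]])

lemma spaceH_add: "L > 0 \<Longrightarrow> u \<in> spaceH L \<Longrightarrow> w \<in> spaceH L \<Longrightarrow> (\<lambda>x. u x + w x) \<in> spaceH L"
proof (rule spaceH_I)
  assume u: "u \<in> spaceH L" and w: "w \<in> spaceH L"
  show "(\<lambda>x. u x + w x) \<in> L2per L" by (rule L2per_add[OF spaceH_L2per[OF u] spaceH_L2per[OF w]])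
  interpret finite_measure "lebesgue_on (square L)" by (rule finite_measure_square)
  show "(LINT x|lebesgue_on (square L). (u x + w x) $ m) = 0" for m
    using sqint_integrable[OF sqint_component[OF spaceH_sqint[OF u]]] sqint_integrable[OF sqint_component[OF spaceH_sqint[OF w]]]
    by (simp add: spaceH_mean[OF u] spaceH_mean[OF w])
  show "(\<Sum>i\<in>UNIV. LINT x|lebesgue_on (square L). partial i \<psi> x * (u x + w x) $ i) = 0"
    if \<psi>: "smooth \<psi>" "periodic L \<psi>" for \<psi>
    using spaceH_div[OF u \<psi>] spaceH_div[OF w \<psi>]
      smooth_test_mult_component(1)[OF smooth_has_derivative(2)[OF \<psi>(1)] spaceH_sqint[OF u]]
      smooth_test_mult_component(1)[OF smooth_has_derivative(2)[OF \<psi>(1)] spaceH_sqint[OF w]]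
    by (simp add: distrib_left sum.distrib)
qed

lemma spaceH_scaleR: "L > 0 \<Longrightarrow> u \<in> spaceH L \<Longrightarrow> (\<lambda>x. c *\<^sub>R u x) \<in> spaceH L"
proof (rule spaceH_I)
  assume u: "u \<in> spaceH L"
  show "(\<lambda>x. c *\<^sub>R u x) \<in> L2per L" by (rule L2per_scaleR[OF spaceH_L2per[OF u]])
  show "(LINT x|lebesgue_on (square L). (c *\<^sub>R u x) $ m) = 0" for m by (simp add: spaceH_mean[OF u])
  show "(\<Sum>i\<in>UNIV. LINT x|lebesgue_on (square L). partial i \<psi> x * (c *\<^sub>R u x) $ i) = 0"
    if \<psi>: "smooth \<psi>" "periodic L \<psi>" for \<psi>
    using spaceH_div[OF u \<psi>] by (simp add: mult.left_commute[of _ c] sum_distrib_left[symmetric])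
qed

lemma spaceH_diff: "L > 0 \<Longrightarrow> u \<in> spaceH L \<Longrightarrow> w \<in> spaceH L \<Longrightarrow> (\<lambda>x. u x - w x) \<in> spaceH L"
  using spaceH_add[OF _ _ spaceH_scaleR[of L w "-1"], of u] by simp

lemma LINT_mult_tendsto:
  fixes w :: "real^2 \<Rightarrow> real"
  assumes "sqint M f" "\<And>n. sqint M (S n)" "sqint M w" "(\<lambda>n. norm2 M (\<lambda>x. S n x - w x)) \<longlonglongrightarrow> 0"
  shows "(\<lambda>n. LINT x|M. f x * S n x) \<longlonglongrightarrow> (LINT x|M. f x * w x)"
proof -
  have "\<bar>(LINT x|M. f x * S n x) - (LINT x|M. f x * w x)\<bar> \<le> norm2 M f * norm2 M (\<lambda>x. S n x - w x)" for n
  proof -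
    have "(LINT x|M. f x * S n x) - (LINT x|M. f x * w x) = (LINT x|M. f x * S n x - f x * w x)"
      using sqint_inner[OF assms(1,2), of n] sqint_inner[OF assms(1,3)] by simp
    also have "\<dots> = (LINT x|M. f x \<bullet> (S n x - w x))" by (simp add: algebra_simps)
    finally show ?thesis using sqint_Cauchy_Schwarz[OF assms(1) sqint_diff[OF assms(2,3)], of n] by simp
  qed
  moreover have "(\<lambda>n. norm2 M f * norm2 M (\<lambda>x. S n x - w x)) \<longlonglongrightarrow> 0" using tendsto_mult_right_zero[OF assms(4)] .
  ultimately have "(\<lambda>n. (LINT x|M. f x * S n x) - (LINT x|M. f x * w x)) \<longlonglongrightarrow> 0"
    by (rule abs_le_tendsto_zero)
  then show ?thesis by (simp add: LIM_zero_iff)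
qed

lemma norm2_component_le:
  assumes "sqint M (f :: 'a \<Rightarrow> real^2)"
  shows "norm2 M (\<lambda>x. f x $ i) \<le> norm2 M f"
  unfolding norm2_def
proof (rule real_sqrt_le_mono, rule integral_mono)
  show "integrable M (\<lambda>x. (norm (f x $ i))\<^sup>2)" "integrable M (\<lambda>x. (norm (f x))\<^sup>2)"
    using assms sqint_component[OF assms, of i] by (simp_all only: sqint_def)
  show "(norm (f x $ i))\<^sup>2 \<le> (norm (f x))\<^sup>2" for x
    using component_le_norm_cart[of "f x" i] by (intro power_mono) auto
qed

text \<open>Each constraint is the pairing with a fixed smooth function and therefore continuous in
  mean square.\<close>

lemma spaceH_limit:
  assumes L: "L > 0" and w: "w \<in> L2per L" and S: "\<And>n. S n \<in> spaceH L"
    and lim: "(\<lambda>n. norm2 (lebesgue_on (square L)) (\<lambda>x. S n x - w x)) \<longlonglongrightarrow> 0"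
  shows "w \<in> spaceH L"
proof (rule spaceH_I[OF w L])
  let ?M = "lebesgue_on (square L)"
  have c: "(\<lambda>n. LINT x|?M. f x * S n x $ i) \<longlonglongrightarrow> (LINT x|?M. f x * w x $ i)" if "smooth f" for f i
  proof (rule LINT_mult_tendsto[where f=f and S="\<lambda>n x. S n x $ i" and w="\<lambda>x. w x $ i" and M="?M"])
    show "(\<lambda>n. norm2 ?M (\<lambda>x. S n x $ i - w x $ i)) \<longlonglongrightarrow> 0"
    proof (rule Lim_null_comparison[OF _ lim])
      show "\<forall>\<^sub>F n in sequentially. norm (norm2 ?M (\<lambda>x. S n x $ i - w x $ i)) \<le> norm2 ?M (\<lambda>x. S n x - w x)"
        using norm2_component_le[OF sqint_diff[OF spaceH_sqint[OF S] L2per_sqint[OF w]]] by auto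
    qed
  next
    show "sqint ?M f" by (rule smooth_bounded_square[OF that])
    show "sqint ?M (\<lambda>x. S n x $ i)" for n by (rule sqint_component[OF spaceH_sqint[OF S]])
    show "sqint ?M (\<lambda>x. w x $ i)" by (rule sqint_component[OF L2per_sqint[OF w]])
  qed
  show "(LINT x|?M. w x $ m) = 0" for m
    using c[OF trigpoly_smooth[OF trigpoly_const[of UNIV L 1, OF UNIV_I]], of m] spaceH_mean[OF S, of _ m]
    by (simp add: LIMSEQ_const_iff)
  fix \<psi> :: "real^2 \<Rightarrow> real" assume \<psi>: "smooth \<psi>" "periodic L \<psi>"
  have "(\<lambda>n. \<Sum>i\<in>UNIV. LINT x|?M. partial i \<psi> x * S n x $ i) \<longlonglongrightarrow> (\<Sum>i\<in>UNIV. LINT x|?M. partial i \<psi> x * w x $ i)"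
    by (intro tendsto_sum c smooth_has_derivative(2) \<psi>)
  then show "(\<Sum>i\<in>UNIV. LINT x|?M. partial i \<psi> x * w x $ i) = 0"
    using spaceH_div[OF S \<psi>] by (simp add: LIMSEQ_const_iff)
qed

section \<open>Completeness of the expansions and the Leray projection\<close>

context stokes_basis
begin

lemma comb_spaceH:
  assumes "F \<subseteq> {1..}"
  shows "comb F c \<in> spaceH L"
proof (cases "finite F")
  case True
  then show ?thesis using assms
  proof (induction F)
    case empty
    show ?case unfolding comb_def by (rule spaceH_I[OF _ L_pos]) (auto intro: L2per_zero)
  next
    case (insert j F)
    have "comb (insert j F) c = (\<lambda>x. c j *\<^sub>R \<phi> j x + comb F c x)"
      using insert by (simp add: comb_def fun_eq_iff)
    then show ?case using insert by (auto intro!: spaceH_add spaceH_scaleR L_pos phi_H)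
  qed
next
  case False
  then have "comb F c = (\<lambda>x. 0)" by (simp add: comb_def fun_eq_iff)
  then show ?thesis by (auto intro!: spaceH_I[OF _ L_pos] L2per_zero)
qed

lemma cf_tendsto:
  assumes "\<And>n. sqint Q (S n)" "sqint Q w" "(\<lambda>n. norm2 Q (\<lambda>x. S n x - w x)) \<longlonglongrightarrow> 0" "sqint Q z"
  shows "(\<lambda>n. l2_inner L (S n) z) \<longlonglongrightarrow> l2_inner L w z"
proof -
  have "\<bar>l2_inner L (S n) z - l2_inner L w z\<bar> \<le> norm2 Q (\<lambda>x. S n x - w x) * norm2 Q z" for n
    using l2_inner_bound[OF sqint_diff[OF assms(1,2)] assms(4), of n]
    by (simp add: l2_inner_diff_left[OF assms(1,2,4)] l2_norm_eq)
  moreover have "(\<lambda>n. norm2 Q (\<lambda>x. S n x - w x) * norm2 Q z) \<longlonglongrightarrow> 0" using tendsto_mult_left_zero[OF assms(3)] .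
  ultimately have "(\<lambda>n. l2_inner L (S n) z - l2_inner L w z) \<longlonglongrightarrow> 0"
    by (rule abs_le_tendsto_zero)
  then show ?thesis by (simp add: LIM_zero_iff)
qed

lemma cf_comb_eventually:
  "j \<ge> 1 \<Longrightarrow> \<forall>\<^sub>F n in sequentially. cf (comb {1..n} c) j = c j"
  using eventually_ge_at_top[of j] by eventually_elim (auto simp: cf_comb)

lemma cf_limit:
  assumes "sqint Q w" "(\<lambda>n. norm2 Q (\<lambda>x. comb {1..n} c x - w x)) \<longlonglongrightarrow> 0" "j \<ge> 1"
  shows "cf w j = c j"
proof -
  have "(\<lambda>n. cf (comb {1..n} c) j) \<longlonglongrightarrow> cf w j"
    by (rule cf_tendsto[OF comb_sqint assms(1,2) phi_sqint[OF assms(3)]]) auto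
  moreover have "(\<lambda>n. cf (comb {1..n} c) j) \<longlonglongrightarrow> c j"
    by (rule tendsto_eventually[OF cf_comb_eventually[OF assms(3)]])
  ultimately show ?thesis by (rule LIMSEQ_unique)
qed

text \<open>A finite set beyond \<open>n0\<close>, joined with \<open>{1..n0}\<close>, lies in a
  longer initial segment, whose sum is at most the limit \<open>l\<close>.\<close>

lemma square_sum_tail:
  fixes a :: "nat \<Rightarrow> real"
  assumes "\<And>F. finite F \<Longrightarrow> F \<subseteq> {1..} \<Longrightarrow> (\<Sum>j\<in>F. (a j)\<^sup>2) \<le> K" and e: "e > 0"
  shows "\<exists>n0. \<forall>F. finite F \<longrightarrow> F \<subseteq> {n0<..} \<longrightarrow> (\<Sum>j\<in>F. (a j)\<^sup>2) \<le> e"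
proof -
  define s where "s n = (\<Sum>j\<in>{1..n}. (a j)\<^sup>2)" for n
  have "incseq s" unfolding s_def by (intro incseq_SucI) (auto simp: sum_mono2)
  moreover have "s n \<le> K" for n unfolding s_def by (rule assms(1)) auto
  ultimately obtain l where l: "s \<longlonglongrightarrow> l" "\<forall>n. s n \<le> l" using incseq_convergent[of s K] by blast
  then obtain n0 where n0: "s n0 > l - e" using order_tendstoD(1)[OF l(1), of "l - e"] e
    by (auto simp: eventually_sequentially)
  show ?thesis
  proof (intro exI[of _ n0] allI impI)
    fix F assume F: "finite F" "F \<subseteq> {n0<..}"
    define m where "m = Max (insert n0 F)"
    have "sum (\<lambda>j. (a j)\<^sup>2) F + s n0 = sum (\<lambda>j. (a j)\<^sup>2) (F \<union> {1..n0})"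
      unfolding s_def using F by (subst sum.union_disjoint) auto
    also have "\<dots> \<le> s m" unfolding s_def
      using F by (intro sum_mono2) (auto simp: m_def Max_ge_iff Suc_le_eq intro: le_less_trans[OF le0])
    also have "\<dots> \<le> l" using l(2) by blast
    finally show "(\<Sum>j\<in>F. (a j)\<^sup>2) \<le> e" using n0 by simp
  qed
qed

lemma comb_diff:
  assumes "m \<le> n"
  shows "comb {1..n} c x - comb {1..m} c x = comb {m<..n} c x"
proof -
  have "{1..n} = {1..m} \<union> {m<..n}" using assms by auto
  then have "comb {1..n} c x = comb {1..m} c x + comb {m<..n} c x"
    unfolding comb_def by (subst sum.union_disjoint[symmetric]) auto
  then show ?thesis by simp
qed

text \<open>Only square summability of the coefficients is assumed, so that the result serves both
  the expansion of members of \<open>spaceH L\<close> and the existence of the Leray projection of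
  an arbitrary square integrable field.\<close>

lemma expansion_exists:
  assumes "\<And>F. finite F \<Longrightarrow> F \<subseteq> {1..} \<Longrightarrow> (\<Sum>j\<in>F. (c j)\<^sup>2) \<le> K"
  shows "\<exists>w\<in>spaceH L. (\<lambda>n. norm2 Q (\<lambda>x. comb {1..n} c x - w x)) \<longlonglongrightarrow> 0"
proof -
  interpret finite_measure Q by (rule finite_measure_square)
  have sq: "sqint Q (comb {1..n} c)" for n by (rule comb_sqint) auto
  have "\<exists>n0. \<forall>m\<ge>n0. \<forall>n\<ge>n0. norm2 Q (\<lambda>x. comb {1..m} c x - comb {1..n} c x) \<le> e" if e: "e > 0" for e
  proof -
    obtain n0 where n0: "\<And>F. finite F \<Longrightarrow> F \<subseteq> {n0<..} \<Longrightarrow> (\<Sum>j\<in>F. (c j)\<^sup>2) \<le> e\<^sup>2"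
      using square_sum_tail[OF assms, of "e\<^sup>2"] e by auto
    have le: "norm2 Q (\<lambda>x. comb {1..n} c x - comb {1..m} c x) \<le> e" if "m \<ge> n0" "m \<le> n" for m n
    proof (rule power2_le_imp_le)
      have "(norm2 Q (\<lambda>x. comb {1..n} c x - comb {1..m} c x))\<^sup>2 = (\<Sum>j\<in>{m<..n}. (c j)\<^sup>2)"
        unfolding comb_diff[OF that(2)] by (rule norm_comb) auto
      also have "\<dots> \<le> e\<^sup>2" using that by (intro n0) auto
      finally show "(norm2 Q (\<lambda>x. comb {1..n} c x - comb {1..m} c x))\<^sup>2 \<le> e\<^sup>2" .
    qed (use e in simp)
    show ?thesis
    proof (intro exI[of _ n0] allI impI)
      fix m n assume "n0 \<le> m" "n0 \<le> n"
      then show "norm2 Q (\<lambda>x. comb {1..m} c x - comb {1..n} c x) \<le> e"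
        using le[of m n] le[of n m] norm2_minus[of Q "comb {1..m} c" "comb {1..n} c"] by (cases "m \<le> n") auto
    qed
  qed
  then obtain r :: "nat \<Rightarrow> nat" where r: "sqint Q (\<lambda>x. lim (\<lambda>k. comb {1..r k} c x))"
    "(\<lambda>n. norm2 Q (\<lambda>x. comb {1..n} c x - lim (\<lambda>k. comb {1..r k} c x))) \<longlonglongrightarrow> 0"
    by (rule Riesz_Fischer[of "\<lambda>n. comb {1..n} c", OF sq])
  define w where "w x = lim (\<lambda>k. comb {1..r k} c x)" for x
  have "w \<in> L2per L"
  proof (rule L2per_I)
    have per: "comb {1..n} c (x + L *\<^sub>R axis i 1) = comb {1..n} c x" for n x i
      using L2per_periodic[OF spaceH_L2per[OF comb_spaceH[of "{1..n}" c]]] by (auto simp: periodic_def)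
    show "periodic L w" unfolding periodic_def w_def per by blast
    have "comb {1..n} c \<in> borel_measurable lebesgue" for n
      using L2per_measurable[OF spaceH_L2per[OF comb_spaceH]] by auto
    then show "w \<in> borel_measurable lebesgue" unfolding w_def by (intro borel_measurable_lim_metric)
    show "sqint Q w" using r(1) by (simp add: w_def[abs_def])
  qed
  then have "w \<in> spaceH L"
    by (rule spaceH_limit[OF L_pos _ comb_spaceH[of "{1..n}" c for n]]) (use r(2) in \<open>auto simp: w_def\<close>)
  then show ?thesis using r(2) by (auto simp: w_def[abs_def])
qed

lemma norm2_triangle_diff:
  assumes "sqint M f" "sqint M g" "sqint M h"
  shows "norm2 M (\<lambda>x. f x - h x) \<le> norm2 M (\<lambda>x. f x - g x) + norm2 M (\<lambda>x. g x - h x)"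
  using norm2_triangle[OF sqint_diff[OF assms(1,2)] sqint_diff[OF assms(2,3)]] by simp

lemma same_cf:
  assumes u: "u \<in> spaceH L" "w \<in> spaceH L" "\<And>j. j \<ge> 1 \<Longrightarrow> cf u j = cf w j"
  shows "norm2 Q (\<lambda>x. u x - w x) = 0" "AE x in Q. u x = w x"
proof -
  have H: "(\<lambda>x. u x - w x) \<in> spaceH L" by (rule spaceH_diff[OF L_pos u(1,2)])
  have "l2_norm L (\<lambda>x. u x - w x) = 0"
    by (rule phi_total[OF H]) (simp add: l2_inner_diff_left[OF spaceH_sqint[OF u(1)] spaceH_sqint[OF u(2)] phi_sqint] u(3))
  then show 0: "norm2 Q (\<lambda>x. u x - w x) = 0" by (simp add: l2_norm_eq)
  then show "AE x in Q. u x = w x" using norm2_0_iff_AE[OF spaceH_sqint[OF H]] by auto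
qed

text \<open>The sum of the expansion has the coefficients of \<open>u\<close>, and totality makes
  fields in \<open>spaceH L\<close> with equal coefficients equal in mean square.\<close>

lemma spaceH_expansion:
  assumes u: "u \<in> spaceH L"
  shows "(\<lambda>n. norm2 Q (\<lambda>x. comb {1..n} (cf u) x - u x)) \<longlonglongrightarrow> 0"
proof -
  obtain w where w: "w \<in> spaceH L" "(\<lambda>n. norm2 Q (\<lambda>x. comb {1..n} (cf u) x - w x)) \<longlonglongrightarrow> 0"
    using expansion_exists[of "cf u", OF Bessel[OF _ _ spaceH_sqint[OF u]]] by blast
  have "cf w j = cf u j" if "j \<ge> 1" for j by (rule cf_limit[OF spaceH_sqint[OF w(1)] w(2) that])
  then have 0: "norm2 Q (\<lambda>x. w x - u x) = 0" by (intro same_cf w u)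
  show ?thesis
  proof (rule Lim_null_comparison[OF _ w(2)])
    show "\<forall>\<^sub>F n in sequentially. norm (norm2 Q (\<lambda>x. comb {1..n} (cf u) x - u x)) \<le> norm2 Q (\<lambda>x. comb {1..n} (cf u) x - w x)"
      using norm2_triangle_diff[OF comb_sqint spaceH_sqint[OF w(1)] spaceH_sqint[OF u], of "{1..n}" "cf u" for n] 0 by auto
  qed
qed

text \<open>The field with the coefficients of \<open>g\<close> is a witness for the choice in
  \<open>leray\<close>. Orthogonality of the remainder holds on finite combinations and passes to
  all of \<open>spaceH L\<close> by expansion.\<close>

lemma leray_props:
  assumes g: "sqint Q g"
  shows "leray L g \<in> spaceH L" "\<And>z. z \<in> spaceH L \<Longrightarrow> l2_inner L (\<lambda>x. g x - leray L g x) z = 0"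
proof -
  obtain w where w: "w \<in> spaceH L" "(\<lambda>n. norm2 Q (\<lambda>x. comb {1..n} (cf g) x - w x)) \<longlonglongrightarrow> 0"
    using expansion_exists[of "cf g", OF Bessel[OF _ _ g]] by blast
  have wj: "cf w j = cf g j" if "j \<ge> 1" for j by (rule cf_limit[OF spaceH_sqint[OF w(1)] w(2) that])
  have gw: "sqint Q (\<lambda>x. g x - w x)" by (rule sqint_diff[OF g spaceH_sqint[OF w(1)]])
  have "l2_inner L (\<lambda>x. g x - w x) z = 0" if z: "z \<in> spaceH L" for z
  proof -
    have "l2_inner L (comb {1..n} (cf z)) (\<lambda>x. g x - w x) = 0" for n
    proof -
      have "cf (\<lambda>x. g x - w x) j = 0" if "j \<ge> 1" for j
        using l2_inner_diff_left[OF g spaceH_sqint[OF w(1)] phi_sqint[OF that]] wj[OF that] by simp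
      then show ?thesis by (subst l2_inner_commute, subst inner_comb[OF _ _ gw]) auto
    qed
    moreover have "(\<lambda>n. l2_inner L (comb {1..n} (cf z)) (\<lambda>x. g x - w x)) \<longlonglongrightarrow> l2_inner L z (\<lambda>x. g x - w x)"
      by (rule cf_tendsto[OF comb_sqint spaceH_sqint[OF z] spaceH_expansion[OF z] gw]) auto
    ultimately have "l2_inner L z (\<lambda>x. g x - w x) = 0" by (simp add: LIMSEQ_const_iff)
    then show ?thesis by (simp add: l2_inner_commute)
  qed
  then have "\<exists>w. w \<in> spaceH L \<and> (\<forall>z\<in>spaceH L. l2_inner L (\<lambda>x. g x - w x) z = 0)" using w by blast
  from someI_ex[OF this] show "leray L g \<in> spaceH L" "\<And>z. z \<in> spaceH L \<Longrightarrow> l2_inner L (\<lambda>x. g x - leray L g x) z = 0"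
    unfolding leray_def by blast+
qed

lemma cf_leray:
  assumes "sqint Q g" "j \<ge> 1"
  shows "cf (leray L g) j = cf g j"
  using leray_props(2)[OF assms(1) phi_H[OF assms(2)]]
    l2_inner_diff_left[OF assms(1) spaceH_sqint[OF leray_props(1)[OF assms(1)]] phi_sqint[OF assms(2)]] by simp

subsection \<open>Uniformly convergent expansions\<close>

text \<open>Membership in the domain of \<open>A\<close>, read off the coefficients.\<close>

definition dsum :: "(nat \<Rightarrow> real) \<Rightarrow> real \<Rightarrow> bool" where
  "dsum c K \<longleftrightarrow> K \<ge> 0 \<and> (\<forall>F. finite F \<longrightarrow> F \<subseteq> {1..} \<longrightarrow> (\<Sum>j\<in>F. (lam j * c j)\<^sup>2) \<le> K\<^sup>2)"

text \<open>The continuous representative of the field with coefficients \<open>c\<close>. As a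
  pointwise limit it is periodic for every \<open>c\<close>; convergence is known under
  \<open>dsum\<close>.\<close>

definition ser :: "(nat \<Rightarrow> real) \<Rightarrow> field" where
  "ser c x = lim (\<lambda>n. comb {1..n} c x)"

lemma dsum_tail:
  assumes c: "dsum c K" and e: "e > 0"
  shows "\<exists>n0. \<forall>n\<ge>n0. \<forall>m\<ge>n. \<forall>x. norm (comb {1..m} c x - comb {1..n} c x) \<le> e"
proof -
  have e': "e / weylC > 0" using e weylC(1) by simp
  obtain n0 where n0: "\<And>F. finite F \<Longrightarrow> F \<subseteq> {n0<..} \<Longrightarrow> (\<Sum>j\<in>F. (lam j * c j)\<^sup>2) \<le> (e / weylC)\<^sup>2"
  proof -
    have bd: "(\<Sum>j\<in>F. (lam j * c j)\<^sup>2) \<le> K\<^sup>2" if "finite F" "F \<subseteq> {1..}" for F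
      using c that by (simp add: dsum_def)
    from square_sum_tail[of "\<lambda>j. lam j * c j", OF bd zero_less_power[OF e', of 2]] that show ?thesis by blast
  qed
  show ?thesis
  proof (intro exI[of _ n0] allI impI)
    fix m n x assume "n0 \<le> n" "n \<le> m"
    have "norm (comb {1..m} c x - comb {1..n} c x) = norm (comb {n<..m} c x)" by (simp only: comb_diff[OF \<open>n \<le> m\<close>])
    also have "\<dots> \<le> (\<Sum>j\<in>{n<..m}. norm (c j *\<^sub>R \<phi> j x))" unfolding comb_def by (rule norm_sum)
    also have "\<dots> \<le> weylC * (e / weylC)"
    proof (rule sum_sup_bound)
      show "(\<Sum>j\<in>{n<..m}. (lam j * c j)\<^sup>2) \<le> (e / weylC)\<^sup>2"
        using \<open>n0 \<le> n\<close> by (intro n0) auto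
    qed (use e' in auto)
    finally show "norm (comb {1..m} c x - comb {1..n} c x) \<le> e" using weylC(1) by simp
  qed
qed

lemma ser_LIMSEQ:
  assumes c: "dsum c K"
  shows "(\<lambda>n. comb {1..n} c x) \<longlonglongrightarrow> ser c x"
proof -
  have "Cauchy (\<lambda>n. comb {1..n} c x)"
  proof (rule metric_CauchyI)
    fix e :: real assume e: "e > 0"
    obtain n0 where n0: "\<And>n m. n \<ge> n0 \<Longrightarrow> m \<ge> n \<Longrightarrow> norm (comb {1..m} c x - comb {1..n} c x) \<le> e / 2"
      using dsum_tail[OF c, of "e/2"] e by auto
    have "dist (comb {1..m} c x) (comb {1..n} c x) < e" if "m \<ge> n0" "n \<ge> n0" for m n
      using n0[of n m] n0[of m n] that e by (cases "n \<le> m") (auto simp: dist_norm norm_minus_commute)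
    then show "\<exists>M. \<forall>m\<ge>M. \<forall>n\<ge>M. dist (comb {1..m} c x) (comb {1..n} c x) < e" by blast
  qed
  then show ?thesis unfolding ser_def by (simp add: Cauchy_convergent_iff convergent_LIMSEQ_iff)
qed

lemma ser_uniform:
  assumes c: "dsum c K" and e: "e > 0"
  shows "\<exists>n0. \<forall>n\<ge>n0. \<forall>x. norm (ser c x - comb {1..n} c x) \<le> e"
proof -
  obtain n0 where n0: "\<And>n m x. n \<ge> n0 \<Longrightarrow> m \<ge> n \<Longrightarrow> norm (comb {1..m} c x - comb {1..n} c x) \<le> e"
    using dsum_tail[OF c e] by blast
  have "norm (ser c x - comb {1..n} c x) \<le> e" if "n \<ge> n0" for n x
    by (rule LIMSEQ_le_const2[OF tendsto_norm[OF tendsto_diff[OF ser_LIMSEQ[OF c] tendsto_const]]])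
      (use n0 that in blast)
  then show ?thesis by blast
qed

lemma norm_ser_le:
  assumes "dsum c K"
  shows "norm (ser c x) \<le> weylC * K"
proof (rule LIMSEQ_le_const2[OF tendsto_norm[OF ser_LIMSEQ[OF assms]]])
  have "norm (comb {1..n} c x) \<le> weylC * K" for n
    unfolding comb_def using assms by (intro order_trans[OF norm_sum sum_sup_bound]) (auto simp: dsum_def)
  then show "\<exists>N. \<forall>n\<ge>N. norm (comb {1..n} c x) \<le> weylC * K" by blast
qed

lemma ser_continuous:
  assumes c: "dsum c K"
  shows "continuous_on UNIV (ser c)"
proof (rule uniform_limit_theorem[of _ "\<lambda>n. comb {1..n} c" sequentially])
  show "\<forall>\<^sub>F n in sequentially. continuous_on UNIV (comb {1..n} c)"
    by (intro always_eventually allI comb_continuous) auto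
  show "uniform_limit UNIV (\<lambda>n. comb {1..n} c) (ser c) sequentially"
  proof (rule uniform_limitI)
    fix e :: real assume e: "e > 0"
    obtain n0 where "\<And>n x. n \<ge> n0 \<Longrightarrow> norm (ser c x - comb {1..n} c x) \<le> e / 2"
      using ser_uniform[OF c, of "e/2"] e by auto
    then show "\<forall>\<^sub>F n in sequentially. \<forall>x\<in>UNIV. dist (comb {1..n} c x) (ser c x) < e"
      using e unfolding eventually_sequentially dist_norm
      by (intro exI[of _ n0] allI impI ballI) (subst norm_minus_commute, smt (verit) field_sum_of_halves)
  qed
qed simp

lemma ser_norm2:
  assumes c: "dsum c K"
  shows "(\<lambda>n. norm2 Q (\<lambda>x. comb {1..n} c x - ser c x)) \<longlonglongrightarrow> 0"
proof (rule LIMSEQ_I)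
  interpret finite_measure Q by (rule finite_measure_square)
  fix e :: real assume e: "e > 0"
  have m: "measure Q (space Q) = L\<^sup>2" using measure_square[OF L_pos] by (simp add: measure_restrict_space)
  have "e / (2 * L) > 0" using e L_pos by simp
  then obtain n0 where n0: "\<And>n x. n \<ge> n0 \<Longrightarrow> norm (ser c x - comb {1..n} c x) \<le> e / (2 * L)"
    using ser_uniform[OF c] by metis
  have "norm2 Q (\<lambda>x. comb {1..n} c x - ser c x) < e" if "n \<ge> n0" for n
  proof -
    have "norm2 Q (\<lambda>x. comb {1..n} c x - ser c x) \<le> sqrt (measure Q (space Q)) * (e / (2 * L))"
      using n0[OF that] e L_pos
      by (intro norm2_bounded borel_measurable_diff sqint_measurable[OF comb_sqint]
        sqint_measurable[OF continuous_imp_sqint_square[OF ser_continuous[OF c]]] AE_I2)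
        (auto simp: norm_minus_commute)
    then show ?thesis using m e L_pos by simp
  qed
  then show "\<exists>no. \<forall>n\<ge>no. norm (norm2 Q (\<lambda>x. comb {1..n} c x - ser c x) - 0) < e"
    by (intro exI[of _ n0]) auto
qed

lemma ser_periodic: "periodic L (ser c)"
proof -
  have "comb {1..n} c (x + L *\<^sub>R axis i 1) = comb {1..n} c x" for n x i
    using L2per_periodic[OF spaceH_L2per[OF comb_spaceH[of "{1..n}" c]]] by (auto simp: periodic_def)
  then show ?thesis by (simp add: periodic_def ser_def)
qed

lemma ser_spaceH: "dsum c K \<Longrightarrow> ser c \<in> spaceH L"
  using spaceH_limit[OF L_pos continuous_L2per[OF ser_continuous ser_periodic] comb_spaceH ser_norm2] by auto

lemma cf_ser: "dsum c K \<Longrightarrow> j \<ge> 1 \<Longrightarrow> cf (ser c) j = c j"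
  using cf_limit[OF spaceH_sqint[OF ser_spaceH] ser_norm2] by blast

lemma AE_eq_ser:
  assumes "u \<in> spaceH L" "dsum (cf u) K"
  shows "AE x in Q. u x = ser (cf u) x"
  by (rule same_cf(2)[OF assms(1) ser_spaceH[OF assms(2)]]) (simp add: cf_ser[OF assms(2)])

end

subsection \<open>Continuous representatives\<close>

text \<open>Every point is moved into the square by a lattice vector, so the exceptional set lies in
  a countable union of translates of a null set.\<close>

lemma AE_square_imp_AE:
  fixes f g :: "real^2 \<Rightarrow> 'b"
  assumes L: "L > 0" and per: "periodic L f" "periodic L g"
    and AE: "AE x in lebesgue_on (square L). f x = g x"
  shows "AE x in lebesgue. f x = g x"
proof -
  have "AE x in lebesgue. x \<in> square L \<longrightarrow> f x = g x"
    using AE by (subst (asm) AE_restrict_space_iff) auto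
  then obtain N where N: "{x \<in> space lebesgue. \<not> (x \<in> square L \<longrightarrow> f x = g x)} \<subseteq> N"
    "emeasure lebesgue N = 0" "N \<in> sets lebesgue" by (rule AE_E)
  then have negN: "negligible N" by (simp only: negligible_iff_null_sets null_setsI)
  define s :: "(2 \<Rightarrow> int) \<Rightarrow> real^2" where "s m = (\<chi> i. L * of_int (m i))" for m
  have "negligible (\<Union>((\<lambda>m. (+) (- s m) ` N) ` UNIV))"
    by (rule negligible_countable_Union) (use negligible_translation[OF negN] in blast)+
  moreover have "{x. f x \<noteq> g x} \<subseteq> (\<Union>((\<lambda>m. (+) (- s m) ` N) ` UNIV))"
  proof
    fix x assume x: "x \<in> {x. f x \<noteq> g x}"
    obtain m where m: "x + s m \<in> square L" using square_shift_ex[OF L, of x] unfolding s_def by metis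
    have "f (x + s m) \<noteq> g (x + s m)"
      using x periodic_int_shift[OF per(1)] periodic_int_shift[OF per(2)] by (simp add: s_def)
    then have "x + s m \<in> N" using m N(1) by auto
    then have "x \<in> (+) (- s m) ` N" by (force simp: image_iff)
    then show "x \<in> (\<Union>((\<lambda>m. (+) (- s m) ` N) ` UNIV))" by blast
  qed
  ultimately have "negligible {x. f x \<noteq> g x}" by (rule negligible_subset)
  then show ?thesis by (intro AE_I'[of "{x. f x \<noteq> g x}"]) (auto simp: negligible_iff_null_sets)
qed

lemma continuous_AE_eq:
  fixes f g :: "real^2 \<Rightarrow> 'b::metric_space"
  assumes "continuous_on UNIV f" "continuous_on UNIV g" "AE x in lebesgue. f x = g x"
  shows "f = g"
proof (rule ccontr)
  assume "f \<noteq> g"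
  have "open {x. f x \<noteq> g x}"
    using closed_Collect_eq[OF assms(1,2)] by (simp add: open_closed Compl_eq)
  moreover have "{x. f x \<noteq> g x} \<noteq> {}" using \<open>f \<noteq> g\<close> by auto
  moreover have "negligible {x. f x \<noteq> g x}"
  proof -
    obtain N where N: "{x \<in> space lebesgue. \<not> f x = g x} \<subseteq> N" "emeasure lebesgue N = 0" "N \<in> sets lebesgue"
      using assms(3) by (rule AE_E)
    then have "negligible N" by (simp only: negligible_iff_null_sets null_setsI)
    then show ?thesis by (rule negligible_subset) (use N(1) in auto)
  qed
  ultimately show False using open_not_negligible by blast
qed

text \<open>Continuous functions that agree almost everywhere agree everywhere, so the definite
  description in \<open>cont_rep\<close> has exactly one candidate.\<close>

lemma cont_rep_eq:
  assumes "L > 0" "periodic L u" "periodic L g" "continuous_on UNIV g" "AE x in lebesgue_on (square L). u x = g x"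
  shows "cont_rep u = g"
proof -
  have g: "AE x in lebesgue. g x = u x"
    using AE_square_imp_AE[OF assms(1,2,3,5)] by (simp add: eq_commute)
  have uniq: "g' = g" if "continuous_on UNIV g'" "AE x in lebesgue. g' x = u x" for g'
  proof (rule continuous_AE_eq[OF that(1) assms(4)])
    show "AE x in lebesgue. g' x = g x" using that(2) g by eventually_elim simp
  qed
  have ex: "\<exists>g. continuous_on UNIV g \<and> (AE x in lebesgue. g x = u x)" using assms(4) g by blast
  show ?thesis unfolding cont_rep_def if_P[OF ex]
    by (rule the_equality) (use assms(4) g uniq in blast)+
qed

subsection \<open>The Stokes operator and the bilinear term on the eigenbasis\<close>

lemma weak_partial_sum:
  assumes "\<And>j. j \<in> F \<Longrightarrow> f j \<in> L2per L" "\<And>j. j \<in> F \<Longrightarrow> g j \<in> L2per L"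
    "\<And>j. j \<in> F \<Longrightarrow> weak_partial L i (f j) (g j)"
  shows "weak_partial L i (\<lambda>x. \<Sum>j\<in>F. c j *\<^sub>R f j x) (\<lambda>x. \<Sum>j\<in>F. c j *\<^sub>R g j x)"
  unfolding weak_partial_def
proof (intro allI impI)
  fix \<psi> :: "real^2 \<Rightarrow> real" assume \<psi>: "smooth \<psi> \<and> periodic L \<psi>"
  have lin: "(LINT x|lebesgue_on (square L). p x *\<^sub>R (\<Sum>j\<in>F. c j *\<^sub>R h j x)) = (\<Sum>j\<in>F. c j *\<^sub>R (LINT x|lebesgue_on (square L). p x *\<^sub>R h j x))"
    if "smooth p" "\<And>j. j \<in> F \<Longrightarrow> h j \<in> L2per L" for p :: "real^2 \<Rightarrow> real" and h
  proof -
    have "(LINT x|lebesgue_on (square L). p x *\<^sub>R (\<Sum>j\<in>F. c j *\<^sub>R h j x)) = (LINT x|lebesgue_on (square L). (\<Sum>j\<in>F. c j *\<^sub>R (p x *\<^sub>R h j x)))"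
      by (simp add: scaleR_sum_right scaleR_left_commute mult.commute)
    also have "\<dots> = (\<Sum>j\<in>F. LINT x|lebesgue_on (square L). c j *\<^sub>R (p x *\<^sub>R h j x))"
      by (rule Bochner_Integration.integral_sum, rule integrable_scaleR_right, rule smooth_test_mult(2)[OF that(1) L2per_sqint[OF that(2)]])
    finally show ?thesis by (simp only: integral_scaleR_right)
  qed
  show "(LINT x|lebesgue_on (square L). partial i \<psi> x *\<^sub>R (\<Sum>j\<in>F. c j *\<^sub>R f j x)) =
       - (LINT x|lebesgue_on (square L). \<psi> x *\<^sub>R (\<Sum>j\<in>F. c j *\<^sub>R g j x))"
    using assms(3) \<psi> smooth_has_derivative(2)[of \<psi> i]
    by (simp add: lin assms(1,2) weak_partial_def sum_negf)
qed

context stokes_basis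
begin

lemma inner_components: "a \<bullet> b = (\<Sum>m\<in>UNIV. a $ m * b $ m)" for a b :: "real^2"
  by (simp add: inner_vec_def)

lemma phi_trigpoly_UNIV: "j \<ge> 1 \<Longrightarrow> trigpoly L UNIV (\<lambda>x. \<phi> j x $ m)"
  by (rule trigpoly_mono[OF phi_trigpoly]) auto

lemma trigpoly_test: "trigpoly L UNIV \<psi> \<Longrightarrow> smooth \<psi> \<and> periodic L \<psi>"
  using trigpoly_smooth trigpoly_periodic L_pos by auto

text \<open>Symmetry of the Laplacian: the components of \<open>\<phi> j\<close> are smooth and
  periodic, hence admissible test functions, and their Laplacian is known pointwise from their
  Fourier support.\<close>

lemma cf_stokes:
  assumes u: "u \<in> domA L" and j: "j \<ge> 1"
  shows "cf (stokes L u) j = lam j * cf u j"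
proof -
  have us: "sqint Q u" by (rule spaceH_sqint[OF domA_H1per(3)[OF u]])
  note sm = conjunct1[OF trigpoly_test[OF phi_trigpoly_UNIV[OF j]]]
  note pe = conjunct2[OF trigpoly_test[OF phi_trigpoly_UNIV[OF j]]]
  have "cf (stokes L u) j = (LINT x|Q. (\<Sum>m\<in>UNIV. \<phi> j x $ m * stokes L u x $ m))"
    unfolding l2_inner_def inner_components by (simp add: mult.commute)
  also have "\<dots> = (\<Sum>m\<in>UNIV. LINT x|Q. \<phi> j x $ m * stokes L u x $ m)"
    by (rule Bochner_Integration.integral_sum, rule smooth_test_mult_component(1)[OF sm L2per_sqint[OF stokes_L2per[OF u]]])
  also have "\<dots> = (\<Sum>m\<in>UNIV. lam j * (LINT x|Q. \<phi> j x $ m * u x $ m))"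
  proof (rule sum.cong[OF refl])
    fix m
    have "(LINT x|Q. \<phi> j x $ m * stokes L u x $ m) = - (\<Sum>i\<in>UNIV. LINT x|Q. partial i (partial i (\<lambda>x. \<phi> j x $ m)) x * u x $ m)"
      by (rule stokes_moment[OF u sm pe])
    also have "\<dots> = - (LINT x|Q. (\<Sum>i\<in>UNIV. partial i (partial i (\<lambda>x. \<phi> j x $ m)) x) * u x $ m)"
      unfolding sum_distrib_right
      by (subst Bochner_Integration.integral_sum)
        (auto intro!: smooth_test_mult_component(1) us smooth_has_derivative(2) sm)
    also have "\<dots> = lam j * (LINT x|Q. \<phi> j x $ m * u x $ m)"
      unfolding trigpoly_laplace[OF phi_trigpoly[OF j]] by (simp add: mult.assoc)
    finally show "(LINT x|Q. \<phi> j x $ m * stokes L u x $ m) = lam j * (LINT x|Q. \<phi> j x $ m * u x $ m)" .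
  qed
  also have "\<dots> = lam j * (LINT x|Q. (\<Sum>m\<in>UNIV. \<phi> j x $ m * u x $ m))"
    unfolding sum_distrib_left[symmetric]
    by (subst Bochner_Integration.integral_sum) (auto intro!: smooth_test_mult_component(1) us sm)
  also have "\<dots> = lam j * cf u j"
    unfolding l2_inner_def inner_components by (simp add: mult.commute)
  finally show ?thesis .
qed

text \<open>This puts the solution, at almost every time, within reach of the uniformly convergent
  series.\<close>

lemma dsum_domA:
  assumes u: "u \<in> domA L"
  shows "dsum (cf u) (l2_norm L (stokes L u))"
  unfolding dsum_def
proof (intro conjI allI impI)
  fix F assume F: "finite F" "F \<subseteq> {1::nat..}"
  have "(\<Sum>j\<in>F. (lam j * cf u j)\<^sup>2) = (\<Sum>j\<in>F. (cf (stokes L u) j)\<^sup>2)"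
    using F by (intro sum.cong) (auto simp: cf_stokes[OF u] subset_iff)
  also have "\<dots> \<le> (l2_norm L (stokes L u))\<^sup>2"
    unfolding l2_norm_eq by (rule Bessel[OF F L2per_sqint[OF stokes_L2per[OF u]]])
  finally show "(\<Sum>j\<in>F. (lam j * cf u j)\<^sup>2) \<le> (l2_norm L (stokes L u))\<^sup>2" .
qed (simp add: l2_norm_eq)

lemma cont_rep_ser:
  assumes "u \<in> spaceH L" "dsum (cf u) K"
  shows "cont_rep u = ser (cf u)"
  by (rule cont_rep_eq[OF L_pos L2per_periodic[OF spaceH_L2per[OF assms(1)]] ser_periodic
    ser_continuous[OF assms(2)] AE_eq_ser[OF assms]])

lemma cont_rep_continuous:
  assumes "continuous_on UNIV g" "periodic L g"
  shows "cont_rep g = g"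
  by (rule cont_rep_eq[OF L_pos assms(2,2,1)]) simp

text \<open>The choice \<open>wd L i (comb F c)\<close> need not coincide with the sum of the
  choices for the eigenfunctions. Both have the same moments, and that is enough to transfer the
  second weak derivatives from the sum to the choice.\<close>

lemma comb_domA:
  assumes F: "F \<subseteq> {1..}"
  shows "comb F c \<in> domA L"
proof -
  have j: "j \<ge> 1" if "j \<in> F" for j using that F by auto
  have wp: "weak_partial L i (comb F c) (\<lambda>x. \<Sum>j\<in>F. c j *\<^sub>R wd L i (\<phi> j) x)" for i
    unfolding comb_def
    by (rule weak_partial_sum) (auto dest!: j intro: phi_L2per wd_props domA_H1per phi_domA)
  have cL: "comb F c \<in> L2per L" by (rule spaceH_L2per[OF comb_spaceH[OF F]])
  have dL: "(\<lambda>x. \<Sum>j\<in>F. c j *\<^sub>R wd L i (\<phi> j) x) \<in> L2per L" for i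
    by (rule L2per_sum, rule L2per_scaleR, rule wd_props(1), rule domA_H1per(1), rule phi_domA, rule j)
  have H1: "comb F c \<in> H1per L"
    unfolding H1per_def using wp cL dL by blast
  have "wd L i (comb F c) \<in> H1per L" for i
    unfolding H1per_def
  proof (intro CollectI conjI allI bexI)
    show "wd L i (comb F c) \<in> L2per L" by (rule wd_props(1)[OF H1])
    fix i'
    show "(\<lambda>x. \<Sum>j\<in>F. c j *\<^sub>R wd L i' (wd L i (\<phi> j)) x) \<in> L2per L"
      by (rule L2per_sum, rule L2per_scaleR, rule wd_props(1), rule domA_H1per(2), rule phi_domA, rule j)
    have wp2: "weak_partial L i' (\<lambda>x. \<Sum>j\<in>F. c j *\<^sub>R wd L i (\<phi> j) x) (\<lambda>x. \<Sum>j\<in>F. c j *\<^sub>R wd L i' (wd L i (\<phi> j)) x)"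
    proof (rule weak_partial_sum)
      fix k assume "k \<in> F"
      note d = phi_domA[OF j[OF this]]
      show "wd L i (\<phi> k) \<in> L2per L" by (rule wd_props(1)[OF domA_H1per(1)[OF d]])
      show "wd L i' (wd L i (\<phi> k)) \<in> L2per L" by (rule wd_props(1)[OF domA_H1per(2)[OF d]])
      show "weak_partial L i' (wd L i (\<phi> k)) (wd L i' (wd L i (\<phi> k)))" by (rule wd_props(2)[OF domA_H1per(2)[OF d]])
    qed
    show "weak_partial L i' (wd L i (comb F c)) (\<lambda>x. \<Sum>j\<in>F. c j *\<^sub>R wd L i' (wd L i (\<phi> j)) x)"
      unfolding weak_partial_def
    proof (intro allI impI)
      fix \<psi> :: "real^2 \<Rightarrow> real" assume \<psi>: "smooth \<psi> \<and> periodic L \<psi>"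
      then have p: "smooth (partial i' \<psi>) \<and> periodic L (partial i' \<psi>)"
        using smooth_has_derivative(2) periodic_partial by blast
      have "(LINT x|Q. partial i (partial i' \<psi>) x *\<^sub>R comb F c x) = - (LINT x|Q. partial i' \<psi> x *\<^sub>R wd L i (comb F c) x)"
        using wd_props(2)[OF H1, of i] p unfolding weak_partial_def by blast
      moreover have "(LINT x|Q. partial i (partial i' \<psi>) x *\<^sub>R comb F c x) = - (LINT x|Q. partial i' \<psi> x *\<^sub>R (\<Sum>j\<in>F. c j *\<^sub>R wd L i (\<phi> j) x))"
        using wp[of i] p unfolding weak_partial_def by blast
      moreover have "(LINT x|Q. partial i' \<psi> x *\<^sub>R (\<Sum>j\<in>F. c j *\<^sub>R wd L i (\<phi> j) x)) = - (LINT x|Q. \<psi> x *\<^sub>R (\<Sum>j\<in>F. c j *\<^sub>R wd L i' (wd L i (\<phi> j)) x))"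
        using wp2 \<psi> unfolding weak_partial_def by blast
      ultimately show "(LINT x|Q. partial i' \<psi> x *\<^sub>R wd L i (comb F c) x) = - (LINT x|Q. \<psi> x *\<^sub>R (\<Sum>j\<in>F. c j *\<^sub>R wd L i' (wd L i (\<phi> j)) x))"
        by simp
    qed
  qed
  then show ?thesis using H1 comb_spaceH[OF F] by (auto simp: domA_def spaceV_def H2per_def)
qed

text \<open>The difference of the two sides is orthogonal to all smooth periodic functions, hence lies in
  \<open>spaceH L\<close>, and its coefficients vanish; no uniqueness of weak derivatives is needed.\<close>

lemma stokes_comb:
  assumes F: "finite F" "F \<subseteq> {1..}"
  shows "AE x in Q. stokes L (comb F c) x = comb F (\<lambda>j. lam j * c j) x"
proof -
  have d: "comb F c \<in> domA L" by (rule comb_domA[OF F(2)])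
  define h where "h x = stokes L (comb F c) x - comb F (\<lambda>j. lam j * c j) x" for x
  have sL: "stokes L (comb F c) \<in> L2per L" by (rule stokes_L2per[OF d])
  have lL: "comb F (\<lambda>j. lam j * c j) \<in> L2per L" by (rule spaceH_L2per[OF comb_spaceH[OF F(2)]])
  have hL: "h \<in> L2per L" unfolding h_def by (rule L2per_diff[OF sL lL])
  have mom: "(LINT x|Q. \<psi> x * h x $ m) = 0" if \<psi>: "smooth \<psi>" "periodic L \<psi>" for \<psi> m
  proof -
    note int = smooth_test_mult_component(1)[OF _ phi_sqint]
    have cc: "(LINT x|Q. p x * comb F a x $ m) = (\<Sum>j\<in>F. a j * (LINT x|Q. p x * \<phi> j x $ m))" if p: "smooth p" for p :: "real^2 \<Rightarrow> real" and a
    proof -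
      have "(LINT x|Q. p x * comb F a x $ m) = (LINT x|Q. (\<Sum>j\<in>F. a j * (p x * \<phi> j x $ m)))"
        by (simp add: comb_def sum_distrib_left mult_ac)
      also have "\<dots> = (\<Sum>j\<in>F. LINT x|Q. a j * (p x * \<phi> j x $ m))"
        by (rule Bochner_Integration.integral_sum, rule integrable_mult_right, rule int[OF p]) (use F in auto)
      finally show ?thesis by simp
    qed
    have lp: "(\<Sum>i\<in>UNIV. LINT x|Q. partial i (partial i \<psi>) x * \<phi> j x $ m) = - lam j * (LINT x|Q. \<psi> x * \<phi> j x $ m)" if j: "j \<in> F" for j
    proof -
      have j1: "j \<ge> 1" using j F by auto
      have "(LINT x|Q. \<psi> x * stokes L (\<phi> j) x $ m) = (LINT x|Q. lam j * (\<psi> x * \<phi> j x $ m))"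
      proof (rule integral_cong_AE)
        show "AE x in Q. \<psi> x * stokes L (\<phi> j) x $ m = lam j * (\<psi> x * \<phi> j x $ m)"
          using phi_eigen[OF j1] by eventually_elim simp
        show "(\<lambda>x. \<psi> x * stokes L (\<phi> j) x $ m) \<in> borel_measurable Q"
          by (rule borel_measurable_integrable[OF smooth_test_mult_component(1)[OF \<psi>(1) L2per_sqint[OF stokes_L2per[OF phi_domA[OF j1]]]]])
        show "(\<lambda>x. lam j * (\<psi> x * \<phi> j x $ m)) \<in> borel_measurable Q"
          using borel_measurable_integrable[OF int[OF \<psi>(1) j1, of m]] by simp
      qed
      then show ?thesis using stokes_moment[OF phi_domA[OF j1] \<psi>, of m] by simp
    qed
    have "(LINT x|Q. \<psi> x * h x $ m) = (LINT x|Q. \<psi> x * stokes L (comb F c) x $ m - \<psi> x * comb F (\<lambda>j. lam j * c j) x $ m)"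
      by (simp add: h_def right_diff_distrib)
    also have "\<dots> = (LINT x|Q. \<psi> x * stokes L (comb F c) x $ m) - (LINT x|Q. \<psi> x * comb F (\<lambda>j. lam j * c j) x $ m)"
      by (rule Bochner_Integration.integral_diff[OF smooth_test_mult_component(1)[OF \<psi>(1) L2per_sqint[OF sL]] smooth_test_mult_component(1)[OF \<psi>(1) L2per_sqint[OF lL]]])
    also have "(LINT x|Q. \<psi> x * stokes L (comb F c) x $ m) = - (\<Sum>i\<in>UNIV. \<Sum>j\<in>F. c j * (LINT x|Q. partial i (partial i \<psi>) x * \<phi> j x $ m))"
      by (subst stokes_moment[OF d \<psi>]) (simp add: cc[OF smooth_has_derivative(2)[OF smooth_has_derivative(2)[OF \<psi>(1)]]])
    also have "\<dots> = - (\<Sum>j\<in>F. c j * (\<Sum>i\<in>UNIV. LINT x|Q. partial i (partial i \<psi>) x * \<phi> j x $ m))"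
      by (subst sum.swap) (simp add: sum_distrib_left)
    also have "\<dots> = (\<Sum>j\<in>F. (lam j * c j) * (LINT x|Q. \<psi> x * \<phi> j x $ m))"
      unfolding sum_negf[symmetric] by (rule sum.cong) (simp_all add: lp)
    finally show ?thesis by (simp add: cc[OF \<psi>(1)])
  qed
  have hH: "h \<in> spaceH L"
  proof (rule spaceH_I[OF hL L_pos])
    show "(LINT x|Q. h x $ m) = 0" for m
      using mom[of "\<lambda>x. 1" m] trigpoly_test[OF trigpoly_const[of UNIV L 1, OF UNIV_I]] by simp
    show "(\<Sum>i\<in>UNIV. LINT x|Q. partial i \<psi> x * h x $ i) = 0" if "smooth \<psi>" "periodic L \<psi>" for \<psi>
      by (simp add: mom[OF smooth_has_derivative(2)[OF that(1)] periodic_partial[OF that]])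
  qed
  have "l2_norm L h = 0"
  proof (rule phi_total[OF hH])
    fix j :: nat assume j: "j \<ge> 1"
    have "cf h j = lam j * cf (comb F c) j - cf (comb F (\<lambda>j. lam j * c j)) j"
      unfolding h_def
      by (simp add: l2_inner_diff_left[OF L2per_sqint[OF sL] L2per_sqint[OF lL] phi_sqint[OF j]] cf_stokes[OF d j])
    then show "cf h j = 0" using cf_comb[OF F j] by simp
  qed
  then show ?thesis using norm2_0_iff_AE[OF L2per_sqint[OF hL]] by (simp add: l2_norm_eq h_def)
qed

section \<open>The trilinear form and the convection term\<close>

definition dphi :: "nat \<Rightarrow> 2 \<Rightarrow> field" where
  "dphi j i x = (\<chi> m. partial i (\<lambda>y. \<phi> j y $ m) x)"

lemma dphi_continuous: "j \<ge> 1 \<Longrightarrow> continuous_on S (dphi j i)"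
  unfolding dphi_def
  by (intro continuous_on_vec_lambda trigpoly_continuous[OF trigpoly_partial[OF phi_trigpoly_UNIV]])

text \<open>The trilinear form \<open>(a \<cdot> \<nabla> \<phi>\<^sub>j, b)\<close>.\<close>

definition tri :: "field \<Rightarrow> field \<Rightarrow> nat \<Rightarrow> real" where
  "tri a b j = (LINT x|Q. (\<Sum>i\<in>UNIV. a x $ i * (b x \<bullet> dphi j i x)))"

lemma tri_cong_AE:
  assumes "AE x in Q. a x = a' x" "AE x in Q. b x = b' x" "sqint Q a" "sqint Q a'" "sqint Q b" "sqint Q b'" "j \<ge> 1"
  shows "tri a b j = tri a' b' j"
  unfolding tri_def
proof (rule integral_cong_AE)
  have [measurable]: "dphi j i \<in> borel_measurable Q" for i
    by (rule sqint_measurable[OF continuous_imp_sqint_square[OF dphi_continuous[OF assms(7)]]])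
  note [measurable] = assms(3-6)[THEN sqint_measurable] assms(3-6)[THEN sqint_component, THEN sqint_measurable]
  show "(\<lambda>x. \<Sum>i\<in>UNIV. a x $ i * (b x \<bullet> dphi j i x)) \<in> borel_measurable Q" by measurable
  show "(\<lambda>x. \<Sum>i\<in>UNIV. a' x $ i * (b' x \<bullet> dphi j i x)) \<in> borel_measurable Q" by measurable
  show "AE x in Q. (\<Sum>i\<in>UNIV. a x $ i * (b x \<bullet> dphi j i x)) = (\<Sum>i\<in>UNIV. a' x $ i * (b' x \<bullet> dphi j i x))"
    using assms(1,2) by eventually_elim simp
qed

lemma tri_integrable:
  "continuous_on UNIV a \<Longrightarrow> continuous_on UNIV b \<Longrightarrow> j \<ge> 1 \<Longrightarrow> integrable Q (\<lambda>x. \<Sum>i\<in>UNIV. a x $ i * (b x \<bullet> dphi j i x))"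
  by (intro continuous_imp_integrable_square continuous_intros dphi_continuous)

lemma tri_add_left:
  "continuous_on UNIV a \<Longrightarrow> continuous_on UNIV a' \<Longrightarrow> continuous_on UNIV b \<Longrightarrow> j \<ge> 1 \<Longrightarrow>
    tri (\<lambda>x. a x + a' x) b j = tri a b j + tri a' b j"
proof -
  assume c: "continuous_on UNIV a" "continuous_on UNIV a'" "continuous_on UNIV b" "j \<ge> 1"
  have "tri (\<lambda>x. a x + a' x) b j = (LINT x|Q. (\<Sum>i\<in>UNIV. a x $ i * (b x \<bullet> dphi j i x)) + (\<Sum>i\<in>UNIV. a' x $ i * (b x \<bullet> dphi j i x)))"
    unfolding tri_def by (rule Bochner_Integration.integral_cong) (simp_all add: sum_2 algebra_simps)
  also have "\<dots> = tri a b j + tri a' b j"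
    unfolding tri_def by (rule Bochner_Integration.integral_add[OF tri_integrable[OF c(1,3,4)] tri_integrable[OF c(2,3,4)]])
  finally show ?thesis .
qed

lemma tri_add_right:
  "continuous_on UNIV a \<Longrightarrow> continuous_on UNIV b' \<Longrightarrow> continuous_on UNIV b \<Longrightarrow> j \<ge> 1 \<Longrightarrow>
    tri a (\<lambda>x. b x + b' x) j = tri a b j + tri a b' j"
proof -
  assume c: "continuous_on UNIV a" "continuous_on UNIV b'" "continuous_on UNIV b" "j \<ge> 1"
  have "tri a (\<lambda>x. b x + b' x) j = (LINT x|Q. (\<Sum>i\<in>UNIV. a x $ i * (b x \<bullet> dphi j i x)) + (\<Sum>i\<in>UNIV. a x $ i * (b' x \<bullet> dphi j i x)))"
    unfolding tri_def by (rule Bochner_Integration.integral_cong) (simp_all add: sum_2 algebra_simps inner_add_left)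
  also have "\<dots> = tri a b j + tri a b' j"
    unfolding tri_def by (rule Bochner_Integration.integral_add[OF tri_integrable[OF c(1,3,4)] tri_integrable[OF c(1,2,4)]])
  finally show ?thesis .
qed

text \<open>The \<open>L^1\<close> norm of the gradient of \<open>\<phi> j\<close>, summed over
  directions. Its growth in \<open>j\<close> is immaterial, as it only influences the size of
  \<open>\<mu>\<close>.\<close>

definition tri_const :: "nat \<Rightarrow> real" where
  "tri_const j = (LINT x|Q. (\<Sum>i\<in>UNIV. norm (dphi j i x)))"

lemma tri_const_nonneg: "tri_const j \<ge> 0"
  unfolding tri_const_def by (intro integral_nonneg_AE AE_I2 sum_nonneg) auto

lemma tri_bound:
  assumes ab: "continuous_on UNIV a" "continuous_on UNIV b" and j: "j \<ge> 1"
    and x: "\<And>x. norm (a x) \<le> A" "\<And>x. norm (b x) \<le> B"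
  shows "\<bar>tri a b j\<bar> \<le> tri_const j * (A * B)"
proof -
  have nn: "A \<ge> 0" "B \<ge> 0" using x norm_ge_zero order_trans by blast+
  have Ti: "integrable Q (\<lambda>x. \<Sum>i\<in>UNIV. norm (dphi j i x))"
    by (intro continuous_imp_integrable_square continuous_intros dphi_continuous j)
  have "\<bar>tri a b j\<bar> \<le> (LINT x|Q. \<bar>\<Sum>i\<in>UNIV. a x $ i * (b x \<bullet> dphi j i x)\<bar>)"
    unfolding tri_def by (rule integral_abs_bound)
  also have "\<dots> \<le> (LINT x|Q. (A * B) * (\<Sum>i\<in>UNIV. norm (dphi j i x)))"
  proof (rule integral_mono)
    show "integrable Q (\<lambda>x. \<bar>\<Sum>i\<in>UNIV. a x $ i * (b x \<bullet> dphi j i x)\<bar>)"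
      by (rule integrable_abs[OF tri_integrable[OF ab j]])
    show "integrable Q (\<lambda>x. (A * B) * (\<Sum>i\<in>UNIV. norm (dphi j i x)))" using Ti by simp
    fix y
    have "\<bar>\<Sum>i\<in>UNIV. a y $ i * (b y \<bullet> dphi j i y)\<bar> \<le> (\<Sum>i\<in>UNIV. (A * B) * norm (dphi j i y))"
    proof (rule order_trans[OF sum_abs sum_mono])
      fix i
      have "\<bar>a y $ i\<bar> \<le> A" using component_le_norm_cart[of "a y" i] x(1)[of y] by simp
      moreover have "\<bar>b y \<bullet> dphi j i y\<bar> \<le> B * norm (dphi j i y)"
        using Cauchy_Schwarz_ineq2[of "b y" "dphi j i y"] mult_right_mono[OF x(2)[of y], of "norm (dphi j i y)"] by simp
      ultimately have "\<bar>a y $ i\<bar> * \<bar>b y \<bullet> dphi j i y\<bar> \<le> A * (B * norm (dphi j i y))"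
        using nn by (intro mult_mono) auto
      then show "\<bar>a y $ i * (b y \<bullet> dphi j i y)\<bar> \<le> (A * B) * norm (dphi j i y)" by (simp add: abs_mult mult.assoc)
    qed
    then show "\<bar>\<Sum>i\<in>UNIV. a y $ i * (b y \<bullet> dphi j i y)\<bar> \<le> (A * B) * (\<Sum>i\<in>UNIV. norm (dphi j i y))"
      by (simp add: sum_distrib_left)
  qed
  finally show ?thesis by (simp add: tri_const_def mult.commute)
qed

lemma comb_component_trigpoly:
  assumes "F \<subseteq> {1..}"
  shows "trigpoly L UNIV (\<lambda>x. comb F c x $ m)"
proof -
  have "(\<lambda>x. comb F c x $ m) = (\<lambda>x. \<Sum>j\<in>F. c j * \<phi> j x $ m)" by (simp add: comb_def)
  then show ?thesis using assms by (auto intro!: trigpoly_sum trigpoly_scale phi_trigpoly_UNIV)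
qed

lemma partial_comb:
  assumes "F \<subseteq> {1..}"
  shows "partial i (\<lambda>x. comb F c x $ m) x = (\<Sum>j\<in>F. c j * dphi j i x $ m)"
proof -
  have tp: "trigpoly L UNIV (\<lambda>x. \<phi> j x $ m)" if "j \<in> F" for j
    using assms that by (intro phi_trigpoly_UNIV) auto
  have eq: "(\<lambda>x. comb F c x $ m) = (\<lambda>x. \<Sum>j\<in>F. c j * \<phi> j x $ m)" by (simp add: comb_def)
  show ?thesis unfolding eq
    by (subst partial_sum[OF trigpoly_scale[OF tp]]) (auto simp: partial_scale[OF tp] dphi_def intro!: sum.cong)
qed

text \<open>The integrand is \<open>a \<cdot> \<nabla>(|w|\<^sup>2 / 2)\<close>.\<close>

lemma tri_energy:
  assumes F: "finite F" "F \<subseteq> {1..}" and a: "a \<in> spaceH L" "continuous_on UNIV a"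
  shows "(\<Sum>j\<in>F. c j * tri a (comb F c) j) = 0"
proof -
  define w where "w = comb F c"
  have w: "continuous_on UNIV w" unfolding w_def by (rule comb_continuous[OF F(2)])
  have tp: "trigpoly L UNIV (\<lambda>x. w x $ m)" for m unfolding w_def by (rule comb_component_trigpoly[OF F(2)])
  \<comment> \<open>\<open>\<psi>\<close> is the squared length of \<open>w\<close>. As a
    trigonometric polynomial it is an admissible test function in the weak divergence constraint on
    \<open>a\<close>.\<close>
  define \<psi> where "\<psi> x = (\<Sum>m\<in>UNIV. w x $ m * w x $ m)" for x
  have \<psi>_tp: "trigpoly L UNIV \<psi>" unfolding \<psi>_def by (intro trigpoly_sum trigpoly_mult tp)
  have d\<psi>: "partial i \<psi> x = 2 * (\<Sum>m\<in>UNIV. w x $ m * partial i (\<lambda>x. w x $ m) x)" for i x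
    unfolding \<psi>_def
    by (subst partial_sum[OF trigpoly_mult[OF tp tp]]) (simp add: partial_mult[OF tp tp] sum_2)
  have "(\<Sum>j\<in>F. c j * tri a w j) = (LINT x|Q. (\<Sum>j\<in>F. c j * (\<Sum>i\<in>UNIV. a x $ i * (w x \<bullet> dphi j i x))))"
    unfolding tri_def using F
    by (subst Bochner_Integration.integral_sum) (auto intro!: integrable_mult_right tri_integrable a w)
  also have "\<dots> = (LINT x|Q. 1/2 * (\<Sum>i\<in>UNIV. a x $ i * partial i \<psi> x))"
  proof (rule Bochner_Integration.integral_cong[OF refl])
    fix x
    have "(\<Sum>j\<in>F. c j * (\<Sum>i\<in>UNIV. a x $ i * (w x \<bullet> dphi j i x))) = (\<Sum>i\<in>UNIV. \<Sum>j\<in>F. a x $ i * (c j * (w x \<bullet> dphi j i x)))"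
      by (simp add: sum_distrib_left mult.left_commute) (rule sum.swap)
    also have "\<dots> = (\<Sum>i\<in>UNIV. a x $ i * (\<Sum>m\<in>UNIV. w x $ m * partial i (\<lambda>x. w x $ m) x))"
    proof (rule sum.cong[OF refl])
      fix i
      have "(\<Sum>j\<in>F. c j * (w x \<bullet> dphi j i x)) = (\<Sum>m\<in>UNIV. w x $ m * partial i (\<lambda>x. w x $ m) x)"
        unfolding w_def partial_comb[OF F(2)] inner_components sum_distrib_left
        by (subst sum.swap) (simp add: mult_ac)
      then show "(\<Sum>j\<in>F. a x $ i * (c j * (w x \<bullet> dphi j i x))) = a x $ i * (\<Sum>m\<in>UNIV. w x $ m * partial i (\<lambda>x. w x $ m) x)"
        by (simp add: sum_distrib_left[symmetric])
    qed
    also have "\<dots> = 1/2 * (\<Sum>i\<in>UNIV. a x $ i * partial i \<psi> x)"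
      unfolding d\<psi> by (simp add: sum_distrib_left)
    finally show "(\<Sum>j\<in>F. c j * (\<Sum>i\<in>UNIV. a x $ i * (w x \<bullet> dphi j i x))) = 1/2 * (\<Sum>i\<in>UNIV. a x $ i * partial i \<psi> x)" .
  qed
  also have "\<dots> = 0"
    using trigpoly_test[OF \<psi>_tp] a(1) by (auto simp: spaceH_def weakly_div_free_def)
  finally show ?thesis by (simp add: w_def)
qed

lemma norm_comb_le: "dsum c K \<Longrightarrow> norm (comb {1..n} c x) \<le> weylC * K"
  unfolding comb_def by (intro order_trans[OF norm_sum sum_sup_bound]) (auto simp: dsum_def)

lemma comb_div_free:
  assumes F: "F \<subseteq> {1..}"
  shows "(\<Sum>i\<in>UNIV. partial i (\<lambda>x. comb F c x $ i) x) = 0"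
proof -
  have "(\<Sum>i\<in>UNIV. partial i (\<lambda>x. comb F c x $ i) x) = (\<Sum>j\<in>F. c j * (\<Sum>i\<in>UNIV. partial i (\<lambda>y. \<phi> j y $ i) x))"
    unfolding partial_comb[OF F] by (subst sum.swap) (simp add: sum_distrib_left dphi_def)
  also have "\<dots> = 0" using F by (intro sum.neutral) (auto simp: phi_div_free)
  finally show ?thesis .
qed

text \<open>Integration by parts against the test functions \<open>P\<^sub>i \<phi>\<^sub>j\<^sub>m\<close>, where \<open>P\<close> is a truncation of \<open>u\<close>.\<close>

lemma convection_by_parts:
  assumes u: "u \<in> H1per L" and F: "F \<subseteq> {1..}" and j: "j \<ge> 1"
  shows "(\<Sum>i\<in>UNIV. LINT x|Q. comb F c x $ i * (wd L i u x \<bullet> \<phi> j x)) =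
    - (\<Sum>i\<in>UNIV. LINT x|Q. comb F c x $ i * (u x \<bullet> dphi j i x))"
proof -
  define P where "P i x = comb F c x $ i" for i x
  define f where "f m x = \<phi> j x $ m" for m x
  have Pt: "trigpoly L UNIV (P i)" for i unfolding P_def by (rule comb_component_trigpoly[OF F])
  have ft: "trigpoly L UNIV (f m)" for m unfolding f_def by (rule phi_trigpoly_UNIV[OF j])
  have us: "sqint Q u" by (rule L2per_sqint[OF H1per_L2per[OF u]])
  have ws: "sqint Q (wd L i u)" for i by (rule L2per_sqint[OF wd_props(1)[OF u]])
  note iu = smooth_test_mult_component(1)[OF trigpoly_smooth us]
  note iw = smooth_test_mult_component(1)[OF trigpoly_smooth ws]
  have "(LINT x|Q. P i x * (wd L i u x \<bullet> \<phi> j x)) = (\<Sum>m\<in>UNIV. LINT x|Q. (P i x * f m x) * wd L i u x $ m)" for i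
  proof -
    have "(LINT x|Q. P i x * (wd L i u x \<bullet> \<phi> j x)) = (LINT x|Q. (\<Sum>m\<in>UNIV. (P i x * f m x) * wd L i u x $ m))"
      by (simp add: inner_components f_def sum_distrib_left mult_ac)
    also have "\<dots> = (\<Sum>m\<in>UNIV. LINT x|Q. (P i x * f m x) * wd L i u x $ m)"
      by (rule Bochner_Integration.integral_sum[OF iw[OF trigpoly_mult[OF ft Pt]]])
    finally show ?thesis .
  qed
  moreover have "(LINT x|Q. (P i x * f m x) * wd L i u x $ m) =
      - ((LINT x|Q. (partial i (P i) x * f m x) * u x $ m) + (LINT x|Q. (P i x * partial i (f m) x) * u x $ m))" for i m
  proof -
    have "(LINT x|Q. (P i x * f m x) * wd L i u x $ m) = - (LINT x|Q. partial i (\<lambda>x. P i x * f m x) x * u x $ m)"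
      using weak_partial_component[OF wd_props(2)[OF u, of i] H1per_L2per[OF u] wd_props(1)[OF u] conjunct1[OF trigpoly_test[OF trigpoly_mult[OF ft Pt]]]
        conjunct2[OF trigpoly_test[OF trigpoly_mult[OF ft Pt]]]] by simp
    also have "(LINT x|Q. partial i (\<lambda>x. P i x * f m x) x * u x $ m) =
       (LINT x|Q. (partial i (P i) x * f m x) * u x $ m + (P i x * partial i (f m) x) * u x $ m)"
      by (simp add: partial_mult[OF Pt ft] algebra_simps)
    also have "\<dots> = (LINT x|Q. (partial i (P i) x * f m x) * u x $ m) + (LINT x|Q. (P i x * partial i (f m) x) * u x $ m)"
      by (rule Bochner_Integration.integral_add[OF iu[OF trigpoly_mult[OF ft trigpoly_partial[OF Pt]]] iu[OF trigpoly_mult[OF trigpoly_partial[OF ft] Pt]]])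
    finally show ?thesis .
  qed
  ultimately have "(\<Sum>i\<in>UNIV. LINT x|Q. P i x * (wd L i u x \<bullet> \<phi> j x)) =
     - (\<Sum>i\<in>UNIV. \<Sum>m\<in>UNIV. LINT x|Q. (partial i (P i) x * f m x) * u x $ m)
     - (\<Sum>i\<in>UNIV. \<Sum>m\<in>UNIV. LINT x|Q. (P i x * partial i (f m) x) * u x $ m)"
    by (simp add: sum_negf sum.distrib sum_subtractf)
  also have "(\<Sum>i\<in>UNIV. \<Sum>m\<in>UNIV. LINT x|Q. (partial i (P i) x * f m x) * u x $ m) =
      (\<Sum>m\<in>UNIV. LINT x|Q. (\<Sum>i\<in>UNIV. (partial i (P i) x * f m x) * u x $ m))"
    by (subst sum.swap, subst Bochner_Integration.integral_sum)
      (auto intro!: iu[OF trigpoly_mult[OF ft trigpoly_partial[OF Pt]]])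
  \<comment> \<open>The terms in which the derivative falls on the advecting truncation add up to
    its pointwise divergence.\<close>
  also have "\<dots> = 0"
  proof -
    have "(\<Sum>i\<in>UNIV. (partial i (P i) x * f m x) * u x $ m) = (\<Sum>i\<in>UNIV. partial i (P i) x) * (f m x * u x $ m)" for m x
      by (simp add: sum_distrib_right mult.assoc)
    moreover have "(\<Sum>i\<in>UNIV. partial i (P i) x) = 0" for x
      using comb_div_free[OF F, of c x] by (simp add: P_def[abs_def])
    ultimately show ?thesis by simp
  qed
  also have "(\<Sum>i\<in>UNIV. \<Sum>m\<in>UNIV. LINT x|Q. (P i x * partial i (f m) x) * u x $ m) =
     (\<Sum>i\<in>UNIV. LINT x|Q. P i x * (u x \<bullet> dphi j i x))"
  proof (rule sum.cong[OF refl])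
    fix i
    have "(\<Sum>m\<in>UNIV. LINT x|Q. (P i x * partial i (f m) x) * u x $ m) = (LINT x|Q. (\<Sum>m\<in>UNIV. (P i x * partial i (f m) x) * u x $ m))"
      by (rule Bochner_Integration.integral_sum[symmetric, OF iu[OF trigpoly_mult[OF trigpoly_partial[OF ft] Pt]]])
    also have "\<dots> = (LINT x|Q. P i x * (u x \<bullet> dphi j i x))"
      by (simp add: inner_components dphi_def f_def[abs_def] sum_distrib_left mult_ac)
    finally show "(\<Sum>m\<in>UNIV. LINT x|Q. (P i x * partial i (f m) x) * u x $ m) = (LINT x|Q. P i x * (u x \<bullet> dphi j i x))" .
  qed
  finally show ?thesis by (simp add: P_def)
qed

text \<open>The partial sums are bounded by \<open>weylC * K\<close> uniformly in \<open>n\<close>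
  and \<open>x\<close>, so any integrable \<open>h\<close> gives a dominating function.\<close>

lemma comb_mult_tendsto:
  assumes c: "dsum c K" and h: "integrable Q h"
  shows "(\<lambda>n. LINT x|Q. comb {1..n} c x $ i * h x) \<longlonglongrightarrow> (LINT x|Q. ser c x $ i * h x)"
proof (rule integral_dominated_convergence[where w="\<lambda>x. weylC * K * \<bar>h x\<bar>"])
  have [measurable]: "h \<in> borel_measurable Q" using h by auto
  have [measurable]: "(\<lambda>x. ser c x $ i) \<in> borel_measurable Q" "(\<lambda>x. comb {1..n} c x $ i) \<in> borel_measurable Q" for n
    by (auto intro!: sqint_measurable[OF sqint_component] continuous_imp_sqint_square ser_continuous[OF c] comb_continuous)
  show "(\<lambda>x. ser c x $ i * h x) \<in> borel_measurable Q" "(\<lambda>x. comb {1..n} c x $ i * h x) \<in> borel_measurable Q" for n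
    by measurable
  show "integrable Q (\<lambda>x. weylC * K * \<bar>h x\<bar>)" using h by simp
  show "AE x in Q. (\<lambda>n. comb {1..n} c x $ i * h x) \<longlonglongrightarrow> ser c x $ i * h x"
    by (intro AE_I2 tendsto_intros tendsto_vec_nth ser_LIMSEQ[OF c])
  have "\<bar>comb {1..n} c x $ i\<bar> \<le> weylC * K" for n x
    using component_le_norm_cart[of "comb {1..n} c x" i] norm_comb_le[OF c, of n x] by linarith
  then show "AE x in Q. norm (comb {1..n} c x $ i * h x) \<le> weylC * K * \<bar>h x\<bar>" for n
    by (intro AE_I2) (auto simp: abs_mult intro: mult_right_mono)
qed

text \<open>The weak gradient of \<open>u\<close> is removed by integrating by parts with
  truncations of the advecting field and letting the truncation grow. What remains contains no
  derivative of \<open>u\<close> and depends on the coefficients alone.\<close>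

lemma cf_bilin:
  assumes u: "u \<in> domA L" and j: "j \<ge> 1"
  shows "sqint Q (bilin L u u)" "cf (bilin L u u) j = - tri (ser (cf u)) (ser (cf u)) j"
proof -
  note d = dsum_domA[OF u]
  note uH = domA_H1per(3)[OF u]
  note u1 = domA_H1per(1)[OF u]
  define U where "U = ser (cf u)"
  define K where "K = l2_norm L (stokes L u)"
  have Uc: "continuous_on UNIV U" unfolding U_def by (rule ser_continuous[OF d])
  have Us: "sqint Q U" by (rule continuous_imp_sqint_square[OF Uc])
  have uU: "AE x in Q. u x = U x" unfolding U_def by (rule AE_eq_ser[OF uH d])
  have us: "sqint Q u" by (rule spaceH_sqint[OF uH])
  have ws: "sqint Q (wd L i u)" for i by (rule L2per_sqint[OF wd_props(1)[OF u1]])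
  define g where "g x = (\<Sum>i\<in>UNIV. u x $ i *\<^sub>R wd L i u x)" for x
  \<comment> \<open>The advecting factor is replaced by its bounded representative, which shows that
    the product is square integrable and hence within the reach of the Leray projection.\<close>
  define h where "h x = (\<Sum>i\<in>UNIV. U x $ i *\<^sub>R wd L i u x)" for x
  have Ub: "\<bar>U x $ i\<bar> \<le> weylC * K" for x i
    using component_le_norm_cart[of "U x" i] norm_ser_le[OF d, of x] by (simp add: U_def K_def)
  have hs: "sqint Q h" unfolding h_def
    by (rule sqint_sum, rule sqint_bounded_mult[OF ws sqint_measurable[OF sqint_component[OF Us]] Ub])
  note [measurable] = us[THEN sqint_measurable] ws[THEN sqint_measurable] us[THEN sqint_component, THEN sqint_measurable]
    hs[THEN sqint_measurable]
  have gm[measurable]: "g \<in> borel_measurable Q" unfolding g_def by measurable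
  have hg: "AE x in Q. h x = g x" using uU by eventually_elim (simp add: h_def g_def)
  have gs: "sqint Q g" by (rule sqint_cong_AE[OF hs gm hg])
  have bg: "bilin L u u = leray L g" by (simp add: bilin_def g_def[abs_def])
  show "sqint Q (bilin L u u)" unfolding bg by (rule spaceH_sqint[OF leray_props(1)[OF gs]])
  have pm[measurable]: "\<phi> j \<in> borel_measurable Q" by (rule sqint_measurable[OF phi_sqint[OF j]])
  have wphi: "integrable Q (\<lambda>x. wd L i u x \<bullet> \<phi> j x)" for i by (rule sqint_inner[OF ws phi_sqint[OF j]])
  have udphi: "integrable Q (\<lambda>x. u x \<bullet> dphi j i x)" for i
    by (rule sqint_inner[OF us continuous_imp_sqint_square[OF dphi_continuous[OF j]]])
  have Uint: "integrable Q (\<lambda>x. U x $ i * k x)" if "integrable Q k" for i k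
  proof (rule Bochner_Integration.integrable_bound[OF integrable_mult_right[OF integrable_abs[OF that], of "weylC * K"]])
    show "(\<lambda>x. U x $ i * k x) \<in> borel_measurable Q"
      using that sqint_measurable[OF sqint_component[OF Us]] by auto
    have "\<bar>U x $ i\<bar> * \<bar>k x\<bar> \<le> \<bar>weylC * K\<bar> * \<bar>k x\<bar>" for x
      using Ub[of x i] by (intro mult_right_mono) auto
    then show "AE x in Q. norm (U x $ i * k x) \<le> norm (weylC * K * \<bar>k x\<bar>)"
      by (intro AE_I2) (auto simp: abs_mult)
  qed
  have "cf (bilin L u u) j = cf g j" unfolding bg by (rule cf_leray[OF gs j])
  also have "\<dots> = (LINT x|Q. h x \<bullet> \<phi> j x)"
    unfolding l2_inner_def
  proof (rule integral_cong_AE)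
    show "AE x in Q. g x \<bullet> \<phi> j x = h x \<bullet> \<phi> j x" using hg by eventually_elim simp
  qed measurable
  also have "\<dots> = (\<Sum>i\<in>UNIV. LINT x|Q. U x $ i * (wd L i u x \<bullet> \<phi> j x))"
    unfolding h_def inner_sum_left inner_scaleR_left by (rule Bochner_Integration.integral_sum[OF Uint[OF wphi]])
  also have "\<dots> = - (\<Sum>i\<in>UNIV. LINT x|Q. U x $ i * (u x \<bullet> dphi j i x))"
  proof (rule LIMSEQ_unique)
    show "(\<lambda>n. \<Sum>i\<in>UNIV. LINT x|Q. comb {1..n} (cf u) x $ i * (wd L i u x \<bullet> \<phi> j x)) \<longlonglongrightarrow>
      (\<Sum>i\<in>UNIV. LINT x|Q. U x $ i * (wd L i u x \<bullet> \<phi> j x))"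
      unfolding U_def by (intro tendsto_sum comb_mult_tendsto[OF d] wphi)
    have "(\<lambda>n. - (\<Sum>i\<in>UNIV. LINT x|Q. comb {1..n} (cf u) x $ i * (u x \<bullet> dphi j i x))) \<longlonglongrightarrow>
      - (\<Sum>i\<in>UNIV. LINT x|Q. U x $ i * (u x \<bullet> dphi j i x))"
      unfolding U_def by (intro tendsto_minus tendsto_sum comb_mult_tendsto[OF d] udphi)
    then show "(\<lambda>n. \<Sum>i\<in>UNIV. LINT x|Q. comb {1..n} (cf u) x $ i * (wd L i u x \<bullet> \<phi> j x)) \<longlonglongrightarrow>
      - (\<Sum>i\<in>UNIV. LINT x|Q. U x $ i * (u x \<bullet> dphi j i x))"
      by (subst convection_by_parts[OF u1 _ j]) auto
  qed
  also have "(\<Sum>i\<in>UNIV. LINT x|Q. U x $ i * (u x \<bullet> dphi j i x)) = tri U u j"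
    unfolding tri_def by (rule Bochner_Integration.integral_sum[symmetric, OF Uint[OF udphi]])
  also have "tri U u j = tri U U j"
    by (rule tri_cong_AE[OF _ uU Us Us us Us j]) simp
  finally show "cf (bilin L u u) j = - tri (ser (cf u)) (ser (cf u)) j" by (simp add: U_def)
qed

end

subsection \<open>A spectral inequality for trigonometric polynomials\<close>

text \<open>Monomial and interpolant are polynomials of degree at most \<open>n\<close> that agree
  at \<open>n + 1\<close> distinct nodes.\<close>

lemma Lagrange_monomial:
  fixes z :: "nat \<Rightarrow> complex"
  assumes inj: "inj_on z {..n}" and p: "p \<le> n"
  shows "w ^ p = (\<Sum>j\<le>n. z j ^ p * (\<Prod>l\<in>{..n}-{j}. (w - z l) / (z j - z l)))"
proof -
  define R where "R j = (\<Prod>l\<in>{..n}-{j}. [:- z l, 1:])" for j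
  define d where "d j = (\<Prod>l\<in>{..n}-{j}. (z j - z l))" for j
  define P where "P = (\<Sum>j\<le>n. smult (z j ^ p / d j) (R j))"
  have pR: "poly (R j) x = (\<Prod>l\<in>{..n}-{j}. (x - z l))" for j x by (simp add: R_def poly_prod)
  have d0: "d j \<noteq> 0" if "j \<le> n" for j
    using inj that by (auto simp: d_def inj_on_def)
  have "monom 1 p = P"
  proof (rule poly_eqI_degree[where A="z ` {..n}"])
    have card: "card (z ` {..n}) = Suc n" using inj by (simp add: card_image)
    show "degree (monom 1 p :: complex poly) < card (z ` {..n})" using p card by (simp add: degree_monom_eq)
    have "degree (R j) \<le> n" if "j \<le> n" for j
    proof -
      have "degree (R j) \<le> sum (degree \<circ> (\<lambda>l. [:- z l, 1:])) ({..n}-{j})" unfolding R_def by (rule degree_prod_sum_le) simp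
      also have "\<dots> = n" using that by simp
      finally show ?thesis .
    qed
    then have "degree P \<le> n" unfolding P_def
      by (intro degree_sum_le) (auto intro: order_trans[OF degree_smult_le])
    then show "degree P < card (z ` {..n})" using card by simp
    fix x assume "x \<in> z ` {..n}"
    then obtain i where i: "i \<le> n" "x = z i" by auto
    have "poly (R j) x = (if j = i then d i else 0)" if "j \<le> n" for j
      unfolding pR using i that by (auto simp: d_def)
    then have "poly P x = (\<Sum>j\<le>n. if j = i then z i ^ p / d i * d i else 0)"
      unfolding P_def poly_sum by (intro sum.cong) auto
    also have "\<dots> = z i ^ p" using i d0 by simp
    finally show "poly (monom 1 p) x = poly P x" using i by (simp add: poly_monom)
  qed
  then have "w ^ p = poly P w" by (metis poly_monom mult_1)
  also have "\<dots> = (\<Sum>j\<le>n. z j ^ p * (\<Prod>l\<in>{..n}-{j}. (w - z l) / (z j - z l)))"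
    unfolding P_def poly_sum by (simp add: pR d_def prod_dividef)
  finally show ?thesis .
qed

lemma norm_cis_diff: "norm (cis a - cis b) = 2 * \<bar>sin ((a - b) / 2)\<bar>"
proof -
  have "(norm (cis a - cis b))\<^sup>2 = (cos a - cos b)\<^sup>2 + (sin a - sin b)\<^sup>2" by (simp add: cmod_power2)
  also have "\<dots> = ((sin a)\<^sup>2 + (cos a)\<^sup>2) + ((sin b)\<^sup>2 + (cos b)\<^sup>2) - 2 * cos (a - b)"
    unfolding cos_diff by (simp add: power2_eq_square algebra_simps)
  also have "\<dots> = 2 - 2 * cos (2 * ((a - b) / 2))"
  proof -
    have h: "2 * ((a - b) / 2) = a - b" by simp
    show ?thesis unfolding h by simp
  qed
  also have "\<dots> = (2 * \<bar>sin ((a - b) / 2)\<bar>)\<^sup>2" unfolding cos_double_sin by (simp add: power_mult_distrib)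
  finally show ?thesis by (rule power2_eq_imp_eq) auto
qed

lemma sin_ge_half:
  assumes "0 \<le> x" "x \<le> (1::real)"
  shows "x / 2 \<le> sin x"
proof -
  have c: "(\<Sum>m<3. sin_coeff m * x ^ m) = x" by (simp add: sin_coeff_def numeral_3_eq_3)
  have "\<bar>sin x - x\<bar> \<le> inverse (fact 3) * \<bar>x\<bar> ^ 3" using Maclaurin_sin_bound[of x 3] unfolding c .
  also have "\<dots> \<le> inverse (fact 3) * x"
    using assms power_decreasing[of 1 3 x] by (intro mult_left_mono) auto
  also have "\<dots> = x / 6" by (simp add: fact_numeral)
  finally show ?thesis using assms by linarith
qed

lemma prod_dist_factorial:
  assumes "j \<le> n"
  shows "(\<Prod>l\<in>{..n}-{j}. \<bar>real j - real l\<bar>) = fact j * fact (n - j)"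
proof -
  have s: "{..n} - {j} = {..<j} \<union> {j<..n}" using assms by auto
  have "(\<Prod>l\<in>{..<j} \<union> {j<..n}. \<bar>real j - real l\<bar>) = (\<Prod>l\<in>{..<j}. \<bar>real j - real l\<bar>) * (\<Prod>l\<in>{j<..n}. \<bar>real j - real l\<bar>)"
    by (rule prod.union_disjoint) auto
  also have "(\<Prod>l\<in>{..<j}. \<bar>real j - real l\<bar>) = (\<Prod>i\<in>{1..j}. real i)"
    by (rule prod.reindex_bij_witness[of _ "\<lambda>i. j - i" "\<lambda>l. j - l"]) (auto simp: of_nat_diff)
  also have "\<dots> = fact j" by (simp add: fact_prod)
  also have "(\<Prod>l\<in>{j<..n}. \<bar>real j - real l\<bar>) = (\<Prod>i\<in>{1..n - j}. real i)"
    by (rule prod.reindex_bij_witness[of _ "\<lambda>i. j + i" "\<lambda>l. l - j"]) (auto simp: of_nat_diff)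
  also have "\<dots> = fact (n - j)" by (simp add: fact_prod)
  finally show ?thesis unfolding s .
qed

text \<open>One term of the exponential series. It absorbs the power of \<open>Suc (2 * K)\<close>
  that comes from the node spacing.\<close>

lemma power_div_fact_le_exp: "real (Suc n) ^ n / fact n \<le> exp (real (Suc n))"
proof -
  have "(\<lambda>k. real (Suc n) ^ k /\<^sub>R fact k) sums exp (real (Suc n))" by (rule exp_converges)
  then have s: "summable (\<lambda>k. real (Suc n) ^ k /\<^sub>R fact k)" and e: "exp (real (Suc n)) = (\<Sum>k. real (Suc n) ^ k /\<^sub>R fact k)"
    by (auto simp: sums_iff)
  have "sum (\<lambda>k. real (Suc n) ^ k /\<^sub>R fact k) {n} \<le> exp (real (Suc n))"
    unfolding e by (rule sum_le_suminf[OF s]) auto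
  then show ?thesis by (simp add: divide_inverse mult.commute)
qed

section \<open>Interpolation at equidistant nodes of the circle\<close>

text \<open>The Lagrange basis functions for the nodes
  \<open>cis (\<kappa> * (\<tau> + real j * \<eta>))\<close>, twisted by a power of order
  \<open>K\<close>: multiplied by the \<open>K\<close>-th power of
  \<open>cis (\<kappa> * t)\<close>, a trigonometric polynomial of degree \<open>K\<close> becomes a
  polynomial of degree \<open>2 * K\<close> in \<open>cis (\<kappa> * t)\<close>, for which
  \<open>2 * K + 1\<close> nodes suffice.\<close>

definition lagr :: "real \<Rightarrow> nat \<Rightarrow> real \<Rightarrow> real \<Rightarrow> nat \<Rightarrow> real \<Rightarrow> complex" where
  "lagr \<kappa> K \<eta> \<tau> j t = (cis (\<kappa> * (\<tau> + real j * \<eta>)) / cis (\<kappa> * t)) ^ K *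
     (\<Prod>l\<in>{..2*K}-{j}. (cis (\<kappa> * t) - cis (\<kappa> * (\<tau> + real l * \<eta>))) /
       (cis (\<kappa> * (\<tau> + real j * \<eta>)) - cis (\<kappa> * (\<tau> + real l * \<eta>))))"

context
  fixes L \<delta> :: real and K :: nat and \<kappa> \<eta> :: real
  assumes L: "L > 0" and \<delta>: "0 < \<delta>" "\<delta> \<le> L / 2"
  defines "\<kappa> \<equiv> 2 * pi / L" and "\<eta> \<equiv> \<delta> / (2 * real (Suc (2 * K)))"
begin

text \<open>Half the angle between two nodes is at most \<open>pi / 4\<close>, because
  \<open>\<delta> \<le> L / 2\<close>; in that range chords are comparable to arcs by
  \<open>sin_ge_half\<close>.\<close>

lemma node_dist:
  assumes "j \<le> 2 * K" "l \<le> 2 * K"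
  shows "norm (cis (\<kappa> * (\<tau> + real j * \<eta>)) - cis (\<kappa> * (\<tau> + real l * \<eta>))) \<ge> \<delta> / (L * real (Suc (2 * K))) * \<bar>real j - real l\<bar>"
proof -
  define x where "x = \<kappa> * \<eta> / 2 * \<bar>real j - real l\<bar>"
  have k: "\<kappa> > 0" "\<eta> > 0" using L \<delta> by (auto simp: \<kappa>_def \<eta>_def)
  have x0: "x \<ge> 0" unfolding x_def using k by simp
  have "\<bar>real j - real l\<bar> \<le> real (Suc (2 * K))" using assms by linarith
  then have "x \<le> \<kappa> * \<eta> / 2 * real (Suc (2 * K))" unfolding x_def using k by (intro mult_left_mono) auto
  also have "\<dots> = pi * \<delta> / (2 * L)"
  proof -
    have "2 * pi / L * (\<delta> / (2 * n)) / 2 * n = pi * \<delta> / (2 * L)" if "n > 0" for n :: real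
      using L that by (simp add: field_simps)
    then show ?thesis by (simp only: \<kappa>_def \<eta>_def of_nat_0_less_iff zero_less_Suc)
  qed
  also have "\<dots> \<le> pi * (L / 2) / (2 * L)" using \<delta> L by (intro divide_right_mono mult_left_mono) auto
  also have "\<dots> \<le> 1" using L pi_less_4 by simp
  finally have x1: "x \<le> 1" .
  have "\<bar>sin ((\<kappa> * (\<tau> + real j * \<eta>) - \<kappa> * (\<tau> + real l * \<eta>)) / 2)\<bar> = \<bar>sin x\<bar>"
  proof -
    have e: "(\<kappa> * (\<tau> + real j * \<eta>) - \<kappa> * (\<tau> + real l * \<eta>)) / 2 = \<kappa> * \<eta> / 2 * (real j - real l)"
      by (simp add: algebra_simps diff_divide_distrib)
    show ?thesis unfolding e x_def
      by (cases "real j - real l \<ge> 0") (simp_all only: abs_of_nonneg abs_of_neg not_le mult_minus_right sin_minus abs_minus_cancel)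
  qed
  then have "norm (cis (\<kappa> * (\<tau> + real j * \<eta>)) - cis (\<kappa> * (\<tau> + real l * \<eta>))) \<ge> x"
    unfolding norm_cis_diff using sin_ge_half[OF x0 x1] x0 by simp
  moreover have "\<delta> / (L * real (Suc (2 * K))) * \<bar>real j - real l\<bar> \<le> x"
  proof -
    have "\<delta> / (L * real (Suc (2 * K))) * 1 \<le> \<delta> / (L * real (Suc (2 * K))) * (pi / 2)"
      using L \<delta> pi_ge_two by (intro mult_left_mono) auto
    also have "\<dots> = \<kappa> * \<eta> / 2"
    proof -
      have "\<delta> / (L * n) * (pi / 2) = 2 * pi / L * (\<delta> / (2 * n)) / 2" for n :: real by (simp add: field_simps)
      then show ?thesis by (simp only: \<kappa>_def \<eta>_def)
    qed
    finally show ?thesis unfolding x_def by (intro mult_right_mono) auto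
  qed
  ultimately show ?thesis by linarith
qed

lemma nodes_inj: "inj_on (\<lambda>l. cis (\<kappa> * (\<tau> + real l * \<eta>))) {..2*K}"
proof (rule inj_onI)
  fix j l assume jl: "j \<in> {..2*K}" "l \<in> {..2*K}" "cis (\<kappa> * (\<tau> + real j * \<eta>)) = cis (\<kappa> * (\<tau> + real l * \<eta>))"
  then have "\<delta> / (L * real (Suc (2 * K))) * \<bar>real j - real l\<bar> \<le> 0" using node_dist[of j l \<tau>] by simp
  moreover have "q * r > 0" if "q > 0" "r > 0" for q r :: real using that by simp
  moreover have "\<delta> / (L * real (Suc (2 * K))) > 0" using L \<delta> by simp
  ultimately have "\<bar>real j - real l\<bar> \<le> 0" by (meson not_le)
  then show "j = l" by simp
qed

text \<open>Each numerator is at most 2, and the denominators multiply to a power times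
  \<open>fact j * fact (2 * K - j)\<close>. Binomial coefficients are at most
  \<open>2 ^ (2 * K)\<close>, and the quotient of a power by a factorial is absorbed by an
  exponential.\<close>

lemma norm_lagr:
  assumes j: "j \<le> 2 * K"
  shows "norm (lagr \<kappa> K \<eta> \<tau> j t) \<le> exp (real (Suc (2*K))) * (4 * L / \<delta>) ^ (2 * K)"
proof -
  let ?n = "2 * K"
  let ?z = "\<lambda>l. cis (\<kappa> * (\<tau> + real l * \<eta>))"
  define q where "q = \<delta> / (L * real (Suc (2 * K)))"
  have q: "q > 0" using L \<delta> by (simp add: q_def)
  have cardj: "card ({..?n} - {j}) = ?n" using j by simp
  have "norm (lagr \<kappa> K \<eta> \<tau> j t) = (\<Prod>l\<in>{..?n}-{j}. norm (cis (\<kappa> * t) - ?z l) / norm (?z j - ?z l))"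
    by (simp add: lagr_def norm_mult norm_power norm_divide prod_norm[symmetric])
  also have "\<dots> \<le> (\<Prod>l\<in>{..?n}-{j}. 2 / (q * \<bar>real j - real l\<bar>))"
  proof (rule prod_mono, rule conjI)
    fix l assume l: "l \<in> {..?n} - {j}"
    have n2: "norm (cis (\<kappa> * t) - ?z l) \<le> 2" using norm_triangle_ineq4[of "cis (\<kappa> * t)" "?z l"] by simp
    show "norm (cis (\<kappa> * t) - ?z l) / norm (?z j - ?z l) \<le> 2 / (q * \<bar>real j - real l\<bar>)"
    proof (rule frac_le)
      show "0 < q * \<bar>real j - real l\<bar>" using q l by (intro mult_pos_pos) auto
      show "q * \<bar>real j - real l\<bar> \<le> norm (?z j - ?z l)" using l j node_dist[of j l \<tau>] by (simp only: q_def) auto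
    qed (use n2 in auto)
  qed simp
  also have "\<dots> = 2 ^ ?n / (q ^ ?n * (fact j * fact (?n - j)))"
    unfolding prod_dividef prod.distrib prod_constant cardj prod_dist_factorial[OF j] ..
  also have "\<dots> \<le> 2 ^ ?n / (q ^ ?n * (fact ?n / 2 ^ ?n))"
  proof -
    have "real (fact ?n) = real (fact j * fact (?n - j)) * real (?n choose j)"
      using binomial_fact_lemma[OF j] by (metis of_nat_mult)
    also have "\<dots> \<le> real (fact j * fact (?n - j)) * 2 ^ ?n"
      using binomial_le_pow2[of ?n j] by (intro mult_left_mono) (auto simp: of_nat_le_iff[of _ "2 ^ _", where ?'a=real, simplified] numeral_power_le_of_nat_cancel_iff of_nat_le_numeral_power_cancel_iff)
    finally have "fact ?n / 2 ^ ?n \<le> (fact j * fact (?n - j) :: real)" by (simp add: field_simps)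
    then show ?thesis using q by (intro divide_left_mono mult_left_mono mult_pos_pos) auto
  qed
  also have "\<dots> = (4 * L / \<delta>) ^ ?n * (real (Suc ?n) ^ ?n / fact ?n)"
  proof -
    have "(4::real) ^ ?n = 2 ^ ?n * 2 ^ ?n" by (simp add: power_mult_distrib[symmetric])
    then show ?thesis unfolding q_def power_divide power_mult_distrib by (simp add: field_simps)
  qed
  also have "\<dots> \<le> (4 * L / \<delta>) ^ ?n * exp (real (Suc ?n))"
    using L \<delta> by (intro mult_left_mono power_div_fact_le_exp) auto
  finally show ?thesis by (simp add: mult.commute)
qed

lemma cis_interpolation:
  assumes "\<bar>m\<bar> \<le> int K"
  shows "cis (\<kappa> * of_int m * t) = (\<Sum>j\<le>2*K. lagr \<kappa> K \<eta> \<tau> j t * cis (\<kappa> * of_int m * (\<tau> + real j * \<eta>)))"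
proof -
  \<comment> \<open>Shifting the exponent by \<open>K\<close> turns all admissible frequencies into
    nonnegative powers of degree at most \<open>2 * K\<close>.\<close>
  define p where "p = nat (m + int K)"
  have p: "p \<le> 2 * K" using assms by (auto simp: p_def)
  have pm: "real p = of_int m + real K" using assms by (simp add: p_def)
  have c: "cis (\<kappa> * s) ^ p = cis (\<kappa> * of_int m * s) * cis (\<kappa> * s) ^ K" for s
  proof -
    have "cis (\<kappa> * s) ^ p = cis (real p * (\<kappa> * s))" by (rule Complex.DeMoivre)
    also have "real p * (\<kappa> * s) = \<kappa> * of_int m * s + real K * (\<kappa> * s)" by (simp add: pm algebra_simps)
    finally show ?thesis by (simp add: cis_mult[symmetric] Complex.DeMoivre)
  qed
  have "cis (\<kappa> * of_int m * t) = cis (\<kappa> * t) ^ p / cis (\<kappa> * t) ^ K" by (simp add: c)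
  also have "\<dots> = (\<Sum>j\<le>2*K. lagr \<kappa> K \<eta> \<tau> j t * cis (\<kappa> * of_int m * (\<tau> + real j * \<eta>)))"
    unfolding Lagrange_monomial[OF nodes_inj[of \<tau>] p, of "cis (\<kappa> * t)"] sum_divide_distrib
    by (rule sum.cong) (simp_all add: lagr_def c power_divide)
  finally show ?thesis .
qed

text \<open>In each direction the nodes spread over less than \<open>\<delta> / 2\<close>, half the
  side of the square; the other half leaves room for translating the grid.\<close>

definition node :: "real^2 \<Rightarrow> nat \<Rightarrow> nat \<Rightarrow> real^2" where
  "node \<tau> j l = (\<chi> i. \<tau> $ i + real (if i = 1 then j else l) * \<eta>)"

lemma trigpoly_interpolation:
  assumes f: "trigpoly L B f" and B: "\<And>k. k \<in> B \<Longrightarrow> \<bar>fst k\<bar> \<le> int K \<and> \<bar>snd k\<bar> \<le> int K"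
  shows "complex_of_real (f y) = (\<Sum>j\<le>2*K. \<Sum>l\<le>2*K. lagr \<kappa> K \<eta> (\<tau> $ 1) j (y $ 1) * lagr \<kappa> K \<eta> (\<tau> $ 2) l (y $ 2) * complex_of_real (f (node \<tau> j l)))"
proof -
  let ?l = "\<lambda>j l. lagr \<kappa> K \<eta> (\<tau> $ 1) j (y $ 1) * lagr \<kappa> K \<eta> (\<tau> $ 2) l (y $ 2)"
  have e: "cis (phase L k y) = (\<Sum>j\<le>2*K. \<Sum>l\<le>2*K. ?l j l * cis (phase L k (node \<tau> j l)))"
    if k: "\<bar>fst k\<bar> \<le> int K" "\<bar>snd k\<bar> \<le> int K" for k
  proof -
    have s: "cis (phase L k x) = cis (\<kappa> * of_int (fst k) * x $ 1) * cis (\<kappa> * of_int (snd k) * x $ 2)" for x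
      by (simp add: phase_eq \<kappa>_def cis_mult)
    show ?thesis
      unfolding s cis_interpolation[OF k(1), of "y $ 1" "\<tau> $ 1"] cis_interpolation[OF k(2), of "y $ 2" "\<tau> $ 2"] sum_product
      by (intro sum.cong refl) (simp add: node_def mult_ac)
  qed
  \<comment> \<open>Euler's formulas reduce cosine and sine to one identity for \<open>k\<close> and
    \<open>- k\<close>; the bound on the frequencies is symmetric under this change of sign.\<close>
  have cosc: "complex_of_real (cos x) = 1/2 * cis x + 1/2 * cis (- x)"
    and sinc: "complex_of_real (sin x) = 1/(2*\<i>) * cis x + (- (1/(2*\<i>))) * cis (- x)" for x
    by (auto simp: complex_eq_iff field_simps Re_divide Im_divide power2_eq_square)
  have lin: "a * cis (phase L k y) + b * cis (- phase L k y) =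
      (\<Sum>j\<le>2*K. \<Sum>l\<le>2*K. ?l j l * (a * cis (phase L k (node \<tau> j l)) + b * cis (- phase L k (node \<tau> j l))))" if "k \<in> B" for k a b
    unfolding phase_uminus[symmetric] using B[OF that] e[of k] e[of "- k"]
    by (simp add: distrib_left sum.distrib sum_distrib_left mult_ac)
  show ?thesis
    using f
  proof induction
    case (trigpoly_cos k)
    show ?case unfolding cosc by (rule lin[OF trigpoly_cos])
  next
    case (trigpoly_sin k)
    show ?case unfolding sinc by (rule lin[OF trigpoly_sin])
  next
    case (trigpoly_scale f c)
    show ?case by (simp add: trigpoly_scale.IH sum_distrib_left mult_ac)
  next
    case (trigpoly_add f g)
    show ?case by (simp add: trigpoly_add.IH sum.distrib distrib_left)
  qed simp
qed

text \<open>The Cauchy-Schwarz inequality over all nodes passes to squares, the form in which the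
  grid can be averaged over translates.\<close>

lemma trigpoly_pointwise_bound:
  assumes f: "trigpoly L B f" and B: "\<And>k. k \<in> B \<Longrightarrow> \<bar>fst k\<bar> \<le> int K \<and> \<bar>snd k\<bar> \<le> int K"
  defines "\<Lambda> \<equiv> exp (real (Suc (2*K))) * (4 * L / \<delta>) ^ (2 * K)"
  shows "(f y)\<^sup>2 \<le> (\<Lambda>^2 * real (Suc (2*K)))\<^sup>2 * (\<Sum>j\<le>2*K. \<Sum>l\<le>2*K. (f (node \<tau> j l))\<^sup>2)"
proof -
  have "\<bar>f y\<bar> = norm (complex_of_real (f y))" by simp
  also have "complex_of_real (f y) = (\<Sum>j\<le>2*K. \<Sum>l\<le>2*K. lagr \<kappa> K \<eta> (\<tau> $ 1) j (y $ 1) * lagr \<kappa> K \<eta> (\<tau> $ 2) l (y $ 2) * complex_of_real (f (node \<tau> j l)))"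
    by (rule trigpoly_interpolation[OF f B])
  also have "norm \<dots> \<le> (\<Sum>j\<le>2*K. \<Sum>l\<le>2*K. \<Lambda>^2 * \<bar>f (node \<tau> j l)\<bar>)"
  proof (rule order_trans[OF norm_sum], rule sum_mono, rule order_trans[OF norm_sum], rule sum_mono)
    fix j l assume "j \<in> {..2*K}" "l \<in> {..2*K}"
    then have "norm (lagr \<kappa> K \<eta> (\<tau> $ 1) j (y $ 1)) * norm (lagr \<kappa> K \<eta> (\<tau> $ 2) l (y $ 2)) \<le> \<Lambda> * \<Lambda>"
      unfolding \<Lambda>_def using L \<delta> by (intro mult_mono norm_lagr) auto
    then show "norm (lagr \<kappa> K \<eta> (\<tau> $ 1) j (y $ 1) * lagr \<kappa> K \<eta> (\<tau> $ 2) l (y $ 2) * complex_of_real (f (node \<tau> j l))) \<le> \<Lambda>^2 * \<bar>f (node \<tau> j l)\<bar>"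
      by (simp add: norm_mult power2_eq_square mult_right_mono)
  qed
  also have "\<dots> = \<Lambda>^2 * (\<Sum>(j,l)\<in>{..2*K}\<times>{..2*K}. \<bar>f (node \<tau> j l)\<bar>)"
    by (simp add: sum_distrib_left sum.cartesian_product split_def)
  finally have "\<bar>f y\<bar> \<le> \<Lambda>^2 * (\<Sum>(j,l)\<in>{..2*K}\<times>{..2*K}. \<bar>f (node \<tau> j l)\<bar>)" .
  then have "\<bar>f y\<bar>\<^sup>2 \<le> (\<Lambda>^2 * (\<Sum>(j,l)\<in>{..2*K}\<times>{..2*K}. \<bar>f (node \<tau> j l)\<bar>))\<^sup>2" by (intro power_mono) auto
  also have "\<dots> \<le> (\<Lambda>^2)\<^sup>2 * ((real (Suc (2*K)))\<^sup>2 * (\<Sum>(j,l)\<in>{..2*K}\<times>{..2*K}. (f (node \<tau> j l))\<^sup>2))"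
  proof -
    have "(\<Sum>(j,l)\<in>{..2*K}\<times>{..2*K}. \<bar>f (node \<tau> j l)\<bar>)\<^sup>2 \<le> (\<Sum>(j,l)\<in>{..2*K}\<times>{..2*K}. \<bar>f (node \<tau> j l)\<bar>\<^sup>2) * real (card ({..2*K}\<times>{..2*K}))"
      using sum_squared_le_sum_of_squares[of "\<lambda>(j,l). \<bar>f (node \<tau> j l)\<bar>" "{..2*K}\<times>{..2*K}"] by (simp add: split_def)
    also have "\<dots> = (real (Suc (2*K)))\<^sup>2 * (\<Sum>(j,l)\<in>{..2*K}\<times>{..2*K}. (f (node \<tau> j l))\<^sup>2)"
      unfolding card_cartesian_product card_atMost of_nat_mult power2_abs split_def
      by (simp add: power2_eq_square mult_ac del: of_nat_Suc)
    finally show ?thesis unfolding power_mult_distrib by (intro mult_left_mono) auto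
  qed
  finally show ?thesis by (simp add: sum.cartesian_product split_def power_mult_distrib mult_ac del: of_nat_Suc)
qed

text \<open>The interpolation bound is averaged over translates of the set of nodes.\<close>

lemma trigpoly_spectral_inequality:
  assumes f: "trigpoly L B f" and B: "\<And>k. k \<in> B \<Longrightarrow> \<bar>fst k\<bar> \<le> int K \<and> \<bar>snd k\<bar> \<le> int K"
  defines "\<Lambda> \<equiv> exp (real (Suc (2*K))) * (4 * L / \<delta>) ^ (2 * K)"
  shows "(f y)\<^sup>2 \<le> 4 / \<delta>\<^sup>2 * \<Lambda>^4 * real (Suc (2*K))^4 * integral (cbox a (a + (\<chi> i. \<delta>))) (\<lambda>x. (f x)\<^sup>2)"
proof -
  let ?S = "cbox 0 (\<chi> i. \<delta> / 2) :: (real^2) set"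
  let ?D = "(\<Lambda>^2 * real (Suc (2*K)))\<^sup>2"
  let ?I = "integral (cbox a (a + (\<chi> i. \<delta>))) (\<lambda>x. (f x)\<^sup>2)"
  have cf: "continuous_on S f" for S by (rule trigpoly_continuous[OF f])
  have \<eta>: "\<eta> > 0" using \<delta> by (simp add: \<eta>_def)
  have content: "measure lborel ?S = (\<delta> / 2)\<^sup>2"
    using \<delta> by (subst content_cbox_cart) (auto simp: interval_ne_empty_cart power2_eq_square)
  have node_shift: "node (a + s) j l = node a j l + s" for s j l
    by (simp add: node_def vec_eq_iff)
  \<comment> \<open>Under translation by \<open>s\<close> each node sweeps a square of side
    \<open>\<delta> / 2\<close> contained in the given one.\<close>
  have part: "integral ?S (\<lambda>s. (f (node (a + s) j l))\<^sup>2) \<le> ?I" if jl: "j \<le> 2*K" "l \<le> 2*K" for j l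
  proof -
    have "integral ?S (\<lambda>s. (f (node (a + s) j l))\<^sup>2) = integral ?S ((\<lambda>x. (f x)\<^sup>2) \<circ> ((+) (node a j l)))"
      by (simp add: node_shift o_def)
    also have "\<dots> = integral (cbox (0 + node a j l) ((\<chi> i. \<delta> / 2) + node a j l)) (\<lambda>x. (f x)\<^sup>2)"
      by (rule integral_shift_cbox_plus)
    also have "\<dots> \<le> ?I"
    proof (rule integral_subset_le)
      have le: "0 \<le> real j * \<eta>" "real j * \<eta> \<le> \<delta> / 2" if "j \<le> 2*K" for j
      proof -
        show "0 \<le> real j * \<eta>" using \<eta> by simp
        have "real j * \<eta> \<le> real (Suc (2*K)) * \<eta>" using that \<eta> by (intro mult_right_mono) auto
        also have "\<dots> = \<delta> / 2" by (simp add: \<eta>_def field_simps)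
        finally show "real j * \<eta> \<le> \<delta> / 2" .
      qed
      show "cbox (0 + node a j l) ((\<chi> i. \<delta> / 2) + node a j l) \<subseteq> cbox a (a + (\<chi> i. \<delta>))"
      proof
        fix x assume x: "x \<in> cbox (0 + node a j l) ((\<chi> i. \<delta> / 2) + node a j l)"
        have "a $ i \<le> x $ i \<and> x $ i \<le> a $ i + \<delta>" for i
        proof -
          have "node a j l $ i \<le> x $ i" "x $ i \<le> \<delta> / 2 + node a j l $ i"
            using x by (auto simp: mem_box_cart dest: spec[of _ i])
          then show ?thesis using le[OF jl(1)] le[OF jl(2)] by (cases "i = 1") (auto simp: node_def)
        qed
        then show "x \<in> cbox a (a + (\<chi> i. \<delta>))" by (simp add: mem_box_cart)
      qed
      show "(\<lambda>x. (f x)\<^sup>2) integrable_on cbox (0 + node a j l) ((\<chi> i. \<delta> / 2) + node a j l)"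
        "(\<lambda>x. (f x)\<^sup>2) integrable_on cbox a (a + (\<chi> i. \<delta>))"
        by (intro integrable_continuous continuous_intros cf)+
    qed auto
    finally show ?thesis .
  qed
  have cn: "continuous_on ?S (\<lambda>s. (f (node (a + s) j l))\<^sup>2)" for j l
    unfolding node_shift by (intro continuous_intros continuous_on_compose2[OF cf[of UNIV]]) auto
  have "(\<delta> / 2)\<^sup>2 * (f y)\<^sup>2 = integral ?S (\<lambda>s. (f y)\<^sup>2)" using content by simp
  also have "\<dots> \<le> integral ?S (\<lambda>s. ?D * (\<Sum>j\<le>2*K. \<Sum>l\<le>2*K. (f (node (a + s) j l))\<^sup>2))"
  proof (rule integral_le)
    show "(\<lambda>s. ?D * (\<Sum>j\<le>2*K. \<Sum>l\<le>2*K. (f (node (a + s) j l))\<^sup>2)) integrable_on ?S"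
      by (intro integrable_continuous continuous_intros cn)
    show "(f y)\<^sup>2 \<le> ?D * (\<Sum>j\<le>2*K. \<Sum>l\<le>2*K. (f (node (a + s) j l))\<^sup>2)" for s
      unfolding \<Lambda>_def by (rule trigpoly_pointwise_bound[OF f B])
  qed auto
  also have "\<dots> = ?D * (\<Sum>j\<le>2*K. \<Sum>l\<le>2*K. integral ?S (\<lambda>s. (f (node (a + s) j l))\<^sup>2))"
    by (simp add: integral_sum integrable_continuous cn integrable_sum)
  also have "\<dots> \<le> ?D * (\<Sum>j\<le>2*K. \<Sum>l\<le>2*K. ?I)"
    by (intro mult_left_mono sum_mono part) auto
  also have "\<dots> = \<Lambda>^4 * real (Suc (2*K))^4 * ?I"
    by (simp add: power_mult_distrib power2_eq_square power4_eq_xxxx mult_ac del: of_nat_Suc)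
  finally show ?thesis using \<delta> by (simp add: field_simps power2_eq_square)
qed

end

context stokes_basis
begin

text \<open>Both constants precede \<open>N\<close> and the position \<open>a\<close>: they depend
  on \<open>L\<close> and \<open>\<delta>\<close>, hence on \<open>\<Omega>\<close> once a square
  inside it is fixed. The value of \<open>c2\<close> later decides how large \<open>\<sigma>\<close>
  must be.\<close>

lemma comb_spectral_inequality:
  assumes \<delta>: "0 < \<delta>" "\<delta> \<le> L / 2"
  shows "\<exists>c1>0. \<exists>c2>0. \<forall>N\<ge>1. \<forall>c y a. (norm (comb {1..N} c y))\<^sup>2 \<le>
     c1 * exp (c2 * sqrt (lam N)) * integral (cbox a (a + (\<chi> i. \<delta>))) (\<lambda>x. (norm (comb {1..N} c x))\<^sup>2)"
proof -
  define b where "b = ln (4 * L / \<delta>)"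
  have "4 * L / \<delta> \<ge> 1" using \<delta> L_pos by (simp add: field_simps)
  then have b: "b \<ge> 0" "4 * L / \<delta> = exp b" using \<delta> L_pos by (auto simp: b_def)
  \<comment> \<open>The factor \<open>\<Lambda> ^ 4\<close> and the fourth power of
    \<open>2 * K + 1\<close>, bounded by an exponential, give the exponent
    \<open>8 + K * (16 + 8 * b)\<close>, in which \<open>K\<close> is at most
    \<open>sqrt (lam N) * (L / (2 * pi))\<close>. The constant 8 goes into
    \<open>c1\<close>.\<close>
  define c2 where "c2 = (8 + 4 * b) * (L / pi)"
  define c1 where "c1 = 4 / \<delta>\<^sup>2 * exp 8"
  have c12: "c1 > 0" "c2 > 0" using \<delta> L_pos b by (auto simp: c1_def c2_def intro: mult_pos_pos add_pos_nonneg)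
  have "(norm (comb {1..N} c y))\<^sup>2 \<le> c1 * exp (c2 * sqrt (lam N)) * integral (cbox a (a + (\<chi> i. \<delta>))) (\<lambda>x. (norm (comb {1..N} c x))\<^sup>2)"
    if N: "N \<ge> 1" for N c y a
  proof -
    \<comment> \<open>The eigenfunctions up to index \<open>N\<close> have wave vectors of length at
      most \<open>sqrt (lam N)\<close>, so \<open>K\<close> bounds both integer components of their
      frequencies.\<close>
    define K where "K = nat \<lfloor>sqrt (lam N) * (L / (2 * pi))\<rfloor>"
    have l0: "lam N > 0" by (rule lam_pos[OF N])
    have K: "real K \<le> sqrt (lam N) * (L / (2 * pi))" unfolding K_def using l0 L_pos by simp
    have kK: "\<bar>m\<bar> \<le> int K" if "of_int m ^ 2 \<le> ksq L k * (L / (2 * pi))\<^sup>2" "ksq L k \<le> lam N" for m :: int and k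
    proof -
      have "(of_int \<bar>m\<bar>)\<^sup>2 \<le> ksq L k * (L / (2 * pi))\<^sup>2" using that by simp
      also have "\<dots> \<le> lam N * (L / (2 * pi))\<^sup>2" using that by (intro mult_right_mono) auto
      also have "\<dots> = (sqrt (lam N) * (L / (2 * pi)))\<^sup>2" by (simp only: power_mult_distrib real_sqrt_pow2[OF less_imp_le[OF l0]])
      finally have "of_int \<bar>m\<bar> \<le> sqrt (lam N) * (L / (2 * pi))"
        by (rule power2_le_imp_le) (use l0 L_pos in auto)
      then show ?thesis unfolding K_def by linarith
    qed
    define B where "B = {k. ksq L k \<le> lam N}"
    have B: "\<bar>fst k\<bar> \<le> int K \<and> \<bar>snd k\<bar> \<le> int K" if "k \<in> B" for k
      using that kK[OF ksq_ge(1)[OF L_pos, of k]] kK[OF ksq_ge(2)[OF L_pos, of k]] by (auto simp: B_def)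
    have tp: "trigpoly L B (\<lambda>x. comb {1..N} c x $ m)" for m
    proof -
      have "(\<lambda>x. comb {1..N} c x $ m) = (\<lambda>x. \<Sum>j\<in>{1..N}. c j * \<phi> j x $ m)" by (simp add: comb_def)
      moreover have "trigpoly L B (\<lambda>x. \<phi> j x $ m)" if "j \<in> {1..N}" for j
        using that lam_mono[of j N] by (intro trigpoly_mono[OF phi_trigpoly]) (auto simp: B_def)
      ultimately show ?thesis by (simp only:) (rule trigpoly_sum, rule trigpoly_scale)
    qed
    define \<Lambda> where "\<Lambda> = exp (real (Suc (2*K))) * (4 * L / \<delta>) ^ (2 * K)"
    define C where "C = 4 / \<delta>\<^sup>2 * \<Lambda>^4 * real (Suc (2*K))^4"
    let ?R = "cbox a (a + (\<chi> i. \<delta>))"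
    have n2: "(norm v)\<^sup>2 = (v $ 1)\<^sup>2 + (v $ 2)\<^sup>2" for v :: "real^2"
      by (simp add: power2_norm_eq_inner inner_vec_def sum_2) (simp add: power2_eq_square)
    have cc: "continuous_on S (\<lambda>x. (comb {1..N} c x $ m)\<^sup>2)" for m S
      by (intro continuous_intros trigpoly_continuous[OF tp])
    have "(norm (comb {1..N} c y))\<^sup>2 \<le> C * integral ?R (\<lambda>x. (comb {1..N} c x $ 1)\<^sup>2) + C * integral ?R (\<lambda>x. (comb {1..N} c x $ 2)\<^sup>2)"
      unfolding n2 C_def \<Lambda>_def
      by (intro add_mono trigpoly_spectral_inequality[OF L_pos \<delta> tp B])
    also have "\<dots> = C * integral ?R (\<lambda>x. (norm (comb {1..N} c x))\<^sup>2)"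
      unfolding n2 distrib_left[symmetric]
      by (subst Henstock_Kurzweil_Integration.integral_add[OF integrable_continuous[OF cc] integrable_continuous[OF cc]]) (rule refl)
    also have "\<dots> \<le> c1 * exp (c2 * sqrt (lam N)) * integral ?R (\<lambda>x. (norm (comb {1..N} c x))\<^sup>2)"
    proof (rule mult_right_mono)
      have "real (Suc (2*K)) \<le> exp (real (Suc (2*K)))" using exp_ge_add_one_self[of "real (Suc (2*K))"] by linarith
      then have "real (Suc (2*K)) ^ 4 \<le> exp (real (Suc (2*K))) ^ 4" by (intro power_mono) auto
      then have "C \<le> 4 / \<delta>\<^sup>2 * \<Lambda>^4 * exp (real (Suc (2*K))) ^ 4" unfolding C_def by (intro mult_left_mono) (auto simp: \<Lambda>_def)
      also have "\<dots> = 4 / \<delta>\<^sup>2 * exp (8 + real K * (16 + 8 * b))"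
        unfolding \<Lambda>_def b(2) by (simp add: exp_of_nat_mult[symmetric] power_mult_distrib exp_add[symmetric] algebra_simps)
      also have "\<dots> = c1 * exp (real K * (16 + 8 * b))" by (simp add: c1_def exp_add)
      also have "\<dots> \<le> c1 * exp (c2 * sqrt (lam N))"
      proof -
        have "real K * (16 + 8 * b) \<le> sqrt (lam N) * (L / (2 * pi)) * (16 + 8 * b)" using K b by (intro mult_right_mono) auto
        also have "\<dots> = c2 * sqrt (lam N)" by (simp add: c2_def field_simps)
        finally show ?thesis using c12 by simp
      qed
      finally show "C \<le> c1 * exp (c2 * sqrt (lam N))" .
    next
      show "0 \<le> integral ?R (\<lambda>x. (norm (comb {1..N} c x))\<^sup>2)"
        by (rule integral_nonneg) (auto intro!: integrable_continuous continuous_on_power continuous_on_norm comb_continuous)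
    qed
    finally show ?thesis .
  qed
  then show ?thesis using c12 by blast
qed

end

subsection \<open>The interpolation operators\<close>

lemma trigpoly_Lipschitz:
  assumes "trigpoly L B f"
  shows "\<exists>C\<ge>0. \<forall>x y. \<bar>f x - f y\<bar> \<le> C * norm (x - y)"
proof -
  have ph: "\<bar>phase L k x - phase L k y\<bar> \<le> (\<bar>2 * pi / L\<bar> * (\<Sum>i\<in>UNIV. \<bar>freq k i\<bar>)) * norm (x - y)" for k and x y :: "real^2"
  proof -
    have "\<bar>phase L k x - phase L k y\<bar> = \<bar>2 * pi / L\<bar> * \<bar>\<Sum>i\<in>UNIV. freq k i * (x - y) $ i\<bar>"
      unfolding phase_diff[symmetric] by (simp only: phase_def abs_mult)
    also have "\<dots> \<le> \<bar>2 * pi / L\<bar> * (\<Sum>i\<in>UNIV. \<bar>freq k i\<bar> * norm (x - y))"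
    proof (rule mult_left_mono)
      have "\<bar>\<Sum>i\<in>UNIV. freq k i * (x - y) $ i\<bar> \<le> (\<Sum>i\<in>UNIV. \<bar>freq k i * (x - y) $ i\<bar>)" by (rule sum_abs)
      also have "\<dots> \<le> (\<Sum>i\<in>UNIV. \<bar>freq k i\<bar> * norm (x - y))"
        unfolding abs_mult by (intro sum_mono mult_left_mono component_le_norm_cart) auto
      finally show "\<bar>\<Sum>i\<in>UNIV. freq k i * (x - y) $ i\<bar> \<le> (\<Sum>i\<in>UNIV. \<bar>freq k i\<bar> * norm (x - y))" .
    qed simp
    finally show ?thesis by (simp add: sum_distrib_right mult.assoc)
  qed
  have nn: "0 \<le> \<bar>2 * pi / L\<bar> * (\<Sum>i\<in>UNIV. \<bar>freq k i\<bar>)" for k by (intro mult_nonneg_nonneg sum_nonneg) auto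
  have prod_le: "2 * (s * r) \<le> t" if "s \<le> 1" "r \<le> t / 2" "0 \<le> r" for s r t :: real
    using mult_right_mono[OF that(1,3)] that by linarith
  have cs: "\<bar>cos a - cos b\<bar> \<le> \<bar>a - b\<bar>" "\<bar>sin a - sin b\<bar> \<le> \<bar>a - b\<bar>" for a b :: real
  proof -
    have h: "\<bar>sin ((b - a) / 2)\<bar> \<le> \<bar>a - b\<bar> / 2" "\<bar>sin ((a - b) / 2)\<bar> \<le> \<bar>a - b\<bar> / 2"
      using abs_sin_x_le_abs_x[of "(b - a) / 2"] abs_sin_x_le_abs_x[of "(a - b) / 2"]
      by (auto simp: abs_minus_commute[of b a])
    show "\<bar>cos a - cos b\<bar> \<le> \<bar>a - b\<bar>"
      unfolding cos_diff_cos abs_mult using prod_le[OF abs_sin_le_one h(1), of "(a + b) / 2"] by simp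
    show "\<bar>sin a - sin b\<bar> \<le> \<bar>a - b\<bar>"
      unfolding sin_diff_sin abs_mult using prod_le[OF abs_cos_le_one h(2), of "(a + b) / 2"] by (simp add: mult_ac)
  qed
  show ?thesis
    using assms
  proof induction
    case (trigpoly_cos k)
    show ?case by (rule exI[of _ "\<bar>2 * pi / L\<bar> * (\<Sum>i\<in>UNIV. \<bar>freq k i\<bar>)"], intro conjI nn allI)
        (rule order_trans[OF cs(1) ph])
  next
    case (trigpoly_sin k)
    show ?case by (rule exI[of _ "\<bar>2 * pi / L\<bar> * (\<Sum>i\<in>UNIV. \<bar>freq k i\<bar>)"], intro conjI nn allI)
        (rule order_trans[OF cs(2) ph])
  next
    case trigpoly_zero
    show ?case by (rule exI[of _ 0]) simp
  next
    case (trigpoly_scale f c)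
    then obtain C where C: "C \<ge> 0" "\<And>x y. \<bar>f x - f y\<bar> \<le> C * norm (x - y)" by blast
    have "\<bar>c * f x - c * f y\<bar> \<le> \<bar>c\<bar> * C * norm (x - y)" for x y
      using mult_left_mono[OF C(2)[of x y], of "\<bar>c\<bar>"] by (simp add: abs_mult[symmetric] right_diff_distrib mult.assoc)
    then show ?case using C(1) by (intro exI[of _ "\<bar>c\<bar> * C"]) auto
  next
    case (trigpoly_add f g)
    then obtain C D where C: "C \<ge> 0" "\<And>x y. \<bar>f x - f y\<bar> \<le> C * norm (x - y)"
      and D: "D \<ge> 0" "\<And>x y. \<bar>g x - g y\<bar> \<le> D * norm (x - y)" by blast
    have "\<bar>(f x + g x) - (f y + g y)\<bar> \<le> (C + D) * norm (x - y)" for x y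
      using C(2)[of x y] D(2)[of x y] unfolding distrib_right by linarith
    then show ?case using C(1) D(1) by (intro exI[of _ "C + D"]) auto
  qed
qed

lemma mem_cell: "x \<in> cell h c \<longleftrightarrow> (\<forall>i. \<bar>x $ i - c $ i\<bar> \<le> h / 2)"
proof -
  have "(c $ i - h / 2 \<le> x $ i \<and> x $ i \<le> c $ i + h / 2) \<longleftrightarrow> \<bar>x $ i - c $ i\<bar> \<le> h / 2" for i by linarith
  then show ?thesis by (simp add: cell_def mem_box_cart)
qed

lemma cell_lmeasurable: "cell h c \<in> lmeasurable"
  by (simp add: cell_def)

lemma measure_cell:
  assumes "h > 0" shows "measure lebesgue (cell h c) = h\<^sup>2"
proof -
  have "measure lebesgue (cell h c) = measure lborel (cell h c)" by (simp add: cell_def)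
  also have "\<dots> = h\<^sup>2" using assms unfolding cell_def
    by (subst content_cbox_cart) (auto simp: power2_eq_square interval_ne_empty_cart)
  finally show ?thesis .
qed

lemma cell_dist:
  assumes "x \<in> cell h c" "y \<in> cell h c"
  shows "norm (x - y) \<le> 2 * h"
proof -
  have "norm (x - y) \<le> (\<Sum>i\<in>UNIV. \<bar>(x - y) $ i\<bar>)" by (rule norm_le_l1_cart)
  also have "\<dots> \<le> (\<Sum>i\<in>(UNIV :: 2 set). h)"
  proof (rule sum_mono)
    fix i :: 2
    have "\<bar>x $ i - c $ i\<bar> \<le> h / 2" "\<bar>y $ i - c $ i\<bar> \<le> h / 2" using assms by (auto simp: mem_cell)
    then show "\<bar>(x - y) $ i\<bar> \<le> h" unfolding vector_minus_component by linarith
  qed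
  finally show ?thesis by simp
qed

text \<open>A centre lies within \<open>h / 2\<close> of the square in each coordinate. A count of
  order \<open>h\<close> to the power \<open>-2\<close> makes sums of cell terms of size
  \<open>h\<^sup>2\<close> bounded independently of \<open>h\<close>.\<close>

lemma centres_bound:
  assumes h: "h > 0" and L: "L > 0" and \<Omega>: "\<Omega> \<subseteq> square L"
  shows "finite (centres h a \<Omega>)" "real (card (centres h a \<Omega>)) * h\<^sup>2 \<le> (L + 2 * h)\<^sup>2"
proof -
  define lo hi where "lo i = (- L / 2 - h / 2 - a $ i) / h" and "hi i = (L / 2 + h / 2 - a $ i) / h" for i
  define A where "A i = {\<lceil>lo i\<rceil>..\<lfloor>hi i\<rfloor>}" for i
  have hl: "hi i - lo i = (L + h) / h" for i using h by (simp add: hi_def lo_def field_simps)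
  have sub: "centres h a \<Omega> \<subseteq> (\<lambda>(p, q). a + (\<chi> i. h * of_int (if i = 1 then p else q))) ` (A 1 \<times> A 2)"
  proof
    fix c assume "c \<in> centres h a \<Omega>"
    then obtain k x where k: "c = a + (\<chi> i. h * of_int (k i))" and x: "x \<in> cell h c" "x \<in> \<Omega>"
      by (auto simp: centres_def)
    have "k i \<in> A i" for i
    proof -
      have "\<bar>x $ i - c $ i\<bar> \<le> h / 2" using x by (simp add: mem_cell)
      moreover have "- L / 2 \<le> x $ i" "x $ i \<le> L / 2" using x \<Omega> by (auto simp: mem_square)
      ultimately have "- L / 2 - h / 2 - a $ i \<le> of_int (k i) * h" "of_int (k i) * h \<le> L / 2 + h / 2 - a $ i"
        unfolding k vector_add_component vec_lambda_beta mult.commute[of h] by linarith+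
      then have "lo i \<le> of_int (k i)" "of_int (k i) \<le> hi i"
        using h by (simp_all add: lo_def hi_def pos_divide_le_eq pos_le_divide_eq)
      then show ?thesis by (simp add: A_def ceiling_le_iff le_floor_iff)
    qed
    moreover have "c = (\<lambda>(p, q). a + (\<chi> i. h * of_int (if i = 1 then p else q))) (k 1, k 2)"
      unfolding k by (simp add: vec_eq_iff forall_2)
    ultimately show "c \<in> (\<lambda>(p, q). a + (\<chi> i. h * of_int (if i = 1 then p else q))) ` (A 1 \<times> A 2)"
      by blast
  qed
  have fin: "finite (A 1 \<times> A 2)" by (simp add: A_def)
  then show "finite (centres h a \<Omega>)" using sub finite_subset by blast
  have card: "real (card (A i)) \<le> (L + 2 * h) / h" for i
  proof -
    have "real (card (A i)) = real (nat (\<lfloor>hi i\<rfloor> - \<lceil>lo i\<rceil> + 1))" by (simp add: A_def)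
    also have "\<dots> \<le> max 0 (hi i - lo i + 1)" by linarith
    also have "\<dots> = (L + 2 * h) / h" unfolding hl using h L by (simp add: field_simps)
    finally show ?thesis .
  qed
  have "card (centres h a \<Omega>) \<le> card (A 1 \<times> A 2)"
    using card_mono[OF finite_imageI[OF fin] sub] card_image_le[OF fin] order_trans by blast
  then have "real (card (centres h a \<Omega>)) \<le> real (card (A 1)) * real (card (A 2))"
    by (metis card_cartesian_product of_nat_le_iff of_nat_mult)
  also have "\<dots> \<le> (L + 2 * h) / h * ((L + 2 * h) / h)"
    using h L by (intro mult_mono card) auto
  finally have "real (card (centres h a \<Omega>)) * h\<^sup>2 \<le> (L + 2 * h) / h * ((L + 2 * h) / h) * h\<^sup>2"
    by (rule mult_right_mono) simp
  then show "real (card (centres h a \<Omega>)) * h\<^sup>2 \<le> (L + 2 * h)\<^sup>2" using h by (simp add: power2_eq_square)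
qed

lemma cell_cover:
  assumes h: "h > 0"
  obtains k :: "2 \<Rightarrow> int" where "x \<in> cell h (a + (\<chi> i. h * of_int (k i)))"
proof
  show "x \<in> cell h (a + (\<chi> i. h * of_int (round ((x $ i - a $ i) / h))))"
    unfolding mem_cell
  proof
    fix i
    let ?r = "of_int (round ((x $ i - a $ i) / h)) :: real"
    have "\<bar>?r - (x $ i - a $ i) / h\<bar> \<le> 1 / 2" by (rule of_int_round_abs_le)
    then have "\<bar>(?r - (x $ i - a $ i) / h) * h\<bar> \<le> 1 / 2 * h" using h by (simp add: abs_mult)
    moreover have "(?r - (x $ i - a $ i) / h) * h = - (x $ i - (a + (\<chi> i. h * of_int (round ((x $ i - a $ i) / h)))) $ i)"
      using h by (simp add: field_simps)
    ultimately show "\<bar>x $ i - (a + (\<chi> i. h * of_int (round ((x $ i - a $ i) / h)))) $ i\<bar> \<le> h / 2"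
      by (simp only: abs_minus_cancel)
  qed
qed

text \<open>The value attached to a cell by the volume-element (\<open>True\<close>) and by the nodal (\<open>False\<close>) operator.\<close>

definition cellval :: "bool \<Rightarrow> real \<Rightarrow> (real^2) set \<Rightarrow> field \<Rightarrow> real^2 \<Rightarrow> real^2" where
  "cellval b h \<Omega> f c = (if b then (1 / measure lebesgue (cell h c)) *\<^sub>R
           (LINT y|lebesgue_on (cell h c). indicat_real \<Omega> y *\<^sub>R f y)
     else indicat_real \<Omega> c *\<^sub>R cont_rep f c)"

text \<open>The observation before projection. The Boolean parameter allows each estimate to be
  proved for both operators at once.\<close>

definition interp :: "bool \<Rightarrow> real \<Rightarrow> real^2 \<Rightarrow> (real^2) set \<Rightarrow> field \<Rightarrow> field" where
  "interp b h a \<Omega> f x = (\<Sum>c\<in>centres h a \<Omega>. indicat_real (cell h c \<inter> \<Omega>) x *\<^sub>R cellval b h \<Omega> f c)"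

lemma indicator_mult_integrable:
  fixes f :: field
  assumes "E \<in> lmeasurable" "continuous_on UNIV f" "\<And>x. norm (f x) \<le> S"
  shows "integrable lebesgue (\<lambda>x. indicat_real E x *\<^sub>R f x)"
proof (rule Bochner_Integration.integrable_bound)
  show "integrable lebesgue (\<lambda>x. S * indicat_real E x)"
    using assms(1) by (auto simp: fmeasurable_def intro!: integrable_mult_right integrable_real_indicator)
  have "f \<in> borel_measurable lebesgue"
    using continuous_imp_measurable_on_sets_lebesgue[OF assms(2)] by (simp add: lebesgue_on_UNIV_eq)
  then show "(\<lambda>x. indicat_real E x *\<^sub>R f x) \<in> borel_measurable lebesgue"
    using fmeasurableD[OF assms(1)] by measurable
  show "AE x in lebesgue. norm (indicat_real E x *\<^sub>R f x) \<le> norm (S * indicat_real E x)"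
    using assms(3) by (intro AE_I2) (auto simp: indicator_def intro: order_trans[OF _ abs_ge_self])
qed

lemma indicator_mult_norm:
  fixes f :: field
  assumes "E \<in> lmeasurable" "continuous_on UNIV f" "\<And>x. norm (f x) \<le> S"
  shows "norm (LINT x|lebesgue. indicat_real E x *\<^sub>R f x) \<le> S * measure lebesgue E"
proof -
  have "norm (LINT x|lebesgue. indicat_real E x *\<^sub>R f x) \<le> (LINT x|lebesgue. norm (indicat_real E x *\<^sub>R f x))"
    by (rule integral_norm_bound)
  also have "\<dots> \<le> (LINT x|lebesgue. S * indicat_real E x)"
  proof (rule integral_mono)
    show "integrable lebesgue (\<lambda>x. norm (indicat_real E x *\<^sub>R f x))"
      using indicator_mult_integrable[OF assms] by (rule integrable_norm)
    show "integrable lebesgue (\<lambda>x. S * indicat_real E x)"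
      using assms(1) by (auto simp: fmeasurable_def intro!: integrable_mult_right integrable_real_indicator)
  qed (use assms(3) in \<open>auto simp: indicator_def\<close>)
  also have "\<dots> = S * measure lebesgue E" using assms(1) by (simp add: fmeasurable_def)
  finally show ?thesis .
qed

section \<open>The observation as a linear functional of continuous fields\<close>

locale observed = stokes_basis +
  fixes \<Omega> :: "(real^2) set"
  assumes \<Omega>_sub: "\<Omega> \<subseteq> square L" and \<Omega>_meas: "\<Omega> \<in> sets lebesgue"
begin

text \<open>On such fields \<open>cont_rep\<close> is the identity, which makes the nodal operator
  linear; on arbitrary fields the values of \<open>cont_rep\<close> need not be additive.\<close>

definition cbp :: "field \<Rightarrow> real \<Rightarrow> bool" where
  "cbp f S \<longleftrightarrow> continuous_on UNIV f \<and> periodic L f \<and> (\<forall>x. norm (f x) \<le> S)"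

lemma cbp_comb:
  "F \<subseteq> {1..} \<Longrightarrow> \<exists>S. cbp (comb F c) S"
proof -
  assume F: "F \<subseteq> {1..}"
  have "\<exists>C. \<forall>x. \<bar>comb F c x $ m\<bar> \<le> C" for m by (rule trigpoly_bounded[OF comb_component_trigpoly[OF F]])
  then obtain C where C: "\<And>m x. \<bar>comb F c x $ m\<bar> \<le> C m" by metis
  have "norm (comb F c x) \<le> C 1 + C 2" for x
    using norm_le_l1_cart[of "comb F c x"] C[of x 1] C[of x 2] by (simp add: sum_2)
  then show ?thesis using comb_continuous[OF F] L2per_periodic[OF spaceH_L2per[OF comb_spaceH[OF F]]]
    by (auto simp: cbp_def)
qed

lemma cbp_ser: "dsum c K \<Longrightarrow> cbp (ser c) (weylC * K)"
  using ser_continuous ser_periodic norm_ser_le by (auto simp: cbp_def)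

lemma cellset: "cell h c \<inter> \<Omega> \<in> lmeasurable" "measure lebesgue (cell h c \<inter> \<Omega>) \<le> measure lebesgue (cell h c)"
proof -
  show "cell h c \<inter> \<Omega> \<in> lmeasurable" by (rule fmeasurable_Int_fmeasurable[OF cell_lmeasurable \<Omega>_meas])
  show "measure lebesgue (cell h c \<inter> \<Omega>) \<le> measure lebesgue (cell h c)"
    by (rule measure_mono_fmeasurable) (use cell_lmeasurable[of h c] \<Omega>_meas in \<open>auto dest: fmeasurableD\<close>)
qed

lemma cellval_volume:
  assumes "h > 0" b
  shows "cellval b h \<Omega> f c = (1 / h\<^sup>2) *\<^sub>R (LINT x|lebesgue. indicat_real (cell h c \<inter> \<Omega>) x *\<^sub>R f x)"
proof -
  have "(LINT y|lebesgue_on (cell h c). indicat_real \<Omega> y *\<^sub>R f y) = (LINT y|lebesgue. indicat_real (cell h c) y *\<^sub>R (indicat_real \<Omega> y *\<^sub>R f y))"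
    by (subst integral_restrict_space) (use fmeasurableD[OF cell_lmeasurable[of h c]] in auto)
  then show ?thesis by (simp add: cellval_def measure_cell[OF assms(1)] assms(2) indicator_inter_arith)
qed

lemma cellval_add:
  assumes "h > 0" "cbp f S" "cbp g T"
  shows "cellval b h \<Omega> (\<lambda>x. f x + g x) c = cellval b h \<Omega> f c + cellval b h \<Omega> g c"
proof (cases b)
  case True
  show ?thesis unfolding cellval_volume[OF assms(1) True] scaleR_add_right[symmetric]
    using assms(2,3) by (subst Bochner_Integration.integral_add[symmetric])
      (auto simp: cbp_def scaleR_add_right intro!: indicator_mult_integrable cellset)
next
  case False
  have "continuous_on UNIV (\<lambda>x. f x + g x)" "periodic L (\<lambda>x. f x + g x)"
    using assms(2,3) by (auto simp: cbp_def periodic_def intro: continuous_intros)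
  then show ?thesis using False assms(2,3)
    by (simp add: cellval_def cont_rep_continuous cbp_def scaleR_add_right)
qed

lemma cellval_scaleR:
  assumes "h > 0" "cbp f S"
  shows "cellval b h \<Omega> (\<lambda>x. r *\<^sub>R f x) c = r *\<^sub>R cellval b h \<Omega> f c"
proof (cases b)
  case True
  have eq: "(\<lambda>x. indicat_real (cell h c \<inter> \<Omega>) x *\<^sub>R (r *\<^sub>R f x)) = (\<lambda>x. r *\<^sub>R (indicat_real (cell h c \<inter> \<Omega>) x *\<^sub>R f x))"
    by (simp add: fun_eq_iff)
  show ?thesis unfolding cellval_volume[OF assms(1) True] eq integral_scaleR_right
    by (rule scaleR_left_commute)
next
  case False
  have "continuous_on UNIV (\<lambda>x. r *\<^sub>R f x)" "periodic L (\<lambda>x. r *\<^sub>R f x)"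
    using assms(2) by (auto simp: cbp_def periodic_def intro: continuous_intros)
  then show ?thesis using False assms(2)
    by (simp add: cellval_def cont_rep_continuous cbp_def)
qed

lemma cellval_bound:
  assumes "h > 0" "cbp f S"
  shows "norm (cellval b h \<Omega> f c) \<le> S"
proof -
  have S: "S \<ge> 0" using assms(2) norm_ge_zero[of "f 0"] unfolding cbp_def by (meson order_trans)
  show ?thesis
  proof (cases b)
    case True
    have "norm (LINT x|lebesgue. indicat_real (cell h c \<inter> \<Omega>) x *\<^sub>R f x) \<le> S * measure lebesgue (cell h c \<inter> \<Omega>)"
      using assms(2) by (intro indicator_mult_norm cellset) (auto simp: cbp_def)
    also have "\<dots> \<le> S * h\<^sup>2" using cellset(2)[of h c] S measure_cell[OF assms(1)] by (intro mult_left_mono) auto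
    finally show ?thesis unfolding cellval_volume[OF assms(1) True] using assms(1) by (simp add: divide_le_eq)
  next
    case False
    then show ?thesis using assms(2) S by (auto simp: cellval_def cont_rep_continuous cbp_def indicator_def)
  qed
qed

text \<open>Averages do not see null sets, and \<open>cont_rep\<close> picks out the series itself,
  so either operator may be computed from the coefficients.\<close>

lemma cellval_ser:
  assumes "h > 0" "u \<in> spaceH L" "dsum (cf u) K"
  shows "cellval b h \<Omega> u c = cellval b h \<Omega> (ser (cf u)) c"
proof (cases b)
  case True
  have AE: "AE x in lebesgue. u x = ser (cf u) x"
    by (rule AE_square_imp_AE[OF L_pos L2per_periodic[OF spaceH_L2per[OF assms(2)]] ser_periodic AE_eq_ser[OF assms(2,3)]])
  have [measurable]: "u \<in> borel_measurable lebesgue" by (rule L2per_measurable[OF spaceH_L2per[OF assms(2)]])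
  have [measurable]: "ser (cf u) \<in> borel_measurable lebesgue"
    by (rule L2per_measurable[OF spaceH_L2per[OF ser_spaceH[OF assms(3)]]])
  have [measurable]: "cell h c \<inter> \<Omega> \<in> sets lebesgue" by (rule fmeasurableD[OF cellset(1)])
  show ?thesis unfolding cellval_volume[OF assms(1) True]
  proof (rule arg_cong[where f="\<lambda>y. (1 / h\<^sup>2) *\<^sub>R y"], rule integral_cong_AE)
    show "AE x in lebesgue. indicat_real (cell h c \<inter> \<Omega>) x *\<^sub>R u x = indicat_real (cell h c \<inter> \<Omega>) x *\<^sub>R ser (cf u) x"
      using AE by eventually_elim simp
  qed measurable
next
  case False
  then show ?thesis
    by (simp add: cellval_def cont_rep_ser[OF assms(2,3)] cont_rep_continuous[OF ser_continuous[OF assms(3)] ser_periodic])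
qed

text \<open>Coefficients of the unprojected observation; projecting to the first \<open>N\<close>
  modes merely restricts the index.\<close>

definition Jc :: "bool \<Rightarrow> real \<Rightarrow> real^2 \<Rightarrow> field \<Rightarrow> nat \<Rightarrow> real" where
  "Jc b h a f j = cf (interp b h a \<Omega> f) j"

lemma volume_interp_eq: "volume_interp L \<phi> h a N \<Omega> f = comb {1..N} (Jc True h a f)"
  by (simp add: volume_interp_def projN_def comb_def fun_eq_iff Jc_def interp_def[abs_def] cellval_def)

lemma nodal_interp_eq: "nodal_interp L \<phi> h a N \<Omega> f = comb {1..N} (Jc False h a f)"
  by (simp add: nodal_interp_def projN_def comb_def fun_eq_iff Jc_def interp_def[abs_def] cellval_def)

lemma Jc_ser: "h > 0 \<Longrightarrow> u \<in> spaceH L \<Longrightarrow> dsum (cf u) K \<Longrightarrow> Jc b h a u j = Jc b h a (ser (cf u)) j"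
  using cellval_ser by (simp add: Jc_def interp_def[abs_def])

lemma interp_sqint:
  assumes "h > 0"
  shows "sqint Q (interp b h a \<Omega> f)"
proof -
  interpret finite_measure Q by (rule finite_measure_square)
  have m: "(\<lambda>x. indicat_real (cell h c \<inter> \<Omega>) x) \<in> borel_measurable Q" for c
    by (rule measurable_restrict_space1[OF borel_measurable_indicator[OF fmeasurableD[OF cellset(1)]]])
  have one: "sqint Q (\<lambda>x. v :: real^2)" for v by (rule sqint_bounded[where C="norm v"]) auto
  show ?thesis unfolding interp_def
    by (rule sqint_sum, rule sqint_bounded_mult[where C=1, OF one m]) (auto simp: indicator_def)
qed

text \<open>Testing the observation with a combination splits over the cells, with a constant vector
  on each; the upper and lower estimates of the observation start from this form.\<close>

lemma Jc_comb_sum: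
  assumes "h > 0" "F \<subseteq> {1..}" "finite F"
  shows "(\<Sum>j\<in>F. d j * Jc b h a f j) = (\<Sum>c\<in>centres h a \<Omega>. cellval b h \<Omega> f c \<bullet> (LINT x|lebesgue. indicat_real (cell h c \<inter> \<Omega>) x *\<^sub>R comb F d x))"
proof -
  obtain S where S: "cbp (comb F d) S" using cbp_comb[OF assms(2)] by blast
  have int: "integrable lebesgue (\<lambda>x. indicat_real (cell h c \<inter> \<Omega>) x *\<^sub>R comb F d x)" for c
    using S by (intro indicator_mult_integrable cellset) (auto simp: cbp_def)
  have "(\<Sum>j\<in>F. d j * Jc b h a f j) = l2_inner L (interp b h a \<Omega> f) (comb F d)"
    unfolding Jc_def by (rule inner_comb[symmetric, OF assms(3,2) interp_sqint[OF assms(1)]])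
  also have "\<dots> = (LINT x|lebesgue. indicat_real (square L) x *\<^sub>R (interp b h a \<Omega> f x \<bullet> comb F d x))"
    unfolding l2_inner_def by (subst integral_restrict_space) auto
  also have "\<dots> = (LINT x|lebesgue. (\<Sum>c\<in>centres h a \<Omega>. cellval b h \<Omega> f c \<bullet> (indicat_real (cell h c \<inter> \<Omega>) x *\<^sub>R comb F d x)))"
  proof (rule Bochner_Integration.integral_cong[OF refl])
    fix x
    have "indicat_real (square L) x * indicat_real (cell h c \<inter> \<Omega>) x = indicat_real (cell h c \<inter> \<Omega>) x" for c
      using \<Omega>_sub by (auto simp: indicator_def)
    then have e: "indicat_real (square L) x * (indicat_real (cell h c \<inter> \<Omega>) x * y) = indicat_real (cell h c \<inter> \<Omega>) x * y" for c y
      by (metis mult.assoc)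
    show "indicat_real (square L) x *\<^sub>R (interp b h a \<Omega> f x \<bullet> comb F d x) = (\<Sum>c\<in>centres h a \<Omega>. cellval b h \<Omega> f c \<bullet> (indicat_real (cell h c \<inter> \<Omega>) x *\<^sub>R comb F d x))"
      by (simp add: interp_def inner_sum_left sum_distrib_left e)
  qed
  also have "\<dots> = (\<Sum>c\<in>centres h a \<Omega>. LINT x|lebesgue. cellval b h \<Omega> f c \<bullet> (indicat_real (cell h c \<inter> \<Omega>) x *\<^sub>R comb F d x))"
    by (rule Bochner_Integration.integral_sum) (intro integrable_inner_right int)
  also have "\<dots> = (\<Sum>c\<in>centres h a \<Omega>. cellval b h \<Omega> f c \<bullet> (LINT x|lebesgue. indicat_real (cell h c \<inter> \<Omega>) x *\<^sub>R comb F d x))"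
    by (intro sum.cong refl integral_inner_right int)
  finally show ?thesis .
qed

lemma Jc_single:
  assumes "h > 0" "j \<ge> 1"
  shows "Jc b h a f j = (\<Sum>c\<in>centres h a \<Omega>. cellval b h \<Omega> f c \<bullet> (LINT x|lebesgue. indicat_real (cell h c \<inter> \<Omega>) x *\<^sub>R comb {j} (\<lambda>_. 1) x))"
  using Jc_comb_sum[OF assms(1), of "{j}" "\<lambda>_. 1" b a f] assms(2) by simp

lemma Jc_add:
  assumes "h > 0" "cbp f S" "cbp g T" "j \<ge> 1"
  shows "Jc b h a (\<lambda>x. f x + g x) j = Jc b h a f j + Jc b h a g j"
  unfolding Jc_single[OF assms(1,4)] cellval_add[OF assms(1-3)] inner_add_left sum.distrib ..

lemma Jc_scaleR:
  assumes "h > 0" "cbp f S" "j \<ge> 1"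
  shows "Jc b h a (\<lambda>x. r *\<^sub>R f x) j = r * Jc b h a f j"
  unfolding Jc_single[OF assms(1,3)] cellval_scaleR[OF assms(1,2)] inner_scaleR_left sum_distrib_left ..

lemma Jc_comb:
  assumes "h > 0" "finite F" "F \<subseteq> {1..}" "j \<ge> 1"
  shows "Jc b h a (comb F d) j = (\<Sum>k\<in>F. d k * Jc b h a (\<phi> k) j)"
  using assms(2,3)
proof (induction F)
  case empty
  have z: "cbp (\<lambda>x. 0) 0" by (simp add: cbp_def periodic_def)
  show ?case using Jc_scaleR[OF assms(1) z assms(4), of b a 0] by (simp add: comb_def[abs_def])
next
  case (insert k F)
  obtain S where S: "cbp (comb F d) S" using cbp_comb[of F d] insert by auto
  obtain T where T: "cbp (comb {k} (\<lambda>_. 1)) T" using cbp_comb[of "{k}" "\<lambda>_. 1"] insert by auto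
  have ck: "comb {k} (\<lambda>_. 1) = \<phi> k" by (simp add: comb_def[abs_def])
  have T': "cbp (\<lambda>x. d k *\<^sub>R \<phi> k x) (\<bar>d k\<bar> * T)" using T unfolding ck
    by (auto simp: cbp_def periodic_def intro!: continuous_intros mult_left_mono)
  have "comb (insert k F) d = (\<lambda>x. d k *\<^sub>R \<phi> k x + comb F d x)"
    using insert by (simp add: comb_def fun_eq_iff)
  then show ?case
    using insert Jc_add[OF assms(1) T' S assms(4), of b a] Jc_scaleR[OF assms(1) T[unfolded ck] assms(4), of b a "d k"] by simp
qed

lemma norm_comb_sup:
  assumes N: "N \<ge> 1"
  shows "norm (comb {1..N} d x) \<le> weylC * (lam N * sqrt (\<Sum>j\<in>{1..N}. (d j)\<^sup>2))"
proof -
  have "norm (comb {1..N} d x) \<le> (\<Sum>j\<in>{1..N}. norm (d j *\<^sub>R \<phi> j x))" unfolding comb_def by (rule norm_sum)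
  also have "\<dots> \<le> weylC * (lam N * sqrt (\<Sum>j\<in>{1..N}. (d j)\<^sup>2))"
  proof (rule sum_sup_bound)
    have "(\<Sum>j\<in>{1..N}. (lam j * d j)\<^sup>2) \<le> (\<Sum>j\<in>{1..N}. (lam N)\<^sup>2 * (d j)\<^sup>2)"
    proof (rule sum_mono)
      fix j assume j: "j \<in> {1..N}"
      then have "0 < lam j" "lam j \<le> lam N" using lam_pos[of j] lam_mono[of j N] by auto
      then have "(lam j)\<^sup>2 \<le> (lam N)\<^sup>2" by (intro power_mono) auto
      then show "(lam j * d j)\<^sup>2 \<le> (lam N)\<^sup>2 * (d j)\<^sup>2" by (simp add: power_mult_distrib mult_right_mono)
    qed
    also have "\<dots> = (lam N * sqrt (\<Sum>j\<in>{1..N}. (d j)\<^sup>2))\<^sup>2"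
      by (simp add: power_mult_distrib sum_distrib_left sum_nonneg)
    finally show "(\<Sum>j\<in>{1..N}. (lam j * d j)\<^sup>2) \<le> (lam N * sqrt (\<Sum>j\<in>{1..N}. (d j)\<^sup>2))\<^sup>2" .
    show "0 \<le> lam N * sqrt (\<Sum>j\<in>{1..N}. (d j)\<^sup>2)" using lam_pos[OF N] by (simp add: sum_nonneg)
  qed auto
  finally show ?thesis .
qed

lemma centres_bound':
  assumes "0 < h" "h < 1"
  shows "real (card (centres h a \<Omega>)) * h\<^sup>2 \<le> (L + 2)\<^sup>2"
proof -
  have "(L + 2 * h)\<^sup>2 \<le> (L + 2)\<^sup>2" using L_pos assms by (intro power_mono) auto
  then show ?thesis using centres_bound(2)[OF assms(1) L_pos \<Omega>_sub, of a] by linarith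
qed

text \<open>Each cell contributes at most \<open>S\<close> times the supremum of the combination
  times \<open>h\<^sup>2\<close>, and the number of cells balances \<open>h\<^sup>2\<close>. The
  resulting factor \<open>lam N\<close> is only polynomial in the frequency, which the Gevrey decay
  can afford.\<close>

lemma Jc_upper:
  assumes h: "0 < h" "h < 1" and f: "cbp f S" and N: "N \<ge> 1"
  shows "\<bar>\<Sum>j\<in>{1..N}. d j * Jc b h a f j\<bar> \<le> (L + 2)\<^sup>2 * S * (weylC * (lam N * sqrt (\<Sum>j\<in>{1..N}. (d j)\<^sup>2)))"
proof -
  define W where "W = weylC * (lam N * sqrt (\<Sum>j\<in>{1..N}. (d j)\<^sup>2))"
  have W: "W \<ge> 0" using weylC(1) lam_pos[OF N] by (simp add: W_def sum_nonneg)
  have S: "S \<ge> 0" using f norm_ge_zero[of "f 0"] unfolding cbp_def by (meson order_trans)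
  have "\<bar>\<Sum>j\<in>{1..N}. d j * Jc b h a f j\<bar> \<le> (\<Sum>c\<in>centres h a \<Omega>. \<bar>cellval b h \<Omega> f c \<bullet> (LINT x|lebesgue. indicat_real (cell h c \<inter> \<Omega>) x *\<^sub>R comb {1..N} d x)\<bar>)"
    by (subst Jc_comb_sum[OF h(1)]) auto
  also have "\<dots> \<le> (\<Sum>c\<in>centres h a \<Omega>. S * (W * h\<^sup>2))"
  proof (rule sum_mono)
    fix c
    have "norm (LINT x|lebesgue. indicat_real (cell h c \<inter> \<Omega>) x *\<^sub>R comb {1..N} d x) \<le> W * measure lebesgue (cell h c \<inter> \<Omega>)"
      using norm_comb_sup[OF N, of d] by (intro indicator_mult_norm cellset comb_continuous) (auto simp: W_def)
    also have "\<dots> \<le> W * h\<^sup>2" using cellset(2)[of h c] W measure_cell[OF h(1)] by (intro mult_left_mono) auto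
    finally have "norm (cellval b h \<Omega> f c) * norm (LINT x|lebesgue. indicat_real (cell h c \<inter> \<Omega>) x *\<^sub>R comb {1..N} d x) \<le> S * (W * h\<^sup>2)"
      using S by (intro mult_mono cellval_bound[OF h(1) f]) auto
    then show "\<bar>cellval b h \<Omega> f c \<bullet> (LINT x|lebesgue. indicat_real (cell h c \<inter> \<Omega>) x *\<^sub>R comb {1..N} d x)\<bar> \<le> S * (W * h\<^sup>2)"
      using Cauchy_Schwarz_ineq2 order_trans by blast
  qed
  also have "\<dots> = (real (card (centres h a \<Omega>)) * h\<^sup>2) * (S * W)" by simp
  also have "\<dots> \<le> (L + 2)\<^sup>2 * (S * W)" using centres_bound'[OF h] S W by (intro mult_right_mono) auto
  finally show ?thesis by (simp add: W_def mult.assoc)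
qed

text \<open>The constant depends on \<open>N\<close> in an untracked way; it is compensated by
  choosing \<open>h\<close> small after \<open>N\<close>.\<close>

lemma comb_Lipschitz:
  "\<exists>\<Lambda>\<ge>0. \<forall>d x y. norm (comb {1..N} d x - comb {1..N} d y) \<le> \<Lambda> * sqrt (\<Sum>j\<in>{1..N}. (d j)\<^sup>2) * norm (x - y)"
proof -
  have "\<exists>C\<ge>0. \<forall>x y. norm (\<phi> j x - \<phi> j y) \<le> C * norm (x - y)" if "j \<ge> 1" for j
  proof -
    have "\<forall>m. \<exists>C\<ge>0. \<forall>x y. \<bar>\<phi> j x $ m - \<phi> j y $ m\<bar> \<le> C * norm (x - y)"
      using trigpoly_Lipschitz[OF phi_trigpoly[OF that]] by blast
    then obtain C where C: "C m \<ge> 0" "\<bar>\<phi> j x $ m - \<phi> j y $ m\<bar> \<le> C m * norm (x - y)" for m x y by metis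
    have "norm (\<phi> j x - \<phi> j y) \<le> (C 1 + C 2) * norm (x - y)" for x y
      using norm_le_l1_cart[of "\<phi> j x - \<phi> j y"] C(2)[of x 1 y] C(2)[of x 2 y] by (simp add: sum_2 distrib_right)
    then show ?thesis using C(1) by (intro exI[of _ "C 1 + C 2"]) (auto intro: add_nonneg_nonneg)
  qed
  then have "\<forall>j. \<exists>C. j \<ge> 1 \<longrightarrow> C \<ge> 0 \<and> (\<forall>x y. norm (\<phi> j x - \<phi> j y) \<le> C * norm (x - y))" by blast
  then obtain C where C: "j \<ge> 1 \<Longrightarrow> C j \<ge> 0" "j \<ge> 1 \<Longrightarrow> norm (\<phi> j x - \<phi> j y) \<le> C j * norm (x - y)" for j x y
    by metis
  show ?thesis
  proof (intro exI[of _ "\<Sum>j\<in>{1..N}. C j"] conjI allI)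
    show "0 \<le> (\<Sum>j\<in>{1..N}. C j)" using C by (intro sum_nonneg) auto
    fix d x y
    define D where "D = sqrt (\<Sum>j\<in>{1..N}. (d j)\<^sup>2)"
    have D: "\<bar>d j\<bar> \<le> D" if "j \<in> {1..N}" for j
      unfolding D_def using that member_le_sum[of j "{1..N}" "\<lambda>j. (d j)\<^sup>2"] by (intro real_le_rsqrt) auto
    have "norm (comb {1..N} d x - comb {1..N} d y) = norm (\<Sum>j\<in>{1..N}. d j *\<^sub>R (\<phi> j x - \<phi> j y))"
      by (simp add: comb_def sum_subtractf scaleR_diff_right)
    also have "\<dots> \<le> (\<Sum>j\<in>{1..N}. norm (d j *\<^sub>R (\<phi> j x - \<phi> j y)))" by (rule norm_sum)
    also have "\<dots> \<le> (\<Sum>j\<in>{1..N}. D * (C j * norm (x - y)))"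
      unfolding norm_scaleR using C D by (intro sum_mono mult_mono) (auto intro: order_trans[OF abs_ge_zero D])
    finally show "norm (comb {1..N} d x - comb {1..N} d y) \<le> (\<Sum>j\<in>{1..N}. C j) * sqrt (\<Sum>j\<in>{1..N}. (d j)\<^sup>2) * norm (x - y)"
      by (simp add: D_def sum_distrib_left sum_distrib_right mult_ac)
  qed
qed

text \<open>On a cell contained in \<open>\<Omega>\<close> the value of either operator is close to that of \<open>w\<close>; the other
  cells contribute a nonnegative term, up to a small error for the nodal operator.\<close>

lemma cell_term_lower:
  assumes h: "0 < h" and w: "cbp w S" and lip: "\<And>x y. norm (w x - w y) \<le> \<Lambda> * norm (x - y)" and \<Lambda>: "\<Lambda> \<ge> 0"
  shows "cellval b h \<Omega> w c \<bullet> (LINT x|lebesgue. indicat_real (cell h c \<inter> \<Omega>) x *\<^sub>R w x) \<ge>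
    (if cell h c \<subseteq> \<Omega> then (LINT x|lebesgue. indicat_real (cell h c) x * (norm (w x))\<^sup>2) else 0) - 2 * h * \<Lambda> * S * h\<^sup>2"
proof -
  define E where "E = cell h c \<inter> \<Omega>"
  define v where "v = cellval b h \<Omega> w c"
  have S: "S \<ge> 0" using w norm_ge_zero[of "w 0"] unfolding cbp_def by (meson order_trans)
  have wb: "norm (w x) \<le> S" for x using w by (simp add: cbp_def)
  have wc: "continuous_on UNIV w" using w by (simp add: cbp_def)
  have cc: "c \<in> cell h c" using h by (simp add: mem_cell)
  have E: "E \<in> lmeasurable" "measure lebesgue E \<le> h\<^sup>2" using cellset[of h c] measure_cell[OF h] by (auto simp: E_def)
  have int: "integrable lebesgue (\<lambda>x. indicat_real E x *\<^sub>R w x)"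
    by (rule indicator_mult_integrable[OF E(1) wc wb])
  have wm: "w \<in> borel_measurable lebesgue"
    using continuous_imp_measurable_on_sets_lebesgue[OF wc] by (simp add: lebesgue_on_UNIV_eq)
  have iE: "integrable lebesgue (\<lambda>x. indicat_real E x)"
    using E(1) by (auto simp: fmeasurable_def intro!: integrable_real_indicator)
  have int2: "integrable lebesgue (\<lambda>x. indicat_real E x * (norm (w x))\<^sup>2)"
  proof (rule Bochner_Integration.integrable_bound[OF integrable_mult_right[OF iE, of "S\<^sup>2"]])
    show "(\<lambda>x. indicat_real E x * (norm (w x))\<^sup>2) \<in> borel_measurable lebesgue"
      using wm iE by auto
    show "AE x in lebesgue. norm (indicat_real E x * (norm (w x))\<^sup>2) \<le> norm (S\<^sup>2 * indicat_real E x)"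
      using power_mono[OF wb norm_ge_zero, of _ 2] by (intro AE_I2) (auto simp: indicator_def)
  qed
  \<comment> \<open>If the cell value is within \<open>2 * h * \<Lambda>\<close> of \<open>w\<close>
    on the cell, replacing it by \<open>w\<close> under the integral costs at most
    \<open>2 * h * \<Lambda> * S\<close> times the area.\<close>
  have close: "v \<bullet> (LINT x|lebesgue. indicat_real E x *\<^sub>R w x) \<ge> (LINT x|lebesgue. indicat_real E x * (norm (w x))\<^sup>2) - 2 * h * \<Lambda> * S * h\<^sup>2"
    if cl: "\<And>x. x \<in> E \<Longrightarrow> norm (v - w x) \<le> \<Lambda> * (2 * h)"
  proof -
    have "(LINT x|lebesgue. indicat_real E x * (norm (w x))\<^sup>2 - (\<Lambda> * (2 * h) * S) * indicat_real E x) \<le> (LINT x|lebesgue. v \<bullet> (indicat_real E x *\<^sub>R w x))"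
    proof (rule integral_mono)
      fix x
      show "indicat_real E x * (norm (w x))\<^sup>2 - (\<Lambda> * (2 * h) * S) * indicat_real E x \<le> v \<bullet> (indicat_real E x *\<^sub>R w x)"
      proof (cases "x \<in> E")
        case True
        have "\<bar>(v - w x) \<bullet> w x\<bar> \<le> norm (v - w x) * norm (w x)" by (rule Cauchy_Schwarz_ineq2)
        also have "\<dots> \<le> (\<Lambda> * (2 * h)) * S" using cl[OF True] wb[of x] h \<Lambda> by (intro mult_mono) auto
        finally have "(v - w x) \<bullet> w x \<ge> - ((\<Lambda> * (2 * h)) * S)" by linarith
        then show ?thesis using True by (simp add: inner_diff_left power2_norm_eq_inner)
      qed simp
    next
      show "integrable lebesgue (\<lambda>x. v \<bullet> (indicat_real E x *\<^sub>R w x))" using int by (rule integrable_inner_right)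
    qed (use int2 iE in auto)
    also have "\<dots> = v \<bullet> (LINT x|lebesgue. indicat_real E x *\<^sub>R w x)" by (rule integral_inner_right[OF int])
    also have "(LINT x|lebesgue. indicat_real E x * (norm (w x))\<^sup>2 - (\<Lambda> * (2 * h) * S) * indicat_real E x) =
      (LINT x|lebesgue. indicat_real E x * (norm (w x))\<^sup>2) - (\<Lambda> * (2 * h) * S) * measure lebesgue E"
      using int2 iE E(1) by (subst Bochner_Integration.integral_diff) (auto simp: fmeasurable_def)
    finally have "(LINT x|lebesgue. indicat_real E x * (norm (w x))\<^sup>2) - (\<Lambda> * (2 * h) * S) * measure lebesgue E \<le> v \<bullet> (LINT x|lebesgue. indicat_real E x *\<^sub>R w x)" .
    moreover have "(\<Lambda> * (2 * h) * S) * measure lebesgue E \<le> (\<Lambda> * (2 * h) * S) * h\<^sup>2"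
      using E(2) \<Lambda> h S by (intro mult_left_mono) auto
    ultimately show ?thesis by (simp add: mult_ac)
  qed
  have err: "2 * h * \<Lambda> * S * h\<^sup>2 \<ge> 0" using h \<Lambda> S by simp
  have nn: "(LINT x|lebesgue. indicat_real E x * (norm (w x))\<^sup>2) \<ge> 0" by (intro integral_nonneg_AE AE_I2) simp
  have "v \<bullet> (LINT x|lebesgue. indicat_real E x *\<^sub>R w x) \<ge>
    (if cell h c \<subseteq> \<Omega> then (LINT x|lebesgue. indicat_real E x * (norm (w x))\<^sup>2) else 0) - 2 * h * \<Lambda> * S * h\<^sup>2"
  proof (cases b)
    case True
    then have v: "v = (1 / h\<^sup>2) *\<^sub>R (LINT x|lebesgue. indicat_real E x *\<^sub>R w x)"
      using cellval_volume[OF h True] by (simp add: v_def E_def)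
    show ?thesis
    proof (cases "cell h c \<subseteq> \<Omega>")
      case True
      then have Ec: "E = cell h c" by (auto simp: E_def)
      have mE: "measure lebesgue E = h\<^sup>2" using measure_cell[OF h] by (simp add: Ec)
      have "norm (v - w x) \<le> \<Lambda> * (2 * h)" if x: "x \<in> E" for x
      proof -
        have "w x = (1 / h\<^sup>2) *\<^sub>R (LINT y|lebesgue. indicat_real E y *\<^sub>R w x)"
          using mE E(1) iE h by simp
        then have "v - w x = (1 / h\<^sup>2) *\<^sub>R ((LINT y|lebesgue. indicat_real E y *\<^sub>R w y) - (LINT y|lebesgue. indicat_real E y *\<^sub>R w x))"
          unfolding v scaleR_diff_right by simp
        also have "(LINT y|lebesgue. indicat_real E y *\<^sub>R w y) - (LINT y|lebesgue. indicat_real E y *\<^sub>R w x) = (LINT y|lebesgue. indicat_real E y *\<^sub>R (w y - w x))"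
          using int iE by (subst Bochner_Integration.integral_diff[symmetric]) (auto simp: scaleR_diff_right intro: integrable_scaleR_left)
        finally have "norm (v - w x) = 1 / h\<^sup>2 * norm (LINT y|lebesgue. indicat_real E y *\<^sub>R (w y - w x))" by simp
        also have "norm (LINT y|lebesgue. indicat_real E y *\<^sub>R (w y - w x)) \<le> (LINT y|lebesgue. (\<Lambda> * (2 * h)) * indicat_real E y)"
        proof (rule order_trans[OF integral_norm_bound integral_mono])
          show "integrable lebesgue (\<lambda>y. norm (indicat_real E y *\<^sub>R (w y - w x)))"
            using int iE unfolding scaleR_diff_right by (intro integrable_norm Bochner_Integration.integrable_diff integrable_scaleR_left)
          fix y
          show "norm (indicat_real E y *\<^sub>R (w y - w x)) \<le> \<Lambda> * (2 * h) * indicat_real E y"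
          proof (cases "y \<in> E")
            case True
            have "norm (w y - w x) \<le> \<Lambda> * norm (y - x)" by (rule lip)
            also have "\<dots> \<le> \<Lambda> * (2 * h)" using cell_dist[of y h c x] True x \<Lambda> by (intro mult_left_mono) (auto simp: Ec)
            finally show ?thesis using True by simp
          qed simp
        qed (use iE in simp)
        also have "\<dots> = \<Lambda> * (2 * h) * h\<^sup>2" using mE E(1) by (simp add: fmeasurable_def)
        finally show ?thesis using h by (simp add: divide_right_mono)
      qed
      then show ?thesis using close True by simp
    next
      case False
      \<comment> \<open>For the volume operator a cell that sticks out of \<open>\<Omega>\<close>
        pairs the integral of \<open>w\<close> with a positive multiple of itself.\<close>
      have "v \<bullet> (LINT x|lebesgue. indicat_real E x *\<^sub>R w x) \<ge> 0" unfolding v using h by simp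
      then have "0 - 2 * h * \<Lambda> * S * h\<^sup>2 \<le> v \<bullet> (LINT x|lebesgue. indicat_real E x *\<^sub>R w x)" using err by linarith
      then show ?thesis unfolding if_not_P[OF False] .
    qed
  next
    case False
    then have v: "v = indicat_real \<Omega> c *\<^sub>R w c" using w by (simp add: v_def cellval_def cont_rep_continuous cbp_def)
    show ?thesis
    \<comment> \<open>A nodal value is either zero or close to \<open>w\<close> on the observed part
      of the cell, so a cell that sticks out of \<open>\<Omega>\<close> costs at most the Lipschitz
      error.\<close>
    proof (cases "c \<in> \<Omega>")
      case True
      have "norm (v - w x) \<le> \<Lambda> * (2 * h)" if "x \<in> E" for x
      proof -
        have "norm (w c - w x) \<le> \<Lambda> * norm (c - x)" by (rule lip)
        also have "\<dots> \<le> \<Lambda> * (2 * h)" using cell_dist[OF cc, of x] that \<Lambda> by (intro mult_left_mono) (auto simp: E_def)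
        finally show ?thesis using True by (simp add: v)
      qed
      from close[OF this] nn have l: "0 - 2 * h * \<Lambda> * S * h\<^sup>2 \<le> v \<bullet> (LINT x|lebesgue. indicat_real E x *\<^sub>R w x)"
        "(LINT x|lebesgue. indicat_real E x * (norm (w x))\<^sup>2) - 2 * h * \<Lambda> * S * h\<^sup>2 \<le> v \<bullet> (LINT x|lebesgue. indicat_real E x *\<^sub>R w x)"
        by linarith+
      show ?thesis by (cases "cell h c \<subseteq> \<Omega>") (simp_all only: if_True if_False l)
    next
      case False
      then have "\<not> cell h c \<subseteq> \<Omega>" using cc by auto
      then show ?thesis using False err by (simp add: v)
    qed
  qed
  moreover have "cell h c \<subseteq> \<Omega> \<Longrightarrow> E = cell h c" by (auto simp: E_def)
  ultimately show ?thesis by (auto simp: v_def E_def split: if_splits)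
qed

text \<open>The margin \<open>\<delta>\<close> around the square at \<open>p\<close> exceeds
  \<open>h\<close>, so every cell that meets this square lies in \<open>\<Omega>\<close>; these
  cells cover it and their integrals dominate. The errors of all cells add up to order
  \<open>h\<close> because the number of cells is of order \<open>h\<close> to the power
  \<open>-2\<close>.\<close>

lemma Jc_lower:
  assumes h: "0 < h" "h < 1" "h < \<delta>" and N: "N \<ge> 1"
    and box: "\<And>x. (\<And>i. p $ i - \<delta> \<le> x $ i \<and> x $ i \<le> p $ i + 2 * \<delta>) \<Longrightarrow> x \<in> \<Omega>"
    and lip: "\<And>d x y. norm (comb {1..N} d x - comb {1..N} d y) \<le> \<Lambda> * sqrt (\<Sum>j\<in>{1..N}. (d j)\<^sup>2) * norm (x - y)" and \<Lambda>: "\<Lambda> \<ge> 0"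
  shows "(\<Sum>j\<in>{1..N}. d j * Jc b h a (comb {1..N} d) j) \<ge>
     integral (cbox p (p + (\<chi> i. \<delta>))) (\<lambda>x. (norm (comb {1..N} d x))\<^sup>2)
       - h * (2 * (L + 2)\<^sup>2 * \<Lambda> * weylC * lam N) * (\<Sum>j\<in>{1..N}. (d j)\<^sup>2)"
proof -
  let ?w = "comb {1..N} d" and ?R = "cbox p (p + (\<chi> i. \<delta>))"
  define D where "D = sqrt (\<Sum>j\<in>{1..N}. (d j)\<^sup>2)"
  have D: "D \<ge> 0" "D * D = (\<Sum>j\<in>{1..N}. (d j)\<^sup>2)" by (auto simp: D_def sum_nonneg)
  define S where "S = weylC * (lam N * D)"
  have S: "S \<ge> 0" using weylC(1) lam_pos[OF N] D by (simp add: S_def)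
  have wc: "continuous_on UNIV ?w" by (rule comb_continuous) auto
  have w: "cbp ?w S"
    using norm_comb_sup[OF N, of d] wc L2per_periodic[OF spaceH_L2per[OF comb_spaceH]] by (auto simp: cbp_def S_def D_def)
  have wb: "norm (?w x) \<le> S" for x using w by (simp add: cbp_def)
  define C where "C = centres h a \<Omega>"
  have fC: "finite C" unfolding C_def by (rule centres_bound(1)[OF h(1) L_pos \<Omega>_sub])
  have wm: "?w \<in> borel_measurable lebesgue"
    using continuous_imp_measurable_on_sets_lebesgue[OF wc] by (simp add: lebesgue_on_UNIV_eq)
  have intc: "integrable lebesgue (\<lambda>x. indicat_real E x * (norm (?w x))\<^sup>2)" if "E \<in> lmeasurable" for E
  proof -
    have iE: "integrable lebesgue (\<lambda>x. indicat_real E x)"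
      using that by (auto simp: fmeasurable_def intro!: integrable_real_indicator)
    show ?thesis
    proof (rule Bochner_Integration.integrable_bound[OF integrable_mult_right[OF iE, of "S\<^sup>2"]])
      show "(\<lambda>x. indicat_real E x * (norm (?w x))\<^sup>2) \<in> borel_measurable lebesgue" using wm iE by auto
      show "AE x in lebesgue. norm (indicat_real E x * (norm (?w x))\<^sup>2) \<le> norm (S\<^sup>2 * indicat_real E x)"
        using power_mono[OF wb norm_ge_zero, of _ 2] by (intro AE_I2) (auto simp: indicator_def)
    qed
  qed
  have "integral ?R (\<lambda>x. (norm (?w x))\<^sup>2) = (LINT x|lebesgue_on ?R. (norm (?w x))\<^sup>2)"
    by (rule lebesgue_integral_eq_integral[symmetric])
      (rule continuous_imp_integrable, intro continuous_on_power continuous_on_norm continuous_on_subset[OF wc] subset_UNIV, simp)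
  also have "\<dots> = (LINT x|lebesgue. indicat_real ?R x * (norm (?w x))\<^sup>2)"
    by (subst integral_restrict_space) auto
  also have "\<dots> \<le> (LINT x|lebesgue. (\<Sum>c\<in>{c\<in>C. cell h c \<subseteq> \<Omega>}. indicat_real (cell h c) x * (norm (?w x))\<^sup>2))"
  proof (rule integral_mono)
    show "integrable lebesgue (\<lambda>x. indicat_real ?R x * (norm (?w x))\<^sup>2)" by (rule intc) simp
    show "integrable lebesgue (\<lambda>x. \<Sum>c\<in>{c\<in>C. cell h c \<subseteq> \<Omega>}. indicat_real (cell h c) x * (norm (?w x))\<^sup>2)"
      by (intro Bochner_Integration.integrable_sum intc cell_lmeasurable)
    fix x
    show "indicat_real ?R x * (norm (?w x))\<^sup>2 \<le> (\<Sum>c\<in>{c\<in>C. cell h c \<subseteq> \<Omega>}. indicat_real (cell h c) x * (norm (?w x))\<^sup>2)"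
    proof (cases "x \<in> ?R")
      case True
      obtain k :: "2 \<Rightarrow> int" where k: "x \<in> cell h (a + (\<chi> i. h * of_int (k i)))" using cell_cover[OF h(1)] .
      define c where "c = a + (\<chi> i. h * of_int (k i))"
      have xR: "p $ i \<le> x $ i" "x $ i \<le> p $ i + \<delta>" for i using True by (auto simp: mem_box_cart)
      have sub: "cell h c \<subseteq> \<Omega>"
      proof
        fix y assume y: "y \<in> cell h c"
        show "y \<in> \<Omega>"
        proof (rule box)
          fix i
          have "\<bar>x $ i - c $ i\<bar> \<le> h / 2" "\<bar>y $ i - c $ i\<bar> \<le> h / 2" using k y by (auto simp: mem_cell c_def)
          then show "p $ i - \<delta> \<le> y $ i \<and> y $ i \<le> p $ i + 2 * \<delta>" using xR[of i] h(3) by linarith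
        qed
      qed
      have "c \<in> C" using sub k by (auto simp: C_def centres_def c_def)
      then have c: "c \<in> {c\<in>C. cell h c \<subseteq> \<Omega>}" using sub by simp
      have "indicat_real (cell h c) x * (norm (?w x))\<^sup>2 \<le> (\<Sum>c\<in>{c\<in>C. cell h c \<subseteq> \<Omega>}. indicat_real (cell h c) x * (norm (?w x))\<^sup>2)"
        by (rule member_le_sum[OF c]) (use fC in auto)
      then show ?thesis using True k by (simp add: c_def)
    qed (auto intro: sum_nonneg)
  qed
  also have "\<dots> = (\<Sum>c\<in>C. if cell h c \<subseteq> \<Omega> then (LINT x|lebesgue. indicat_real (cell h c) x * (norm (?w x))\<^sup>2) else 0)"
    by (subst Bochner_Integration.integral_sum[OF intc[OF cell_lmeasurable]]) (use fC in \<open>simp add: sum.If_cases Int_def\<close>)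
  finally have 1: "integral ?R (\<lambda>x. (norm (?w x))\<^sup>2) \<le> \<dots>" .
  have "(\<Sum>j\<in>{1..N}. d j * Jc b h a ?w j) = (\<Sum>c\<in>C. cellval b h \<Omega> ?w c \<bullet> (LINT x|lebesgue. indicat_real (cell h c \<inter> \<Omega>) x *\<^sub>R ?w x))"
    unfolding C_def by (rule Jc_comb_sum[OF h(1)]) auto
  also have "\<dots> \<ge> (\<Sum>c\<in>C. (if cell h c \<subseteq> \<Omega> then (LINT x|lebesgue. indicat_real (cell h c) x * (norm (?w x))\<^sup>2) else 0) - 2 * h * (\<Lambda> * D) * S * h\<^sup>2)"
    by (rule sum_mono, rule cell_term_lower[OF h(1) w]) (use lip[of d] \<Lambda> D in \<open>auto simp: D_def\<close>)
  finally have 2: "(\<Sum>j\<in>{1..N}. d j * Jc b h a ?w j) \<ge>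
     (\<Sum>c\<in>C. if cell h c \<subseteq> \<Omega> then (LINT x|lebesgue. indicat_real (cell h c) x * (norm (?w x))\<^sup>2) else 0) - (real (card C) * h\<^sup>2) * (2 * h * (\<Lambda> * D) * S)"
    by (simp add: sum_subtractf mult_ac)
  have "(real (card C) * h\<^sup>2) * (2 * h * (\<Lambda> * D) * S) \<le> (L + 2)\<^sup>2 * (2 * h * (\<Lambda> * D) * S)"
    unfolding C_def using centres_bound'[OF h(1,2)] h \<Lambda> D S by (intro mult_right_mono) auto
  also have "\<dots> = h * (2 * (L + 2)\<^sup>2 * \<Lambda> * weylC * lam N) * (D * D)" by (simp add: S_def mult_ac)
  finally show ?thesis using 1 2 unfolding D(2) by linarith
qed

end

subsection \<open>Ordinary differential equations\<close>

lemma continuous_on_halfline: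
  fixes f :: "real \<Rightarrow> real"
  assumes "\<And>T. T > 0 \<Longrightarrow> continuous_on {0..T} f"
  shows "continuous_on {0..} f"
proof (subst continuous_on_eq_continuous_within, rule ballI)
  fix t :: real assume t: "t \<in> {0..}"
  have "continuous (at t within {0..t+1}) f"
    using assms[of "t + 1"] t by (auto simp: continuous_on_eq_continuous_within)
  moreover have "at t within {0..t+1} = at t within {0..}"
  proof (rule at_within_nhd[where S="{..<t+1}"])
    show "{0..t + 1} \<inter> {..<t + 1} - {t} = {0..} \<inter> {..<t + 1} - {t}" by auto
  qed auto
  ultimately show "continuous (at t within {0..}) f" by simp
qed

lemma continuous_on_integral_halfline:
  fixes f :: "real \<Rightarrow> real"
  assumes "continuous_on {0..} f"
  shows "continuous_on {0..} (\<lambda>t. integral {0..t} f)"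
proof (rule continuous_on_halfline)
  fix T :: real assume "T > 0"
  have "continuous_on {0..T} f" by (rule continuous_on_subset[OF assms]) auto
  then show "continuous_on {0..T} (\<lambda>t. integral {0..t} f)"
    by (intro indefinite_integral_continuous_1 integrable_continuous_real)
qed

lemma integral_halfline_derivative:
  fixes f :: "real \<Rightarrow> real"
  assumes "continuous_on {0..} f" "t > 0"
  shows "((\<lambda>t. integral {0..t} f) has_real_derivative f t) (at t)"
proof -
  have "continuous_on {0..t+1} f" by (rule continuous_on_subset[OF assms(1)]) auto
  then have "((\<lambda>t. integral {0..t} f) has_real_derivative f t) (at t within {0..t+1})"
    using assms(2) by (intro integral_has_real_derivative) auto
  then show ?thesis using assms(2) by (simp add: at_within_Icc_at)
qed

text \<open>\<open>E * exp (- \<Gamma>)\<close> is nonincreasing. The primitive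
  \<open>\<Gamma>\<close> is an argument so that a variable growth rate and a constant decay rate
  are covered alike.\<close>

lemma gronwall_exp:
  fixes E \<Gamma> \<gamma> :: "real \<Rightarrow> real"
  assumes ab: "a \<le> b" and cE: "continuous_on {a..b} E" and cG: "continuous_on {a..b} \<Gamma>"
    and dE: "\<And>s. a < s \<Longrightarrow> s < b \<Longrightarrow> \<exists>D. (E has_real_derivative D) (at s) \<and> D \<le> \<gamma> s * E s"
    and dG: "\<And>s. a < s \<Longrightarrow> s < b \<Longrightarrow> (\<Gamma> has_real_derivative \<gamma> s) (at s)"
  shows "E b \<le> E a * exp (\<Gamma> b - \<Gamma> a)"
proof (cases "a = b")
  case False
  define H where "H s = E s * exp (- \<Gamma> s)" for s
  have "H b \<le> H a"
  proof (rule DERIV_nonpos_imp_decreasing_open[of a b])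
    show "a \<le> b" by fact
    show "\<exists>y. DERIV H s :> y \<and> y \<le> 0" if s: "a < s" "s < b" for s
    proof -
      obtain D where D: "(E has_real_derivative D) (at s)" "D \<le> \<gamma> s * E s" using dE[OF s] by blast
      have "DERIV H s :> D * exp (- \<Gamma> s) + (exp (- \<Gamma> s) * - \<gamma> s) * E s"
        unfolding H_def by (rule DERIV_mult[OF D(1)]) (auto intro!: derivative_eq_intros dG[OF s])
      moreover have "D * exp (- \<Gamma> s) + (exp (- \<Gamma> s) * - \<gamma> s) * E s = (D - \<gamma> s * E s) * exp (- \<Gamma> s)"
        by (simp add: algebra_simps)
      ultimately show ?thesis using D(2) by (intro exI[of _ "(D - \<gamma> s * E s) * exp (- \<Gamma> s)"]) (auto simp: mult_le_0_iff)
    qed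
    show "continuous_on {a..b} H" unfolding H_def by (intro continuous_intros cE cG)
  qed
  then have "H b * exp (\<Gamma> b) \<le> H a * exp (\<Gamma> b)" by simp
  then show ?thesis by (simp add: H_def exp_diff exp_minus field_simps)
qed simp

text \<open>Successive iterates differ by at most \<open>C * (a * t) ^ n / fact n\<close> on each
  \<open>[0, T]\<close>, so they converge uniformly there. As the right-hand side is Lipschitz on
  all of the state space, the solution lives on the half-line without any continuation
  argument.\<close>

lemma Picard:
  fixes g :: "nat \<Rightarrow> real \<Rightarrow> (nat \<Rightarrow> real) \<Rightarrow> real"
  assumes fin: "finite I"
    and cont: "\<And>X j. j \<in> I \<Longrightarrow> (\<And>k. k \<in> I \<Longrightarrow> continuous_on {0..} (X k)) \<Longrightarrow> continuous_on {0..} (\<lambda>s. g j s (\<lambda>k. X k s))"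
    and lip: "\<And>T. T > 0 \<Longrightarrow> \<exists>K\<ge>0. \<forall>s\<in>{0..T}. \<forall>j\<in>I. \<forall>x y. \<bar>g j s x - g j s y\<bar> \<le> K * (\<Sum>k\<in>I. \<bar>x k - y k\<bar>)"
  shows "\<exists>Y. \<forall>j\<in>I. continuous_on {0..} (Y j) \<and> (\<forall>t\<ge>0. Y j t = integral {0..t} (\<lambda>s. g j s (\<lambda>k. Y k s)))"
proof -
  define X where "X = rec_nat (\<lambda>j t. 0 :: real) (\<lambda>n Xn j t. integral {0..t} (\<lambda>s. g j s (\<lambda>k. Xn k s)))"
  have X0: "X 0 = (\<lambda>j t. 0)" and XS: "X (Suc n) = (\<lambda>j t. integral {0..t} (\<lambda>s. g j s (\<lambda>k. X n k s)))" for n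
    by (simp_all add: X_def)
  have Xc: "continuous_on {0..} (X n j)" if "j \<in> I" for n j
    using that
  proof (induction n arbitrary: j)
    case (Suc n)
    show ?case unfolding XS by (rule continuous_on_integral_halfline[OF cont[OF Suc.prems Suc.IH]])
  qed (simp add: X0)
  have gX: "continuous_on {0..} (\<lambda>s. g j s (\<lambda>k. X n k s))" if "j \<in> I" for n j
    by (rule cont[OF that Xc])
  have gint: "(\<lambda>s. g j s (\<lambda>k. X n k s)) integrable_on {0..t}" if "j \<in> I" for n j t
    by (rule integrable_continuous_real[OF continuous_on_subset[OF gX[OF that]]]) auto
  define Y where "Y j t = (\<Sum>n. X (Suc n) j t - X n j t)" for j t
  have unif: "uniform_limit {0..T} (\<lambda>n. X n j) (Y j) sequentially" if T: "T > 0" and j: "j \<in> I" for T j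
  proof -
    obtain K where K: "K \<ge> 0" "\<And>s i x y. s \<in> {0..T} \<Longrightarrow> i \<in> I \<Longrightarrow> \<bar>g i s x - g i s y\<bar> \<le> K * (\<Sum>k\<in>I. \<bar>x k - y k\<bar>)"
      using lip[OF T] by blast
    define a where "a = real (card I) * K"
    have a0: "a \<ge> 0" using K by (simp add: a_def)
    define D where "D n t = (\<Sum>i\<in>I. \<bar>X (Suc n) i t - X n i t\<bar>)" for n t
    have Dc: "continuous_on {0..T} (D n)" for n
      unfolding D_def by (intro continuous_intros continuous_on_subset[OF Xc]) auto
    have "compact (D 0 ` {0..T})" by (intro compact_continuous_image Dc) auto
    then have "bounded (D 0 ` {0..T})" by (rule compact_imp_bounded)
    then obtain C where C: "\<And>t. t \<in> {0..T} \<Longrightarrow> \<bar>D 0 t\<bar> \<le> C" "C > 0" by (force simp: bounded_pos)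
    \<comment> \<open>The factor \<open>card I\<close> in \<open>a\<close> arises when the bounds
      for the single components are added.\<close>
    have Db: "D n t \<le> C * (a * t) ^ n / fact n" if "t \<in> {0..T}" for n t
      using that
    proof (induction n arbitrary: t)
      case 0
      then show ?case using C(1)[of t] by simp
    next
      case (Suc n)
      have step: "\<bar>X (Suc (Suc n)) i t - X (Suc n) i t\<bar> \<le> K * (C * a ^ n * t ^ Suc n / fact (Suc n))" if i: "i \<in> I" for i
      proof -
        define d where "d = K * C * a ^ n / fact (Suc n)"
        have ft: "((\<lambda>s. K * (C * (a * s) ^ n / fact n)) has_integral (d * t ^ Suc n - d * 0 ^ Suc n)) {0..t}"
        proof (rule fundamental_theorem_of_calculus)
          fix s assume "s \<in> {0..t}"
          have D: "((\<lambda>s. d * s ^ Suc n) has_real_derivative d * (real (Suc n) * s ^ (Suc n - Suc 0))) (at s within {0..t})"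
            by (rule DERIV_cmult[OF DERIV_pow])
          have "K * C * p / (m * f) * (m * q) = K * (C * (p * q) / f)" if "m \<noteq> 0" for m p q f :: real
            using that by simp
          from this[of "real (Suc n)" "a ^ n" "fact n" "s ^ n"]
          have e: "d * (real (Suc n) * s ^ (Suc n - Suc 0)) = K * (C * (a * s) ^ n / fact n)"
            by (simp add: d_def power_mult_distrib fact_Suc del: of_nat_Suc)
          show "((\<lambda>s. d * s ^ Suc n) has_vector_derivative K * (C * (a * s) ^ n / fact n)) (at s within {0..t})"
            using D unfolding e has_real_derivative_iff_has_vector_derivative .
        qed (use Suc.prems in auto)
        have "X (Suc (Suc n)) i t - X (Suc n) i t = integral {0..t} (\<lambda>s. g i s (\<lambda>k. X (Suc n) k s) - g i s (\<lambda>k. X n k s))"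
          unfolding XS[of "Suc n"] by (subst (2) XS) (rule Henstock_Kurzweil_Integration.integral_diff[symmetric, OF gint[OF i] gint[OF i]])
        also have "\<bar>\<dots>\<bar> \<le> integral {0..t} (\<lambda>s. K * (C * (a * s) ^ n / fact n))"
          unfolding real_norm_def[symmetric]
        proof (rule integral_norm_bound_integral)
          show "(\<lambda>s. g i s (\<lambda>k. X (Suc n) k s) - g i s (\<lambda>k. X n k s)) integrable_on {0..t}"
            by (rule integrable_diff[OF gint[OF i] gint[OF i]])
          show "(\<lambda>s. K * (C * (a * s) ^ n / fact n)) integrable_on {0..t}" using ft by (rule has_integral_integrable)
          fix s assume s: "s \<in> {0..t}"
          have "\<bar>g i s (\<lambda>k. X (Suc n) k s) - g i s (\<lambda>k. X n k s)\<bar> \<le> K * D n s"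
            unfolding D_def using s Suc.prems by (intro K(2) i) auto
          also have "\<dots> \<le> K * (C * (a * s) ^ n / fact n)" using s Suc.prems K(1) by (intro mult_left_mono Suc.IH) auto
          finally show "norm (g i s (\<lambda>k. X (Suc n) k s) - g i s (\<lambda>k. X n k s)) \<le> K * (C * (a * s) ^ n / fact n)" by simp
        qed
        also have "\<dots> = K * (C * a ^ n * t ^ Suc n / fact (Suc n))" unfolding integral_unique[OF ft] by (simp add: d_def)
        finally show ?thesis .
      qed
      have "D (Suc n) t \<le> (\<Sum>i\<in>I. K * (C * a ^ n * t ^ Suc n / fact (Suc n)))"
        unfolding D_def by (rule sum_mono) (rule step)
      also have "\<dots> = a * (C * a ^ n * t ^ Suc n / fact (Suc n))" by (simp add: a_def)
      also have "\<dots> = C * (a * t) ^ Suc n / fact (Suc n)" by (simp add: power_mult_distrib)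
      finally show ?case .
    qed
    define B where "B n = C * ((a * T) ^ n /\<^sub>R fact n)" for n
    have sB: "summable B" unfolding B_def by (intro summable_mult summable_exp_generic)
    have "uniform_limit {0..T} (\<lambda>n t. \<Sum>i<n. X (Suc i) j t - X i j t) (\<lambda>t. \<Sum>i. X (Suc i) j t - X i j t) sequentially"
    proof (rule Weierstrass_m_test[OF _ sB])
      fix n t assume t: "t \<in> {0..T}"
      have "\<bar>X (Suc n) j t - X n j t\<bar> \<le> D n t" unfolding D_def using fin j by (intro member_le_sum[where f="\<lambda>i. \<bar>X (Suc n) i t - X n i t\<bar>"]) auto
      also have "\<dots> \<le> C * (a * t) ^ n / fact n" by (rule Db[OF t])
      also have "\<dots> \<le> C * (a * T) ^ n / fact n"
        using t a0 C(2) by (intro divide_right_mono mult_left_mono power_mono) auto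
      finally show "norm (X (Suc n) j t - X n j t) \<le> B n" by (simp add: B_def divide_inverse mult_ac)
    qed
    moreover have "(\<Sum>i<n. X (Suc i) j t - X i j t) = X n j t" for n t
      by (subst sum_lessThan_telescope) (simp add: X0)
    ultimately show ?thesis by (simp add: Y_def[abs_def])
  qed
  have Yc: "continuous_on {0..} (Y j)" if j: "j \<in> I" for j
  proof (rule continuous_on_halfline)
    fix T :: real assume T: "T > 0"
    have "\<forall>\<^sub>F n in sequentially. continuous_on {0..T} (X n j)"
      by (intro always_eventually allI continuous_on_subset[OF Xc[OF j]]) auto
    then show "continuous_on {0..T} (Y j)" by (rule uniform_limit_theorem[OF _ unif[OF T j]]) simp
  qed
  have Yint: "Y j t = integral {0..t} (\<lambda>s. g j s (\<lambda>k. Y k s))" if j: "j \<in> I" and t: "t \<ge> 0" for j t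
  proof -
    define T where "T = t + 1"
    have T: "T > 0" "t \<in> {0..T}" using t by (auto simp: T_def)
    obtain K where K: "K \<ge> 0" "\<And>s i x y. s \<in> {0..T} \<Longrightarrow> i \<in> I \<Longrightarrow> \<bar>g i s x - g i s y\<bar> \<le> K * (\<Sum>k\<in>I. \<bar>x k - y k\<bar>)"
      using lip[OF T(1)] by blast
    have gY: "(\<lambda>s. g j s (\<lambda>k. Y k s)) integrable_on {0..t}"
      by (rule integrable_continuous_real[OF continuous_on_subset[OF cont[OF j Yc]]]) auto
    have "(\<lambda>n. X (Suc n) j t) \<longlonglongrightarrow> Y j t"
      using tendsto_uniform_limitI[OF unif[OF T(1) j] T(2)] by (rule LIMSEQ_Suc)
    moreover have "(\<lambda>n. X (Suc n) j t) \<longlonglongrightarrow> integral {0..t} (\<lambda>s. g j s (\<lambda>k. Y k s))"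
    proof (rule LIMSEQ_I)
      fix e :: real assume e: "e > 0"
      \<comment> \<open>The added 1 keeps \<open>m\<close> positive and makes the final estimate
        strict.\<close>
      define m where "m = K * real (card I) * T + 1"
      have m: "m > 0" using K T by (simp add: m_def add_nonneg_pos)
      have "\<forall>\<^sub>F n in sequentially. \<forall>k\<in>I. \<forall>s\<in>{0..T}. dist (X n k s) (Y k s) < e / m"
        using fin by (intro eventually_ball_finite) (auto intro!: uniform_limitD[OF unif[OF T(1)]] simp: e m)
      then obtain n0 where "\<forall>n\<ge>n0. \<forall>k\<in>I. \<forall>s\<in>{0..T}. \<bar>X n k s - Y k s\<bar> < e / m"
        unfolding eventually_sequentially dist_real_def by blast
      then have n0: "\<bar>X n k s - Y k s\<bar> < e / m" if "n \<ge> n0" "k \<in> I" "s \<in> {0..T}" for n k s using that by blast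
      have "\<bar>X (Suc n) j t - integral {0..t} (\<lambda>s. g j s (\<lambda>k. Y k s))\<bar> < e" if n: "n \<ge> n0" for n
      proof -
        have "X (Suc n) j t - integral {0..t} (\<lambda>s. g j s (\<lambda>k. Y k s)) = integral {0..t} (\<lambda>s. g j s (\<lambda>k. X n k s) - g j s (\<lambda>k. Y k s))"
          unfolding XS by (rule Henstock_Kurzweil_Integration.integral_diff[symmetric, OF gint[OF j] gY])
        also have "\<bar>\<dots>\<bar> \<le> integral {0..t} (\<lambda>s. K * (real (card I) * (e / m)))"
          unfolding real_norm_def[symmetric]
        proof (rule integral_norm_bound_integral)
          show "(\<lambda>s. g j s (\<lambda>k. X n k s) - g j s (\<lambda>k. Y k s)) integrable_on {0..t}"
            by (rule integrable_diff[OF gint[OF j] gY])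
          fix s assume s: "s \<in> {0..t}"
          then have sT: "s \<in> {0..T}" by (auto simp: T_def)
          have "\<bar>g j s (\<lambda>k. X n k s) - g j s (\<lambda>k. Y k s)\<bar> \<le> K * (\<Sum>k\<in>I. \<bar>X n k s - Y k s\<bar>)"
            by (rule K(2)[OF sT j])
          also have "\<dots> \<le> K * (\<Sum>k\<in>I. e / m)"
            using n0[OF n _ sT] K(1) by (intro mult_left_mono sum_mono) (auto intro: less_imp_le)
          finally show "norm (g j s (\<lambda>k. X n k s) - g j s (\<lambda>k. Y k s)) \<le> K * (real (card I) * (e / m))" by simp
        qed (rule integrable_const_ivl)
        also have "\<dots> = (K * real (card I) * t) * (e / m)" using t by simp
        also have "\<dots> \<le> (K * real (card I) * T) * (e / m)"
          using t K e m by (intro mult_right_mono mult_left_mono) (auto simp: T_def)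
        also have "\<dots> < m * (e / m)" using e m by (intro mult_strict_right_mono) (auto simp: m_def)
        also have "\<dots> = e" using m by simp
        finally show ?thesis .
      qed
      then show "\<exists>no. \<forall>n\<ge>no. norm (X (Suc n) j t - integral {0..t} (\<lambda>s. g j s (\<lambda>k. Y k s))) < e" by auto
    qed
    ultimately show ?thesis by (rule LIMSEQ_unique)
  qed
  show ?thesis using Yc Yint by blast
qed

text \<open>The map is the radial retraction onto the ball of radius \<open>R\<close>. A difference
  splits into the change of the vector and the change of the scaling factor, each at most the
  Euclidean distance; hence the 2.\<close>

lemma radial_truncation_Lipschitz:
  fixes y z :: "nat \<Rightarrow> real"
  assumes R: "R > 0" and I: "finite I" "k \<in> I"
  defines "\<pi> \<equiv> \<lambda>y k. R / max R (L2_set y I) * y k"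
  shows "\<bar>\<pi> y k\<bar> \<le> R" "\<bar>\<pi> y k - \<pi> z k\<bar> \<le> 2 * (\<Sum>i\<in>I. \<bar>y i - z i\<bar>)"
proof -
  have mem: "\<bar>y k\<bar> \<le> L2_set y I" for y :: "nat \<Rightarrow> real" using member_le_L2_set[OF I, of "\<lambda>i. \<bar>y i\<bar>"] by (simp add: L2_set_def)
  define p q where "p = max R (L2_set y I)" and "q = max R (L2_set z I)"
  have pq: "p > 0" "q > 0" "R \<le> p" "R \<le> q" using R by (auto simp: p_def q_def)
  have "\<bar>\<pi> y k\<bar> = R / p * \<bar>y k\<bar>" using R pq by (simp add: \<pi>_def p_def abs_mult)
  also have "\<dots> \<le> R / p * p" using mem[of y] R pq by (intro mult_left_mono) (auto simp: p_def)
  finally show "\<bar>\<pi> y k\<bar> \<le> R" using pq by simp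
  define D where "D = L2_set (\<lambda>i. y i - z i) I"
  have D1: "D \<le> (\<Sum>i\<in>I. \<bar>y i - z i\<bar>)" unfolding D_def by (rule L2_set_le_sum_abs)
  have tri: "\<bar>L2_set y I - L2_set z I\<bar> \<le> D"
  proof -
    have "L2_set y I \<le> D + L2_set z I"
      using L2_set_triangle_ineq[of "\<lambda>i. y i - z i" z I] by (simp add: D_def)
    moreover have "L2_set z I \<le> D + L2_set y I"
      using L2_set_triangle_ineq[of "\<lambda>i. z i - y i" y I]
      by (simp add: D_def L2_set_def power2_commute)
    ultimately show ?thesis by linarith
  qed
  have "\<pi> y k - \<pi> z k = R / p * (y k - z k) + (R / p - R / q) * z k"
  proof -
    have "c * s - d * t = c * (s - t) + (c - d) * t" for c d s t :: real by (simp add: algebra_simps)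
    then show ?thesis unfolding \<pi>_def p_def q_def by blast
  qed
  also have "\<bar>\<dots>\<bar> \<le> \<bar>R / p * (y k - z k)\<bar> + \<bar>(R / p - R / q) * z k\<bar>" by (rule abs_triangle_ineq)
  also have "\<bar>R / p * (y k - z k)\<bar> \<le> D"
  proof -
    have "\<bar>R / p * (y k - z k)\<bar> = R / p * \<bar>y k - z k\<bar>" using R pq by (simp add: abs_mult)
    also have "\<dots> \<le> 1 * D" using R pq mem[of "\<lambda>i. y i - z i"] by (intro mult_mono) (auto simp: D_def)
    finally show ?thesis by simp
  qed
  also have "\<bar>(R / p - R / q) * z k\<bar> \<le> D"
  proof -
    have "(R / p - R / q) * z k = R / p * ((q - p) * (z k / q))" using pq by (simp add: field_simps)
    then have "\<bar>(R / p - R / q) * z k\<bar> = R / p * (\<bar>q - p\<bar> * (\<bar>z k\<bar> / q))" using R pq by (simp add: abs_mult)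
    also have "\<dots> \<le> 1 * (\<bar>q - p\<bar> * 1)"
      using R pq mem[of z] by (intro mult_mono) (auto simp: q_def divide_le_eq)
    also have "\<bar>q - p\<bar> \<le> D" using tri by (auto simp: p_def q_def max_def abs_le_iff)
    finally show ?thesis by simp
  qed
  finally show "\<bar>\<pi> y k - \<pi> z k\<bar> \<le> 2 * (\<Sum>i\<in>I. \<bar>y i - z i\<bar>)" using D1 by simp
qed

text \<open>The quadratic term is cut off outside a ball whose radius \<open>R s\<close> is the a priori bound for the
  solution; the cut-off is radial and therefore respects the cancellation \<open>energy\<close>.\<close>

lemma quadratic_ode_solution:
  fixes A :: "nat \<Rightarrow> nat \<Rightarrow> real" and \<beta> :: "nat \<Rightarrow> nat \<Rightarrow> nat \<Rightarrow> real" and F :: "nat \<Rightarrow> real \<Rightarrow> real"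
  assumes I: "finite I" and F: "\<And>j. j \<in> I \<Longrightarrow> continuous_on {0..} (F j)"
    and energy: "\<And>x z. (\<Sum>j\<in>I. z j * (\<Sum>k\<in>I. \<Sum>l\<in>I. \<beta> k l j * (x k * z l))) = 0"
  shows "\<exists>c. \<forall>j\<in>I. continuous_on {0..} (c j) \<and> (\<forall>t\<ge>0. c j t = F j t +
     integral {0..t} (\<lambda>s. (\<Sum>k\<in>I. A j k * c k s) + (\<Sum>k\<in>I. \<Sum>l\<in>I. \<beta> k l j * (c k s * c l s))))"
proof -
  define b where "b j x z = (\<Sum>k\<in>I. \<Sum>l\<in>I. \<beta> k l j * (x k * z l))" for j and x z :: "nat \<Rightarrow> real"
  define Ab where "Ab = (\<Sum>j\<in>I. \<Sum>k\<in>I. \<bar>A j k\<bar>)"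
  define Bb where "Bb = (\<Sum>j\<in>I. \<Sum>k\<in>I. \<Sum>l\<in>I. \<bar>\<beta> k l j\<bar>)"
  have Ab0: "Ab \<ge> 0" "Bb \<ge> 0" unfolding Ab_def Bb_def by (intro sum_nonneg; simp)+
  have Aj: "(\<Sum>k\<in>I. \<bar>A j k\<bar>) \<le> Ab" if "j \<in> I" for j
    unfolding Ab_def using I that by (intro member_le_sum[where f="\<lambda>j. \<Sum>k\<in>I. \<bar>A j k\<bar>"]) (auto intro: sum_nonneg)
  have Bj: "(\<Sum>k\<in>I. \<Sum>l\<in>I. \<bar>\<beta> k l j\<bar>) \<le> Bb" if "j \<in> I" for j
    unfolding Bb_def using I that by (intro member_le_sum[where f="\<lambda>j. \<Sum>k\<in>I. \<Sum>l\<in>I. \<bar>\<beta> k l j\<bar>"]) (auto intro!: sum_nonneg)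
  have A_bd: "\<bar>\<Sum>k\<in>I. A j k * x k\<bar> \<le> Ab * m" if "j \<in> I" "\<And>k. k \<in> I \<Longrightarrow> \<bar>x k\<bar> \<le> m" "m \<ge> 0" for j x m
  proof -
    have "\<bar>\<Sum>k\<in>I. A j k * x k\<bar> \<le> (\<Sum>k\<in>I. \<bar>A j k\<bar> * m)"
      by (intro order_trans[OF sum_abs] sum_mono) (simp add: abs_mult that mult_left_mono)
    also have "\<dots> \<le> Ab * m" unfolding sum_distrib_right[symmetric] using Aj that by (intro mult_right_mono) auto
    finally show ?thesis .
  qed
  have b_bd: "\<bar>\<Sum>k\<in>I. \<Sum>l\<in>I. \<beta> k l j * w k l\<bar> \<le> Bb * m" if "j \<in> I" "\<And>k l. k \<in> I \<Longrightarrow> l \<in> I \<Longrightarrow> \<bar>w k l\<bar> \<le> m" "m \<ge> 0" for j w m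
  proof -
    have "\<bar>\<Sum>k\<in>I. \<Sum>l\<in>I. \<beta> k l j * w k l\<bar> \<le> (\<Sum>k\<in>I. \<Sum>l\<in>I. \<bar>\<beta> k l j\<bar> * m)"
      by (rule order_trans[OF sum_abs], rule sum_mono, rule order_trans[OF sum_abs], rule sum_mono)
        (simp add: abs_mult that mult_left_mono)
    also have "\<dots> \<le> Bb * m" unfolding sum_distrib_right[symmetric] using Bj that by (intro mult_right_mono) auto
    finally show ?thesis .
  qed
  define Fb where "Fb s = (\<Sum>k\<in>I. \<bar>F k s\<bar>)" for s
  have Fb: "Fb s \<ge> 0" "k \<in> I \<Longrightarrow> \<bar>F k s\<bar> \<le> Fb s" for s k
    unfolding Fb_def using I by (auto intro: sum_nonneg member_le_sum[where f="\<lambda>k. \<bar>F k s\<bar>"])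
  have Fbc: "continuous_on {0..} Fb" unfolding Fb_def by (intro continuous_intros F)
  \<comment> \<open>This rate is what the energy computation below produces for \<open>E\<close>;
    the radius of the cut-off is the exponential of its primitive, so that the bound closes on
    itself.\<close>
  define \<gamma> where "\<gamma> s = 2 * ((Ab + Bb * Fb s) * (1 + Fb s))" for s
  have \<gamma>c: "continuous_on {0..} \<gamma>" unfolding \<gamma>_def by (intro continuous_intros Fbc)
  define \<Gamma> where "\<Gamma> t = integral {0..t} \<gamma>" for t
  have \<Gamma>c: "continuous_on {0..} \<Gamma>" unfolding \<Gamma>_def by (rule continuous_on_integral_halfline[OF \<gamma>c])
  define R where "R t = exp (\<Gamma> t)" for t
  have Rc: "continuous_on {0..} R" unfolding R_def by (intro continuous_intros \<Gamma>c)
  have R0: "R t > 0" for t by (simp add: R_def)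
  define \<pi> where "\<pi> s y k = R s / max (R s) (L2_set y I) * y k" for s y k
  have \<pi>1: "\<bar>\<pi> s y k\<bar> \<le> R s" and \<pi>2: "\<bar>\<pi> s y k - \<pi> s z k\<bar> \<le> 2 * (\<Sum>i\<in>I. \<bar>y i - z i\<bar>)" if "k \<in> I" for s y z k
    using radial_truncation_Lipschitz[OF R0 I that] by (simp_all add: \<pi>_def)
  \<comment> \<open>The unknown is the solution minus \<open>F\<close>, so that forcing enters only
    through its continuous primitive. The second argument of the quadratic term is split: the part
    in \<open>\<pi> s y\<close> cancels in the energy, while the part in \<open>F\<close> grows only
    linearly in the unknown.\<close>
  define g where "g j s y = (\<Sum>k\<in>I. A j k * (y k + F k s)) + b j (\<lambda>k. \<pi> s y k + F k s) (\<pi> s y)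
      + b j (\<lambda>k. \<pi> s y k + F k s) (\<lambda>l. F l s)" for j s y
  have "\<exists>Y. \<forall>j\<in>I. continuous_on {0..} (Y j) \<and> (\<forall>t\<ge>0. Y j t = integral {0..t} (\<lambda>s. g j s (\<lambda>k. Y k s)))"
  proof (rule Picard[OF I])
    fix X :: "nat \<Rightarrow> real \<Rightarrow> real" and j assume j: "j \<in> I" and X: "\<And>k. k \<in> I \<Longrightarrow> continuous_on {0..} (X k)"
    have "continuous_on {0..} (\<lambda>s. L2_set (\<lambda>k. X k s) I)" unfolding L2_set_def by (intro continuous_intros X)
    moreover have "max (R s) r \<noteq> 0" for s r using R0[of s] by (auto simp: max_def)
    ultimately have "continuous_on {0..} (\<lambda>s. \<pi> s (\<lambda>k. X k s) k)" if "k \<in> I" for k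
      unfolding \<pi>_def by (intro continuous_intros Rc X that) auto
    then show "continuous_on {0..} (\<lambda>s. g j s (\<lambda>k. X k s))"
      unfolding g_def b_def by (intro continuous_intros F X)
  next
    fix T :: real assume T: "T > 0"
    have bdd: "\<exists>M\<ge>0. \<forall>s\<in>{0..T}. \<bar>f s\<bar> \<le> M" if "continuous_on {0..} f" for f :: "real \<Rightarrow> real"
    proof -
      have "compact (f ` {0..T})" using that by (intro compact_continuous_image continuous_on_subset[OF that]) auto
      then have "bounded (f ` {0..T})" by (rule compact_imp_bounded)
      then obtain M where "M > 0" "\<forall>s\<in>{0..T}. \<bar>f s\<bar> \<le> M" by (force simp: bounded_pos)
      then show ?thesis by (intro exI[of _ M]) auto
    qed
    obtain M1 where M1: "M1 \<ge> 0" "\<And>s. s \<in> {0..T} \<Longrightarrow> \<bar>R s\<bar> \<le> M1" using bdd[OF Rc] by blast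
    obtain M2 where M2: "M2 \<ge> 0" "\<And>s. s \<in> {0..T} \<Longrightarrow> \<bar>Fb s\<bar> \<le> M2" using bdd[OF Fbc] by blast
    define K where "K = Ab + Bb * (4 * M1 + 4 * M2)"
    show "\<exists>K\<ge>0. \<forall>s\<in>{0..T}. \<forall>j\<in>I. \<forall>x y. \<bar>g j s x - g j s y\<bar> \<le> K * (\<Sum>k\<in>I. \<bar>x k - y k\<bar>)"
    proof (intro exI[of _ K] conjI ballI allI)
      show "K \<ge> 0" using Ab0 M1 M2 by (simp add: K_def)
      fix s j and x y :: "nat \<Rightarrow> real" assume s: "s \<in> {0..T}" and j: "j \<in> I"
      define D where "D = (\<Sum>k\<in>I. \<bar>x k - y k\<bar>)"
      have D: "D \<ge> 0" "k \<in> I \<Longrightarrow> \<bar>x k - y k\<bar> \<le> D" for k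
        unfolding D_def using I by (auto intro: sum_nonneg member_le_sum[where f="\<lambda>k. \<bar>x k - y k\<bar>"])
      define u v where "u = \<pi> s x" and "v = \<pi> s y"
      have uv: "\<bar>u k\<bar> \<le> M1" "\<bar>v k\<bar> \<le> M1" "\<bar>u k - v k\<bar> \<le> 2 * D" "\<bar>F k s\<bar> \<le> M2" if "k \<in> I" for k
        using \<pi>1[OF that, of s x] \<pi>1[OF that, of s y] \<pi>2[OF that, of s x y] M1(2)[OF s] M2(2)[OF s] Fb(2)[OF that, of s]
        by (auto simp: u_def v_def D_def abs_le_iff)
      have 1: "(\<Sum>k\<in>I. A j k * (x k + F k s)) - (\<Sum>k\<in>I. A j k * (y k + F k s)) = (\<Sum>k\<in>I. A j k * (x k - y k))"
        unfolding sum_subtractf[symmetric] by (rule sum.cong[OF refl]) (simp add: algebra_simps)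
      have alg2: "w * ((p + f) * p') - w * ((q + f) * q') = w * ((p - q) * p' + (q + f) * (p' - q'))" for w p f p' q q' :: real
        by (simp add: algebra_simps)
      have alg3: "w * ((p + f) * m) - w * ((q + f) * m) = w * ((p - q) * m)" for w p f q m :: real
        by (simp add: algebra_simps)
      have 2: "b j (\<lambda>k. u k + F k s) u - b j (\<lambda>k. v k + F k s) v = (\<Sum>k\<in>I. \<Sum>l\<in>I. \<beta> k l j * ((u k - v k) * u l + (v k + F k s) * (u l - v l)))"
        unfolding b_def
        by (subst sum_subtractf[symmetric], rule sum.cong[OF refl], subst sum_subtractf[symmetric], rule sum.cong[OF refl], rule alg2)
      have 3: "b j (\<lambda>k. u k + F k s) (\<lambda>l. F l s) - b j (\<lambda>k. v k + F k s) (\<lambda>l. F l s) = (\<Sum>k\<in>I. \<Sum>l\<in>I. \<beta> k l j * ((u k - v k) * F l s))"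
        unfolding b_def
        by (subst sum_subtractf[symmetric], rule sum.cong[OF refl], subst sum_subtractf[symmetric], rule sum.cong[OF refl], rule alg3)
      have "g j s x - g j s y = ((\<Sum>k\<in>I. A j k * (x k + F k s)) - (\<Sum>k\<in>I. A j k * (y k + F k s))) +
          (b j (\<lambda>k. u k + F k s) u - b j (\<lambda>k. v k + F k s) v) + (b j (\<lambda>k. u k + F k s) (\<lambda>l. F l s) - b j (\<lambda>k. v k + F k s) (\<lambda>l. F l s))"
        by (simp add: g_def u_def v_def)
      also have "\<dots> = (\<Sum>k\<in>I. A j k * (x k - y k)) +
         (\<Sum>k\<in>I. \<Sum>l\<in>I. \<beta> k l j * ((u k - v k) * u l + (v k + F k s) * (u l - v l))) + (\<Sum>k\<in>I. \<Sum>l\<in>I. \<beta> k l j * ((u k - v k) * F l s))"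
        by (simp only: 1 2 3)
      also have "\<bar>\<dots>\<bar> \<le> Ab * D + Bb * (2 * D * M1 + (M1 + M2) * (2 * D)) + Bb * (2 * D * M2)"
      proof (intro order_trans[OF abs_triangle_ineq add_mono])
        show "\<bar>\<Sum>k\<in>I. A j k * (x k - y k)\<bar> \<le> Ab * D" by (rule A_bd[OF j D(2) D(1)])
        show "\<bar>\<Sum>k\<in>I. \<Sum>l\<in>I. \<beta> k l j * ((u k - v k) * u l + (v k + F k s) * (u l - v l))\<bar> \<le> Bb * (2 * D * M1 + (M1 + M2) * (2 * D))"
        proof (rule b_bd[OF j])
          fix k l assume kl: "k \<in> I" "l \<in> I"
          have "\<bar>(u k - v k) * u l\<bar> \<le> 2 * D * M1" unfolding abs_mult
            by (rule mult_mono[OF uv(3)[OF kl(1)] uv(1)[OF kl(2)]]) (use D(1) in simp_all)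
          moreover have "\<bar>(v k + F k s) * (u l - v l)\<bar> \<le> (M1 + M2) * (2 * D)" unfolding abs_mult
            by (rule mult_mono[OF order_trans[OF abs_triangle_ineq add_mono[OF uv(2,4)[OF kl(1)]]] uv(3)[OF kl(2)]])
              (use M1(1) M2(1) in simp_all)
          ultimately show "\<bar>(u k - v k) * u l + (v k + F k s) * (u l - v l)\<bar> \<le> 2 * D * M1 + (M1 + M2) * (2 * D)" by linarith
        qed (use D M1 M2 in auto)
        show "\<bar>\<Sum>k\<in>I. \<Sum>l\<in>I. \<beta> k l j * ((u k - v k) * F l s)\<bar> \<le> Bb * (2 * D * M2)"
        proof (rule b_bd[OF j])
          fix k l assume kl: "k \<in> I" "l \<in> I"
          show "\<bar>(u k - v k) * F l s\<bar> \<le> 2 * D * M2" unfolding abs_mult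
            by (rule mult_mono[OF uv(3)[OF kl(1)] uv(4)[OF kl(2)]]) (use D(1) in simp_all)
        qed (use D M2 in auto)
      qed
      also have "\<dots> = K * D" by (simp add: K_def algebra_simps)
      finally show "\<bar>g j s x - g j s y\<bar> \<le> K * (\<Sum>k\<in>I. \<bar>x k - y k\<bar>)" by (simp add: D_def)
    qed
  qed
  then obtain Y where Yc: "\<And>j. j \<in> I \<Longrightarrow> continuous_on {0..} (Y j)"
    and Y: "\<And>j t. j \<in> I \<Longrightarrow> t \<ge> 0 \<Longrightarrow> Y j t = integral {0..t} (\<lambda>s. g j s (\<lambda>k. Y k s))" by blast
  have gY: "continuous_on {0..} (\<lambda>s. g j s (\<lambda>k. Y k s))" if j: "j \<in> I" for j
  proof -
    have "continuous_on {0..} (\<lambda>s. L2_set (\<lambda>k. Y k s) I)" unfolding L2_set_def by (intro continuous_intros Yc)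
    moreover have "max (R s) r \<noteq> 0" for s r using R0[of s] by (auto simp: max_def)
    ultimately have "continuous_on {0..} (\<lambda>s. \<pi> s (\<lambda>k. Y k s) k)" if "k \<in> I" for k
      unfolding \<pi>_def by (intro continuous_intros Rc Yc that) auto
    then show ?thesis unfolding g_def b_def by (intro continuous_intros F Yc)
  qed
  have Yd: "(Y j has_real_derivative g j t (\<lambda>k. Y k t)) (at t)" if "j \<in> I" "t > 0" for j t
  proof -
    have "((\<lambda>t. integral {0..t} (\<lambda>s. g j s (\<lambda>k. Y k s))) has_real_derivative g j t (\<lambda>k. Y k t)) (at t)"
      by (rule integral_halfline_derivative[OF gY[OF that(1)] that(2)])
    then show ?thesis
    proof (rule DERIV_cong_ev[THEN iffD1, rotated -1])
      show "\<forall>\<^sub>F x in nhds t. integral {0..x} (\<lambda>s. g j s (\<lambda>k. Y k s)) = Y j x"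
        using eventually_nhds_in_open[of "{0<..}" t] that by (auto elim!: eventually_mono simp: Y)
    qed auto
  qed
  \<comment> \<open>The summand 1 makes \<open>E\<close> dominate both the norm of \<open>Y\<close>
    and its square.\<close>
  define E where "E t = 1 + (\<Sum>j\<in>I. (Y j t)\<^sup>2)" for t
  have L2E: "L2_set (\<lambda>k. Y k t) I \<le> E t" "(L2_set (\<lambda>k. Y k t) I)\<^sup>2 \<le> E t" for t
  proof -
    define r where "r = L2_set (\<lambda>k. Y k t) I"
    have r: "r \<ge> 0" "E t = 1 + r\<^sup>2" by (simp_all add: r_def E_def L2_set_def sum_nonneg)
    then have "r\<^sup>2 \<le> E t" "r \<le> E t" using sum_squares_bound[of r 1] by simp_all
    then show "(L2_set (\<lambda>k. Y k t) I)\<^sup>2 \<le> E t" "L2_set (\<lambda>k. Y k t) I \<le> E t" by (simp_all add: r_def)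
  qed
  have ER: "E t \<le> R t" if t: "t \<ge> 0" for t
  proof -
    have "E t \<le> E 0 * exp (\<Gamma> t - \<Gamma> 0)"
    proof (rule gronwall_exp[OF t])
      show "continuous_on {0..t} E" unfolding E_def by (intro continuous_intros continuous_on_subset[OF Yc]) auto
      show "continuous_on {0..t} \<Gamma>" by (rule continuous_on_subset[OF \<Gamma>c]) auto
      fix s assume s: "0 < s" "s < t"
      show "(\<Gamma> has_real_derivative \<gamma> s) (at s)" unfolding \<Gamma>_def by (rule integral_halfline_derivative[OF \<gamma>c s(1)])
      define y where "y = (\<lambda>k. Y k s)"
      define r where "r = L2_set y I"
      have r: "r \<ge> 0" "r \<le> E s" "r * r \<le> E s"
        using L2E[of s] unfolding r_def y_def power2_eq_square by (auto intro: L2_set_nonneg)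
      have yr: "\<bar>y k\<bar> \<le> r" if "k \<in> I" for k unfolding r_def using member_le_L2_set[OF I that, of "\<lambda>i. \<bar>y i\<bar>"] by (simp add: L2_set_def)
      define \<theta> where "\<theta> = R s / max (R s) r"
      have \<theta>: "0 \<le> \<theta>" "\<theta> \<le> 1" using R0[of s] by (auto simp: \<theta>_def max_def divide_le_eq_1)
      have \<pi>y: "\<pi> s y = (\<lambda>k. \<theta> * y k)" by (simp add: \<pi>_def \<theta>_def r_def fun_eq_iff)
      have \<pi>r: "\<bar>\<pi> s y k\<bar> \<le> r" if "k \<in> I" for k
        unfolding \<pi>y abs_mult using \<theta> yr[OF that] mult_mono[of "\<bar>\<theta>\<bar>" 1 "\<bar>y k\<bar>" r] by simp
      have dE: "(E has_real_derivative (\<Sum>j\<in>I. 2 * (y j * g j s y))) (at s)"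
        unfolding E_def y_def by (auto intro!: derivative_eq_intros Yd s(1) sum.cong simp: mult_ac)
      \<comment> \<open>The cut-off multiplies \<open>y\<close> by one scalar
        \<open>\<theta>\<close>, which factors out and leaves the assumed identity.\<close>
      have en: "(\<Sum>j\<in>I. y j * b j (\<lambda>k. \<pi> s y k + F k s) (\<pi> s y)) = 0"
      proof -
        have "(\<Sum>j\<in>I. y j * b j (\<lambda>k. \<pi> s y k + F k s) (\<pi> s y)) = \<theta> * (\<Sum>j\<in>I. y j * (\<Sum>k\<in>I. \<Sum>l\<in>I. \<beta> k l j * ((\<pi> s y k + F k s) * y l)))"
          unfolding b_def \<pi>y by (simp add: sum_distrib_left mult_ac)
        then show ?thesis using energy[of y "\<lambda>k. \<pi> s y k + F k s"] by simp
      qed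
      have "(\<Sum>j\<in>I. y j * g j s y) = (\<Sum>j\<in>I. y j * (\<Sum>k\<in>I. A j k * (y k + F k s))) + (\<Sum>j\<in>I. y j * b j (\<lambda>k. \<pi> s y k + F k s) (\<lambda>l. F l s))"
        using en by (simp add: g_def distrib_left sum.distrib)
      also have "(\<Sum>j\<in>I. y j * (\<Sum>k\<in>I. A j k * (y k + F k s))) \<le> r * (Ab * (r + Fb s))"
      proof -
        have "\<bar>\<Sum>k\<in>I. A j k * (y k + F k s)\<bar> \<le> (\<Sum>k\<in>I. \<bar>A j k\<bar>) * (r + Fb s)" if "j \<in> I" for j
          unfolding sum_distrib_right
        proof (rule order_trans[OF sum_abs], rule sum_mono)
          fix k assume k: "k \<in> I"
          have "\<bar>y k + F k s\<bar> \<le> r + Fb s" by (rule order_trans[OF abs_triangle_ineq add_mono[OF yr[OF k] Fb(2)[OF k]]])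
          then show "\<bar>A j k * (y k + F k s)\<bar> \<le> \<bar>A j k\<bar> * (r + Fb s)" unfolding abs_mult by (rule mult_left_mono) simp
        qed
        then have "y j * (\<Sum>k\<in>I. A j k * (y k + F k s)) \<le> r * ((\<Sum>k\<in>I. \<bar>A j k\<bar>) * (r + Fb s))" if "j \<in> I" for j
          unfolding abs_mult using that yr[OF that] r(1)
          by (intro order_trans[OF abs_ge_self[of "y j * _"]], unfold abs_mult) (rule mult_mono; simp)
        then have "(\<Sum>j\<in>I. y j * (\<Sum>k\<in>I. A j k * (y k + F k s))) \<le> (\<Sum>j\<in>I. r * ((\<Sum>k\<in>I. \<bar>A j k\<bar>) * (r + Fb s)))" by (rule sum_mono)
        then show ?thesis by (simp add: Ab_def sum_distrib_left sum_distrib_right)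
      qed
      also have "(\<Sum>j\<in>I. y j * b j (\<lambda>k. \<pi> s y k + F k s) (\<lambda>l. F l s)) \<le> r * (Bb * ((r + Fb s) * Fb s))"
      proof -
        have "\<bar>b j (\<lambda>k. \<pi> s y k + F k s) (\<lambda>l. F l s)\<bar> \<le> (\<Sum>k\<in>I. \<Sum>l\<in>I. \<bar>\<beta> k l j\<bar>) * ((r + Fb s) * Fb s)" if "j \<in> I" for j
          unfolding sum_distrib_right b_def
        proof (rule order_trans[OF sum_abs], rule sum_mono, rule order_trans[OF sum_abs], rule sum_mono)
          fix k l assume k: "k \<in> I" "l \<in> I"
          have "\<bar>\<pi> s y k + F k s\<bar> \<le> r + Fb s" by (rule order_trans[OF abs_triangle_ineq add_mono[OF \<pi>r[OF k(1)] Fb(2)[OF k(1)]]])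
          then have "\<bar>\<pi> s y k + F k s\<bar> * \<bar>F l s\<bar> \<le> (r + Fb s) * Fb s"
            using r(1) Fb(1)[of s] Fb(2)[OF k(2), of s] by (intro mult_mono) auto
          then show "\<bar>\<beta> k l j * ((\<pi> s y k + F k s) * F l s)\<bar> \<le> \<bar>\<beta> k l j\<bar> * ((r + Fb s) * Fb s)"
            unfolding abs_mult by (rule mult_left_mono) simp
        qed
        then have "y j * b j (\<lambda>k. \<pi> s y k + F k s) (\<lambda>l. F l s) \<le> r * ((\<Sum>k\<in>I. \<Sum>l\<in>I. \<bar>\<beta> k l j\<bar>) * ((r + Fb s) * Fb s))" if "j \<in> I" for j
          unfolding abs_mult using that yr[OF that] r(1)
          by (intro order_trans[OF abs_ge_self[of "y j * _"]], unfold abs_mult) (rule mult_mono; simp)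
        then have "(\<Sum>j\<in>I. y j * b j (\<lambda>k. \<pi> s y k + F k s) (\<lambda>l. F l s)) \<le> (\<Sum>j\<in>I. r * ((\<Sum>k\<in>I. \<Sum>l\<in>I. \<bar>\<beta> k l j\<bar>) * ((r + Fb s) * Fb s)))" by (rule sum_mono)
        then show ?thesis by (simp add: Bb_def sum_distrib_left sum_distrib_right)
      qed
      finally have "(\<Sum>j\<in>I. y j * g j s y) \<le> (Ab + Bb * Fb s) * (r * (r + Fb s))" by (simp add: algebra_simps)
      also have "\<dots> \<le> (Ab + Bb * Fb s) * (E s * (1 + Fb s))"
      proof (rule mult_left_mono)
        show "r * (r + Fb s) \<le> E s * (1 + Fb s)"
          using r(3) mult_right_mono[OF r(2) Fb(1)[of s]] by (simp add: distrib_left)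
      qed (use Ab0 Fb in simp)
      also have "2 * \<dots> = \<gamma> s * E s" by (simp add: \<gamma>_def)
      finally have "(\<Sum>j\<in>I. 2 * (y j * g j s y)) \<le> \<gamma> s * E s" by (simp add: sum_distrib_left[symmetric])
      then show "\<exists>D. (E has_real_derivative D) (at s) \<and> D \<le> \<gamma> s * E s" using dE by blast
    qed
    moreover have "E 0 = 1" using Y by (simp add: E_def)
    ultimately show ?thesis by (simp add: R_def \<Gamma>_def)
  qed
  \<comment> \<open>The norm of \<open>Y\<close> never exceeds \<open>R\<close>, so the cut-off is
    inactive along the solution.\<close>
  have \<pi>Y: "\<pi> s (\<lambda>k. Y k s) = (\<lambda>k. Y k s)" if "s \<ge> 0" for s
  proof -
    have "max (R s) (L2_set (\<lambda>k. Y k s) I) = R s" using L2E(1)[of s] ER[OF that] by (intro max_absorb1) linarith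
    then show ?thesis using R0[of s] by (intro ext) (simp add: \<pi>_def)
  qed
  have gc: "g j s (\<lambda>k. Y k s) = (\<Sum>k\<in>I. A j k * (F k s + Y k s)) + (\<Sum>k\<in>I. \<Sum>l\<in>I. \<beta> k l j * ((F k s + Y k s) * (F l s + Y l s)))" if "s \<ge> 0" for s j
    unfolding g_def \<pi>Y[OF that] b_def by (simp add: algebra_simps sum.distrib)
  show ?thesis
  proof (intro exI[of _ "\<lambda>j t. F j t + Y j t"] ballI conjI allI impI)
    fix j assume j: "j \<in> I"
    show "continuous_on {0..} (\<lambda>t. F j t + Y j t)" by (intro continuous_intros F Yc j)
    fix t :: real assume t: "t \<ge> 0"
    have "Y j t = integral {0..t} (\<lambda>s. (\<Sum>k\<in>I. A j k * (F k s + Y k s)) + (\<Sum>k\<in>I. \<Sum>l\<in>I. \<beta> k l j * ((F k s + Y k s) * (F l s + Y l s))))"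
      unfolding Y[OF j t] by (rule integral_cong) (simp add: gc)
    then show "F j t + Y j t = F j t + integral {0..t} (\<lambda>s. (\<Sum>k\<in>I. A j k * (F k s + Y k s)) + (\<Sum>k\<in>I. \<Sum>l\<in>I. \<beta> k l j * ((F k s + Y k s) * (F l s + Y l s))))" by simp
  qed
qed

subsection \<open>Existence of the nudged solution\<close>

lemma AE_lebesgue_on_iff:
  assumes "S \<in> sets lebesgue"
  shows "(AE x in lebesgue_on S. P x) \<longleftrightarrow> (AE x in lebesgue. x \<in> S \<longrightarrow> P x)"
  using assms by (subst AE_restrict_space_iff) auto

text \<open>The hypothesis concerns open intervals starting at 0, whereas \<open>s\<close> may be 0;
  the endpoint is added as a separate integrable term.\<close>

lemma locally_integrable_ivl:
  fixes g :: "real \<Rightarrow> real"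
  assumes g: "\<And>T. T > 0 \<Longrightarrow> integrable (lebesgue_on {0<..<T}) g" and s: "0 \<le> s"
  shows "integrable (lebesgue_on {s..t}) g"
proof -
  define T where "T = \<bar>t\<bar> + 1"
  have T: "T > 0" "t < T" by (auto simp: T_def)
  have 1: "integrable lebesgue (\<lambda>x. indicat_real {0<..<T} x *\<^sub>R g x)"
    using g[OF T(1)] by (subst (asm) integrable_restrict_space) auto
  have 2: "integrable lebesgue (\<lambda>x. indicat_real {s..t} x *\<^sub>R (indicat_real {0<..<T} x *\<^sub>R g x))"
    by (rule integrable_mult_indicator[OF _ 1]) auto
  have 3: "integrable lebesgue (\<lambda>x. indicat_real {0} x * (indicat_real {s..t} 0 * g 0))"
    by (intro integrable_mult_left integrable_real_indicator) auto
  have "indicat_real {s..t} x *\<^sub>R g x = indicat_real {s..t} x *\<^sub>R (indicat_real {0<..<T} x *\<^sub>R g x) + indicat_real {0} x * (indicat_real {s..t} 0 * g 0)" for x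
    using s T(2) by (auto simp: indicator_def)
  then have "integrable lebesgue (\<lambda>x. indicat_real {s..t} x *\<^sub>R g x)"
    using Bochner_Integration.integrable_add[OF 2 3] by presburger
  then show ?thesis by (subst integrable_restrict_space) auto
qed

lemma locally_integrable_primitive:
  fixes g :: "real \<Rightarrow> real"
  assumes g: "\<And>T. T > 0 \<Longrightarrow> integrable (lebesgue_on {0<..<T}) g"
  shows "continuous_on {0..} (\<lambda>t. LINT r|lebesgue_on {0..t}. g r)"
    and "0 \<le> s \<Longrightarrow> s \<le> t \<Longrightarrow> (LINT r|lebesgue_on {0..t}. g r) - (LINT r|lebesgue_on {0..s}. g r) = (LINT r|lebesgue_on {s..t}. g r)"
proof -
  have eq: "(LINT r|lebesgue_on {s..t}. g r) = integral {s..t} g" and int: "g integrable_on {s..t}" if "0 \<le> s" for s t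
    using locally_integrable_ivl[OF g that, of t] by (auto intro!: lebesgue_integral_eq_integral integrable_on_lebesgue_on)
  have eq0: "(\<lambda>t. LINT r|lebesgue_on {0..t}. g r) = (\<lambda>t. integral {0..t} g)" using eq[of 0] by auto
  show "continuous_on {0..} (\<lambda>t. LINT r|lebesgue_on {0..t}. g r)"
    unfolding eq0 by (rule continuous_on_halfline, rule indefinite_integral_continuous_1, rule int) simp
  assume st: "0 \<le> s" "s \<le> t"
  have "integral {0..s} g + integral {s..t} g = integral {0..t} g"
    by (rule Henstock_Kurzweil_Integration.integral_combine) (use st int[of 0] in auto)
  then show "(LINT r|lebesgue_on {0..t}. g r) - (LINT r|lebesgue_on {0..s}. g r) = (LINT r|lebesgue_on {s..t}. g r)"
    using st by (simp add: eq)
qed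

lemma continuous_halfline_sqint:
  fixes g :: "real \<Rightarrow> real"
  assumes "continuous_on {0..} g" "T > 0"
  shows "sqint (lebesgue_on {0<..<T}) g"
proof -
  interpret finite_measure "lebesgue_on {0<..<T}" by (rule finite_measure_lebesgue_on) simp
  have "compact (g ` {0..T})" by (intro compact_continuous_image continuous_on_subset[OF assms(1)]) auto
  then have "bounded (g ` {0..T})" by (rule compact_imp_bounded)
  then obtain C where C: "\<And>t. t \<in> {0..T} \<Longrightarrow> \<bar>g t\<bar> \<le> C" by (force simp: bounded_iff)
  show ?thesis
  proof (rule sqint_bounded)
    show "g \<in> borel_measurable (lebesgue_on {0<..<T})"
      by (rule continuous_imp_measurable_on_sets_lebesgue[OF continuous_on_subset[OF assms(1)]]) auto
    show "AE x in lebesgue_on {0<..<T}. norm (g x) \<le> C" using C by (intro AE_I2) auto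
  qed
qed

lemma measurable_lebesgue_on_subset:
  "f \<in> borel_measurable (lebesgue_on S) \<Longrightarrow> T \<subseteq> S \<Longrightarrow> T \<in> sets lebesgue \<Longrightarrow> f \<in> borel_measurable (lebesgue_on T)"
  using measurable_restrict_mono by blast

lemma l2_norm_le_v_norm: "v_norm L u \<ge> l2_norm L u"
  unfolding v_norm_def by (rule real_le_rsqrt) (simp add: sum_nonneg)

context stokes_basis
begin

lemma projN_eq: "projN L \<phi> N g = comb {1..N} (cf g)"
  by (simp add: projN_def comb_def fun_eq_iff)

lemma tri_comb:
  assumes F: "finite F" "F \<subseteq> {1..}" and j: "j \<ge> 1"
  shows "tri (comb F x) (comb F z) j = (\<Sum>k\<in>F. \<Sum>l\<in>F. tri (\<phi> k) (\<phi> l) j * (x k * z l))"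
proof -
  have c: "continuous_on UNIV (\<phi> k)" if "k \<in> F" for k using that F by (intro phi_continuous) auto
  have "(\<Sum>i\<in>UNIV. comb F x y $ i * (comb F z y \<bullet> dphi j i y)) = (\<Sum>k\<in>F. \<Sum>l\<in>F. (x k * z l) * (\<Sum>i\<in>UNIV. \<phi> k y $ i * (\<phi> l y \<bullet> dphi j i y)))" for y
  proof -
    have "comb F x y $ i * (comb F z y \<bullet> dphi j i y) = (\<Sum>k\<in>F. \<Sum>l\<in>F. (x k * z l) * (\<phi> k y $ i * (\<phi> l y \<bullet> dphi j i y)))" for i
      by (simp add: comb_def inner_sum_left sum_product mult_ac)
    then show ?thesis by (simp add: sum_2 sum.distrib distrib_left)
  qed
  then have "tri (comb F x) (comb F z) j = (LINT y|Q. (\<Sum>k\<in>F. \<Sum>l\<in>F. (x k * z l) * (\<Sum>i\<in>UNIV. \<phi> k y $ i * (\<phi> l y \<bullet> dphi j i y))))"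
    by (simp add: tri_def)
  also have "\<dots> = (\<Sum>k\<in>F. LINT y|Q. (\<Sum>l\<in>F. (x k * z l) * (\<Sum>i\<in>UNIV. \<phi> k y $ i * (\<phi> l y \<bullet> dphi j i y))))"
    by (rule Bochner_Integration.integral_sum) (intro Bochner_Integration.integrable_sum integrable_mult_right tri_integrable c j)
  also have "\<dots> = (\<Sum>k\<in>F. \<Sum>l\<in>F. LINT y|Q. (x k * z l) * (\<Sum>i\<in>UNIV. \<phi> k y $ i * (\<phi> l y \<bullet> dphi j i y)))"
    by (intro sum.cong refl Bochner_Integration.integral_sum integrable_mult_right tri_integrable c j)
  finally show ?thesis by (simp add: tri_def mult.commute)
qed

lemma cf_bilin_continuous:
  assumes u: "u \<in> domA L" and U: "continuous_on UNIV U" "AE x in Q. u x = U x" and j: "j \<ge> 1"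
  shows "cf (bilin L u u) j = - tri U U j"
proof -
  have d: "dsum (cf u) (l2_norm L (stokes L u))" by (rule dsum_domA[OF u])
  have s: "continuous_on UNIV (ser (cf u))" by (rule ser_continuous[OF d])
  have "AE x in Q. u x = ser (cf u) x" by (rule AE_eq_ser[OF domA_H1per(3)[OF u] d])
  then have "AE x in Q. ser (cf u) x = U x" using U(2) by eventually_elim simp
  then have "tri (ser (cf u)) (ser (cf u)) j = tri U U j"
    by (intro tri_cong_AE continuous_imp_sqint_square s U j)
  then show ?thesis using cf_bilin(2)[OF u j] by simp
qed

lemma ns_cf_continuous:
  assumes "ns_solution L \<nu> f u0 u" and j: "j \<ge> 1"
  shows "continuous_on {0..} (\<lambda>t. cf (u t) j)"
proof -
  have V: "u t \<in> spaceV L" "((\<lambda>s. v_norm L (\<lambda>x. u s x - u t x)) \<longlongrightarrow> 0) (at t within {0..})" if "t \<ge> 0" for t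
    using assms(1) that by (auto simp: ns_solution_def)
  have H: "sqint Q (u t)" if "t \<ge> 0" for t using V(1)[OF that] by (auto simp: spaceV_def intro: spaceH_sqint)
  have n1: "l2_norm L (\<phi> j) = 1" using phi_orthonormal[OF j j] by (simp add: l2_norm_def)
  have "((\<lambda>s. cf (u s) j) \<longlongrightarrow> cf (u t) j) (at t within {0..})" if t: "t \<ge> 0" for t
  proof (rule LIM_zero_cancel, rule Lim_null_comparison[OF _ V(2)[OF t]])
    show "\<forall>\<^sub>F s in at t within {0..}. norm (cf (u s) j - cf (u t) j) \<le> v_norm L (\<lambda>x. u s x - u t x)"
      unfolding eventually_at_filter
    proof (intro always_eventually allI impI)
      fix s assume "s \<in> {0::real..}"
      then have s: "s \<ge> 0" by simp
      have "\<bar>cf (u s) j - cf (u t) j\<bar> = \<bar>cf (\<lambda>x. u s x - u t x) j\<bar>"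
        by (simp add: l2_inner_diff_left[OF H[OF s] H[OF t] phi_sqint[OF j]])
      also have "\<dots> \<le> l2_norm L (\<lambda>x. u s x - u t x) * l2_norm L (\<phi> j)"
        by (rule l2_inner_bound[OF sqint_diff[OF H[OF s] H[OF t]] phi_sqint[OF j]])
      also have "\<dots> \<le> v_norm L (\<lambda>x. u s x - u t x)" using l2_norm_le_v_norm n1 by simp
      finally show "norm (cf (u s) j - cf (u t) j) \<le> v_norm L (\<lambda>x. u s x - u t x)" by simp
    qed
  qed
  then show ?thesis by (auto simp: continuous_on_def)
qed

lemma Linf_cf_sqint:
  assumes "Linf_time L f" and j: "j \<ge> 1" and T: "T > 0"
  shows "sqint (lebesgue_on {0<..<T}) (\<lambda>t. cf (f t) j)"
proof -
  interpret finite_measure "lebesgue_on {0<..<T}" by (rule finite_measure_lebesgue_on) simp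
  obtain C where C: "AE t in lebesgue_on {0<..}. l2_norm L (f t) \<le> C" using assms(1) by (auto simp: Linf_time_def)
  have n1: "l2_norm L (\<phi> j) = 1" using phi_orthonormal[OF j j] by (simp add: l2_norm_def)
  show ?thesis
  proof (rule sqint_bounded)
    have "(\<lambda>t. cf (f t) j) \<in> borel_measurable (lebesgue_on {0<..})"
      using assms(1) phi_H[OF j] by (auto simp: Linf_time_def time_measurable_def)
    then show "(\<lambda>t. cf (f t) j) \<in> borel_measurable (lebesgue_on {0<..<T})"
      by (rule measurable_lebesgue_on_subset) auto
    have "AE t in lebesgue_on {0<..}. f t \<in> spaceH L" using assms(1) by (auto simp: Linf_time_def time_measurable_def)
    then have "AE t in lebesgue_on {0<..}. \<bar>cf (f t) j\<bar> \<le> C" using C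
    proof eventually_elim
      case (elim t)
      then show ?case using l2_inner_bound[OF spaceH_sqint[OF elim(1)] phi_sqint[OF j]] n1 by simp
    qed
    then show "AE t in lebesgue_on {0<..<T}. norm (cf (f t) j) \<le> C"
      by (subst AE_lebesgue_on_iff, simp, subst (asm) AE_lebesgue_on_iff, simp) (auto elim: eventually_mono)
  qed
qed

end

context observed
begin

text \<open>\<open>C\<close> may depend on \<open>h\<close> and \<open>j\<close>; this is enough for
  limits taken at fixed \<open>h\<close>.\<close>

lemma Jc_bound:
  assumes "h > 0" "j \<ge> 1"
  shows "\<exists>C\<ge>0. \<forall>f S. cbp f S \<longrightarrow> \<bar>Jc b h a f j\<bar> \<le> C * S"
proof -
  define V where "V c = (LINT x|lebesgue. indicat_real (cell h c \<inter> \<Omega>) x *\<^sub>R comb {j} (\<lambda>_. 1) x)" for c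
  show ?thesis
  proof (intro exI[of _ "\<Sum>c\<in>centres h a \<Omega>. norm (V c)"] conjI allI impI sum_nonneg norm_ge_zero)
    fix f S assume f: "cbp f S"
    have "\<bar>Jc b h a f j\<bar> \<le> (\<Sum>c\<in>centres h a \<Omega>. \<bar>cellval b h \<Omega> f c \<bullet> V c\<bar>)"
      unfolding Jc_single[OF assms] V_def by (rule sum_abs)
    also have "\<dots> \<le> (\<Sum>c\<in>centres h a \<Omega>. norm (V c) * S)"
    proof (rule sum_mono)
      fix c
      have "\<bar>cellval b h \<Omega> f c \<bullet> V c\<bar> \<le> norm (cellval b h \<Omega> f c) * norm (V c)" by (rule Cauchy_Schwarz_ineq2)
      also have "\<dots> \<le> S * norm (V c)" by (rule mult_right_mono[OF cellval_bound[OF assms(1) f]]) simp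
      finally show "\<bar>cellval b h \<Omega> f c \<bullet> V c\<bar> \<le> norm (V c) * S" by (simp add: mult.commute)
    qed
    finally show "\<bar>Jc b h a f j\<bar> \<le> (\<Sum>c\<in>centres h a \<Omega>. norm (V c)) * S" by (simp add: sum_distrib_right)
  qed
qed

lemma Jc_ser_diff:
  assumes h: "h > 0" and c: "dsum c K" and j: "j \<ge> 1"
    and C: "\<And>f S. cbp f S \<Longrightarrow> \<bar>Jc b h a f j\<bar> \<le> C * S"
    and e: "\<And>x. norm (ser c x - comb {1..n} c x) \<le> e"
  shows "\<bar>Jc b h a (ser c) j - (\<Sum>k\<in>{1..n}. c k * Jc b h a (\<phi> k) j)\<bar> \<le> C * e"
proof -
  obtain S where S: "cbp (comb {1..n} c) S" using cbp_comb[of "{1..n}" c] by auto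
  have d: "cbp (\<lambda>x. ser c x - comb {1..n} c x) e"
    using S cbp_ser[OF c] e by (auto simp: cbp_def periodic_def intro: continuous_intros)
  have "Jc b h a (ser c) j = Jc b h a (\<lambda>x. (ser c x - comb {1..n} c x) + comb {1..n} c x) j" by simp
  also have "\<dots> = Jc b h a (\<lambda>x. ser c x - comb {1..n} c x) j + Jc b h a (comb {1..n} c) j"
    by (rule Jc_add[OF h d S j])
  also have "Jc b h a (comb {1..n} c) j = (\<Sum>k\<in>{1..n}. c k * Jc b h a (\<phi> k) j)"
    by (rule Jc_comb[OF h _ _ j]) auto
  finally show ?thesis using C[OF d] by simp
qed

lemma Jc_ser_tendsto:
  assumes h: "h > 0" and c: "dsum c K" and j: "j \<ge> 1"
  shows "(\<lambda>n. \<Sum>k\<in>{1..n}. c k * Jc b h a (\<phi> k) j) \<longlonglongrightarrow> Jc b h a (ser c) j"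
proof (rule LIMSEQ_I)
  fix e :: real assume e: "e > 0"
  obtain C where C: "C \<ge> 0" "\<And>f S. cbp f S \<Longrightarrow> \<bar>Jc b h a f j\<bar> \<le> C * S" using Jc_bound[OF h j] by blast
  have e': "e / (C + 1) > 0" using e C by simp
  then obtain n0 where n0: "\<And>n x. n \<ge> n0 \<Longrightarrow> norm (ser c x - comb {1..n} c x) \<le> e / (C + 1)"
    using ser_uniform[OF c e'] by blast
  have "norm ((\<Sum>k\<in>{1..n}. c k * Jc b h a (\<phi> k) j) - Jc b h a (ser c) j) < e" if "n \<ge> n0" for n
  proof -
    have "\<bar>Jc b h a (ser c) j - (\<Sum>k\<in>{1..n}. c k * Jc b h a (\<phi> k) j)\<bar> \<le> C * (e / (C + 1))"
      by (rule Jc_ser_diff[OF h c j C(2) n0[OF that]])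
    also have "\<dots> < (C + 1) * (e / (C + 1))" using e' by (intro mult_strict_right_mono) auto
    also have "\<dots> = e" using C by simp
    finally show ?thesis by (simp add: abs_minus_commute)
  qed
  then show "\<exists>no. \<forall>n\<ge>no. norm ((\<Sum>k\<in>{1..n}. c k * Jc b h a (\<phi> k) j) - Jc b h a (ser c) j) < e" by blast
qed

text \<open>At almost every time \<open>u t\<close> lies in the domain of the Stokes operator and is observed through its
  continuous representative; there the observation is the limit of measurable functions of time.\<close>

lemma observation_sqint:
  assumes ns: "ns_solution L \<nu> f u0 u" and h: "h > 0" and j: "j \<ge> 1"
  shows "\<exists>q. (\<forall>T>0. sqint (lebesgue_on {0<..<T}) q) \<and> (AE t in lebesgue_on {0<..}. q t = Jc b h a (u t) j)"
proof -
  define q where "q t = lim (\<lambda>n. \<Sum>k\<in>{1..n}. cf (u t) k * Jc b h a (\<phi> k) j)" for t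
  have dom: "AE t in lebesgue_on {0<..}. u t \<in> domA L" using ns by (auto simp: ns_solution_def)
  have qJ: "q t = Jc b h a (ser (cf (u t))) j" if "u t \<in> domA L" for t
    unfolding q_def by (rule limI[OF Jc_ser_tendsto[OF h dsum_domA[OF that] j]])
  have qJ': "AE t in lebesgue_on {0<..}. q t = Jc b h a (u t) j"
    using dom
  proof eventually_elim
    case (elim t)
    show ?case using qJ[OF elim] Jc_ser[OF h domA_H1per(3)[OF elim] dsum_domA[OF elim]] by simp
  qed
  obtain C where C: "C \<ge> 0" "\<And>f S. cbp f S \<Longrightarrow> \<bar>Jc b h a f j\<bar> \<le> C * S" using Jc_bound[OF h j] by blast
  have "sqint (lebesgue_on {0<..<T}) q" if T: "T > 0" for T
    unfolding sqint_def
  proof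
    have "(\<lambda>t. cf (u t) k) \<in> borel_measurable (lebesgue_on {0<..<T})" if "k \<ge> 1" for k
      by (rule continuous_imp_measurable_on_sets_lebesgue[OF continuous_on_subset[OF ns_cf_continuous[OF ns that]]]) auto
    then show qm: "q \<in> borel_measurable (lebesgue_on {0<..<T})"
      unfolding q_def by (intro borel_measurable_lim_metric borel_measurable_sum borel_measurable_times borel_measurable_const) auto
    \<comment> \<open>The Stokes image is square integrable in time and dominates the observation
      through the supremum bound.\<close>
    have st: "integrable (lebesgue_on {0<..<T}) (\<lambda>t. (l2_norm L (stokes L (u t)))\<^sup>2)"
      using ns T by (auto simp: ns_solution_def L2_time_def)
    show "integrable (lebesgue_on {0<..<T}) (\<lambda>t. (norm (q t))\<^sup>2)"
    proof (rule Bochner_Integration.integrable_bound[OF integrable_mult_right[OF st, of "(C * weylC)\<^sup>2"]])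
      show "(\<lambda>t. (norm (q t))\<^sup>2) \<in> borel_measurable (lebesgue_on {0<..<T})" using qm by measurable
      have "AE t in lebesgue_on {0<..}. (norm (q t))\<^sup>2 \<le> (C * weylC)\<^sup>2 * (l2_norm L (stokes L (u t)))\<^sup>2"
        using dom
      proof eventually_elim
        case (elim t)
        have "\<bar>q t\<bar> \<le> C * (weylC * l2_norm L (stokes L (u t)))"
          unfolding qJ[OF elim] by (rule C(2)[OF cbp_ser[OF dsum_domA[OF elim]]])
        then have "\<bar>q t\<bar>\<^sup>2 \<le> (C * (weylC * l2_norm L (stokes L (u t))))\<^sup>2" by (rule power_mono) simp
        then show ?case by (simp add: power_mult_distrib)
      qed
      then show "AE t in lebesgue_on {0<..<T}. norm ((norm (q t))\<^sup>2) \<le> norm ((C * weylC)\<^sup>2 * (l2_norm L (stokes L (u t)))\<^sup>2)"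
        by (subst AE_lebesgue_on_iff, simp, subst (asm) AE_lebesgue_on_iff, simp) (auto elim: eventually_mono)
    qed
  qed
  then show ?thesis using qJ' by blast
qed

text \<open>For the coefficients the equation is a quadratic system whose forcing, from
  \<open>f\<close> and from the observation of \<open>u\<close>, is only square integrable in time.
  Its primitive \<open>F\<close> is continuous, and the antisymmetry of the trilinear form is the
  hypothesis \<open>energy\<close> of \<open>quadratic_ode_solution\<close>.\<close>

lemma nudged_solution_exists:
  assumes ns: "ns_solution L \<nu> f u0 u" and f: "Linf_time L f" and h: "h > 0"
    and J: "\<And>g. J g = comb {1..N} (Jc b h a g)"
  shows "\<exists>v. nudged_solution L \<nu> \<phi> N \<mu> J f u v"
proof -
  let ?I = "{1..N}"
  have I1: "j \<ge> 1" if "j \<in> ?I" for j using that by simp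
  have "\<forall>j. \<exists>q. j \<in> ?I \<longrightarrow> (\<forall>T>0. sqint (lebesgue_on {0<..<T}) q) \<and> (AE t in lebesgue_on {0<..}. q t = Jc b h a (u t) j)"
    using observation_sqint[OF ns h] by auto
  then obtain q where q: "\<And>j T. j \<in> ?I \<Longrightarrow> T > 0 \<Longrightarrow> sqint (lebesgue_on {0<..<T}) (q j)"
    "\<And>j. j \<in> ?I \<Longrightarrow> AE t in lebesgue_on {0<..}. q j t = Jc b h a (u t) j" by metis
  define k where "k j t = cf (f t) j + \<mu> * q j t" for j t
  have ks: "sqint (lebesgue_on {0<..<T}) (k j)" if "j \<in> ?I" "T > 0" for j T
    unfolding k_def using sqint_add[OF Linf_cf_sqint[OF f I1[OF that(1)] that(2)] sqint_scaleR[OF q(1)[OF that], of \<mu>]] by simp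
  have fin: "finite_measure (lebesgue_on {0<..<T :: real})" for T by (rule finite_measure_lebesgue_on) simp
  have ki: "integrable (lebesgue_on {0<..<T}) (k j)" if "j \<in> ?I" "T > 0" for j T
    by (rule finite_measure.sqint_integrable[OF fin ks[OF that]])
  define F where "F j t = (LINT r|lebesgue_on {0..t}. k j r)" for j t
  have Fc: "continuous_on {0..} (F j)" if "j \<in> ?I" for j
    unfolding F_def by (rule locally_integrable_primitive(1)[OF ki[OF that]])
  \<comment> \<open>The linear part consists of viscosity and the feedback of \<open>v\<close>
    itself; the observation of \<open>u\<close> went into \<open>k\<close>.\<close>
  define A where "A j l = (if l = j then - \<nu> * lam j else 0) - \<mu> * Jc b h a (\<phi> l) j" for j l
  define \<beta> where "\<beta> l m j = tri (\<phi> l) (\<phi> m) j" for l m j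
  have energy: "(\<Sum>j\<in>?I. z j * (\<Sum>l\<in>?I. \<Sum>m\<in>?I. \<beta> l m j * (x l * z m))) = 0" for x z
  proof -
    have "(\<Sum>j\<in>?I. z j * (\<Sum>l\<in>?I. \<Sum>m\<in>?I. \<beta> l m j * (x l * z m))) = (\<Sum>j\<in>?I. z j * tri (comb ?I x) (comb ?I z) j)"
      unfolding \<beta>_def by (intro sum.cong refl) (subst tri_comb; simp)
    also have "\<dots> = 0" by (rule tri_energy) (auto intro: comb_spaceH comb_continuous)
    finally show ?thesis .
  qed
  have fI: "finite ?I" by simp
  obtain c where c0: "\<forall>j\<in>?I. continuous_on {0..} (c j) \<and> (\<forall>t\<ge>0. c j t = F j t +
      integral {0..t} (\<lambda>s. (\<Sum>l\<in>?I. A j l * c l s) + (\<Sum>l\<in>?I. \<Sum>m\<in>?I. \<beta> l m j * (c l s * c m s))))"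
    using quadratic_ode_solution[of ?I F \<beta> A, OF fI Fc energy] by blast
  have cc: "continuous_on {0..} (c j)" if "j \<in> ?I" for j using c0 that by blast
  have c: "c j t = F j t + integral {0..t} (\<lambda>s. (\<Sum>l\<in>?I. A j l * c l s) + (\<Sum>l\<in>?I. \<Sum>m\<in>?I. \<beta> l m j * (c l s * c m s)))"
    if "j \<in> ?I" "t \<ge> 0" for j t using c0 that by blast
  define P where "P j s = (\<Sum>l\<in>?I. A j l * c l s) + (\<Sum>l\<in>?I. \<Sum>m\<in>?I. \<beta> l m j * (c l s * c m s))" for j s
  have Pc: "continuous_on {0..} (P j)" for j unfolding P_def by (intro continuous_intros cc)
  define G where "G j t = P j t + k j t" for j t
  have Gs: "sqint (lebesgue_on {0<..<T}) (G j)" if "j \<in> ?I" "T > 0" for j T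
    unfolding G_def by (rule sqint_add[OF continuous_halfline_sqint[OF Pc that(2)] ks[OF that]])
  have Gi: "integrable (lebesgue_on {0<..<T}) (G j)" if "j \<in> ?I" "T > 0" for j T
    by (rule finite_measure.sqint_integrable[OF fin Gs[OF that]])
  have Pi: "integrable (lebesgue_on {0<..<T}) (P j)" if "T > 0" for j T
    by (rule finite_measure.sqint_integrable[OF fin continuous_halfline_sqint[OF Pc that]])
  have cG: "c j t - c j s = (LINT r|lebesgue_on {s..t}. G j r)" if j: "j \<in> ?I" and st: "0 \<le> s" "s \<le> t" for j s t
  proof -
    have Pint: "integral {0..t} (P j) = (LINT r|lebesgue_on {0..t}. P j r)" for t
      by (rule lebesgue_integral_eq_integral[symmetric, OF locally_integrable_ivl[OF Pi]]) auto
    have "c j t - c j s = ((LINT r|lebesgue_on {0..t}. k j r) - (LINT r|lebesgue_on {0..s}. k j r)) + ((LINT r|lebesgue_on {0..t}. P j r) - (LINT r|lebesgue_on {0..s}. P j r))"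
      using c[OF j, of t] c[OF j, of s] st unfolding P_def[symmetric] F_def Pint by simp
    also have "\<dots> = (LINT r|lebesgue_on {s..t}. k j r) + (LINT r|lebesgue_on {s..t}. P j r)"
      by (simp only: locally_integrable_primitive(2)[OF ki[OF j] st] locally_integrable_primitive(2)[OF Pi st])
    also have "\<dots> = (LINT r|lebesgue_on {s..t}. G j r)"
      unfolding G_def
      by (subst Bochner_Integration.integral_add[OF locally_integrable_ivl[OF Pi st(1)] locally_integrable_ivl[OF ki[OF j] st(1)]]) auto
    finally show ?thesis .
  qed
  define v where "v t = comb ?I (\<lambda>j. c j t)" for t
  define dv where "dv t = comb ?I (\<lambda>j. G j t)" for t
  have ip: "l2_inner L (comb ?I d) w = (\<Sum>j\<in>?I. d j * cf w j)" if "w \<in> spaceH L" for w d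
    by (subst l2_inner_commute, rule inner_comb) (auto intro: spaceH_sqint that)
  show ?thesis
    unfolding nudged_solution_def
  proof (rule exI[of _ v], intro conjI allI impI exI[of _ dv])
    show "v t \<in> galerkin_space \<phi> N" for t
      unfolding galerkin_space_def v_def comb_def[abs_def] by (rule range_eqI) (rule refl)
    have "c j 0 = 0" if "j \<in> ?I" for j
    proof -
      have "F j 0 = integral {0..0} (k j)" unfolding F_def
        by (rule lebesgue_integral_eq_integral[OF locally_integrable_ivl[OF ki[OF that]]]) auto
      then show ?thesis using c[OF that, of 0] by simp
    qed
    then show "v 0 = (\<lambda>x. 0)" by (simp add: v_def comb_def fun_eq_iff)
    fix T :: real assume T: "T > 0"
    show "L2_time L T dv"
      unfolding L2_time_def time_measurable_def
    proof (intro conjI ballI)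
      show "AE t in lebesgue_on {0<..<T}. dv t \<in> spaceH L" unfolding dv_def by (intro AE_I2 comb_spaceH) auto
      show "(\<lambda>t. l2_inner L (dv t) w) \<in> borel_measurable (lebesgue_on {0<..<T})" if "w \<in> spaceH L" for w
        unfolding dv_def ip[OF that]
        by (intro borel_measurable_sum borel_measurable_times borel_measurable_const sqint_measurable[OF Gs[OF _ T]])
      have "(l2_norm L (dv t))\<^sup>2 = (\<Sum>j\<in>?I. (norm (G j t))\<^sup>2)" for t
        unfolding dv_def l2_norm_eq by (subst norm_comb) auto
      moreover have "integrable (lebesgue_on {0<..<T}) (\<lambda>t. \<Sum>j\<in>?I. (norm (G j t))\<^sup>2)"
        by (rule Bochner_Integration.integrable_sum) (use Gs[OF _ T] in \<open>blast dest: sqint_def[THEN iffD1]\<close>)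
      ultimately show "integrable (lebesgue_on {0<..<T}) (\<lambda>t. (l2_norm L (dv t))\<^sup>2)" by (simp only:)
    qed
  next
    show "has_time_derivative L v dv"
      unfolding has_time_derivative_def
    proof (intro ballI allI impI)
      fix w s t assume w: "w \<in> spaceH L" and st: "0 \<le> s \<and> s \<le> (t :: real)"
      have "l2_inner L (v t) w - l2_inner L (v s) w = (\<Sum>j\<in>?I. (c j t - c j s) * cf w j)"
        unfolding v_def ip[OF w] by (simp add: sum_subtractf left_diff_distrib)
      also have "\<dots> = (\<Sum>j\<in>?I. (LINT r|lebesgue_on {s..t}. G j r * cf w j))"
        using st by (intro sum.cong refl) (simp add: cG)
      also have "\<dots> = (LINT r|lebesgue_on {s..t}. (\<Sum>j\<in>?I. G j r * cf w j))"
        by (rule Bochner_Integration.integral_sum[symmetric], rule integrable_mult_left, rule locally_integrable_ivl[OF Gi]) (use st in auto)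
      finally show "l2_inner L (v t) w - l2_inner L (v s) w = (LINT r|lebesgue_on {s..t}. l2_inner L (dv r) w)"
        unfolding dv_def ip[OF w] .
    qed
    have "AE t in lebesgue_on {0<..}. \<forall>j\<in>?I. q j t = Jc b h a (u t) j"
      by (rule AE_finite_allI) (use q(2) in auto)
    then show "AE t in lebesgue_on {0<..}. AE x in Q. dv t x + \<nu> *\<^sub>R stokes L (v t) x + projN L \<phi> N (bilin L (v t) (v t)) x =
        projN L \<phi> N (f t) x - \<mu> *\<^sub>R (J (v t) x - J (u t) x)"
    proof eventually_elim
      case (elim t)
      have co: "G j t + \<nu> * (lam j * c j t) + cf (bilin L (v t) (v t)) j = cf (f t) j - \<mu> * (Jc b h a (v t) j - Jc b h a (u t) j)" if j: "j \<in> ?I" for j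
      proof -
        have d: "v t \<in> domA L" unfolding v_def by (rule comb_domA) auto
        have "cf (bilin L (v t) (v t)) j = - tri (v t) (v t) j"
          by (rule cf_bilin_continuous[OF d _ _ I1[OF j]]) (auto simp: v_def intro!: comb_continuous)
        also have "tri (v t) (v t) j = (\<Sum>l\<in>?I. \<Sum>m\<in>?I. \<beta> l m j * (c l t * c m t))"
          unfolding v_def \<beta>_def by (rule tri_comb) (use j in auto)
        finally have 1: "cf (bilin L (v t) (v t)) j = - (\<Sum>l\<in>?I. \<Sum>m\<in>?I. \<beta> l m j * (c l t * c m t))" .
        have 2: "Jc b h a (v t) j = (\<Sum>l\<in>?I. c l t * Jc b h a (\<phi> l) j)"
          unfolding v_def by (rule Jc_comb[OF h _ _ I1[OF j]]) auto
        have 3: "(\<Sum>l\<in>?I. A j l * c l t) = - \<nu> * (lam j * c j t) - \<mu> * (\<Sum>l\<in>?I. c l t * Jc b h a (\<phi> l) j)"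
        proof -
          have "(\<Sum>l\<in>?I. A j l * c l t) = (\<Sum>l\<in>?I. (if l = j then - \<nu> * lam j * c j t else 0) - \<mu> * (c l t * Jc b h a (\<phi> l) j))"
            by (rule sum.cong) (auto simp: A_def algebra_simps)
          then show ?thesis using j by (simp add: sum_subtractf sum_distrib_left)
        qed
        have "q j t = Jc b h a (u t) j" using elim j by blast
        then show ?thesis unfolding G_def P_def k_def 1 2 3 by (simp add: algebra_simps)
      qed
      have "AE x in Q. stokes L (v t) x = comb ?I (\<lambda>j. lam j * c j t) x"
        unfolding v_def by (rule stokes_comb) auto
      then show ?case
      proof eventually_elim
        case (elim x)
        have "dv t x + \<nu> *\<^sub>R stokes L (v t) x + projN L \<phi> N (bilin L (v t) (v t)) x =
          (\<Sum>j\<in>?I. (G j t + \<nu> * (lam j * c j t) + cf (bilin L (v t) (v t)) j) *\<^sub>R \<phi> j x)"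
          unfolding elim projN_eq by (simp add: dv_def comb_def scaleR_sum_right sum.distrib scaleR_add_left)
        also have "\<dots> = (\<Sum>j\<in>?I. (cf (f t) j - \<mu> * (Jc b h a (v t) j - Jc b h a (u t) j)) *\<^sub>R \<phi> j x)"
          by (rule sum.cong) (simp_all only: co)
        also have "\<dots> = projN L \<phi> N (f t) x - \<mu> *\<^sub>R (J (v t) x - J (u t) x)"
          unfolding projN_eq J by (simp add: comb_def scaleR_sum_right sum_subtractf[symmetric] scaleR_diff_left scaleR_diff_right right_diff_distrib)
        finally show ?case .
      qed
    qed
  qed
qed

end

subsection \<open>Gevrey tails and the energy estimate\<close>

context stokes_basis
begin

text \<open>A finite norm excludes the default value infinity, so the chosen field has the weighted
  coefficients of \<open>u\<close>, and Bessel's inequality applies to it.\<close>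

lemma gevrey_sum:
  assumes u: "gevrey_norm L \<phi> lam \<sigma> u < ereal K" and F: "finite F" "F \<subseteq> {1..}"
  shows "(\<Sum>j\<in>F. (sqrt (lam j) * exp (\<sigma> * sqrt (lam j)) * cf u j)\<^sup>2) \<le> K\<^sup>2" "K > 0"
proof -
  define Op where "Op = spectral_calculus L \<phi> lam (\<lambda>l. sqrt l * exp (\<sigma> * sqrt l)) u"
  have ex: "\<exists>w. Op w" using u by (auto simp: gevrey_norm_def Op_def Let_def split: if_splits)
  define w where "w = (SOME w. Op w)"
  have w: "Op w" unfolding w_def by (rule someI_ex[OF ex])
  have n: "l2_norm L w < K" using u ex by (simp add: gevrey_norm_def Op_def[symmetric] w_def[symmetric] Let_def)
  have n0: "l2_norm L w \<ge> 0" unfolding l2_norm_eq by (simp add: norm2_def)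
  show "K > 0" using n n0 by simp
  have wH: "w \<in> spaceH L" and c: "\<And>j. j \<ge> 1 \<Longrightarrow> cf w j = sqrt (lam j) * exp (\<sigma> * sqrt (lam j)) * cf u j"
    using w by (auto simp: Op_def spectral_calculus_def)
  have "(\<Sum>j\<in>F. (sqrt (lam j) * exp (\<sigma> * sqrt (lam j)) * cf u j)\<^sup>2) = (\<Sum>j\<in>F. (cf w j)\<^sup>2)"
    using F c by (intro sum.cong) auto
  also have "\<dots> \<le> (l2_norm L w)\<^sup>2" unfolding l2_norm_eq by (rule Bessel[OF F spaceH_sqint[OF wH]])
  also have "\<dots> \<le> K\<^sup>2" using n n0 by (intro power_mono) auto
  finally show "(\<Sum>j\<in>F. (sqrt (lam j) * exp (\<sigma> * sqrt (lam j)) * cf u j)\<^sup>2) \<le> K\<^sup>2" .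
qed

definition tailc :: "nat \<Rightarrow> (nat \<Rightarrow> real) \<Rightarrow> nat \<Rightarrow> real" where
  "tailc N c j = (if j \<le> N then 0 else c j)"

text \<open>One exponential factor of the Gevrey weight pays for the missing half power of the eigenvalue.\<close>

lemma gevrey_weight:
  assumes j: "j \<ge> 1"
  shows "lam j * \<bar>c\<bar> \<le> exp (- (\<sigma> - 1) * sqrt (lam j)) * \<bar>sqrt (lam j) * exp (\<sigma> * sqrt (lam j)) * c\<bar>"
proof -
  define r where "r = sqrt (lam j)"
  have r: "r \<ge> 0" "lam j = r * r" using lam_pos[OF j] by (auto simp: r_def)
  have "r \<le> exp r" using exp_ge_add_one_self[of r] by linarith
  then have "r * r * \<bar>c\<bar> \<le> r * exp r * \<bar>c\<bar>" using r by (intro mult_right_mono mult_left_mono) auto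
  also have "\<dots> = exp (- (\<sigma> - 1) * r) * \<bar>r * exp (\<sigma> * r) * c\<bar>"
  proof -
    have "exp (- (\<sigma> - 1) * r) * exp (\<sigma> * r) = exp r" by (simp add: exp_add[symmetric] algebra_simps)
    then show ?thesis using r by (simp add: abs_mult mult_ac)
  qed
  finally show ?thesis unfolding r(2)[symmetric] r_def[symmetric] .
qed

text \<open>Stated for coefficients that vanish below a spectral threshold \<open>\<rho>\<close>, so
  that \<open>\<rho> = 0\<close> gives the whole field and \<open>\<rho> = sqrt (lam N)\<close> the
  tail.\<close>

lemma gevrey_dsum_above:
  assumes u: "gevrey_norm L \<phi> lam \<sigma> u < ereal K" and s: "\<sigma> \<ge> 1"
    and c: "\<And>j. j \<ge> 1 \<Longrightarrow> c j = 0 \<or> c j = cf u j \<and> \<rho> \<le> sqrt (lam j)"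
  shows "dsum c (exp (- (\<sigma> - 1) * \<rho>) * K)"
  unfolding dsum_def
proof (intro conjI allI impI)
  have K: "K > 0" using gevrey_sum(2)[OF u, of "{}"] by simp
  then show "0 \<le> exp (- (\<sigma> - 1) * \<rho>) * K" by simp
  fix F :: "nat set" assume F: "finite F" "F \<subseteq> {1..}"
  let ?g = "\<lambda>j. sqrt (lam j) * exp (\<sigma> * sqrt (lam j)) * cf u j" and ?e = "exp (- (\<sigma> - 1) * \<rho>)"
  have "(lam j * c j)\<^sup>2 \<le> ?e\<^sup>2 * (?g j)\<^sup>2" if "j \<in> F" for j
  proof (cases "c j = 0")
    case False
    have j: "j \<ge> 1" using F that by auto
    have cj: "c j = cf u j" "\<rho> \<le> sqrt (lam j)" using c[OF j] False by auto
    have "\<bar>lam j * c j\<bar> = lam j * \<bar>cf u j\<bar>" using lam_pos[OF j] cj by (simp add: abs_mult)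
    also have "\<dots> \<le> exp (- (\<sigma> - 1) * sqrt (lam j)) * \<bar>?g j\<bar>" by (rule gevrey_weight[OF j])
    also have "\<dots> \<le> ?e * \<bar>?g j\<bar>"
    proof (rule mult_right_mono)
      have "(\<sigma> - 1) * \<rho> \<le> (\<sigma> - 1) * sqrt (lam j)" using s cj by (intro mult_left_mono) auto
      then show "exp (- (\<sigma> - 1) * sqrt (lam j)) \<le> ?e" by (simp only: exp_le_cancel_iff mult_minus_left neg_le_iff_le)
    qed simp
    finally have "\<bar>lam j * c j\<bar>\<^sup>2 \<le> (?e * \<bar>?g j\<bar>)\<^sup>2" by (rule power_mono) simp
    then show ?thesis by (simp add: power_mult_distrib)
  qed simp
  then have "(\<Sum>j\<in>F. (lam j * c j)\<^sup>2) \<le> (\<Sum>j\<in>F. ?e\<^sup>2 * (?g j)\<^sup>2)" by (rule sum_mono)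
  also have "\<dots> = ?e\<^sup>2 * (\<Sum>j\<in>F. (?g j)\<^sup>2)" by (rule sum_distrib_left[symmetric])
  also have "\<dots> \<le> ?e\<^sup>2 * K\<^sup>2" by (rule mult_left_mono[OF gevrey_sum(1)[OF u F]]) simp
  finally show "(\<Sum>j\<in>F. (lam j * c j)\<^sup>2) \<le> (?e * K)\<^sup>2" by (simp add: power_mult_distrib)
qed

lemma gevrey_dsum:
  assumes "gevrey_norm L \<phi> lam \<sigma> u < ereal K" "\<sigma> \<ge> 1"
  shows "dsum (cf u) K"
  using gevrey_dsum_above[OF assms, of "cf u" 0] lam_pos by (simp add: less_imp_le)

lemma gevrey_tail:
  assumes u: "gevrey_norm L \<phi> lam \<sigma> u < ereal K" "\<sigma> \<ge> 1" and N: "N \<ge> 1"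
  shows "dsum (tailc N (cf u)) (exp (- (\<sigma> - 1) * sqrt (lam N)) * K)"
  by (rule gevrey_dsum_above[OF u]) (use lam_mono[OF N] in \<open>auto simp: tailc_def\<close>)

lemma ser_split:
  assumes c: "dsum c K" and t: "dsum (tailc N c) K'"
  shows "ser c x = comb {1..N} c x + ser (tailc N c) x"
proof -
  have "comb {1..n} c x = comb {1..N} c x + comb {1..n} (tailc N c) x" if "n \<ge> N" for n
  proof -
    have "comb {1..n} c x = comb {1..N} c x + comb {N<..n} c x" using comb_diff[OF that, of c x] by (simp add: algebra_simps)
    also have "comb {N<..n} c x = comb {1..n} (tailc N c) x"
      unfolding comb_def by (rule sum.mono_neutral_cong_left) (auto simp: tailc_def)
    finally show ?thesis .
  qed
  then have "\<forall>\<^sub>F n in sequentially. comb {1..N} c x + comb {1..n} (tailc N c) x = comb {1..n} c x"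
    by (intro eventually_sequentiallyI[of N]) (rule sym)
  moreover have "(\<lambda>n. comb {1..N} c x + comb {1..n} (tailc N c) x) \<longlonglongrightarrow> comb {1..N} c x + ser (tailc N c) x"
    by (intro tendsto_intros ser_LIMSEQ[OF t])
  ultimately have "(\<lambda>n. comb {1..n} c x) \<longlonglongrightarrow> comb {1..N} c x + ser (tailc N c) x"
    by (rule Lim_transform_eventually[rotated])
  then show ?thesis using LIMSEQ_unique[OF ser_LIMSEQ[OF c]] by blast
qed

end

section \<open>Estimates for the trilinear and observation terms\<close>

context observed
begin

lemma norm2_square_le:
  assumes "continuous_on UNIV (f :: field)" "\<And>x. norm (f x) \<le> S"
  shows "norm2 Q f \<le> S * L"
proof -
  have S: "S \<ge> 0" using assms(2) norm_ge_zero order_trans by blast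
  have "finite_measure Q" by (rule finite_measure_square)
  then have "norm2 Q f \<le> sqrt (measure Q (space Q)) * S"
    by (rule finite_measure.norm2_bounded) (use assms S in \<open>auto intro!: continuous_imp_measurable_on_sets_lebesgue continuous_on_subset[OF assms(1)] simp: square_def\<close>)
  also have "measure Q (space Q) = L\<^sup>2" using measure_square[OF L_pos] by (simp add: measure_restrict_space square_def)
  finally show ?thesis using L_pos by (simp add: mult.commute)
qed

text \<open>The Galerkin solution \<open>V\<close> has no a priori bound; writing it as the low modes of \<open>U\<close> minus the error
  \<open>W\<close>, all terms in which \<open>V\<close> is not dominated by \<open>U\<close> vanish by antisymmetry.\<close>

lemma trilinear_difference:
  assumes N: "N \<ge> 1" and c: "dsum c K" and q: "dsum (tailc N c) K'" and w: "\<And>j. w j = c j - d j"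
    and n: "n = sqrt (\<Sum>j\<in>{1..N}. (w j)\<^sup>2)"
  shows "(\<Sum>j\<in>{1..N}. w j * (tri (ser c) (ser c) j - tri (comb {1..N} d) (comb {1..N} d) j)) \<le>
    (\<Sum>j\<in>{1..N}. tri_const j) * (weylC * K * (weylC * lam N * n + 2 * (weylC * K'))) * n"
proof -
  let ?I = "{1..N}"
  define p where "p = comb ?I c"
  define V where "V = comb ?I d"
  define W where "W = comb ?I w"
  define r where "r = ser (tailc N c)"
  have ct: "continuous_on UNIV p" "continuous_on UNIV V" "continuous_on UNIV W" "continuous_on UNIV r"
    unfolding p_def V_def W_def r_def by (auto intro!: comb_continuous ser_continuous[OF q])
  have cU: "continuous_on UNIV (ser c)" by (rule ser_continuous[OF c])
  have pVW: "p = (\<lambda>x. V x + W x)" by (auto simp: fun_eq_iff p_def V_def W_def comb_def w sum.distrib[symmetric] scaleR_add_left[symmetric])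
  have UVWr: "ser c = (\<lambda>x. V x + (W x + r x))"
  proof
    fix x
    have "ser c x = p x + r x" unfolding p_def r_def by (rule ser_split[OF c q])
    then show "ser c x = V x + (W x + r x)" by (simp add: pVW)
  qed
  have n0: "n \<ge> 0" unfolding n by (intro real_sqrt_ge_zero sum_nonneg) auto
  have bW: "norm (W x) \<le> weylC * lam N * n" for x
    using norm_comb_sup[OF N, of w x] unfolding W_def n by (simp add: mult.assoc)
  have bp: "norm (p x) \<le> weylC * K" for x unfolding p_def by (rule norm_comb_le[OF c])
  have br: "norm (r x) \<le> weylC * K'" for x unfolding r_def by (rule norm_ser_le[OF q])
  have bU: "norm (ser c x) \<le> weylC * K" for x by (rule norm_ser_le[OF c])

  \<comment> \<open>Since \<open>V = p - W\<close> with \<open>p\<close> bounded, each term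
    containing \<open>V\<close> next to \<open>W\<close> or \<open>r\<close> becomes one of the
    terms of \<open>R\<close> plus one with \<open>W\<close> in the second argument. The latter
    vanish when paired with \<open>w\<close>.\<close>
  define R where "R j = tri W p j + tri r p j + tri (ser c) r j" for j
  have dec: "tri (ser c) (ser c) j - tri V V j = R j + tri (ser c) W j - tri W W j - tri r W j" if "j \<in> ?I" for j
  proof -
    have j: "j \<ge> 1" using that by simp
    have "tri (ser c) (ser c) j = tri (ser c) V j + (tri (ser c) W j + tri (ser c) r j)"
      by (subst (2) UVWr) (simp only: tri_add_right[OF _ _ _ j] ct cU continuous_on_add)
    moreover have "tri (ser c) V j = tri V V j + (tri W V j + tri r V j)"
      by (subst UVWr) (simp only: tri_add_left[OF _ _ _ j] ct continuous_on_add)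
    moreover have "tri W p j = tri W V j + tri W W j" "tri r p j = tri r V j + tri r W j"
      unfolding pVW by (simp_all only: tri_add_right[OF _ _ _ j] ct)
    ultimately show ?thesis by (simp add: R_def)
  qed
  have z: "(\<Sum>j\<in>?I. w j * tri a W j) = 0" if "a \<in> spaceH L" "continuous_on UNIV a" for a
    unfolding W_def by (rule tri_energy) (use that in auto)
  have "W \<in> spaceH L" "r \<in> spaceH L" "ser c \<in> spaceH L"
    unfolding W_def r_def by (auto intro!: comb_spaceH ser_spaceH[OF q] ser_spaceH[OF c])
  then have zz: "(\<Sum>j\<in>?I. w j * tri (ser c) W j) = 0" "(\<Sum>j\<in>?I. w j * tri W W j) = 0" "(\<Sum>j\<in>?I. w j * tri r W j) = 0"
    using z ct cU by blast+
  have "(\<Sum>j\<in>?I. w j * (tri (ser c) (ser c) j - tri V V j)) = (\<Sum>j\<in>?I. w j * R j + w j * tri (ser c) W j - w j * tri W W j - w j * tri r W j)"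
    by (rule sum.cong) (simp_all add: dec algebra_simps)
  also have "\<dots> = (\<Sum>j\<in>?I. w j * R j)" by (simp only: sum_subtractf sum.distrib zz)
  also have "\<dots> \<le> (\<Sum>j\<in>?I. n * (tri_const j * (weylC * K * (weylC * lam N * n + 2 * (weylC * K')))))"
  proof (rule sum_mono)
    fix j assume j: "j \<in> ?I"
    have "(w j)\<^sup>2 \<le> (\<Sum>j\<in>?I. (w j)\<^sup>2)" by (rule member_le_sum[OF j]) auto
    then have wn: "\<bar>w j\<bar> \<le> n" unfolding n by (metis real_sqrt_abs real_sqrt_le_mono)
    have j1: "j \<ge> 1" using j by simp
    have "\<bar>R j\<bar> \<le> \<bar>tri W p j\<bar> + \<bar>tri r p j\<bar> + \<bar>tri (ser c) r j\<bar>" unfolding R_def by linarith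
    also have "\<dots> \<le> tri_const j * (weylC * lam N * n * (weylC * K)) + tri_const j * (weylC * K' * (weylC * K)) + tri_const j * (weylC * K * (weylC * K'))"
      by (intro add_mono tri_bound ct cU bW bp br bU j1)
    also have "\<dots> = tri_const j * (weylC * K * (weylC * lam N * n + 2 * (weylC * K')))" by (simp add: algebra_simps)
    finally have R: "\<bar>R j\<bar> \<le> tri_const j * (weylC * K * (weylC * lam N * n + 2 * (weylC * K')))" .
    have "w j * R j \<le> \<bar>w j\<bar> * \<bar>R j\<bar>" by (metis abs_ge_self abs_mult)
    also have "\<dots> \<le> n * (tri_const j * (weylC * K * (weylC * lam N * n + 2 * (weylC * K'))))"
      by (rule mult_mono[OF wn R n0]) simp
    finally show "w j * R j \<le> n * (tri_const j * (weylC * K * (weylC * lam N * n + 2 * (weylC * K'))))" .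
  qed
  also have "\<dots> = (\<Sum>j\<in>?I. tri_const j) * (weylC * K * (weylC * lam N * n + 2 * (weylC * K'))) * n"
    by (simp add: sum_distrib_left sum_distrib_right mult_ac)
  finally show ?thesis unfolding V_def .
qed

text \<open>The spectral inequality bounds the \<open>L^2\<close> norm of the combination over the
  whole period square by its integral over the small square. Half of the resulting constant
  \<open>1 / (L\<^sup>2 * E)\<close> is given up to absorb the error of order
  \<open>h\<close>.\<close>

lemma observation_coercive:
  assumes h: "0 < h" "h < 1" "h < \<delta>" and N: "N \<ge> 1"
    and box: "\<And>x. (\<And>i. p $ i - \<delta> \<le> x $ i \<and> x $ i \<le> p $ i + 2 * \<delta>) \<Longrightarrow> x \<in> \<Omega>"
    and lip: "\<And>d x y. norm (comb {1..N} d x - comb {1..N} d y) \<le> \<Lambda> * sqrt (\<Sum>j\<in>{1..N}. (d j)\<^sup>2) * norm (x - y)" and \<Lambda>: "\<Lambda> \<ge> 0"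
    and E: "E > 0" "\<And>d y. (norm (comb {1..N} d y))\<^sup>2 \<le> E * integral (cbox p (p + (\<chi> i. \<delta>))) (\<lambda>x. (norm (comb {1..N} d x))\<^sup>2)"
    and hs: "h * (2 * (L + 2)\<^sup>2 * \<Lambda> * weylC * lam N) \<le> 1 / (2 * (L\<^sup>2 * E))"
  shows "(\<Sum>j\<in>{1..N}. w j * Jc b h a (comb {1..N} w) j) \<ge> (\<Sum>j\<in>{1..N}. (w j)\<^sup>2) / (2 * (L\<^sup>2 * E))"
proof -
  let ?I = "{1..N}"
  define y where "y = (\<Sum>j\<in>?I. (w j)\<^sup>2)"
  define i where "i = integral (cbox p (p + (\<chi> i. \<delta>))) (\<lambda>x. (norm (comb ?I w x))\<^sup>2)"
  have y0: "y \<ge> 0" unfolding y_def by (rule sum_nonneg) simp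
  have i0: "i \<ge> 0" unfolding i_def by (rule integral_nonneg) (auto intro!: integrable_continuous continuous_intros comb_continuous)
  have L2: "L\<^sup>2 * E > 0" using L_pos E by simp
  have "y = (norm2 Q (comb ?I w))\<^sup>2" unfolding y_def by (rule norm_comb[symmetric]) auto
  also have "\<dots> \<le> (sqrt (E * i) * L)\<^sup>2"
  proof (rule power_mono)
  show "norm2 Q (comb ?I w) \<le> sqrt (E * i) * L"
  proof (rule norm2_square_le)
    show "norm (comb ?I w x) \<le> sqrt (E * i)" for x using E(2)[of w x] by (simp add: i_def real_le_rsqrt)
  qed (auto intro: comb_continuous)
  qed simp
  also have "\<dots> = L\<^sup>2 * E * i" using E i0 by (simp add: power_mult_distrib)
  finally have yi: "y / (L\<^sup>2 * E) \<le> i" using L2 by (simp add: divide_le_eq mult.commute)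
  have "(\<Sum>j\<in>?I. w j * Jc b h a (comb ?I w) j) \<ge> i - h * (2 * (L + 2)\<^sup>2 * \<Lambda> * weylC * lam N) * y"
    unfolding i_def y_def by (rule Jc_lower[OF h N box lip \<Lambda>])
  moreover have "y / (2 * (L\<^sup>2 * E)) = 1 / (2 * (L\<^sup>2 * E)) * y" by simp
  moreover have "h * (2 * (L + 2)\<^sup>2 * \<Lambda> * weylC * lam N) * y \<le> 1 / (2 * (L\<^sup>2 * E)) * y" by (rule mult_right_mono[OF hs y0])
  moreover have "y / (L\<^sup>2 * E) = 2 * (y / (2 * (L\<^sup>2 * E)))" using L2 by simp
  ultimately show ?thesis using yi unfolding y_def[symmetric] by linarith
qed

text \<open>By linearity the observed error splits into the low modes, which damp, and the tail of
  \<open>c\<close>, whose contribution is controlled by its supremum norm and is linear in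
  \<open>n\<close>.\<close>

lemma observation_difference:
  assumes h: "0 < h" "h < 1" and N: "N \<ge> 1" and c: "dsum c K" and q: "dsum (tailc N c) K'" and w: "\<And>j. w j = c j - d j"
    and low: "(\<Sum>j\<in>{1..N}. w j * Jc b h a (comb {1..N} w) j) \<ge> \<kappa> * (\<Sum>j\<in>{1..N}. (w j)\<^sup>2)"
    and n: "n = sqrt (\<Sum>j\<in>{1..N}. (w j)\<^sup>2)"
  shows "(\<Sum>j\<in>{1..N}. w j * (Jc b h a (comb {1..N} d) j - Jc b h a (ser c) j)) \<le>
    - \<kappa> * n\<^sup>2 + (L + 2)\<^sup>2 * (weylC * K') * (weylC * lam N) * n"
proof -
  let ?I = "{1..N}"
  have I: "?I \<subseteq> {1..}" by auto
  obtain S where S: "cbp (comb ?I d) S" using cbp_comb[OF I] by blast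
  obtain S' where S': "cbp (comb ?I w) S'" using cbp_comb[OF I] by blast
  have Q: "cbp (ser (tailc N c)) (weylC * K')" by (rule cbp_ser[OF q])
  have SQ: "cbp (\<lambda>x. comb ?I w x + ser (tailc N c) x) (S' + weylC * K')"
    using S' Q by (auto simp: cbp_def periodic_def intro!: continuous_intros norm_triangle_le add_mono)
  have e: "ser c = (\<lambda>x. comb ?I d x + (comb ?I w x + ser (tailc N c) x))"
    using ser_split[OF c q] by (auto simp: fun_eq_iff comb_def w sum.distrib[symmetric] scaleR_add_left[symmetric] add.assoc[symmetric])
  have "Jc b h a (comb ?I d) j - Jc b h a (ser c) j = - Jc b h a (comb ?I w) j - Jc b h a (ser (tailc N c)) j" if "j \<in> ?I" for j
  proof -
    have j: "j \<ge> 1" using that by simp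
    have "Jc b h a (ser c) j = Jc b h a (comb ?I d) j + Jc b h a (\<lambda>x. comb ?I w x + ser (tailc N c) x) j"
      unfolding e by (rule Jc_add[OF h(1) S SQ j])
    moreover have "Jc b h a (\<lambda>x. comb ?I w x + ser (tailc N c) x) j = Jc b h a (comb ?I w) j + Jc b h a (ser (tailc N c)) j"
      by (rule Jc_add[OF h(1) S' Q j])
    ultimately show ?thesis by simp
  qed
  then have "w j * (Jc b h a (comb ?I d) j - Jc b h a (ser c) j) =
      - (w j * Jc b h a (comb ?I w) j) - w j * Jc b h a (ser (tailc N c)) j" if "j \<in> ?I" for j
    by (simp only: that right_diff_distrib mult_minus_right)
  then have "(\<Sum>j\<in>?I. w j * (Jc b h a (comb ?I d) j - Jc b h a (ser c) j)) =
      (\<Sum>j\<in>?I. - (w j * Jc b h a (comb ?I w) j) - w j * Jc b h a (ser (tailc N c)) j)"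
    by (rule sum.cong[OF refl])
  also have "\<dots> = - (\<Sum>j\<in>?I. w j * Jc b h a (comb ?I w) j) - (\<Sum>j\<in>?I. w j * Jc b h a (ser (tailc N c)) j)"
    by (simp only: sum_subtractf sum_negf)
  also have "\<dots> \<le> - \<kappa> * n\<^sup>2 + (L + 2)\<^sup>2 * (weylC * K') * (weylC * lam N) * n"
  proof -
    have "n\<^sup>2 = (\<Sum>j\<in>?I. (w j)\<^sup>2)" unfolding n by (simp add: sum_nonneg)
    then show ?thesis using low Jc_upper[OF h Q N, of w b a] unfolding n by (simp add: mult.assoc abs_le_iff)
  qed
  finally show ?thesis .
qed

end

text \<open>With \<open>\<mu> \<kappa> = 4 (A + 1)\<close> the nudging absorbs the trilinear term, and Young's inequality leaves a
  linear damping towards the observation error \<open>B\<close>.\<close>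

lemma damping_arithmetic:
  fixes A S D \<kappa> \<delta> \<mu> n :: real
  assumes A: "A \<ge> 0" and \<kappa>: "\<kappa> > 0" and \<mu>: "\<mu> = 4 * (A + 1) / \<kappa>" and \<delta>: "\<delta> \<ge> 0" and n: "n \<ge> 0"
    and B: "B = (1 + 4 * D / \<kappa>) * \<delta>"
    and X: "X \<le> A * (n + \<delta>) * n" and Y: "Y \<le> - (\<kappa> / 2) * n\<^sup>2 + D * \<delta> * n"
  shows "2 * (X + \<mu> * Y) \<le> - (A + 1) * (n\<^sup>2 - B\<^sup>2)"
proof -
  have m: "\<mu> > 0" "\<mu> * \<kappa> = 4 * (A + 1)" using A \<kappa> \<mu> by auto
  have "\<mu> * Y \<le> \<mu> * (- (\<kappa> / 2) * n\<^sup>2 + D * \<delta> * n)" using Y m by (intro mult_left_mono) auto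
  also have "\<dots> = - 2 * (A + 1) * n\<^sup>2 + \<mu> * D * \<delta> * n"
  proof -
    have "\<mu> * (- (\<kappa> / 2) * n\<^sup>2 + D * \<delta> * n) = - (\<mu> * \<kappa>) / 2 * n\<^sup>2 + \<mu> * D * \<delta> * n" by (simp add: algebra_simps)
    also have "- (\<mu> * \<kappa>) / 2 = - 2 * (A + 1)" unfolding m(2) by simp
    finally show ?thesis .
  qed
  finally have 1: "\<mu> * Y \<le> - 2 * (A + 1) * n\<^sup>2 + \<mu> * D * \<delta> * n" .
  \<comment> \<open>The factor \<open>A + 1\<close> in \<open>\<mu>\<close> divides out, which is
    why \<open>B\<close> contains neither \<open>A\<close> nor \<open>\<mu>\<close>.\<close>
  have 2: "(A + 1) * B = (A + 1) * \<delta> + \<mu> * D * \<delta>" unfolding B \<mu> using \<kappa> by (simp add: field_simps)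
  have "A * \<delta> * n \<le> (A + 1) * \<delta> * n" using \<delta> n by (intro mult_right_mono) auto
  moreover have "A * n\<^sup>2 \<le> (A + 1) * n\<^sup>2" by (intro mult_right_mono) auto
  moreover have "X \<le> A * n\<^sup>2 + A * \<delta> * n" using X by (simp add: algebra_simps power2_eq_square)
  moreover have "((A + 1) * \<delta> + \<mu> * D * \<delta>) * n = (A + 1) * \<delta> * n + \<mu> * D * \<delta> * n" by (simp add: algebra_simps)
  moreover have "- 2 * (A + 1) * n\<^sup>2 = - (A + 1) * n\<^sup>2 - (A + 1) * n\<^sup>2" by (simp add: algebra_simps)
  ultimately have "X + \<mu> * Y \<le> - (A + 1) * n\<^sup>2 + ((A + 1) * \<delta> + \<mu> * D * \<delta>) * n"
    using 1 by linarith
  also have "\<dots> = - (A + 1) * n\<^sup>2 + (A + 1) * (B * n)" unfolding 2[symmetric] by simp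
  finally have 3: "2 * (X + \<mu> * Y) \<le> (A + 1) * (2 * B * n) - 2 * (A + 1) * n\<^sup>2" by (simp add: algebra_simps)
  have "2 * B * n \<le> B\<^sup>2 + n\<^sup>2" using sum_squares_bound[of B n] by simp
  then have "(A + 1) * (2 * B * n) \<le> (A + 1) * (B\<^sup>2 + n\<^sup>2)" using A by (intro mult_left_mono) auto
  then show ?thesis using 3 by (simp add: algebra_simps)
qed

subsection \<open>Evolution of the error modes\<close>

lemma AE_halfline:
  assumes "\<And>T. T > 0 \<Longrightarrow> AE t in lebesgue_on {0<..<T :: real}. P t"
  shows "AE t in lebesgue_on {0<..}. P t"
proof -
  have "AE t in lebesgue. t \<in> {0<..<real (Suc n)} \<longrightarrow> P t" for n
  proof -
    have "AE t in lebesgue_on {0<..<real (Suc n)}. P t" by (rule assms) simp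
    then show ?thesis by (subst (asm) AE_lebesgue_on_iff) auto
  qed
  then have "AE t in lebesgue. \<forall>n. t \<in> {0<..<real (Suc n)} \<longrightarrow> P t" by (subst AE_all_countable) auto
  then have "AE t in lebesgue. t \<in> {0<..} \<longrightarrow> P t"
  proof eventually_elim
    case (elim t)
    show ?case
    proof
      assume t: "t \<in> {0<..}"
      obtain n where "t < real n" using reals_Archimedean2 by blast
      then have "t \<in> {0<..<real (Suc n)}" using t by auto
      then show "P t" using elim by blast
    qed
  qed
  then show ?thesis by (subst AE_lebesgue_on_iff) auto
qed

lemma continuous_on_uniform_approx:
  fixes f :: "'a::metric_space \<Rightarrow> real"
  assumes "\<And>e. e > 0 \<Longrightarrow> \<exists>g. continuous_on S g \<and> (\<forall>x\<in>S. \<bar>f x - g x\<bar> \<le> e)"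
  shows "continuous_on S f"
proof -
  have "\<forall>n. \<exists>g. continuous_on S g \<and> (\<forall>x\<in>S. \<bar>f x - g x\<bar> \<le> inverse (real (Suc n)))" by (intro allI assms) simp
  then obtain g where g: "\<And>n. continuous_on S (g n)" "\<And>n x. x \<in> S \<Longrightarrow> \<bar>f x - g n x\<bar> \<le> inverse (real (Suc n))" by metis
  have "uniform_limit S g f sequentially"
  proof (rule uniform_limitI)
    fix e :: real assume "e > 0"
    then obtain n0 where n0: "inverse (real (Suc n0)) < e" using reals_Archimedean by blast
    show "\<forall>\<^sub>F n in sequentially. \<forall>x\<in>S. dist (g n x) (f x) < e"
    proof (intro eventually_sequentiallyI[of n0] ballI)
      fix n x assume n: "n0 \<le> n" and x: "x \<in> S"
      have "inverse (real (Suc n)) \<le> inverse (real (Suc n0))" using n by (intro le_imp_inverse_le) auto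
      then have "\<bar>f x - g n x\<bar> < e" using g(2)[OF x, of n] n0 by linarith
      then show "dist (g n x) (f x) < e" by (simp add: dist_real_def abs_minus_commute)
    qed
  qed
  then show ?thesis using g(1) by (intro uniform_limit_theorem[where F = sequentially and f = g]) auto
qed

lemma decay_limit:
  fixes y :: "real \<Rightarrow> real"
  assumes a: "a > 0" and c: "continuous_on {T..} y"
    and d: "\<And>t. t > T \<Longrightarrow> \<exists>D. (y has_real_derivative D) (at t) \<and> D \<le> - a * (y t - b)" and e: "e > 0"
  shows "\<forall>\<^sub>F t in at_top. y t < b + e"
proof -
  have bound: "y t - b \<le> (y T - b) * exp (- a * (t - T))" if t: "t \<ge> T" for t
  proof -
    have "y t - b \<le> (y T - b) * exp (- a * t - (- a * T))"
    proof (rule gronwall_exp[of T t "\<lambda>t. y t - b" "\<lambda>t. - a * t" "\<lambda>_. - a"])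
      show "continuous_on {T..t} (\<lambda>t. y t - b)" by (intro continuous_intros continuous_on_subset[OF c]) auto
      show "\<exists>D. ((\<lambda>t. y t - b) has_real_derivative D) (at s) \<and> D \<le> - a * (y s - b)" if s: "T < s" "s < t" for s
      proof -
        obtain D where D: "(y has_real_derivative D) (at s)" "D \<le> - a * (y s - b)" using d[OF s(1)] by blast
        have "((\<lambda>t. y t - b) has_real_derivative D) (at s)" using D(1) by (auto intro!: derivative_eq_intros)
        then show ?thesis using D(2) by blast
      qed
    qed (use t in \<open>auto intro!: continuous_intros derivative_eq_intros\<close>)
    then show ?thesis by (simp add: algebra_simps)
  qed
  have "((\<lambda>t. (y T - b) * exp (- a * (t - T))) \<longlongrightarrow> (y T - b) * 0) at_top"
  proof (intro tendsto_intros filterlim_compose[OF exp_at_bot])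
    show "LIM t at_top. - a * (t - T) :> at_bot"
    proof (rule filterlim_tendsto_neg_mult_at_bot[OF tendsto_const])
      show "LIM t at_top. t - T :> at_top"
        using filterlim_tendsto_add_at_top[OF tendsto_const[of "- T"] filterlim_ident] by simp
    qed (use a in simp)
  qed
  then have "\<forall>\<^sub>F t in at_top. (y T - b) * exp (- a * (t - T)) < e"
    using e by (intro order_tendstoD(2)[of _ 0]) auto
  then show ?thesis using eventually_ge_at_top[of T]
  proof eventually_elim
    case (elim t)
    then show ?case using bound[of t] by simp
  qed
qed

context stokes_basis
begin

lemma l2_inner_cong_AE:
  assumes "AE x in Q. f x = g x" "sqint Q f" "sqint Q g" "sqint Q h"
  shows "l2_inner L f h = l2_inner L g h"
  unfolding l2_inner_def
  by (rule integral_cong_AE) (use assms in \<open>auto intro!: borel_measurable_inner sqint_measurable\<close>)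

lemma L2_time_cf_integrable:
  assumes g: "L2_time L T g" and j: "j \<ge> 1"
  shows "integrable (lebesgue_on {0<..<T}) (\<lambda>t. cf (g t) j)"
proof (rule finite_measure.sqint_integrable)
  show "finite_measure (lebesgue_on {0<..<T})" by (rule finite_measure_lebesgue_on) simp
  have n1: "l2_norm L (\<phi> j) = 1" using phi_orthonormal[OF j j] by (simp add: l2_norm_def)
  have m: "(\<lambda>t. cf (g t) j) \<in> borel_measurable (lebesgue_on {0<..<T})"
    using g phi_H[OF j] by (auto simp: L2_time_def time_measurable_def)
  show "sqint (lebesgue_on {0<..<T}) (\<lambda>t. cf (g t) j)"
    unfolding sqint_def
  proof
    show "integrable (lebesgue_on {0<..<T}) (\<lambda>t. (norm (cf (g t) j))\<^sup>2)"
    proof (rule Bochner_Integration.integrable_bound)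
      show "integrable (lebesgue_on {0<..<T}) (\<lambda>t. (l2_norm L (g t))\<^sup>2)" using g by (simp add: L2_time_def)
      show "(\<lambda>t. (norm (cf (g t) j))\<^sup>2) \<in> borel_measurable (lebesgue_on {0<..<T})" using m by measurable
      have "AE t in lebesgue_on {0<..<T}. g t \<in> spaceH L" using g by (simp add: L2_time_def time_measurable_def)
      then show "AE t in lebesgue_on {0<..<T}. norm ((norm (cf (g t) j))\<^sup>2) \<le> norm ((l2_norm L (g t))\<^sup>2)"
      proof eventually_elim
        case (elim t)
        have "\<bar>cf (g t) j\<bar> \<le> l2_norm L (g t)"
          using l2_inner_bound[OF spaceH_sqint[OF elim] phi_sqint[OF j]] n1 by simp
        then have "\<bar>cf (g t) j\<bar>\<^sup>2 \<le> (l2_norm L (g t))\<^sup>2" by (rule power_mono) simp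
        then show ?case by simp
      qed
    qed
  qed (rule m)
qed

text \<open>Pairing with the eigenfunctions is possible at almost every time; the exceptional null
  set is common to all \<open>j\<close>.\<close>

lemma ns_modes:
  assumes ns: "ns_solution L \<nu> f u0 u" and f: "Linf_time L f"
  shows "\<exists>du. (\<forall>T>0. L2_time L T du) \<and> has_time_derivative L u du \<and>
    (AE t in lebesgue_on {0<..}. \<forall>j\<ge>1. cf (du t) j =
       cf (f t) j - \<nu> * (lam j * cf (u t) j) + tri (ser (cf (u t))) (ser (cf (u t))) j)"
proof -
  obtain du where du: "\<forall>T>0. L2_time L T du" "has_time_derivative L u du"
    and eq: "AE t in lebesgue_on {0<..}. AE x in Q. du t x + \<nu> *\<^sub>R stokes L (u t) x + bilin L (u t) (u t) x = f t x"
    using ns unfolding ns_solution_def by blast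
  have 1: "AE t in lebesgue_on {0<..}. du t \<in> spaceH L"
    using du(1) by (intro AE_halfline) (auto simp: L2_time_def time_measurable_def)
  have 2: "AE t in lebesgue_on {0<..}. stokes L (u t) \<in> spaceH L"
    using ns by (intro AE_halfline) (auto simp: ns_solution_def L2_time_def time_measurable_def)
  have 3: "AE t in lebesgue_on {0<..}. f t \<in> spaceH L" using f by (auto simp: Linf_time_def time_measurable_def)
  have 4: "AE t in lebesgue_on {0<..}. u t \<in> domA L" using ns by (auto simp: ns_solution_def)
  have "AE t in lebesgue_on {0<..}. \<forall>j\<ge>1. cf (du t) j =
       cf (f t) j - \<nu> * (lam j * cf (u t) j) + tri (ser (cf (u t))) (ser (cf (u t))) j"
    using 1 2 3 4 eq
  proof eventually_elim
    case (elim t)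
    show ?case
    proof (intro allI impI)
      fix j :: nat assume j: "j \<ge> 1"
      have s: "sqint Q (du t)" "sqint Q (\<lambda>x. \<nu> *\<^sub>R stokes L (u t) x)" "sqint Q (bilin L (u t) (u t))" "sqint Q (f t)" "sqint Q (\<phi> j)"
        using elim j by (auto intro: spaceH_sqint sqint_scaleR cf_bilin(1) phi_sqint)
      have "cf (f t) j = cf (\<lambda>x. du t x + \<nu> *\<^sub>R stokes L (u t) x + bilin L (u t) (u t) x) j"
        by (rule l2_inner_cong_AE[OF _ s(4) sqint_add[OF sqint_add[OF s(1,2)] s(3)] s(5)]) (use elim(5) in eventually_elim, simp)
      also have "\<dots> = cf (du t) j + cf (\<lambda>x. \<nu> *\<^sub>R stokes L (u t) x) j + cf (bilin L (u t) (u t)) j"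
        by (simp only: l2_inner_add_left[OF sqint_add[OF s(1,2)] s(3) s(5)] l2_inner_add_left[OF s(1,2) s(5)])
      also have "cf (\<lambda>x. \<nu> *\<^sub>R stokes L (u t) x) j = \<nu> * (lam j * cf (u t) j)"
        by (simp add: l2_inner_scaleR_left cf_stokes[OF elim(4) j])
      also have "cf (bilin L (u t) (u t)) j = - tri (ser (cf (u t))) (ser (cf (u t))) j" by (rule cf_bilin(2)[OF elim(4) j])
      finally show "cf (du t) j = cf (f t) j - \<nu> * (lam j * cf (u t) j) + tri (ser (cf (u t))) (ser (cf (u t))) j" by simp
    qed
  qed
  then show ?thesis using du by blast
qed

lemma galerkin_space_comb:
  assumes "v \<in> galerkin_space \<phi> N"
  shows "v = comb {1..N} (cf v)"
proof -
  obtain c where c: "v = comb {1..N} c" using assms by (auto simp: galerkin_space_def comb_def[abs_def])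
  have "cf v j = c j" if "j \<in> {1..N}" for j unfolding c by (subst cf_comb) (use that in auto)
  then have "comb {1..N} (cf v) x = comb {1..N} c x" for x unfolding comb_def by (intro sum.cong) auto
  then show ?thesis unfolding c by auto
qed

lemma nudged_modes:
  assumes v: "nudged_solution L \<nu> \<phi> N \<mu> J f u v" and J: "\<And>g. J g = comb {1..N} (Jc g)"
  shows "\<exists>dv. (\<forall>T>0. L2_time L T dv) \<and> has_time_derivative L v dv \<and>
    (AE t in lebesgue_on {0<..}. \<forall>j\<in>{1..N}. cf (dv t) j =
       cf (f t) j - \<nu> * (lam j * cf (v t) j) + tri (v t) (v t) j - \<mu> * (Jc (v t) j - Jc (u t) j))"
proof -
  let ?I = "{1..N}"
  have I: "finite ?I" "?I \<subseteq> {1..}" by auto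
  obtain dv where dv: "\<forall>T>0. L2_time L T dv" "has_time_derivative L v dv"
    and eq: "AE t in lebesgue_on {0<..}. AE x in Q. dv t x + \<nu> *\<^sub>R stokes L (v t) x + projN L \<phi> N (bilin L (v t) (v t)) x
             = projN L \<phi> N (f t) x - \<mu> *\<^sub>R (J (v t) x - J (u t) x)"
    using v unfolding nudged_solution_def by blast
  have 1: "AE t in lebesgue_on {0<..}. dv t \<in> spaceH L"
    using dv(1) by (intro AE_halfline) (auto simp: L2_time_def time_measurable_def)
  have 2: "AE t in lebesgue_on {0<..}. (t :: real) > 0" by (rule AE_I2) auto
  have "AE t in lebesgue_on {0<..}. \<forall>j\<in>{1..N}. cf (dv t) j =
       cf (f t) j - \<nu> * (lam j * cf (v t) j) + tri (v t) (v t) j - \<mu> * (Jc (v t) j - Jc (u t) j)"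
    using 1 2 eq
  proof eventually_elim
    case (elim t)
    have vt: "v t = comb ?I (cf (v t))" using v elim(2) by (intro galerkin_space_comb) (auto simp: nudged_solution_def)
    have d: "v t \<in> domA L" by (subst vt, rule comb_domA[OF I(2)])
    have vc: "continuous_on UNIV (v t)" by (subst vt, rule comb_continuous[OF I(2)])
    have st: "AE x in Q. stokes L (v t) x = comb ?I (\<lambda>j. lam j * cf (v t) j) x" by (subst vt, rule stokes_comb[OF I])
    \<comment> \<open>Solving the equation for \<open>dv t\<close> exhibits it, almost everywhere in
      space, as a combination of the first \<open>N\<close> eigenfunctions, whose coefficients can
      be read off.\<close>
    define e where "e j = cf (f t) j - \<mu> * (Jc (v t) j - Jc (u t) j) - \<nu> * (lam j * cf (v t) j) - cf (bilin L (v t) (v t)) j" for j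
    have de: "AE x in Q. dv t x = comb ?I e x"
      using st elim(3)
    proof eventually_elim
      case (elim x)
      have "dv t x = comb ?I (cf (f t)) x - \<mu> *\<^sub>R (comb ?I (Jc (v t)) x - comb ?I (Jc (u t)) x) - \<nu> *\<^sub>R comb ?I (\<lambda>j. lam j * cf (v t) j) x
         - comb ?I (cf (bilin L (v t) (v t))) x"
        using elim(2) unfolding projN_eq J elim(1) by (simp add: algebra_simps)
      then show ?case by (simp add: comb_def e_def scaleR_sum_right sum_subtractf[symmetric] scaleR_diff_left scaleR_diff_right right_diff_distrib)
    qed
    show ?case
    proof
      fix j assume j: "j \<in> ?I"
      then have j1: "j \<ge> 1" by simp
      have "cf (dv t) j = cf (comb ?I e) j"
        by (rule l2_inner_cong_AE[OF de spaceH_sqint[OF elim(1)] comb_sqint[OF I(2)] phi_sqint[OF j1]])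
      also have "\<dots> = e j" by (subst cf_comb[OF I j1]) (use j in simp)
      also have "cf (bilin L (v t) (v t)) j = - tri (v t) (v t) j"
        by (rule cf_bilin_continuous[OF d vc _ j1]) simp
      then have "e j = cf (f t) j - \<nu> * (lam j * cf (v t) j) + tri (v t) (v t) j - \<mu> * (Jc (v t) j - Jc (u t) j)" by (simp add: e_def)
      finally show "cf (dv t) j = cf (f t) j - \<nu> * (lam j * cf (v t) j) + tri (v t) (v t) j - \<mu> * (Jc (v t) j - Jc (u t) j)" .
    qed
  qed
  then show ?thesis using dv by blast
qed

lemma time_derivative_cf:
  assumes g: "\<forall>T>0. L2_time L T g" and d: "has_time_derivative L v g" and j: "j \<ge> 1"
  shows "0 \<le> s \<Longrightarrow> s \<le> t \<Longrightarrow> cf (v t) j - cf (v s) j = (LINT r|lebesgue_on {s..t}. cf (g r) j)"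
    and "0 \<le> s \<Longrightarrow> integrable (lebesgue_on {s..t}) (\<lambda>r. cf (g r) j)"
    and "continuous_on {0..} (\<lambda>t. cf (v t) j)"
proof -
  show 1: "cf (v t) j - cf (v s) j = (LINT r|lebesgue_on {s..t}. cf (g r) j)" if "0 \<le> s" "s \<le> t" for s t
    using d phi_H[OF j] that unfolding has_time_derivative_def by blast
  have i: "integrable (lebesgue_on {0<..<T}) (\<lambda>r. cf (g r) j)" if "T > 0" for T
    using L2_time_cf_integrable[OF _ j] g that by blast
  show "0 \<le> s \<Longrightarrow> integrable (lebesgue_on {s..t}) (\<lambda>r. cf (g r) j)" by (rule locally_integrable_ivl[OF i])
  have "continuous_on {0..} (\<lambda>t. cf (v 0) j + (LINT r|lebesgue_on {0..t}. cf (g r) j))"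
    by (intro continuous_intros locally_integrable_primitive(1)[OF i])
  moreover have "cf (v 0) j + (LINT r|lebesgue_on {0..t}. cf (g r) j) = cf (v t) j" if "t \<in> {0..}" for t using 1[of 0 t] that by simp
  ultimately show "continuous_on {0..} (\<lambda>t. cf (v t) j)" by (rule continuous_on_eq)
qed

lemma exp_sqrt_lam_small:
  assumes e: "e > 0" and a: "a > 0"
  shows "\<exists>n\<ge>1. \<forall>N\<ge>n. exp (- a * sqrt (lam N)) * C \<le> e"
proof -
  define s where "s = max 0 (ln ((\<bar>C\<bar> + 1) / e) / a)"
  obtain n where n: "n \<ge> 1" "\<forall>j\<ge>n. lam j > s\<^sup>2" using lam_at_top[of "s\<^sup>2"] by blast
  have "exp (- a * sqrt (lam N)) * C \<le> e" if "N \<ge> n" for N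
  proof -
    have "s\<^sup>2 \<le> lam N" using n(2) that by (simp add: less_imp_le)
    then have "s \<le> sqrt (lam N)" by (rule real_le_rsqrt)
    then have "ln ((\<bar>C\<bar> + 1) / e) \<le> a * sqrt (lam N)" using a by (simp add: s_def divide_le_eq mult.commute)
    then have "exp (ln ((\<bar>C\<bar> + 1) / e)) \<le> exp (a * sqrt (lam N))" by simp
    then have "\<bar>C\<bar> + 1 \<le> e * exp (a * sqrt (lam N))" using e by (simp add: divide_le_eq mult.commute)
    then have "C \<le> e * exp (a * sqrt (lam N))" by linarith
    then show ?thesis by (simp add: exp_minus divide_le_eq field_simps)
  qed
  then show ?thesis using n(1) by blast
qed

text \<open>The Gevrey bound makes the tails small uniformly in time as well as in space. Trilinear
  and observation terms are therefore uniform limits of polynomials in finitely many coefficients,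
  hence continuous in time.\<close>

lemma ser_uniform_time:
  assumes \<sigma>: "\<sigma> > 1" and g: "\<And>t. t \<in> S \<Longrightarrow> gevrey_norm L \<phi> lam \<sigma> (u t) < ereal K" and e: "e > 0"
  shows "\<exists>n. \<forall>t\<in>S. \<forall>x. norm (ser (cf (u t)) x - comb {1..n} (cf (u t)) x) \<le> e"
proof -
  obtain n where n: "n \<ge> 1" "exp (- (\<sigma> - 1) * sqrt (lam n)) * (weylC * K) \<le> e"
    using exp_sqrt_lam_small[OF e, of "\<sigma> - 1" "weylC * K"] \<sigma> by auto
  have "norm (ser (cf (u t)) x - comb {1..n} (cf (u t)) x) \<le> e" if t: "t \<in> S" for t x
  proof -
    have q: "dsum (tailc n (cf (u t))) (exp (- (\<sigma> - 1) * sqrt (lam n)) * K)"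
      by (rule gevrey_tail[OF g[OF t] _ n(1)]) (use \<sigma> in simp)
    have "ser (cf (u t)) x - comb {1..n} (cf (u t)) x = ser (tailc n (cf (u t))) x"
      using ser_split[OF gevrey_dsum[OF g[OF t]] q, of x] \<sigma> by simp
    then show ?thesis using norm_ser_le[OF q, of x] n(2) by (simp add: mult_ac)
  qed
  then show ?thesis by blast
qed

end

section \<open>Continuity in time and the equation for the error\<close>

context observed
begin

lemma tri_ser_approx:
  assumes c: "dsum c K" and e: "\<And>x. norm (ser c x - comb {1..n} c x) \<le> e" and j: "j \<ge> 1"
  shows "\<bar>tri (ser c) (ser c) j - tri (comb {1..n} c) (comb {1..n} c) j\<bar> \<le> 2 * tri_const j * (weylC * K) * e"
proof -
  let ?P = "comb {1..n} c"
  define r where "r x = ser c x - ?P x" for x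
  have cP: "continuous_on UNIV ?P" by (rule comb_continuous) auto
  have cU: "continuous_on UNIV (ser c)" by (rule ser_continuous[OF c])
  have cr: "continuous_on UNIV r" unfolding r_def by (intro continuous_intros cU cP)
  have U: "ser c = (\<lambda>x. ?P x + r x)" by (auto simp: r_def)
  have "tri (ser c) (ser c) j = tri (ser c) ?P j + tri (ser c) r j"
    by (subst (2) U) (rule tri_add_right[OF cU cr cP j] tri_add_right[OF cU cP cr j])
  moreover have "tri (ser c) ?P j = tri ?P ?P j + tri r ?P j"
    by (subst U) (rule tri_add_left[OF cP cr cP j])
  moreover have "\<bar>tri (ser c) r j\<bar> \<le> tri_const j * (weylC * K * e)"
    by (rule tri_bound[OF cU cr j norm_ser_le[OF c]]) (unfold r_def, rule e)
  moreover have "\<bar>tri r ?P j\<bar> \<le> tri_const j * (e * (weylC * K))"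
    by (rule tri_bound[OF cr cP j]) (unfold r_def, rule e, rule norm_comb_le[OF c])
  moreover have "2 * tri_const j * (weylC * K) * e = tri_const j * (weylC * K * e) + tri_const j * (e * (weylC * K))" by (simp add: algebra_simps)
  ultimately show ?thesis by linarith
qed

lemma continuous_tri_time:
  fixes u :: "real \<Rightarrow> field"
  assumes cc: "\<And>k. k \<ge> 1 \<Longrightarrow> continuous_on S (\<lambda>t. cf (u t) k)" and \<sigma>: "\<sigma> > 1"
    and g: "\<And>t. t \<in> S \<Longrightarrow> gevrey_norm L \<phi> lam \<sigma> (u t) < ereal K" and j: "j \<ge> 1"
  shows "continuous_on S (\<lambda>t. tri (ser (cf (u t))) (ser (cf (u t))) j)"
proof (rule continuous_on_uniform_approx)
  fix e :: real assume e: "e > 0"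
  define m where "m = 2 * tri_const j * (weylC * \<bar>K\<bar>) + 1"
  have m: "m > 0" unfolding m_def using tri_const_nonneg[of j] weylC(1) by (intro add_nonneg_pos mult_nonneg_nonneg) auto
  obtain n where n: "\<forall>t\<in>S. \<forall>x. norm (ser (cf (u t)) x - comb {1..n} (cf (u t)) x) \<le> e / m"
    using ser_uniform_time[of \<sigma> S u K "e / m", OF \<sigma> g divide_pos_pos[OF e m]] by blast
  let ?g = "\<lambda>t. \<Sum>k\<in>{1..n}. \<Sum>l\<in>{1..n}. tri (\<phi> k) (\<phi> l) j * (cf (u t) k * cf (u t) l)"
  have "continuous_on S ?g" by (intro continuous_intros cc) auto
  moreover have "\<bar>tri (ser (cf (u t))) (ser (cf (u t))) j - ?g t\<bar> \<le> e" if t: "t \<in> S" for t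
  proof -
    have d: "dsum (cf (u t)) K" by (rule gevrey_dsum[OF g[OF t]]) (use \<sigma> in simp)
    have "\<bar>tri (ser (cf (u t))) (ser (cf (u t))) j - tri (comb {1..n} (cf (u t))) (comb {1..n} (cf (u t))) j\<bar> \<le> 2 * tri_const j * (weylC * K) * (e / m)"
      by (rule tri_ser_approx[OF d _ j]) (use n t in blast)
    also have "\<dots> \<le> m * (e / m)"
    proof (rule mult_right_mono)
      have "K \<ge> 0" using d by (simp add: dsum_def)
      then show "2 * tri_const j * (weylC * K) \<le> m" by (simp add: m_def)
    qed (use e m in simp)
    also have "\<dots> = e" using m by simp
    finally show ?thesis by (subst (asm) tri_comb[OF _ _ j]) auto
  qed
  ultimately show "\<exists>g. continuous_on S g \<and> (\<forall>t\<in>S. \<bar>tri (ser (cf (u t))) (ser (cf (u t))) j - g t\<bar> \<le> e)" by blast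
qed

lemma continuous_Jc_time:
  fixes u :: "real \<Rightarrow> field"
  assumes cc: "\<And>k. k \<ge> 1 \<Longrightarrow> continuous_on S (\<lambda>t. cf (u t) k)" and \<sigma>: "\<sigma> > 1"
    and g: "\<And>t. t \<in> S \<Longrightarrow> gevrey_norm L \<phi> lam \<sigma> (u t) < ereal K" and h: "h > 0" and j: "j \<ge> 1"
  shows "continuous_on S (\<lambda>t. Jc b h a (ser (cf (u t))) j)"
proof (rule continuous_on_uniform_approx)
  fix e :: real assume e: "e > 0"
  obtain C where C: "C \<ge> 0" "\<And>f S. cbp f S \<Longrightarrow> \<bar>Jc b h a f j\<bar> \<le> C * S" using Jc_bound[OF h j] by blast
  obtain n where n: "\<forall>t\<in>S. \<forall>x. norm (ser (cf (u t)) x - comb {1..n} (cf (u t)) x) \<le> e / (C + 1)"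
    using ser_uniform_time[of \<sigma> S u K "e / (C + 1)", OF \<sigma> g divide_pos_pos[OF e]] C(1) by force
  let ?g = "\<lambda>t. \<Sum>k\<in>{1..n}. cf (u t) k * Jc b h a (\<phi> k) j"
  have "continuous_on S ?g" by (intro continuous_intros cc) auto
  moreover have "\<bar>Jc b h a (ser (cf (u t))) j - ?g t\<bar> \<le> e" if t: "t \<in> S" for t
  proof -
    have d: "dsum (cf (u t)) K" by (rule gevrey_dsum[OF g[OF t]]) (use \<sigma> in simp)
    have "\<bar>Jc b h a (ser (cf (u t))) j - ?g t\<bar> \<le> C * (e / (C + 1))"
      by (rule Jc_ser_diff[OF h d j C(2)]) (use n t in auto)
    also have "\<dots> \<le> (C + 1) * (e / (C + 1))" using e C(1) by (intro mult_right_mono) auto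
    also have "\<dots> = e" using C(1) by simp
    finally show ?thesis .
  qed
  ultimately show "\<exists>g. continuous_on S g \<and> (\<forall>t\<in>S. \<bar>Jc b h a (ser (cf (u t))) j - g t\<bar> \<le> e)" by blast
qed

text \<open>With forcing that is merely measurable in time, neither \<open>u\<close> nor
  \<open>v\<close> need have classically differentiable modes. In the difference the forcing cancels
  and the remaining right-hand side is continuous, so the integrated equation can be differentiated
  at every time after \<open>T0\<close>.\<close>

lemma error_modes:
  assumes ns: "ns_solution L \<nu> f u0 u" and f: "Linf_time L f" and h: "h > 0"
    and J: "\<And>g. J g = comb {1..N} (Jc b h a g)" and v: "nudged_solution L \<nu> \<phi> N \<mu> J f u v"
    and \<sigma>: "\<sigma> > 1" and T0: "T0 \<ge> 0" and g: "\<And>t. t \<ge> T0 \<Longrightarrow> gevrey_norm L \<phi> lam \<sigma> (u t) < ereal K" and j: "j \<in> {1..N}"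
  shows "continuous_on {T0..} (\<lambda>t. cf (u t) j - cf (v t) j)"
    and "t > T0 \<Longrightarrow> ((\<lambda>t. cf (u t) j - cf (v t) j) has_real_derivative
      - \<nu> * (lam j * (cf (u t) j - cf (v t) j))
      + (tri (ser (cf (u t))) (ser (cf (u t))) j - tri (comb {1..N} (cf (v t))) (comb {1..N} (cf (v t))) j)
      + \<mu> * (Jc b h a (comb {1..N} (cf (v t))) j - Jc b h a (ser (cf (u t))) j)) (at t)"
proof -
  let ?I = "{1..N}"
  have j1: "j \<ge> 1" using j by simp
  define w where "w t = cf (u t) j - cf (v t) j" for t
  define H where "H t = - \<nu> * (lam j * (cf (u t) j - cf (v t) j))
      + (tri (ser (cf (u t))) (ser (cf (u t))) j - tri (comb ?I (cf (v t))) (comb ?I (cf (v t))) j)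
      + \<mu> * (Jc b h a (comb ?I (cf (v t))) j - Jc b h a (ser (cf (u t))) j)" for t
  obtain du where du: "\<forall>T>0. L2_time L T du" "has_time_derivative L u du"
    and eu: "AE t in lebesgue_on {0<..}. \<forall>j\<ge>1. cf (du t) j =
       cf (f t) j - \<nu> * (lam j * cf (u t) j) + tri (ser (cf (u t))) (ser (cf (u t))) j"
    using ns_modes[OF ns f] by blast
  obtain dv where dv: "\<forall>T>0. L2_time L T dv" "has_time_derivative L v dv"
    and ev: "AE t in lebesgue_on {0<..}. \<forall>j\<in>?I. cf (dv t) j =
       cf (f t) j - \<nu> * (lam j * cf (v t) j) + tri (v t) (v t) j - \<mu> * (Jc b h a (v t) j - Jc b h a (u t) j)"
    using nudged_modes[OF v J] by blast
  have vt: "v t = comb ?I (cf (v t))" if "t \<ge> 0" for t using v that by (intro galerkin_space_comb) (auto simp: nudged_solution_def)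
  have cu: "continuous_on {T0..} (\<lambda>t. cf (u t) k)" if "k \<ge> 1" for k
    by (rule continuous_on_subset[OF ns_cf_continuous[OF ns that]]) (use T0 in auto)
  have cv: "continuous_on {T0..} (\<lambda>t. cf (v t) k)" if "k \<ge> 1" for k
    by (rule continuous_on_subset[OF time_derivative_cf(3)[OF dv that]]) (use T0 in auto)
  have cw: "continuous_on {T0..} w" unfolding w_def by (intro continuous_intros cu cv j1)
  then show "continuous_on {T0..} (\<lambda>t. cf (u t) j - cf (v t) j)" unfolding w_def .
  have I: "finite ?I" "?I \<subseteq> {1..}" by auto
  have cH: "continuous_on {T0..} H"
    unfolding H_def tri_comb[OF I j1] Jc_comb[OF h I j1]
    by (intro continuous_intros cu cv j1 continuous_tri_time[OF cu \<sigma> g] continuous_Jc_time[OF cu \<sigma> g h]) auto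
  have ae: "AE t in lebesgue_on {0<..}. t \<ge> T0 \<longrightarrow> cf (du t) j - cf (dv t) j = H t"
  proof -
    have "AE t in lebesgue_on {0<..}. (t :: real) > 0" by (rule AE_I2) auto
    with eu ev show ?thesis
    proof eventually_elim
      case (elim t)
      show ?case
      proof
        assume t: "t \<ge> T0"
        have s: "u t \<in> spaceH L" using ns t T0 by (auto simp: ns_solution_def spaceV_def)
        have d: "dsum (cf (u t)) K" by (rule gevrey_dsum[OF g[OF t]]) (use \<sigma> in simp)
        have vc: "comb ?I (cf (v t)) = v t" using vt[of t] elim(3) by simp
        have "cf (du t) j = cf (f t) j - \<nu> * (lam j * cf (u t) j) + tri (ser (cf (u t))) (ser (cf (u t))) j" using elim(1) j1 by blast
        moreover have "cf (dv t) j = cf (f t) j - \<nu> * (lam j * cf (v t) j) + tri (v t) (v t) j - \<mu> * (Jc b h a (v t) j - Jc b h a (u t) j)"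
          using elim(2) j by blast
        ultimately show "cf (du t) j - cf (dv t) j = H t"
          unfolding H_def vc Jc_ser[OF h s d] by (simp add: algebra_simps)
      qed
    qed
  qed
  have wi: "w t = w T0 + integral {T0..t} H" if t: "t \<ge> T0" for t
  proof -
    have cHt: "continuous_on {T0..t} H" by (rule continuous_on_subset[OF cH]) auto
    have iu: "integrable (lebesgue_on {T0..t}) (\<lambda>r. cf (du r) j)" by (rule time_derivative_cf(2)[OF du j1 T0])
    have iv: "integrable (lebesgue_on {T0..t}) (\<lambda>r. cf (dv r) j)" by (rule time_derivative_cf(2)[OF dv j1 T0])
    have "w t - w T0 = (LINT r|lebesgue_on {T0..t}. cf (du r) j) - (LINT r|lebesgue_on {T0..t}. cf (dv r) j)"
      using time_derivative_cf(1)[OF du j1 T0 t] time_derivative_cf(1)[OF dv j1 T0 t] by (simp add: w_def)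
    also have "\<dots> = (LINT r|lebesgue_on {T0..t}. cf (du r) j - cf (dv r) j)"
      by (rule Bochner_Integration.integral_diff[symmetric, OF iu iv])
    also have "\<dots> = (LINT r|lebesgue_on {T0..t}. H r)"
    proof (rule integral_cong_AE)
      show "(\<lambda>r. cf (du r) j - cf (dv r) j) \<in> borel_measurable (lebesgue_on {T0..t})"
        by (intro borel_measurable_diff borel_measurable_integrable iu iv)
      show "H \<in> borel_measurable (lebesgue_on {T0..t})"
        by (rule continuous_imp_measurable_on_sets_lebesgue[OF cHt]) auto
      have "AE r in lebesgue. r \<in> {0<..} \<longrightarrow> (r \<ge> T0 \<longrightarrow> cf (du r) j - cf (dv r) j = H r)"
        using ae by (subst (asm) AE_lebesgue_on_iff) auto
      \<comment> \<open>The equations hold at almost every positive time, and \<open>T0\<close> may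
        be 0.\<close>
      moreover have "AE r in lebesgue. r \<noteq> (0 :: real)" by (rule AE_completion[OF AE_lborel_singleton])
      ultimately have "AE r in lebesgue. r \<in> {T0..t} \<longrightarrow> cf (du r) j - cf (dv r) j = H r"
        by eventually_elim (use T0 in auto)
      then show "AE r in lebesgue_on {T0..t}. cf (du r) j - cf (dv r) j = H r" by (subst AE_lebesgue_on_iff) auto
    qed
    also have "\<dots> = integral {T0..t} H"
      by (rule lebesgue_integral_eq_integral[OF continuous_imp_integrable_real[OF cHt]]) auto
    finally show ?thesis by simp
  qed
  show "((\<lambda>t. cf (u t) j - cf (v t) j) has_real_derivative
      - \<nu> * (lam j * (cf (u t) j - cf (v t) j))
      + (tri (ser (cf (u t))) (ser (cf (u t))) j - tri (comb {1..N} (cf (v t))) (comb {1..N} (cf (v t))) j)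
      + \<mu> * (Jc b h a (comb {1..N} (cf (v t))) j - Jc b h a (ser (cf (u t))) j)) (at t)" if t: "t > T0"
  proof -
    have "((\<lambda>t. w T0 + integral {T0..t} H) has_real_derivative H t) (at t within {T0..t+1})"
      using t by (auto intro!: derivative_eq_intros integral_has_real_derivative continuous_on_subset[OF cH])
    then have "((\<lambda>t. w T0 + integral {T0..t} H) has_real_derivative H t) (at t)" using t by (simp add: at_within_Icc_at)
    then have "(w has_real_derivative H t) (at t)"
    proof (rule has_field_derivative_transform_within_open[of _ _ _ "{T0<..}"])
      show "w T0 + integral {T0..s} H = w s" if "s \<in> {T0<..}" for s using wi[of s] that by simp
    qed (use t in auto)
    then show ?thesis unfolding w_def[abs_def] H_def .
  qed
qed

end

section \<open>Choice of the parameters\<close>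

text \<open>The types fix the admissible dependence: \<open>Ns\<close> sees
  \<open>\<epsilon>\<close> and \<open>M\<close>, while \<open>m\<close> and \<open>hs\<close> see
  \<open>N\<close>, and all are chosen before the forcing and the solution. As a predicate it lets
  the parameters be chosen for each \<open>\<Omega>\<close> separately.\<close>

definition nudging_parameters :: "real \<Rightarrow> (nat \<Rightarrow> field) \<Rightarrow> (nat \<Rightarrow> real) \<Rightarrow> (real^2) set \<Rightarrow>
    (real \<Rightarrow> real \<Rightarrow> nat) \<Rightarrow> (nat \<Rightarrow> real) \<Rightarrow> (nat \<Rightarrow> real) \<Rightarrow> real \<Rightarrow> bool" where
  "nudging_parameters L \<phi> lam \<Omega> Ns m hs ss \<longleftrightarrow> (\<forall>\<nu> u0 f u \<sigma> M \<epsilon>. \<nu> > 0 \<and> Linf_time L f \<and> ns_solution L \<nu> f u0 u \<and>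
      Limsup at_top (\<lambda>t. gevrey_norm L \<phi> lam \<sigma> (u t)) = ereal M \<and> \<epsilon> > 0 \<longrightarrow>
      (\<forall>N\<ge>Ns \<epsilon> M. m N > 0 \<and> hs N > 0 \<and> ss > 0 \<and>
        (\<forall>h a J. 0 < h \<and> h < hs N \<and> \<sigma> > ss \<and>
            (J = volume_interp L \<phi> h a N \<Omega> \<or> J = nodal_interp L \<phi> h a N \<Omega>) \<longrightarrow>
            (\<exists>v. nudged_solution L \<nu> \<phi> N (m N) J f u v) \<and>
            (\<forall>v. nudged_solution L \<nu> \<phi> N (m N) J f u v \<longrightarrow>
               (\<forall>\<^sub>F t in at_top. l2_norm L (\<lambda>x. u t x - v t x) < \<epsilon>)))))"

context observed
begin

text \<open>The squared norm \<open>y\<close> of the low-mode error satisfies a linear differential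
  inequality with equilibrium \<open>B\<^sup>2\<close>, so its upper limit is at most that; the high
  modes of \<open>u\<close> add \<open>L * \<delta>q\<close>. The bound \<open>K\<close> of the
  solution enters \<open>A\<close>, and with it \<open>\<mu>\<close>, only through the larger
  \<open>K0\<close>.\<close>

lemma nudging_error:
  assumes ns: "ns_solution L \<nu> f u0 u" and f: "Linf_time L f" and \<nu>: "\<nu> > 0"
    and J: "\<And>g. J g = comb {1..N} (Jc b h a g)" and v: "nudged_solution L \<nu> \<phi> N \<mu> J f u v"
    and \<sigma>: "\<sigma> > 1" and T0: "T0 \<ge> 0" and g: "\<And>t. t \<ge> T0 \<Longrightarrow> gevrey_norm L \<phi> lam \<sigma> (u t) < ereal K"
    and K: "K \<le> K0" and N: "N \<ge> 1" and h: "0 < h" "h < 1" "h < \<delta>"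
    and box: "\<And>x. (\<And>i. p $ i - \<delta> \<le> x $ i \<and> x $ i \<le> p $ i + 2 * \<delta>) \<Longrightarrow> x \<in> \<Omega>"
    and lip: "\<And>d x y. norm (comb {1..N} d x - comb {1..N} d y) \<le> \<Lambda> * sqrt (\<Sum>j\<in>{1..N}. (d j)\<^sup>2) * norm (x - y)" and \<Lambda>: "\<Lambda> \<ge> 0"
    and E: "E > 0" "\<And>d y. (norm (comb {1..N} d y))\<^sup>2 \<le> E * integral (cbox p (p + (\<chi> i. \<delta>))) (\<lambda>x. (norm (comb {1..N} d x))\<^sup>2)"
    and hs: "h * (2 * (L + 2)\<^sup>2 * \<Lambda> * weylC * lam N) \<le> \<kappa> / 2"
    and \<kappa>: "\<kappa> = 1 / (L\<^sup>2 * E)" and A: "A = (\<Sum>j\<in>{1..N}. tri_const j) * (weylC * K0 * (weylC * lam N + 2))" and \<mu>: "\<mu> = 4 * (A + 1) / \<kappa>"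
    and \<delta>q: "\<delta>q = weylC * (exp (- (\<sigma> - 1) * sqrt (lam N)) * K)"
    and B: "B = (1 + 4 * ((L + 2)\<^sup>2 * (weylC * lam N)) / \<kappa>) * \<delta>q" and e: "e > 0"
  shows "\<forall>\<^sub>F t in at_top. l2_norm L (\<lambda>x. u t x - v t x) < B + e + L * \<delta>q"
proof -
  let ?I = "{1..N}"
  have I: "finite ?I" "?I \<subseteq> {1..}" by auto
  have wp: "weylC > 0" by (rule weylC)
  have lp: "lam N > 0" by (rule lam_pos[OF N])
  have K1: "K > 0" using gevrey_sum(2)[OF g[OF order_refl], of "{}"] by simp
  have \<kappa>0: "\<kappa> > 0" unfolding \<kappa> using L_pos E(1) by simp
  have sT: "(\<Sum>j\<in>?I. tri_const j) \<ge> 0" by (rule sum_nonneg[OF tri_const_nonneg])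
  have A0: "A \<ge> 0" unfolding A using sT wp lp K K1 by (intro mult_nonneg_nonneg add_nonneg_nonneg) auto
  have \<delta>0: "\<delta>q \<ge> 0" unfolding \<delta>q using wp K1 by simp
  have B0: "B \<ge> 0" unfolding B using \<delta>0 \<kappa>0 wp lp by (intro mult_nonneg_nonneg add_nonneg_nonneg divide_nonneg_nonneg) auto
  define w where "w t j = cf (u t) j - cf (v t) j" for t j
  define y where "y t = (\<Sum>j\<in>?I. (w t j)\<^sup>2)" for t
  have y0: "y t \<ge> 0" for t unfolding y_def by (rule sum_nonneg) simp
  have d: "dsum (cf (u t)) K" if "t \<ge> T0" for t by (rule gevrey_dsum[OF g[OF that]]) (use \<sigma> in simp)
  have q: "dsum (tailc N (cf (u t))) (exp (- (\<sigma> - 1) * sqrt (lam N)) * K)" if "t \<ge> T0" for t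
    by (rule gevrey_tail[OF g[OF that] _ N]) (use \<sigma> in simp)
  note em = error_modes[OF ns f h(1) J v \<sigma> T0 g]
  have cy: "continuous_on {T0..} y" unfolding y_def w_def by (intro continuous_intros em(1))
  have dy: "\<exists>D. (y has_real_derivative D) (at t) \<and> D \<le> - (A + 1) * (y t - B\<^sup>2)" if t: "t > T0" for t
  proof -
    have t': "t \<ge> T0" using t by simp
    define X where "X = (\<Sum>j\<in>?I. w t j * (tri (ser (cf (u t))) (ser (cf (u t))) j - tri (comb ?I (cf (v t))) (comb ?I (cf (v t))) j))"
    define Y where "Y = (\<Sum>j\<in>?I. w t j * (Jc b h a (comb ?I (cf (v t))) j - Jc b h a (ser (cf (u t))) j))"
    define H where "H j = - \<nu> * (lam j * w t j)
      + (tri (ser (cf (u t))) (ser (cf (u t))) j - tri (comb ?I (cf (v t))) (comb ?I (cf (v t))) j)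
      + \<mu> * (Jc b h a (comb ?I (cf (v t))) j - Jc b h a (ser (cf (u t))) j)" for j
    have dw: "((\<lambda>t. w t j) has_real_derivative H j) (at t)" if "j \<in> ?I" for j
      unfolding w_def H_def by (rule em(2)[OF _ that t])
    define n where "n = sqrt (y t)"
    have n: "n \<ge> 0" "n\<^sup>2 = y t" using y0 by (auto simp: n_def)
    have "(y has_real_derivative (\<Sum>j\<in>?I. 2 * (w t j * H j))) (at t)"
      unfolding y_def[abs_def] by (rule DERIV_sum) (auto intro!: derivative_eq_intros dw)
    moreover have "(\<Sum>j\<in>?I. 2 * (w t j * H j)) \<le> - (A + 1) * (y t - B\<^sup>2)"
    proof -
      have "(\<Sum>j\<in>?I. w t j * H j) = (\<Sum>j\<in>?I. - \<nu> * (lam j * (w t j)\<^sup>2)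
        + w t j * (tri (ser (cf (u t))) (ser (cf (u t))) j - tri (comb ?I (cf (v t))) (comb ?I (cf (v t))) j)
        + \<mu> * (w t j * (Jc b h a (comb ?I (cf (v t))) j - Jc b h a (ser (cf (u t))) j)))"
        by (rule sum.cong) (simp_all add: H_def algebra_simps power2_eq_square)
      also have "\<dots> = (\<Sum>j\<in>?I. - \<nu> * (lam j * (w t j)\<^sup>2)) + X + \<mu> * Y"
        by (simp only: sum.distrib X_def Y_def sum_distrib_left)
      \<comment> \<open>The viscous term has a favourable sign and is dropped.\<close>
      also have "\<dots> \<le> X + \<mu> * Y"
      proof -
        have "- \<nu> * (lam j * (w t j)\<^sup>2) \<le> 0" if "j \<in> ?I" for j using \<nu> lam_pos[of j] that by simp
        then have "(\<Sum>j\<in>?I. - \<nu> * (lam j * (w t j)\<^sup>2)) \<le> 0" by (rule sum_nonpos)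
        then show ?thesis by simp
      qed
      finally have 1: "(\<Sum>j\<in>?I. w t j * H j) \<le> X + \<mu> * Y" .
      have X: "X \<le> A * (n + \<delta>q) * n"
      proof -
        have "X \<le> (\<Sum>j\<in>?I. tri_const j) * (weylC * K * (weylC * lam N * n + 2 * \<delta>q)) * n"
          unfolding X_def \<delta>q by (rule trilinear_difference[OF N d[OF t'] q[OF t'] w_def]) (simp_all add: n_def y_def)
        also have "\<dots> \<le> (\<Sum>j\<in>?I. tri_const j) * (weylC * K0 * ((weylC * lam N + 2) * (n + \<delta>q))) * n"
        proof (intro mult_right_mono[OF _ n(1)] mult_left_mono[OF _ sT])
          have "weylC * lam N * n + 2 * \<delta>q \<le> (weylC * lam N + 2) * (n + \<delta>q)"
            using wp lp n \<delta>0 by (simp add: algebra_simps)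
          then show "weylC * K * (weylC * lam N * n + 2 * \<delta>q) \<le> weylC * K0 * ((weylC * lam N + 2) * (n + \<delta>q))"
            using wp lp n \<delta>0 K K1 by (intro mult_mono) auto
        qed
        also have "\<dots> = A * (n + \<delta>q) * n" unfolding A by (simp only: mult_ac)
        finally show ?thesis .
      qed
      have Y: "Y \<le> - (\<kappa> / 2) * n\<^sup>2 + (L + 2)\<^sup>2 * (weylC * lam N) * \<delta>q * n"
      proof -
        have "h * (2 * (L + 2)\<^sup>2 * \<Lambda> * weylC * lam N) \<le> 1 / (2 * (L\<^sup>2 * E))" using hs unfolding \<kappa> by simp
        then have "(\<Sum>j\<in>?I. w t j * Jc b h a (comb ?I (w t)) j) \<ge> (\<Sum>j\<in>?I. (w t j)\<^sup>2) / (2 * (L\<^sup>2 * E))"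
          by (intro observation_coercive[OF h N box lip \<Lambda> E])
        then have "(\<Sum>j\<in>?I. w t j * Jc b h a (comb ?I (w t)) j) \<ge> \<kappa> / 2 * (\<Sum>j\<in>?I. (w t j)\<^sup>2)" unfolding \<kappa> by simp
        then have "Y \<le> - (\<kappa> / 2) * n\<^sup>2 + (L + 2)\<^sup>2 * (weylC * (exp (- (\<sigma> - 1) * sqrt (lam N)) * K)) * (weylC * lam N) * n"
          unfolding Y_def by (rule observation_difference[OF h(1,2) N d[OF t'] q[OF t'] w_def]) (simp add: n_def y_def)
        then show ?thesis unfolding \<delta>q by (simp only: mult_ac)
      qed
      have "2 * (X + \<mu> * Y) \<le> - (A + 1) * (n\<^sup>2 - B\<^sup>2)"
        by (rule damping_arithmetic[OF A0 \<kappa>0 \<mu> \<delta>0 n(1) B X Y])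
      moreover have "2 * (\<Sum>j\<in>?I. w t j * H j) \<le> 2 * (X + \<mu> * Y)" using 1 by (rule mult_left_mono) simp
      ultimately show ?thesis unfolding n(2) sum_distrib_left[symmetric] by (rule order_trans[rotated])
    qed
    ultimately show ?thesis by blast
  qed
  have "\<forall>\<^sub>F t in at_top. y t < B\<^sup>2 + e\<^sup>2" by (rule decay_limit[OF _ cy dy]) (use A0 e in auto)
  then show ?thesis using eventually_ge_at_top[of T0]
  proof eventually_elim
    case (elim t)
    have t: "t \<ge> T0" by (rule elim)
    have uH: "u t \<in> spaceH L" using ns t T0 by (auto simp: ns_solution_def spaceV_def)
    define U where "U = ser (cf (u t))"
    define W where "W = comb ?I (w t)"
    define r where "r = ser (tailc N (cf (u t)))"
    have UH: "U \<in> spaceH L" unfolding U_def by (rule ser_spaceH[OF d[OF t]])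
    have rH: "r \<in> spaceH L" unfolding r_def by (rule ser_spaceH[OF q[OF t]])
    have vt: "v t x = comb ?I (cf (v t)) x" for x
      using galerkin_space_comb[of "v t" N] v t T0 by (auto simp: nudged_solution_def)
    have dec: "u t x - v t x = (u t x - U x) + (W x + r x)" for x
      using ser_split[OF d[OF t] q[OF t], of x] vt[of x]
      by (simp add: U_def W_def r_def w_def comb_def sum_subtractf scaleR_diff_left)
    have sW: "sqint Q W" unfolding W_def by (rule comb_sqint[OF I(2)])
    have sr: "sqint Q r" by (rule spaceH_sqint[OF rH])
    have z: "norm2 Q (\<lambda>x. u t x - U x) = 0"
      by (rule same_cf(1)[OF uH UH]) (simp add: U_def cf_ser[OF d[OF t]])
    have "l2_norm L (\<lambda>x. u t x - v t x) \<le> norm2 Q (\<lambda>x. u t x - U x) + norm2 Q (\<lambda>x. W x + r x)"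
      unfolding l2_norm_eq dec by (rule norm2_triangle[OF sqint_diff[OF spaceH_sqint[OF uH] spaceH_sqint[OF UH]] sqint_add[OF sW sr]])
    also have "\<dots> \<le> norm2 Q W + norm2 Q r" unfolding z using norm2_triangle[OF sW sr] by simp
    also have "norm2 Q r \<le> \<delta>q * L"
      unfolding \<delta>q r_def by (rule norm2_square_le[OF ser_continuous[OF q[OF t]] norm_ser_le[OF q[OF t]]])
    also have "norm2 Q W < B + e"
    proof -
      have "(norm2 Q W)\<^sup>2 = y t" unfolding W_def y_def by (rule norm_comb[OF I])
      also have "\<dots> < B\<^sup>2 + e\<^sup>2" by (rule elim)
      also have "\<dots> \<le> (B + e)\<^sup>2" using B0 e by (simp add: power2_sum)
      finally show ?thesis by (rule power_less_imp_less_base) (use B0 e in simp)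
    qed
    finally show ?case by (simp add: mult.commute)
  qed
qed

text \<open>Here \<open>s\<close> stands for \<open>sqrt (lam N)\<close>. The exponent
  \<open>\<sigma> - 1\<close> exceeds \<open>c2 + 2\<close>: the amount \<open>c2\<close> pays for
  the coercivity constant, 1 pays for the factor \<open>s\<^sup>2 \<le> 2 * exp s\<close>, and the
  last 1 is left over as decay.\<close>

lemma error_arithmetic:
  fixes w c1 c2 s K \<sigma> R :: real
  assumes pos: "w > 0" "c1 > 0" "c2 > 0" "s \<ge> 0" "K > 0" "R \<ge> 0" and \<sigma>: "\<sigma> > c2 + 3"
  shows "(1 + 4 * (R * (w * s\<^sup>2)) / (1 / (L\<^sup>2 * (c1 * exp (c2 * s))))) * (w * (exp (- (\<sigma> - 1) * s) * K)) + L * (w * (exp (- (\<sigma> - 1) * s) * K))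
    \<le> w * (1 + L + 8 * R * w * L\<^sup>2 * c1) * K * exp (- s)"
proof -
  define x where "x = exp (- (\<sigma> - 1) * s)"
  define z where "z = exp (c2 * s) * (s\<^sup>2 * x)"
  have "(c2 + 2) * s \<le> (\<sigma> - 1) * s" using \<sigma> pos by (intro mult_right_mono) auto
  then have x: "x \<le> exp (- ((c2 + 2) * s))" unfolding x_def by (simp add: algebra_simps)
  have "s \<le> (c2 + 2) * s" using pos mult_right_mono[of 1 "c2 + 2" s] by simp
  then have "exp (- ((c2 + 2) * s)) \<le> exp (- s)" by simp
  then have xs: "x \<le> exp (- s)" using x by linarith
  have "s\<^sup>2 \<le> 2 * exp s" using exp_lower_Taylor_quadratic[OF pos(4)] pos(4) by simp
  then have "z \<le> exp (c2 * s) * ((2 * exp s) * exp (- ((c2 + 2) * s)))"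
    unfolding z_def using x by (intro mult_left_mono mult_mono) (auto simp: x_def)
  also have "\<dots> = 2 * exp (c2 * s + s + - ((c2 + 2) * s))" by (simp only: exp_add mult_ac)
  also have "c2 * s + s + - ((c2 + 2) * s) = - s" by (simp add: algebra_simps)
  finally have z: "z \<le> 2 * exp (- s)" .
  have "(1 + 4 * (R * (w * s\<^sup>2)) / (1 / (L\<^sup>2 * (c1 * exp (c2 * s))))) * (w * (x * K)) + L * (w * (x * K))
    = (w * K) * ((1 + L) * x + (4 * R * w * L\<^sup>2 * c1) * z)" by (simp add: z_def algebra_simps)
  also have "\<dots> \<le> (w * K) * ((1 + L) * exp (- s) + (4 * R * w * L\<^sup>2 * c1) * (2 * exp (- s)))"
    using pos L_pos xs z by (intro mult_left_mono add_mono) auto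
  also have "\<dots> = w * (1 + L + 8 * R * w * L\<^sup>2 * c1) * K * exp (- s)" by (simp add: algebra_simps)
  finally show ?thesis unfolding x_def .
qed

text \<open>Since the spectral index may depend on \<open>M\<close>, it is taken above \<open>M\<close>; then \<open>N + 1\<close> bounds the solution,
  so that \<open>\<mu>\<close> needs no other information about it.\<close>

lemma nudging_constants:
  assumes \<delta>: "0 < \<delta>" "\<delta> \<le> L / 2"
    and box: "\<And>x. (\<And>i. p $ i - \<delta> \<le> x $ i \<and> x $ i \<le> p $ i + 2 * \<delta>) \<Longrightarrow> x \<in> \<Omega>"
  shows "\<exists>Ns m hs ss. nudging_parameters L \<phi> lam \<Omega> Ns m hs ss"
proof -
  obtain c1 c2 where c: "c1 > 0" "c2 > 0" and spec: "\<And>N d y a. N \<ge> 1 \<Longrightarrow> (norm (comb {1..N} d y))\<^sup>2 \<le>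
     c1 * exp (c2 * sqrt (lam N)) * integral (cbox a (a + (\<chi> i. \<delta>))) (\<lambda>x. (norm (comb {1..N} d x))\<^sup>2)"
    using comb_spectral_inequality[OF \<delta>] by metis
  have "\<forall>N. \<exists>\<Lambda>\<ge>0. \<forall>d x y. norm (comb {1..N} d x - comb {1..N} d y) \<le> \<Lambda> * sqrt (\<Sum>j\<in>{1..N}. (d j)\<^sup>2) * norm (x - y)"
    using comb_Lipschitz by blast
  then obtain \<Lambda> where \<Lambda>: "\<And>N. \<Lambda> N \<ge> 0"
    and lip: "\<And>N d x y. norm (comb {1..N} d x - comb {1..N} d y) \<le> \<Lambda> N * sqrt (\<Sum>j\<in>{1..N}. (d j)\<^sup>2) * norm (x - y)" by metis
  define E where "E N = c1 * exp (c2 * sqrt (lam N))" for N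
  define \<kappa> where "\<kappa> N = 1 / (L\<^sup>2 * E N)" for N
  define A where "A N = (\<Sum>j\<in>{1..N}. tri_const j) * (weylC * (real N + 1) * (weylC * lam N + 2))" for N
  define m where "m N = 4 * (A N + 1) / \<kappa> N" for N
  define C where "C N = 2 * (L + 2)\<^sup>2 * \<Lambda> N * weylC * lam N" for N
  \<comment> \<open>The bound 1/2 gives \<open>h < 1\<close> for counting cells,
    \<open>\<delta>\<close> keeps the cells near the observed square in \<open>\<Omega>\<close>, and
    the last term makes the Lipschitz error at most half of \<open>\<kappa> N\<close>;
    \<open>C N + 1\<close> avoids division by zero.\<close>
  define hs where "hs N = min (min (1/2) \<delta>) (\<kappa> N / (2 * (C N + 1)))" for N
  \<comment> \<open>The constant of \<open>error_arithmetic\<close> for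
    \<open>R = (L + 2)\<^sup>2\<close>, without the factor \<open>K\<close>.\<close>
  define C3 where "C3 = weylC * (1 + L + 8 * (L + 2)\<^sup>2 * weylC * L\<^sup>2 * c1)"
  have "\<forall>\<epsilon> M. \<exists>n\<ge>1. \<epsilon> > 0 \<longrightarrow> (\<forall>N\<ge>n. \<bar>M\<bar> \<le> real N \<and> C3 * (\<bar>M\<bar> + 1) * exp (- sqrt (lam N)) \<le> \<epsilon> / 2)"
  proof (intro allI)
    fix \<epsilon> M :: real
    obtain k where k: "\<bar>M\<bar> \<le> real k" using real_arch_simple by blast
    show "\<exists>n\<ge>1. \<epsilon> > 0 \<longrightarrow> (\<forall>N\<ge>n. \<bar>M\<bar> \<le> real N \<and> C3 * (\<bar>M\<bar> + 1) * exp (- sqrt (lam N)) \<le> \<epsilon> / 2)"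
    proof (cases "\<epsilon> > 0")
      case True
      then obtain n where n: "n \<ge> 1" "\<forall>N\<ge>n. C3 * (\<bar>M\<bar> + 1) * exp (- sqrt (lam N)) \<le> \<epsilon> / 2"
        using exp_sqrt_lam_small[of "\<epsilon> / 2" 1 "C3 * (\<bar>M\<bar> + 1)"] by (auto simp: mult.commute)
      show ?thesis by (rule exI[of _ "max n k"]) (use n k in auto)
    qed auto
  qed
  then obtain Ns where Ns: "\<And>\<epsilon> M. Ns \<epsilon> M \<ge> 1"
    "\<And>\<epsilon> M N. \<epsilon> > 0 \<Longrightarrow> N \<ge> Ns \<epsilon> M \<Longrightarrow> \<bar>M\<bar> \<le> real N \<and> C3 * (\<bar>M\<bar> + 1) * exp (- sqrt (lam N)) \<le> \<epsilon> / 2" by metis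
  have wp: "weylC > 0" by (rule weylC)
  show ?thesis
    unfolding nudging_parameters_def
  proof (rule exI[of _ Ns], rule exI[of _ m], rule exI[of _ hs], rule exI[of _ "c2 + 3"], intro allI impI, elim conjE)
    fix \<nu> \<sigma> M \<epsilon> :: real and u0 f u and N :: nat
    assume \<nu>: "\<nu> > 0" and f: "Linf_time L f" and ns: "ns_solution L \<nu> f u0 u"
      and lim: "Limsup at_top (\<lambda>t. gevrey_norm L \<phi> lam \<sigma> (u t)) = ereal M" and \<epsilon>: "\<epsilon> > 0" and NN: "N \<ge> Ns \<epsilon> M"
    have N: "N \<ge> 1" using NN Ns(1) order_trans by blast
    have lp: "lam N > 0" by (rule lam_pos[OF N])
    have E0: "E N > 0" unfolding E_def using c by simp
    have \<kappa>0: "\<kappa> N > 0" unfolding \<kappa>_def using E0 L_pos by simp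
    have A0: "A N \<ge> 0" unfolding A_def using wp lp tri_const_nonneg by (intro mult_nonneg_nonneg sum_nonneg add_nonneg_nonneg) auto
    have C0: "C N \<ge> 0" unfolding C_def using \<Lambda>[of N] wp lp by simp
    have m0: "m N > 0" unfolding m_def using A0 \<kappa>0 by simp
    have hs0: "hs N > 0" unfolding hs_def using \<delta> \<kappa>0 C0 by simp
    have main: "(\<exists>v. nudged_solution L \<nu> \<phi> N (m N) J f u v) \<and>
            (\<forall>v. nudged_solution L \<nu> \<phi> N (m N) J f u v \<longrightarrow>
               (\<forall>\<^sub>F t in at_top. l2_norm L (\<lambda>x. u t x - v t x) < \<epsilon>))"
      if h: "0 < h" "h < hs N" and \<sigma>: "\<sigma> > c2 + 3" and J': "J = volume_interp L \<phi> h a N \<Omega> \<or> J = nodal_interp L \<phi> h a N \<Omega>" for h a J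
    proof -
      obtain b where J: "\<And>g. J g = comb {1..N} (Jc b h a g)"
        using J' volume_interp_eq[of h a N] nodal_interp_eq[of h a N] by blast
      \<comment> \<open>Strictly above the upper limit \<open>M\<close>, hence a bound from some
        time on, and at most \<open>N + 1\<close> by the choice of \<open>Ns\<close>.\<close>
      define K where "K = \<bar>M\<bar> + 1"
      have K: "K > 0" "K \<le> real N + 1" using Ns(2)[OF \<epsilon> NN] by (auto simp: K_def)
      have "Limsup at_top (\<lambda>t. gevrey_norm L \<phi> lam \<sigma> (u t)) < ereal K" unfolding lim by (simp add: K_def)
      then have "\<forall>\<^sub>F t in at_top. gevrey_norm L \<phi> lam \<sigma> (u t) < ereal K" by (rule Limsup_lessD)
      then obtain T1 where T1: "\<And>t. t \<ge> T1 \<Longrightarrow> gevrey_norm L \<phi> lam \<sigma> (u t) < ereal K" by (auto simp: eventually_at_top_linorder)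
      define T0 where "T0 = max T1 0"
      have T0: "T0 \<ge> 0" "\<And>t. t \<ge> T0 \<Longrightarrow> gevrey_norm L \<phi> lam \<sigma> (u t) < ereal K" using T1 by (auto simp: T0_def)
      have h1: "h < 1" "h < \<delta>" using h(2) by (auto simp: hs_def)
      have "h \<le> \<kappa> N / (2 * (C N + 1))" using h(2) by (simp add: hs_def)
      then have "h * (2 * (C N + 1)) \<le> \<kappa> N" using C0 by (simp add: le_divide_eq)
      then have hC: "h * C N \<le> \<kappa> N / 2" using h(1) by (simp add: algebra_simps)
      define \<delta>q where "\<delta>q = weylC * (exp (- (\<sigma> - 1) * sqrt (lam N)) * K)"
      define B where "B = (1 + 4 * ((L + 2)\<^sup>2 * (weylC * lam N)) / \<kappa> N) * \<delta>q"
      have BL: "B + L * \<delta>q \<le> \<epsilon> / 2"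
      proof -
        have "B + L * \<delta>q \<le> weylC * (1 + L + 8 * (L + 2)\<^sup>2 * weylC * L\<^sup>2 * c1) * K * exp (- sqrt (lam N))"
          unfolding B_def \<delta>q_def \<kappa>_def E_def
          using error_arithmetic[OF wp c(1) c(2) _ K(1) _ \<sigma>, of "sqrt (lam N)" "(L + 2)\<^sup>2"] lp by simp
        also have "\<dots> \<le> \<epsilon> / 2" using Ns(2)[OF \<epsilon> NN] unfolding C3_def K_def by simp
        finally show ?thesis .
      qed
      have ex: "\<exists>v. nudged_solution L \<nu> \<phi> N (m N) J f u v" by (rule nudged_solution_exists[OF ns f h(1) J])
      have "\<forall>\<^sub>F t in at_top. l2_norm L (\<lambda>x. u t x - v t x) < \<epsilon>" if v: "nudged_solution L \<nu> \<phi> N (m N) J f u v" for v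
      proof -
        have "\<forall>\<^sub>F t in at_top. l2_norm L (\<lambda>x. u t x - v t x) < B + \<epsilon> / 4 + L * \<delta>q"
        proof (rule nudging_error[OF ns f \<nu> J v _ T0 K(2) N h(1) h1 box lip \<Lambda> E0 _ hC[unfolded C_def] \<kappa>_def A_def m_def \<delta>q_def B_def])
          show "1 < \<sigma>" using \<sigma> c by simp
          show "0 < \<epsilon> / 4" using \<epsilon> by simp
          show "(norm (comb {1..N} d y))\<^sup>2 \<le> E N * integral (cbox p (p + (\<chi> i. \<delta>))) (\<lambda>x. (norm (comb {1..N} d x))\<^sup>2)" for d y
            unfolding E_def by (rule spec[OF N])
        qed
        \<comment> \<open>The limiting error is at most \<open>\<epsilon> / 2\<close> by
          \<open>BL\<close>, and the slack adds \<open>\<epsilon> / 4\<close>.\<close>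
        then show ?thesis by eventually_elim (use BL \<epsilon> in linarith)
      qed
      with ex show ?thesis by blast
    qed
    show "m N > 0 \<and> hs N > 0 \<and> c2 + 3 > 0 \<and>
        (\<forall>h a J. 0 < h \<and> h < hs N \<and> \<sigma> > c2 + 3 \<and>
            (J = volume_interp L \<phi> h a N \<Omega> \<or> J = nodal_interp L \<phi> h a N \<Omega>) \<longrightarrow>
            (\<exists>v. nudged_solution L \<nu> \<phi> N (m N) J f u v) \<and>
            (\<forall>v. nudged_solution L \<nu> \<phi> N (m N) J f u v \<longrightarrow>
               (\<forall>\<^sub>F t in at_top. l2_norm L (\<lambda>x. u t x - v t x) < \<epsilon>)))"
      using m0 hs0 c main by auto
  qed
qed

end

section \<open>From open sets to an observed square, and the conclusion\<close>

text \<open>A relatively open set may touch the boundary of the square, but the open square is dense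
  in it, so \<open>\<Omega>\<close> contains a full ball of the plane.\<close>

lemma openin_square_box:
  assumes L: "L > 0" and \<Omega>: "openin (top_of_set (square L)) \<Omega>" "\<Omega> \<noteq> {}"
  shows "\<Omega> \<subseteq> square L" "\<Omega> \<in> sets lebesgue"
    "\<exists>p \<delta>. 0 < \<delta> \<and> \<delta> \<le> L / 2 \<and> (\<forall>x. (\<forall>i. p $ i - \<delta> \<le> x $ i \<and> x $ i \<le> p $ i + 2 * \<delta>) \<longrightarrow> x \<in> \<Omega>)"
proof -
  obtain T where T: "open T" "\<Omega> = square L \<inter> T" using \<Omega>(1) by (auto simp: openin_open)
  show "\<Omega> \<subseteq> square L" using T by simp
  show "\<Omega> \<in> sets lebesgue" unfolding T(2) square_def by (intro sets.Int) (use T(1) in auto)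
  let ?b = "box (\<chi> i. - L / 2) (\<chi> i. L / 2) :: (real^2) set"
  have ne: "?b \<noteq> {}" using L by (auto simp: box_ne_empty Basis_vec_def inner_axis)
  obtain x0 where x0: "x0 \<in> \<Omega>" using \<Omega>(2) by blast
  have "x0 \<in> T \<inter> closure ?b" using x0 T(2) closure_box[OF ne] by (auto simp: square_def)
  then have "T \<inter> ?b \<noteq> {}" using open_Int_closure_eq_empty[OF T(1), of ?b] by blast
  then obtain p where p: "p \<in> T \<inter> ?b" by blast
  have "open (T \<inter> ?b)" using T(1) by (intro open_Int open_box)
  then obtain r where r: "r > 0" "ball p r \<subseteq> T \<inter> ?b" using p open_contains_ball by blast
  \<comment> \<open>A point of the box deviates from \<open>p\<close> by at most
    \<open>2 * \<delta>\<close> in each coordinate, hence by at most \<open>4 * \<delta>\<close>,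
    which \<open>r / 8\<close> keeps below \<open>r\<close>.\<close>
  define \<delta> where "\<delta> = min (L / 2) (r / 8)"
  have \<delta>: "0 < \<delta>" "\<delta> \<le> L / 2" "8 * \<delta> \<le> r" using L r(1) by (auto simp: \<delta>_def)
  have "x \<in> \<Omega>" if x: "\<forall>i. p $ i - \<delta> \<le> x $ i \<and> x $ i \<le> p $ i + 2 * \<delta>" for x
  proof -
    have "norm (x - p) \<le> (\<Sum>i\<in>UNIV. \<bar>(x - p) $ i\<bar>)" by (rule norm_le_l1_cart)
    also have "\<dots> \<le> (\<Sum>i\<in>(UNIV :: 2 set). 2 * \<delta>)"
    proof (rule sum_mono)
      show "\<bar>(x - p) $ i\<bar> \<le> 2 * \<delta>" for i using x[rule_format, of i] \<delta>(1) by (simp add: abs_le_iff)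
    qed
    also have "\<dots> < r" using \<delta> by (simp add: UNIV_2)
    finally have "x \<in> ball p r" by (simp add: dist_norm norm_minus_commute)
    then have "x \<in> T" "x \<in> ?b" using r(2) by auto
    moreover have "?b \<subseteq> square L" unfolding square_def by (rule box_subset_cbox)
    ultimately show ?thesis using T(2) by blast
  qed
  then show "\<exists>p \<delta>. 0 < \<delta> \<and> \<delta> \<le> L / 2 \<and> (\<forall>x. (\<forall>i. p $ i - \<delta> \<le> x $ i \<and> x $ i \<le> p $ i + 2 * \<delta>) \<longrightarrow> x \<in> \<Omega>)"
    using \<delta> by blast
qed

theorem theorem2p1:
  fixes L :: real and \<phi> :: "nat \<Rightarrow> field" and lam :: "nat \<Rightarrow> real"
  assumes "L > 0" and "stokes_eigenbasis L \<phi> lam"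
  shows "\<exists>(Nstar :: (real^2) set \<Rightarrow> real \<Rightarrow> real \<Rightarrow> real \<Rightarrow> real \<Rightarrow> nat)
          (\<mu> :: real \<Rightarrow> (real^2) set \<Rightarrow> real \<Rightarrow> nat \<Rightarrow> real)
          (hstar :: real \<Rightarrow> (real^2) set \<Rightarrow> real \<Rightarrow> nat \<Rightarrow> real)
          (\<sigma>star :: (real^2) set \<Rightarrow> real).
    \<forall>(\<Omega> :: (real^2) set) (\<nu> :: real) (u0 :: field) (f :: real \<Rightarrow> field) (u :: real \<Rightarrow> field)
      (\<sigma> :: real) (M :: real) (\<epsilon> :: real) (G :: real).
      openin (top_of_set (square L)) \<Omega> \<and> \<Omega> \<noteq> {} \<and> \<nu> > 0 \<and>
      u0 \<in> spaceV L \<and> Linf_time L f \<and> ns_solution L \<nu> f u0 u \<and>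
      \<sigma> > 0 \<and> Limsup at_top (\<lambda>t. gevrey_norm L \<phi> lam \<sigma> (u t)) = ereal M \<and>
      \<epsilon> > 0 \<and> G = grashof L \<nu> lam f \<longrightarrow>
      (\<forall>N \<ge> Nstar \<Omega> G \<nu> \<epsilon> M.
         \<mu> \<nu> \<Omega> G N > 0 \<and> hstar \<nu> \<Omega> G N > 0 \<and> \<sigma>star \<Omega> > 0 \<and>
         (\<forall>h a J. 0 < h \<and> h < hstar \<nu> \<Omega> G N \<and> \<sigma> > \<sigma>star \<Omega> \<and>
            (J = volume_interp L \<phi> h a N \<Omega> \<or> J = nodal_interp L \<phi> h a N \<Omega>) \<longrightarrow>
            (\<exists>v. nudged_solution L \<nu> \<phi> N (\<mu> \<nu> \<Omega> G N) J f u v) \<and>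
            (\<forall>v. nudged_solution L \<nu> \<phi> N (\<mu> \<nu> \<Omega> G N) J f u v \<longrightarrow>
               (\<forall>\<^sub>F t in at_top. l2_norm L (\<lambda>x. u t x - v t x) < \<epsilon>))))"
proof -
  \<comment> \<open>Existence is stated for all sets, vacuously for those that are not admissible,
    so that choice yields parameters as functions of \<open>\<Omega>\<close>.\<close>
  have "\<forall>\<Omega>. \<exists>Ns m hs ss. openin (top_of_set (square L)) \<Omega> \<and> \<Omega> \<noteq> {} \<longrightarrow> nudging_parameters L \<phi> lam \<Omega> Ns m hs ss"
  proof
    fix \<Omega> :: "(real^2) set"
    show "\<exists>Ns m hs ss. openin (top_of_set (square L)) \<Omega> \<and> \<Omega> \<noteq> {} \<longrightarrow> nudging_parameters L \<phi> lam \<Omega> Ns m hs ss"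
    proof (cases "openin (top_of_set (square L)) \<Omega> \<and> \<Omega> \<noteq> {}")
      case True
      note b = openin_square_box[OF assms(1) conjunct1[OF True] conjunct2[OF True]]
      interpret observed L \<phi> lam \<Omega> by unfold_locales (use assms b in auto)
      obtain p \<delta> where p: "0 < \<delta>" "\<delta> \<le> L / 2" "\<And>x. (\<And>i. p $ i - \<delta> \<le> x $ i \<and> x $ i \<le> p $ i + 2 * \<delta>) \<Longrightarrow> x \<in> \<Omega>" using b(3) by blast
      have "\<exists>Ns m hs ss. nudging_parameters L \<phi> lam \<Omega> Ns m hs ss" by (rule nudging_constants[OF p])
      then show ?thesis by blast
    qed blast
  qed
  then obtain Ns m hs ss where P: "\<And>\<Omega>. openin (top_of_set (square L)) \<Omega> \<and> \<Omega> \<noteq> {} \<Longrightarrow> nudging_parameters L \<phi> lam \<Omega> (Ns \<Omega>) (m \<Omega>) (hs \<Omega>) (ss \<Omega>)"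
    by metis
  show ?thesis
    by (rule exI[of _ "\<lambda>\<Omega> G \<nu>. Ns \<Omega>"], rule exI[of _ "\<lambda>\<nu> \<Omega> G. m \<Omega>"], rule exI[of _ "\<lambda>\<nu> \<Omega> G. hs \<Omega>"], rule exI[of _ ss], intro allI impI)
      (elim conjE, rule P[unfolded nudging_parameters_def, rule_format], auto)
qed

end
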